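(* Let $\Omega_1,\Omega_2\subset\mathbb{R}^d$ be nonempty open sets. For $j=1,2$ let $Q_j\in W^{1,\infty}_{\rm loc}(\overline{\Omega_j};\mathbb{C})$ be admissible on $\Omega_j$ with constants $\varepsilon_{\nabla,j},M_{\nabla,j}$, and let $T_j=-\Delta+Q_j$ be the Dirichlet realization in $L^2(\Omega_j)$ with form $t_j$ (see context). Put $\Omega_0:=\Omega_1\cup\Omega_2$ and suppose there is a cut-off $\xi:\Omega_0\to[0,1]$ such that $\chi_{\Omega_1\cap\Omega_2}\,\xi=\xi$ on $\Omega_0$, $|\nabla\xi|,\Delta\xi\in L^\infty(\Omega_0)$, and $$\forall f\in \mathrm{Dom}(T_1):\ \xi f\in \mathrm{Dom}(t_2),\qquad \forall g\in \mathrm{Dom}(T_2):\ \xi g\in \mathrm{Dom}(t_1),$$ where $\xi f$ is understood as the function on $\Omega_2$ equal to $\xi f$ on $\Omega_1\cap\Omega_2$ and to $0$ on $\Omega_2\setminus\Omega_1$, and analogously for $\xi g$ on $\Omega_1$. Let $\widetilde\xi:=1-\xi$, $\zeta:=\chi_{\operatorname{supp}\widetilde\xi}$, let $P_jf:=\chi_{\Omega_j}f$ for $f\in L^2(\Omega_0)$, and let $R_j(-1):=(T_j+1)^{-1}$. Then there exists a constant $K\ge 0$, depending only on $\|\nabla\xi\|_{L^\infty}$ and $\varepsilon_{\nabla,j},M_{\nabla,j}$, $j=1,2$, such that $$\|R_1(-1)P_1-R_2(-1)P_2\|_{\mathcal{B}(L^2(\Omega_0))}\le K\left(\left\|\frac{\xi(Q_1-Q_2)}{(Q_1+1)(Q_2+1)}\right\|_{L^\infty(\Omega_1\cap\Omega_2)}+\sum_{j=1}^2\left\|\frac{\zeta}{Q_j+1}\right\|_{L^\infty(\Omega_j)}\right).$$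 If in addition $R_j(-1)\in\mathcal{S}_p(L^2(\Omega_j))$, $j=1,2$, for some $p>0$, then for every $q\in(p,\infty)$ there exists a constant $K_q>0$ such that $$\|R_1(-1)P_1-R_2(-1)P_2\|_{\mathcal{S}_q}\le K_q\,\|R_1(-1)P_1-R_2(-1)P_2\|_{\mathcal{B}(L^2(\Omega_0))}^{1-\frac pq}.$$
   Context: Admissible potentials: for a nonempty open $\Omega\subset\mathbb{R}^d$, a function $Q\in W^{1,\infty}_{\rm loc}(\overline\Omega;\mathbb{C})$ (i.e. $Q$ and its weak gradient are bounded on bounded subsets of $\Omega$) is called admissible on $\Omega$ with constants $\varepsilon_\nabla\in[0,2-\sqrt2)$ and $M_\nabla\ge0$ if $\operatorname{Re}Q\ge0$ and $|\nabla Q|\le\varepsilon_\nabla|Q|^{3/2}+M_\nabla$ a.e. in $\Omega$. Dirichlet realization: for such $Q$ let $t(f,g)=\int_\Omega\nabla f\cdot\overline{\nabla g}\,dx+\int_\Omega Qf\overline g\,dx$ on $\mathrm{Dom}(t)=W^{1,2}_0(\Omega)\cap\mathrm{Dom}(|Q|^{1/2})$, where $\mathrm{Dom}(|Q|^{1/2})=\{f\in L^2(\Omega):|Q|^{1/2}f\in L^2(\Omega)\}$. The operator $T=-\Delta+Q$ has domain $\mathrm{Dom}(T)=\{f\in\mathrm{Dom}(t):\exists\eta\in L^2(\Omega)\ \forall g\in\mathrm{Dom}(t),\ t(f,g)=\langle\eta,g\rangle\}$ and $Tf=\eta$; it is m-accretive (so $-1\in\rho(T)$). $\mathcal{S}_p$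 denotes the Schatten class with its (quasi-)norm and $\mathcal{B}$ the bounded operators. $\chi_\Sigma$ is the characteristic function of $\Sigma$. The operators $R_j(-1)P_j$ act in $L^2(\Omega_0)$, with functions on $\Omega_j$ extended by zero to $\Omega_0$. *)

theory Defs
  imports "HOL-Probability.Essential_Supremum"
begin

text \<open>
  The constant of the theorem must not depend on the dimension \<open>d\<close>, so \<open>d\<close> is a natural number
  that can be quantified below the constant, rather than a type.  A point of \<open>\<real>\<^sup>d\<close> is an extensional
  function on \<open>{..<d}\<close>.  The type class topology of \<^typ>\<open>nat \<Rightarrow> real\<close> (product topology)
  induces the usual topology on \<open>Rd d\<close>, but the metric of that type is not the Euclidean one, so
  boundedness and lengths are expressed with \<^const>\<open>L2_set\<close>.
\<close>

type_synonym pt = "nat \<Rightarrow> real"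

definition Rd :: "nat \<Rightarrow> pt set" where
  "Rd d = (\<Pi>\<^sub>E i\<in>{..<d}. UNIV)"

definition leb :: "nat \<Rightarrow> pt measure" where
  "leb d = (\<Pi>\<^sub>M i\<in>{..<d}. lborel)"

definition leb_on :: "nat \<Rightarrow> pt set \<Rightarrow> pt measure" where
  "leb_on d \<Omega> = restrict_space (leb d) \<Omega>"

definition open_Rd :: "nat \<Rightarrow> pt set \<Rightarrow> bool" where
  "open_Rd d \<Omega> \<longleftrightarrow> openin (top_of_set (Rd d)) \<Omega>"


section \<open>Lebesgue spaces\<close>

text \<open>
  Elements of Lebesgue spaces are represented by functions; values outside the space of the measure
  are irrelevant and equality is meant almost everywhere.  Norms take values in \<^typ>\<open>ennreal\<close>.
\<close>

definition epowr :: "ennreal \<Rightarrow> real \<Rightarrow> ennreal" where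
  "epowr x a = (if x = \<infinity> then \<infinity> else ennreal (enn2real x powr a))"

definition L2_norm :: "'a measure \<Rightarrow> ('a \<Rightarrow> complex) \<Rightarrow> ennreal" where
  "L2_norm M f = epowr (\<integral>\<^sup>+x. ennreal ((cmod (f x))\<^sup>2) \<partial>M) (1/2)"

definition L2 :: "'a measure \<Rightarrow> ('a \<Rightarrow> complex) set" where
  "L2 M = {f \<in> borel_measurable M. L2_norm M f < \<infinity>}"

definition L2_inner :: "'a measure \<Rightarrow> ('a \<Rightarrow> complex) \<Rightarrow> ('a \<Rightarrow> complex) \<Rightarrow> complex" where
  "L2_inner M f g = (\<integral>x. f x * cnj (g x) \<partial>M)"

definition Linf_norm :: "'a measure \<Rightarrow> ('a \<Rightarrow> 'b::real_normed_vector) \<Rightarrow> ennreal" where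
  "Linf_norm M f = esssup M (\<lambda>x. ennreal (norm (f x)))"


section \<open>Operators on \<open>L\<^sup>2\<close>\<close>

definition op_norm :: "'a measure \<Rightarrow> (('a \<Rightarrow> complex) \<Rightarrow> ('a \<Rightarrow> complex)) \<Rightarrow> ennreal" where
  "op_norm M A = Inf {C. \<forall>f\<in>L2 M. L2_norm M (A f) \<le> C * L2_norm M f}"

definition linear_op :: "'a measure \<Rightarrow> (('a \<Rightarrow> complex) \<Rightarrow> ('a \<Rightarrow> complex)) \<Rightarrow> bool" where
  "linear_op M A \<longleftrightarrow> (\<forall>f\<in>L2 M. A f \<in> L2 M) \<and>
     (\<forall>f\<in>L2 M. \<forall>g\<in>L2 M. \<forall>a b.
        AE x in M. A (\<lambda>y. a * f y + b * g y) x = a * A f x + b * A g x)"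

definition compact_op :: "'a measure \<Rightarrow> (('a \<Rightarrow> complex) \<Rightarrow> ('a \<Rightarrow> complex)) \<Rightarrow> bool" where
  "compact_op M A \<longleftrightarrow> linear_op M A \<and>
     (\<forall>F :: nat \<Rightarrow> 'a \<Rightarrow> complex. (\<forall>n. F n \<in> L2 M \<and> L2_norm M (F n) \<le> 1) \<longrightarrow>
        (\<exists>r g. strict_mono (r :: nat \<Rightarrow> nat) \<and> g \<in> L2 M \<and>
           (\<lambda>n. L2_norm M (\<lambda>x. A (F (r n)) x - g x)) \<longlonglongrightarrow> 0))"

text \<open>The eigenspace \<open>A\<^sup>*A f = \<sigma>\<^sup>2 f\<close>, with the adjoint moved to the other side of the inner product.\<close>

definition singular_space ::
    "'a measure \<Rightarrow> (('a \<Rightarrow> complex) \<Rightarrow> ('a \<Rightarrow> complex)) \<Rightarrow> real \<Rightarrow> ('a \<Rightarrow> complex) set" where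
  "singular_space M A \<sigma> =
     {f \<in> L2 M. \<forall>g\<in>L2 M. L2_inner M (A f) (A g) = of_real (\<sigma>\<^sup>2) * L2_inner M f g}"

text \<open>Its dimension (modulo null functions), as the largest size of an orthonormal system.\<close>

definition singular_mult ::
    "'a measure \<Rightarrow> (('a \<Rightarrow> complex) \<Rightarrow> ('a \<Rightarrow> complex)) \<Rightarrow> real \<Rightarrow> ennreal" where
  "singular_mult M A \<sigma> =
     (SUP n \<in> {n. \<exists>e :: nat \<Rightarrow> 'a \<Rightarrow> complex. (\<forall>i<n. e i \<in> singular_space M A \<sigma>) \<and>
                    (\<forall>i<n. \<forall>j<n. L2_inner M (e i) (e j) = of_bool (i = j))}. of_nat n)"

text \<open>
  The (quasi-)norm \<open>(\<Sum>\<^sub>n s\<^sub>n(A)\<^sup>p)\<^sup>1\<^sup>/\<^sup>p\<close>, where the singular values \<open>s\<^sub>n(A)\<close> of a compact operator are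
  the square roots of the nonzero eigenvalues of \<open>A\<^sup>*A\<close> repeated by multiplicity; the sum is
  grouped by distinct values.  It is infinite outside the Schatten class.
\<close>

definition schatten_norm ::
    "'a measure \<Rightarrow> real \<Rightarrow> (('a \<Rightarrow> complex) \<Rightarrow> ('a \<Rightarrow> complex)) \<Rightarrow> ennreal" where
  "schatten_norm M p A =
     (if compact_op M A
      then epowr (\<integral>\<^sup>+\<sigma>. singular_mult M A \<sigma> * ennreal (\<sigma> powr p) \<partial>count_space {0<..}) (1/p)
      else \<infinity>)"

definition schatten_class ::
    "'a measure \<Rightarrow> real \<Rightarrow> (('a \<Rightarrow> complex) \<Rightarrow> ('a \<Rightarrow> complex)) set" where
  "schatten_class M p = {A. schatten_norm M p A < \<infinity>}"


section \<open>Weak derivatives and Sobolev spaces\<close>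

definition partial :: "nat \<Rightarrow> (pt \<Rightarrow> complex) \<Rightarrow> pt \<Rightarrow> complex" where
  "partial i \<phi> x = vector_derivative (\<lambda>s. \<phi> (x(i := s))) (at (x i))"

definition smooth :: "nat \<Rightarrow> (pt \<Rightarrow> complex) \<Rightarrow> bool" where
  "smooth d \<phi> \<longleftrightarrow> (\<forall>is. set is \<subseteq> {..<d} \<longrightarrow>
     continuous_on (Rd d) (foldr partial is \<phi>) \<and>
     (\<forall>i<d. \<forall>x\<in>Rd d. (\<lambda>s. foldr partial is \<phi> (x(i := s))) differentiable at (x i)))"

definition test_fun :: "nat \<Rightarrow> pt set \<Rightarrow> (pt \<Rightarrow> complex) set" where
  "test_fun d \<Omega> = {\<phi>. smooth d \<phi> \<and> (\<exists>K. compact K \<and> K \<subseteq> \<Omega> \<and> (\<forall>x\<in>Rd d - K. \<phi> x = 0))}"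

definition loc_integrable :: "nat \<Rightarrow> pt set \<Rightarrow> (pt \<Rightarrow> complex) \<Rightarrow> bool" where
  "loc_integrable d \<Omega> f \<longleftrightarrow> f \<in> borel_measurable (leb_on d \<Omega>) \<and>
     (\<forall>K. compact K \<and> K \<subseteq> \<Omega> \<longrightarrow> set_integrable (leb d) K f)"

definition weak_grad :: "nat \<Rightarrow> pt set \<Rightarrow> (pt \<Rightarrow> complex) \<Rightarrow> (nat \<Rightarrow> pt \<Rightarrow> complex) \<Rightarrow> bool" where
  "weak_grad d \<Omega> f G \<longleftrightarrow> loc_integrable d \<Omega> f \<and>
     (\<forall>i<d. loc_integrable d \<Omega> (G i) \<and>
       (\<forall>\<phi>\<in>test_fun d \<Omega>.
          (\<integral>x. f x * partial i \<phi> x \<partial>leb_on d \<Omega>) = - (\<integral>x. G i x * \<phi> x \<partial>leb_on d \<Omega>)))"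

definition grad :: "nat \<Rightarrow> pt set \<Rightarrow> (pt \<Rightarrow> complex) \<Rightarrow> nat \<Rightarrow> pt \<Rightarrow> complex" where
  "grad d \<Omega> f = (SOME G. weak_grad d \<Omega> f G)"

definition weakly_differentiable :: "nat \<Rightarrow> pt set \<Rightarrow> (pt \<Rightarrow> complex) \<Rightarrow> bool" where
  "weakly_differentiable d \<Omega> f \<longleftrightarrow> (\<exists>G. weak_grad d \<Omega> f G)"

definition grad_length :: "nat \<Rightarrow> pt set \<Rightarrow> (pt \<Rightarrow> complex) \<Rightarrow> pt \<Rightarrow> real" where
  "grad_length d \<Omega> f x = L2_set (\<lambda>i. cmod (grad d \<Omega> f i x)) {..<d}"

definition weak_laplacian :: "nat \<Rightarrow> pt set \<Rightarrow> (pt \<Rightarrow> complex) \<Rightarrow> (pt \<Rightarrow> complex) \<Rightarrow> bool" where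
  "weak_laplacian d \<Omega> f h \<longleftrightarrow> loc_integrable d \<Omega> f \<and> loc_integrable d \<Omega> h \<and>
     (\<forall>\<phi>\<in>test_fun d \<Omega>.
        (\<integral>x. f x * (\<Sum>i<d. partial i (partial i \<phi>) x) \<partial>leb_on d \<Omega>) = (\<integral>x. h x * \<phi> x \<partial>leb_on d \<Omega>))"

definition W12 :: "nat \<Rightarrow> pt set \<Rightarrow> (pt \<Rightarrow> complex) set" where
  "W12 d \<Omega> = {f \<in> L2 (leb_on d \<Omega>).
     weakly_differentiable d \<Omega> f \<and> (\<forall>i<d. grad d \<Omega> f i \<in> L2 (leb_on d \<Omega>))}"

definition W12_0 :: "nat \<Rightarrow> pt set \<Rightarrow> (pt \<Rightarrow> complex) set" where
  "W12_0 d \<Omega> = {f \<in> W12 d \<Omega>. \<exists>\<phi> :: nat \<Rightarrow> pt \<Rightarrow> complex. (\<forall>n. \<phi> n \<in> test_fun d \<Omega>) \<and>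
     (\<lambda>n. L2_norm (leb_on d \<Omega>) (\<lambda>x. \<phi> n x - f x)) \<longlonglongrightarrow> 0 \<and>
     (\<forall>i<d. (\<lambda>n. L2_norm (leb_on d \<Omega>) (\<lambda>x. partial i (\<phi> n) x - grad d \<Omega> f i x)) \<longlonglongrightarrow> 0)}"

text \<open>\<open>W\<^sup>1\<^sup>,\<^sup>\<infinity>\<close> on every bounded subset of \<open>\<Omega>\<close>, up to the boundary.\<close>

definition W1inf_loc :: "nat \<Rightarrow> pt set \<Rightarrow> (pt \<Rightarrow> complex) set" where
  "W1inf_loc d \<Omega> = {Q. weakly_differentiable d \<Omega> Q \<and>
     (\<forall>r. \<exists>C. AE x in leb_on d \<Omega>.
        L2_set x {..<d} \<le> r \<longrightarrow> cmod (Q x) \<le> C \<and> grad_length d \<Omega> Q x \<le> C)}"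

definition admissible :: "nat \<Rightarrow> pt set \<Rightarrow> (pt \<Rightarrow> complex) \<Rightarrow> real \<Rightarrow> real \<Rightarrow> bool" where
  "admissible d \<Omega> Q \<epsilon> m \<longleftrightarrow> Q \<in> W1inf_loc d \<Omega> \<and> 0 \<le> \<epsilon> \<and> \<epsilon> < 2 - sqrt 2 \<and> 0 \<le> m \<and>
     (AE x in leb_on d \<Omega>. 0 \<le> Re (Q x) \<and> grad_length d \<Omega> Q x \<le> \<epsilon> * cmod (Q x) powr (3/2) + m)"


section \<open>The Dirichlet realization\<close>

definition form_dom :: "nat \<Rightarrow> pt set \<Rightarrow> (pt \<Rightarrow> complex) \<Rightarrow> (pt \<Rightarrow> complex) set" where
  "form_dom d \<Omega> Q = W12_0 d \<Omega> \<inter>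
     {f \<in> L2 (leb_on d \<Omega>). (\<lambda>x. of_real (sqrt (cmod (Q x))) * f x) \<in> L2 (leb_on d \<Omega>)}"

definition form ::
    "nat \<Rightarrow> pt set \<Rightarrow> (pt \<Rightarrow> complex) \<Rightarrow> (pt \<Rightarrow> complex) \<Rightarrow> (pt \<Rightarrow> complex) \<Rightarrow> complex" where
  "form d \<Omega> Q f g =
     (\<integral>x. (\<Sum>i<d. grad d \<Omega> f i x * cnj (grad d \<Omega> g i x)) \<partial>leb_on d \<Omega>) +
     (\<integral>x. Q x * f x * cnj (g x) \<partial>leb_on d \<Omega>)"

definition represents ::
    "nat \<Rightarrow> pt set \<Rightarrow> (pt \<Rightarrow> complex) \<Rightarrow> (pt \<Rightarrow> complex) \<Rightarrow> (pt \<Rightarrow> complex) \<Rightarrow> bool" where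
  "represents d \<Omega> Q f \<eta> \<longleftrightarrow> \<eta> \<in> L2 (leb_on d \<Omega>) \<and>
     (\<forall>g\<in>form_dom d \<Omega> Q. form d \<Omega> Q f g = L2_inner (leb_on d \<Omega>) \<eta> g)"

definition schr_dom :: "nat \<Rightarrow> pt set \<Rightarrow> (pt \<Rightarrow> complex) \<Rightarrow> (pt \<Rightarrow> complex) set" where
  "schr_dom d \<Omega> Q = {f \<in> form_dom d \<Omega> Q. \<exists>\<eta>. represents d \<Omega> Q f \<eta>}"

definition schr ::
    "nat \<Rightarrow> pt set \<Rightarrow> (pt \<Rightarrow> complex) \<Rightarrow> (pt \<Rightarrow> complex) \<Rightarrow> (pt \<Rightarrow> complex)" where
  "schr d \<Omega> Q f = (SOME \<eta>. represents d \<Omega> Q f \<eta>)"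

text \<open>\<open>(T - z)\<^sup>-\<^sup>1\<close>; for \<open>z\<close> in the resolvent set of \<open>T\<close> the choice is unique almost everywhere.\<close>

definition resolvent ::
    "nat \<Rightarrow> pt set \<Rightarrow> (pt \<Rightarrow> complex) \<Rightarrow> complex \<Rightarrow> (pt \<Rightarrow> complex) \<Rightarrow> (pt \<Rightarrow> complex)" where
  "resolvent d \<Omega> Q z h = (SOME u. u \<in> schr_dom d \<Omega> Q \<and>
     (AE x in leb_on d \<Omega>. schr d \<Omega> Q u x - z * u x = h x))"

definition extend_zero :: "pt set \<Rightarrow> (pt \<Rightarrow> complex) \<Rightarrow> (pt \<Rightarrow> complex)" where
  "extend_zero S f = (\<lambda>x. if x \<in> S then f x else 0)"

text \<open>
  \<open>R(z) P\<close> on the larger open set: \<open>P\<close> is multiplication with the characteristic function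
  of \<open>\<Omega>\<close>, and the outer \<^const>\<open>extend_zero\<close> is the extension by zero.
\<close>

definition ext_resolvent ::
    "nat \<Rightarrow> pt set \<Rightarrow> (pt \<Rightarrow> complex) \<Rightarrow> complex \<Rightarrow> (pt \<Rightarrow> complex) \<Rightarrow> (pt \<Rightarrow> complex)" where
  "ext_resolvent d \<Omega> Q z f = extend_zero \<Omega> (resolvent d \<Omega> Q z (extend_zero \<Omega> f))"

end

theory Submission
 imports Defs "HOL-Probability.Giry_Monad"
begin

text \<open>
  Testing the equation \<open>(T + 1) u = h\<close> with \<open>\<theta>\<^sup>2 Q u\<close> and \<open>\<theta>\<^sup>2 (1 + |Q|\<^sup>2)\<^sup>1\<^sup>/\<^sup>2 u\<close> for cut-offs \<open>\<theta>\<close> at infinity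
  yields the separation property \<open>\<parallel>Q u\<parallel> \<le> C \<parallel>h\<parallel>\<close>, where \<open>C\<close> depends only on the constants of
  admissibility.  Now let \<open>u\<close> be the solution on \<open>\<Omega>\<^sub>1\<close> with datum \<open>f\<close> and \<open>w\<close> the one on \<open>\<Omega>\<^sub>2\<close> with datum
  the conjugate of \<open>g\<close>.  Testing each equation with \<open>\<xi>\<close> times the other solution and subtracting
  expresses the pairing of the resolvent difference at \<open>f\<close> with \<open>g\<close> through integrals against
  \<open>\<nabla>\<xi>\<close>, which lives on the support of \<open>1 - \<xi>\<close>, against \<open>(Q\<^sub>1 - Q\<^sub>2) \<xi> u w\<close>, and against \<open>1 - \<xi>\<close>; the separation
  property bounds each of them.  For the Schatten part, the singular values of the difference have
  a weak-type bound inherited from the two resolvents, so their \<open>q\<close>-th powers are summable for \<open>q > p\<close>.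
\<close>

text \<open>Admissibility bounds grad Q by |Q|^(3/2), so testing with Q u leaves |Q|^(1/2) |grad u|
  against |Q| |u|. Only the second test function controls the first factor, and the two quadratic
  inequalities close together because e < 1. As Im Q may dominate Re Q >= 0, the form is not
  coercive in the norm of its domain and Lax-Milgram does not apply directly. A term delta <Q> with
  <z> = sqrt (1 + |z|^2) is added; separation holds uniformly in delta, so the solutions are Cauchy
  as delta tends to 0. Q and <Q> are only locally bounded and weakly differentiable; mollification
  shows that their cut-off products with u lie in the form domain. The conjugate in the datum of w
  makes the equations bilinear and symmetric, so adjoints are avoided and the terms in grad u . grad
  w cancel on subtraction. The constants come from the quadratic inequalities, from |Q + 1| <= 2 <Q>
  and from the bound on grad \<xi>; none involves the dimension. K_q is quantified after the
  operators, so the substance there is finiteness of the S_q norm, besides the case of a vanishing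
  difference.\<close>

notation LIMSEQ (infix "~~>" 60)

abbreviation (input) bm :: "'a measure => ('a => 'b::topological_space) set" where
 "bm M \<equiv> borel_measurable M"

lemmas Bint_cong = Bochner_Integration.integral_cong
lemmas Bintble_bound = Bochner_Integration.integrable_bound
lemmas Bint_add = Bochner_Integration.integral_add
lemmas Bint_diff = Bochner_Integration.integral_diff
lemmas Bintble_add = Bochner_Integration.integrable_add
lemmas Bint_sum = Bochner_Integration.integral_sum

section \<open>Semi-Hilbert spaces of functions\<close>

definition snorm :: "(('a => complex) => ('a => complex) => complex) => ('a => complex) => real" where
 "snorm ip f = sqrt (Re (ip f f))"

text \<open>Functions that agree almost everywhere are not identified, so the inner product is only
  positive semidefinite and equality becomes seminorm distance zero. Projection, Riesz and
  Lax-Milgram are proved in that sense, as existence statements. The set \<open>S\<close> is a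
  parameter because L2, W^(1,2) and the form domain are all instances.\<close>

locale semi_inner =
 fixes S :: "('a => complex) set" and ip :: "('a => complex) => ('a => complex) => complex"
 assumes zero: "(%x. 0) : S"
  and lin: "f : S ==> g : S ==> (%x. a * f x + b * g x) : S"
  and ip_lin: "f : S ==> g : S ==> h : S ==> ip (%x. a * f x + b * g x) h = a * ip f h + b * ip g h"
  and ip_cnj: "f : S ==> g : S ==> ip g f = cnj (ip f g)"
  and ip_nonneg: "f : S ==> 0 <= Re (ip f f)"
begin

abbreviation "nrm \<equiv> snorm ip"

lemma diff_mem: "f : S ==> g : S ==> (%x. f x - g x) : S"
 using lin[of f g 1 "-1"] by simp

lemma add_mem: "f : S ==> g : S ==> (%x. f x + g x) : S"
 using lin[of f g 1 1] by simp

lemma scale_mem: "f : S ==> (%x. c * f x) : S"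
 using lin[of f f c 0] by simp

lemma ip_scale: "f : S ==> h : S ==> ip (%x. c * f x) h = c * ip f h"
 using ip_lin[of f f h c 0] by simp

lemma ip_add: "f : S ==> g : S ==> h : S ==> ip (%x. f x + g x) h = ip f h + ip g h"
 using ip_lin[of f g h 1 1] by simp

lemma ip_diff: "f : S ==> g : S ==> h : S ==> ip (%x. f x - g x) h = ip f h - ip g h"
 using ip_lin[of f g h 1 "-1"] by simp

lemma ip_lin2:
 assumes "f : S" "g : S" "h : S"
 shows "ip h (%x. a * f x + b * g x) = cnj a * ip h f + cnj b * ip h g"
 using assms ip_lin[of f g h a b] ip_cnj[of "%x. a * f x + b * g x" h] ip_cnj[of f h] ip_cnj[of g h]
 by(simp add: lin)

lemma ip_scale2: "f : S ==> h : S ==> ip h (%x. c * f x) = cnj c * ip h f"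
 using ip_lin2[of f f h c 0] by simp

lemma ip_add2: "f : S ==> g : S ==> h : S ==> ip h (%x. f x + g x) = ip h f + ip h g"
 using ip_lin2[of f g h 1 1] by simp

lemma ip_diff2: "f : S ==> g : S ==> h : S ==> ip h (%x. f x - g x) = ip h f - ip h g"
 using ip_lin2[of f g h 1 "-1"] by simp

lemma ip_self: "f : S ==> ip f f = of_real (Re (ip f f))"
 using ip_cnj[of f f] by(simp add: complex_eq_iff)

lemma nrm_nonneg: "f : S ==> 0 <= nrm f"
 by(simp add: snorm_def ip_nonneg)

lemma nrm_sq: "f : S ==> (nrm f)\<^sup>2 = Re (ip f f)"
 by(simp add: snorm_def ip_nonneg)

lemma ip_self_nrm: "f : S ==> ip f f = of_real ((nrm f)^2)"
 using ip_self nrm_sq by simp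

lemma ip_zero_left: "h : S ==> ip (%x. 0) h = 0"
 using ip_scale[of "%x. 0" h 0] zero by simp

lemma ip_zero_right: "h : S ==> ip h (%x. 0) = 0"
 using ip_scale2[of "%x. 0" h 0] zero by simp

lemma expand:
 assumes "f : S" "g : S"
 shows "Re (ip (%x. f x - c * g x) (%x. f x - c * g x)) =
  Re (ip f f) - 2 * Re (cnj c * ip f g) + (cmod c)^2 * Re (ip g g)"
proof -
 have *: "(%x. c * g x) : S" using assms scale_mem by auto
 have "ip (%x. f x - c * g x) (%x. f x - c * g x)
   = ip f f - cnj c * ip f g - c * ip g f + c * cnj c * ip g g"
  using assms * by(simp add: ip_diff ip_diff2 ip_scale ip_scale2 diff_mem algebra_simps)
 also have "ip g f = cnj (ip f g)" by(rule ip_cnj[OF assms])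
 finally show ?thesis
  using ip_self[OF assms(2)]
  by(simp add: complex_norm_square[symmetric] complex_eq_iff algebra_simps)
qed

text \<open>Expanding along c = t <f,g> gives a quadratic inequality in the real number t, and
  optimising t yields the bound. With e = 0 it says that a minimiser is orthogonal; with e = <f,f>
  it is the Cauchy-Schwarz inequality.\<close>

lemma ortho_of_min:
 assumes fg: "f : S" "g : S"
  and "!!c. Re (ip f f) <= Re (ip (%x. f x - c * g x) (%x. f x - c * g x)) + e"
 shows "(cmod (ip f g))^2 <= e * Re (ip g g)"
proof -
 let ?z = "ip f g" and ?b = "Re (ip g g)"
 have b: "?b >= 0" using fg ip_nonneg by auto
 have main: "2 * t * (cmod ?z)^2 <= e + t^2 * (cmod ?z)^2 * ?b" for t :: real
 proof -
  have "Re (cnj (of_real t * ?z) * ?z) = t * (cmod ?z)^2"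
   unfolding cmod_power2 by(simp add: power2_eq_square algebra_simps)
  thus ?thesis
   using assms(3)[of "of_real t * ?z"] expand[OF fg, of "of_real t * ?z"]
   by(simp add: norm_mult power_mult_distrib algebra_simps)
 qed
 show ?thesis
 proof (cases "?b = 0")
  case True
  have "(cmod ?z)^2 = 0"
  proof (rule ccontr)
   assume n: "(cmod ?z)^2 ~= 0"
   hence p: "(cmod ?z)^2 > 0" by simp
   \<comment> \<open>The quadratic term is absent here, so the linear one is unbounded: this t gives
     2 (e + 1) <= e, impossible for e >= 0.\<close>
   have "2 * ((e + 1) / (cmod ?z)^2) * (cmod ?z)^2 <= e"
   using main[of "(e + 1) / (cmod ?z)^2"] True by simp
   moreover have "0 <= e" using main[of 0] by simp
   ultimately show False using n by simp
  qed
  thus ?thesis using True by simp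
 next
  case False
  hence "?b > 0" using b by simp
  thus ?thesis using main[of "1 / ?b"]
   by(simp add: field_simps power2_eq_square)
 qed
qed

lemma cauchy_schwarz_sq:
 assumes "f : S" "g : S"
 shows "(cmod (ip f g))^2 <= Re (ip f f) * Re (ip g g)"
 using assms by(intro ortho_of_min) (auto intro!: ip_nonneg diff_mem scale_mem)

lemma cauchy_schwarz:
 assumes "f : S" "g : S"
 shows "cmod (ip f g) <= nrm f * nrm g"
proof (rule power2_le_imp_le)
 show "(cmod (ip f g))^2 <= (nrm f * nrm g)^2"
  using cauchy_schwarz_sq[OF assms] assms by(simp add: nrm_sq power_mult_distrib)
qed (simp add: assms nrm_nonneg)

lemma nrm_zero_ip: "f : S ==> g : S ==> nrm g = 0 ==> ip f g = 0"
 using cauchy_schwarz[of f g] by simp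

lemma nrm_scale: "f : S ==> nrm (%x. c * f x) = cmod c * nrm f"
 using ip_self[of f]
 by(simp add: snorm_def ip_scale ip_scale2 scale_mem mult.assoc[symmetric] complex_norm_square[symmetric]
   real_sqrt_mult ip_nonneg)

lemma nrm_triangle:
 assumes "f : S" "g : S" shows "nrm (%x. f x + g x) <= nrm f + nrm g"
proof (rule power2_le_imp_le)
 have "(nrm (%x. f x + g x))^2 = Re (ip f f) + Re (ip g g) + 2 * Re (ip f g)"
  using assms ip_cnj[of f g] by(simp add: nrm_sq add_mem ip_add ip_add2)
 also have "... <= (nrm f + nrm g)^2"
  using cauchy_schwarz[OF assms] assms complex_Re_le_cmod[of "ip f g"]
  by(simp add: nrm_sq power2_sum)
 finally show "(nrm (%x. f x + g x))^2 <= (nrm f + nrm g)^2" .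
qed (simp add: assms nrm_nonneg)

lemma nrm_triangle_diff:
 assumes "f : S" "g : S" "h : S"
 shows "nrm (%x. f x - h x) <= nrm (%x. f x - g x) + nrm (%x. g x - h x)"
 using nrm_triangle[of "%x. f x - g x" "%x. g x - h x"] assms diff_mem by simp

lemma nrm_minus: "f : S ==> g : S ==> nrm (%x. f x - g x) = nrm (%x. g x - f x)"
 using nrm_scale[of "%x. g x - f x" "-1"] diff_mem by simp

lemma nrm_diff_le: "f : S ==> g : S ==> nrm f - nrm g <= nrm (%x. f x - g x)"
 using nrm_triangle[of "%x. f x - g x" g] diff_mem by simp

lemma ip_tendsto:
 assumes "!!n. F n : S" "f : S" "g : S" "(%n. nrm (%x. F n x - f x)) ~~> 0"
 shows "(%n. ip (F n) g) ~~> ip f g"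
proof (rule Lim_transform2[OF tendsto_const])
 have "(%n. nrm (%x. F n x - f x) * nrm g) ~~> 0"
  using tendsto_mult_right[OF assms(4), of "nrm g"] by simp
 hence "(%n. ip (F n) g - ip f g) ~~> 0"
 proof (rule tendsto_0_le[where K = 1], intro eventuallyI)
  fix n
  show "norm (ip (F n) g - ip f g) <= norm (nrm (%x. F n x - f x) * nrm g) * 1"
   using cauchy_schwarz[of "%x. F n x - f x" g] assms by(simp add: ip_diff diff_mem)
 qed
 from tendsto_minus[OF this] show "(%n. ip f g - ip (F n) g) ~~> 0" by simp
qed

lemma nrm_tendsto:
 assumes "!!n. F n : S" "f : S" "(%n. nrm (%x. F n x - f x)) ~~> 0"
 shows "(%n. nrm (F n)) ~~> nrm f"
proof (rule Lim_transform2[OF tendsto_const])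
 show "(%n. nrm f - nrm (F n)) ~~> 0"
 proof (rule tendsto_0_le[where K = 1, OF assms(3)], intro eventuallyI)
  fix n
  show "norm (nrm f - nrm (F n)) <= norm (nrm (%x. F n x - f x)) * 1"
   using nrm_diff_le[of f "F n"] nrm_diff_le[of "F n" f] nrm_minus[of f "F n"] assms nrm_nonneg diff_mem
   by(simp add: abs_le_iff)
 qed
qed

end

locale semi_hilbert = semi_inner +
 assumes complete: "(!!n. F n : S) ==>
   (!!e. 0 < e ==> EX N. ALL m>=N. ALL n>=N. snorm ip (%x. F m x - F n x) < e) ==>
   EX f:S. (%n. snorm ip (%x. F n x - f x)) ~~> 0"

locale closed_sub = semi_hilbert +
 fixes N :: "('a => complex) set"
 assumes sub: "N \<subseteq> S" and zeroN: "(%x. 0) : N"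
  and linN: "f : N ==> g : N ==> (%x. a * f x + b * g x) : N"
  and closedN: "(!!n. F n : N) ==> f : S ==> (%n. snorm ip (%x. F n x - f x)) ~~> 0 ==> f : N"
begin

text \<open>A minimising sequence is Cauchy by the parallelogram law, and
  \<open>ortho_of_min\<close> with e = 0 turns minimality of the limit into orthogonality.\<close>

lemma projection:
 assumes x: "x : S"
 shows "EX p:N. ALL g:N. ip (%t. x t - p t) g = 0"
proof -
 define Q where "Q p = Re (ip (%t. x t - p t) (%t. x t - p t))" for p
 define D where "D = Inf (Q ` N)"
 have NS: "g : S" if "g : N" for g using that sub by auto
 have Q0: "Q p >= 0" if "p : N" for p unfolding Q_def using that x NS diff_mem ip_nonneg by auto
 have bdd: "bdd_below (Q ` N)" using Q0 by(auto intro!: bdd_belowI)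
 have DQ: "D <= Q p" if "p : N" for p unfolding D_def using that bdd by(auto intro: cINF_lower)
 have "EX p:N. Q p < D + e" if "e > 0" for e
 proof -
  have "Inf (Q ` N) < D + e" using that D_def by simp
  thus ?thesis using cInf_lessD[of "Q ` N"] zeroN by fastforce
 qed
 hence "ALL n. EX p:N. Q p < D + 1 / real (Suc n)" by simp
 then obtain F where F: "!!n. F n : N" "!!n. Q (F n) < D + 1 / real (Suc n)" by metis
 have par: "(nrm (%t. F m t - F n t))^2 <= 2 / real (Suc m) + 2 / real (Suc n)" for m n
 proof -
  define f where "f t = x t - F m t" for t
  define g where "g t = x t - F n t" for t
  have fg: "f : S" "g : S" unfolding f_def g_def using x F(1) NS diff_mem by blast+
  \<comment> \<open>The midpoint stays in \<open>N\<close>, so its squared distance to x is at least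
    \<open>D\<close>; this is the lower bound that the parallelogram law needs.\<close>
  have h: "(%t. (1/2) * F m t + (1/2) * F n t) : N" using linN[OF F(1)[of m] F(1)[of n]] .
  have "(%t. x t - ((1/2) * F m t + (1/2) * F n t)) = (%t. (1/2) * (f t + g t))"
   by(auto simp: f_def g_def field_simps)
  moreover have "ip (%t. c * (f t + g t)) (%t. c * (f t + g t)) =
   c * (cnj c * ip (%t. f t + g t) (%t. f t + g t))" for c
   using add_mem[OF fg] scale_mem[OF add_mem[OF fg]]
   by(simp only: ip_scale ip_scale2)
  note this[of "1/2"]
  ultimately have "Re (ip (%t. x t - ((1/2) * F m t + (1/2) * F n t)) (%t. x t - ((1/2) * F m t + (1/2) * F n t)))
   = Re (1/2 * (cnj (1/2) * ip (%t. f t + g t) (%t. f t + g t)))" by presburger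
  also have "... = Re (ip (%t. f t + g t) (%t. f t + g t)) / 4" by simp
  finally have *: "Re (ip (%t. x t - ((1/2) * F m t + (1/2) * F n t)) (%t. x t - ((1/2) * F m t + (1/2) * F n t)))
   = Re (ip (%t. f t + g t) (%t. f t + g t)) / 4" .
  have "D <= Re (ip (%t. f t + g t) (%t. f t + g t)) / 4"
   using DQ[OF h] by(simp only: Q_def *)
  hence 1: "4 * D <= Re (ip f f) + Re (ip g g) + 2 * Re (ip f g)"
   using fg ip_cnj[of f g] by(simp add: add_mem ip_add ip_add2)
  have "(%t. F m t - F n t) = (%t. g t - f t)" by(auto simp: f_def g_def)
  hence "(nrm (%t. F m t - F n t))^2 = Re (ip f f) + Re (ip g g) - 2 * Re (ip f g)"
   using fg ip_cnj[of f g] by(simp add: nrm_sq diff_mem ip_diff ip_diff2)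
  also have "... <= 2 * Re (ip f f) + 2 * Re (ip g g) - 4 * D" using 1 by simp
  also have "... <= 2 / real (Suc m) + 2 / real (Suc n)"
   using F(2)[of m] F(2)[of n] by(simp add: Q_def f_def[abs_def] g_def[abs_def])
  finally show ?thesis .
 qed
 have "EX f:S. (%n. nrm (%t. F n t - f t)) ~~> 0"
 proof (rule complete)
  fix e :: real assume e: "e > 0"
  obtain K :: nat where K: "4 / e^2 < real K" using reals_Archimedean2 by blast
  have Kp: "real K > 0" using K e by(smt (verit) divide_pos_pos zero_less_power)
  have "nrm (%t. F m t - F n t) < e" if "m >= K" "n >= K" for m n
  proof (rule power2_less_imp_less)
   have "2 / real (Suc m) <= 2 / real K" "2 / real (Suc n) <= 2 / real K"
   using that Kp by(auto intro!: divide_left_mono)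
   hence "(nrm (%t. F m t - F n t))^2 <= 4 / real K" using par[of m n] by simp
   also have "... < e^2" using K Kp e by(simp add: field_simps)
   finally show "(nrm (%t. F m t - F n t))^2 < e^2" .
  qed (use e in simp)
  thus "EX N. ALL m>=N. ALL n>=N. nrm (%x. F m x - F n x) < e" by blast
 qed (use F NS in auto)
 then obtain p where p: "p : S" "(%n. nrm (%t. F n t - p t)) ~~> 0" by blast
 have pN: "p : N" using closedN[OF F(1) p] .
 have Qlim: "(%n. nrm (%t. x t - F n t)) ~~> nrm (%t. x t - p t)"
 proof (rule nrm_tendsto)
  have "nrm (%t. x t - F n t - (x t - p t)) = nrm (%t. F n t - p t)" for n
   using nrm_minus[of p "F n"] p F(1) NS by simp
  thus "(%n. nrm (%t. x t - F n t - (x t - p t))) ~~> 0" using p(2) by simp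
 qed (use x p F(1) NS diff_mem in auto)
 have "Q p <= D"
 proof (rule LIMSEQ_le[OF _ _ exI[of _ 0]])
  show "(%n. (nrm (%t. x t - F n t))^2) ~~> Q p"
   using tendsto_power[OF Qlim, of 2] x p by(simp add: nrm_sq diff_mem Q_def)
  show "(%n. D + 1 / real (Suc n)) ~~> D"
   using tendsto_add[OF tendsto_const LIMSEQ_inverse_real_of_nat] by(simp add: inverse_eq_divide)
  show "ALL n>=0. (nrm (%t. x t - F n t))^2 <= D + 1 / real (Suc n)"
   using F x NS by(auto simp: nrm_sq diff_mem Q_def intro: less_imp_le)
 qed
 have "ip (%t. x t - p t) g = 0" if g: "g : N" for g
 proof -
  have "(cmod (ip (%t. x t - p t) g))^2 <= 0 * Re (ip g g)"
  proof (rule ortho_of_min)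
   fix c
   have "(%t. p t + c * g t) : N" using linN[OF pN g, of 1 c] by simp
   from DQ[OF this] \<open>Q p <= D\<close>
   show "Re (ip (%t. x t - p t) (%t. x t - p t)) <=
   Re (ip (%t. x t - p t - c * g t) (%t. x t - p t - c * g t)) + 0"
   by(simp add: Q_def diff_diff_eq)
  qed (use x p g NS diff_mem in auto)
  thus ?thesis by simp
 qed
 thus ?thesis using pN by blast
qed

end

context semi_hilbert
begin

text \<open>If l is not zero, take y with l y nonzero and orthogonal to the kernel of l. As f - (l f
  / l y) y lies in the kernel, l f = (l y / |y|^2) <f,y>. The bound on l serves twice: it makes the
  kernel closed, and it prevents y from having seminorm zero.\<close>

lemma riesz:
 assumes lin_l: "!!f g a b. f : S ==> g : S ==> l (%x. a * f x + b * g x) = a * l f + b * l g"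
  and bd: "!!f. f : S ==> cmod (l f) <= C * nrm f"
 shows "EX z:S. ALL f:S. l f = ip f z"
proof -
 define N where "N = {f : S. l f = 0}"
 have l0: "l (%x. 0) = 0" using lin_l[OF zero zero, of 0 0] by simp
 have lS: "l (%x. c * f x) = c * l f" if "f : S" for f c using lin_l[OF that that, of c 0] by simp
 have lD: "l (%x. f x - g x) = l f - l g" if "f : S" "g : S" for f g
  using lin_l[OF that, of 1 "-1"] by simp
 interpret closed_sub S ip N
 proof unfold_locales
  fix F f assume F: "!!n. F n : N" and f: "f : S" and lim: "(%n. nrm (%x. F n x - f x)) ~~> 0"
  have "cmod (l f) <= C * nrm (%x. F n x - f x)" for n
   using F[of n] f bd[of "%x. F n x - f x"] by(simp add: N_def lD diff_mem)
  moreover have "(%n. C * nrm (%x. F n x - f x)) ~~> 0" using tendsto_mult_left[OF lim, of C] by simp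
  ultimately have "cmod (l f) <= 0" by(intro LIMSEQ_le_const) auto
  thus "f : N" using f by(simp add: N_def)
 qed (auto simp: N_def l0 zero lin lin_l)
 show ?thesis
 proof (cases "ALL f:S. l f = 0")
  case True
  thus ?thesis using zero ip_zero_right by(intro bexI[of _ "%x. 0"]) auto
 next
  case False
  then obtain x where x: "x : S" "l x ~= 0" by blast
  obtain p where p: "p : N" "ALL g:N. ip (%t. x t - p t) g = 0" using projection[OF x(1)] by blast
  define y where "y = (%t. x t - p t)"
  have pS: "p : S" "l p = 0" using p by(auto simp: N_def)
  have y: "y : S" "l y ~= 0" using x pS by(auto simp: y_def diff_mem lD)
  have yn: "nrm y ~= 0" using bd[OF y(1)] y(2) by auto
  have "l f = ip f (%t. cnj (l y / of_real ((nrm y)^2)) * y t)" if f: "f : S" for f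
  proof -
   have "l (%t. f t - (l f / l y) * y t) = l f - (l f / l y) * l y"
   using lD[OF f scale_mem[OF y(1)]] lS[OF y(1)] by metis
   hence "(%t. f t - (l f / l y) * y t) : N"
   using y(2) diff_mem[OF f scale_mem[OF y(1), of "l f / l y"]] by(simp add: N_def)
   hence "ip y (%t. f t - (l f / l y) * y t) = 0" using p(2) y_def by blast
   hence "ip (%t. f t - (l f / l y) * y t) y = 0"
   using ip_cnj[OF y(1) diff_mem[OF f scale_mem[OF y(1), of "l f / l y"]]] by simp
   hence "ip f y = (l f / l y) * of_real ((nrm y)^2)"
   using ip_diff[OF f scale_mem[OF y(1), of "l f / l y"] y(1)] ip_scale[OF y(1) y(1), of "l f / l y"]
   ip_self_nrm[OF y(1)] by simp
   thus ?thesis using ip_scale2[OF y(1) f, of "cnj (l y / of_real ((nrm y)^2))"] y yn by simp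
  qed
  thus ?thesis using y scale_mem by blast
 qed
qed

text \<open>The set of all \<open>y\<close> representing some \<open>B u\<close> is a closed subspace, and an element orthogonal
 to it vanishes by coercivity.\<close>

lemma lax_milgram:
 assumes lin1: "!!f g h a b. f : S ==> g : S ==> h : S ==>
   B (%x. a * f x + b * g x) h = a * B f h + b * B g h"
  and lin2: "!!f g h a b. f : S ==> g : S ==> h : S ==>
   B h (%x. a * f x + b * g x) = cnj a * B h f + cnj b * B h g"
  and bd: "!!f g. f : S ==> g : S ==> cmod (B f g) <= C * nrm f * nrm g"
  and coer: "!!f. f : S ==> c * (nrm f)^2 <= cmod (B f f)" "c > 0"
  and z: "z : S"
 shows "EX u:S. ALL v:S. B u v = ip z v"
proof -
 define N where "N = {y : S. EX u:S. ALL v:S. ip y v = B u v}"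
 have BD: "B (%x. f x - g x) h = B f h - B g h" if "f : S" "g : S" "h : S" for f g h
  using lin1[OF that, of 1 "-1"] by simp
 have ex: "EX y:S. ALL v:S. ip y v = B u v" if u: "u : S" for u
 proof -
  have "EX y:S. ALL v:S. cnj (B u v) = ip v y"
  proof (rule riesz[where C = "C * nrm u"])
   show "cnj (B u (%x. a * f x + b * g x)) = a * cnj (B u f) + b * cnj (B u g)"
   if "f : S" "g : S" for f g a b using lin2[of f g u a b] that u by simp
  qed (use bd u in auto)
  then obtain y where "y : S" "ALL v:S. cnj (B u v) = ip v y" by blast
  hence "ip y v = B u v" if "v : S" for v
   using ip_cnj[OF that, of y] that by(metis complex_cnj_cnj)
  thus ?thesis using \<open>y : S\<close> by blast
 qed
 interpret closed_sub S ip N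
 proof unfold_locales
  show "(%x. 0) : N"
   using zero lin1[OF zero zero, of _ 0 0] ip_zero_left by(auto simp: N_def intro!: bexI[of _ "%x. 0"])
  fix f g a b assume "f : N" "g : N"
  then obtain u v where "f : S" "g : S" "u : S" "v : S"
   "ALL w:S. ip f w = B u w" "ALL w:S. ip g w = B v w" by(auto simp: N_def)
  hence "(%x. a * f x + b * g x) : S" "(%x. a * u x + b * v x) : S"
   "ALL w:S. ip (%x. a * f x + b * g x) w = B (%x. a * u x + b * v x) w"
   by(simp_all add: lin ip_lin lin1)
  thus "(%x. a * f x + b * g x) : N" unfolding N_def by blast
 next
  fix F f assume F: "!!n. F n : N" and f: "f : S" and lim: "(%n. nrm (%x. F n x - f x)) ~~> 0"
  have FS: "F n : S" for n using F by(auto simp: N_def)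
  obtain U where U: "!!n. U n : S" "!!n v. v : S ==> ip (F n) v = B (U n) v"
   using F unfolding N_def by(auto) metis
  \<comment> \<open>Coercivity makes the preimage depend continuously on the represented element, so
    a convergent sequence in \<open>N\<close> has a Cauchy sequence of preimages.\<close>
  have cau: "c * nrm (%x. U m x - U n x) <= nrm (%x. F m x - F n x)" for m n
  proof -
   let ?w = "%x. U m x - U n x"
   have w: "?w : S" using U diff_mem by blast
   have "c * (nrm ?w)^2 <= cmod (B ?w ?w)" using coer w by blast
   also have "B ?w ?w = ip (%x. F m x - F n x) ?w" using U w FS by(simp add: BD ip_diff)
   also have "cmod ... <= nrm (%x. F m x - F n x) * nrm ?w" using cauchy_schwarz w FS diff_mem by blast
   finally have "c * nrm ?w * nrm ?w <= nrm (%x. F m x - F n x) * nrm ?w"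
   by(simp add: power2_eq_square mult.assoc)
   thus ?thesis using nrm_nonneg[OF w] nrm_nonneg[OF diff_mem[OF FS[of m] FS[of n]]]
   by(cases "nrm ?w = 0") auto
  qed
  have "EX u:S. (%n. nrm (%x. U n x - u x)) ~~> 0"
  proof (rule complete)
   fix e :: real assume e: "e > 0"
   have "\<forall>\<^sub>F n in sequentially. nrm (%x. F n x - f x) < c * e / 2"
   by(rule order_tendstoD(2)[OF lim]) (use e coer(2) in simp)
   then obtain K where K: "!!n. n >= K ==> nrm (%x. F n x - f x) < c * e / 2"
   by(auto simp: eventually_sequentially)
   have "nrm (%x. U m x - U n x) < e" if "m >= K" "n >= K" for m n
   proof -
   have "c * nrm (%x. U m x - U n x) <= nrm (%x. F m x - F n x)" by(rule cau)
   also have "... <= nrm (%x. F m x - f x) + nrm (%x. f x - F n x)"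
   using nrm_triangle_diff FS f by blast
   also have "... < c * e" using K[OF that(1)] K[OF that(2)] nrm_minus[OF f FS[of n]] by simp
   finally show ?thesis using coer(2) by simp
   qed
   thus "EX N. ALL m>=N. ALL n>=N. nrm (%x. U m x - U n x) < e" by blast
  qed (rule U)
  then obtain u where u: "u : S" "(%n. nrm (%x. U n x - u x)) ~~> 0" by blast
  have "ip f v = B u v" if v: "v : S" for v
  proof (rule LIMSEQ_unique[OF ip_tendsto[OF FS f v lim]])
   obtain y where y: "y : S" "ALL v:S. ip y v = B u v" using ex[OF u(1)] by blast
   have "(%n. C * nrm (%x. U n x - u x) * nrm v) ~~> C * 0 * nrm v"
   by(intro tendsto_intros u)
   hence "(%n. C * nrm (%x. U n x - u x) * nrm v) ~~> 0" by simp
   hence "(%n. ip (F n) v - B u v) ~~> 0"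
   proof (rule Lim_null_comparison[rotated], intro always_eventually allI)
   fix n show "norm (ip (F n) v - B u v) <= C * nrm (%x. U n x - u x) * nrm v"
   using bd[of "%x. U n x - u x" v] U u v by(simp add: BD diff_mem)
   qed
   thus "(%n. ip (F n) v) ~~> B u v" by(simp add: LIM_zero_iff)
  qed
  thus "f : N" using f u by(auto simp: N_def)
 qed (auto simp: N_def)
 obtain p where p: "p : N" "ALL g:N. ip (%t. z t - p t) g = 0" using projection[OF z] by blast
 define w where "w = (%t. z t - p t)"
 have pS: "p : S" using p(1) by(simp add: N_def)
 have w: "w : S" using z pS by(simp add: w_def diff_mem)
 obtain y where y: "y : S" "ALL v:S. ip y v = B w v" using ex[OF w] by blast
 hence "y : N" using w by(auto simp: N_def)
 hence "ip w y = 0" using p(2) w_def by blast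
 hence "B w w = 0" using y w ip_cnj[OF w y(1)] by auto
 hence "c * (nrm w)^2 <= 0" using coer(1)[OF w] by simp
 hence nw: "nrm w = 0" using coer(2) by(auto simp: mult_le_0_iff)
 obtain u where u: "u : S" "ALL v:S. ip p v = B u v" using p(1) by(auto simp: N_def)
 have "B u v = ip z v" if v: "v : S" for v
 proof -
  have "ip w v = 0" using nrm_zero_ip[OF v w nw] ip_cnj[OF v w] by simp
  thus ?thesis using u v z pS by(simp add: w_def ip_diff)
 qed
 thus ?thesis using u by blast
qed

end

section \<open>The space of square integrable functions\<close>

text \<open>Real-valued counterpart of \<open>L2_norm\<close>, convenient for algebra and limits. It
  is meaningful only on \<open>L2 M\<close>: the Bochner integral of a non-integrable square is 0,
  so membership has to be carried along.\<close>

abbreviation n2 :: "'a measure => ('a => complex) => real" where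
 "n2 M \<equiv> snorm (L2_inner M)"

abbreviation L2_lim :: "'a measure => (nat => 'a => complex) => ('a => complex) => bool" where
 "L2_lim M F f == (%n. n2 M (%x. F n x - f x)) ~~> 0"

lemma borel_measurable_cnj [measurable (raw)]:
 "f : bm M ==> (%x. cnj (f x)) : bm M"
 by(rule borel_measurable_continuous_on[where f = cnj]) (intro continuous_intros)

lemma nn_finite_iff:
 assumes "f : bm M"
 shows "(\<integral>\<^sup>+x. ennreal ((cmod (f x))^2) \<partial>M) < \<infinity> \<longleftrightarrow> integrable M (%x. (cmod (f x))^2)"
 using assms by(simp add: integrable_iff_bounded)

lemma L2_iff: "f : L2 M \<longleftrightarrow> f : bm M & integrable M (%x. (cmod (f x))^2)"
 using nn_finite_iff[of f M] by(auto simp: L2_def L2_norm_def epowr_def less_top)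

lemma L2_measurable [measurable_dest]: "f : L2 M ==> f : bm M"
 by(simp add: L2_iff)

lemma n2_eq: "n2 M f = sqrt (LINT x|M. (cmod (f x))^2)"
proof -
 have "L2_inner M f f = (LINT x|M. of_real ((cmod (f x))^2))"
  by(simp add: L2_inner_def complex_norm_square[symmetric])
 thus ?thesis by(simp add: snorm_def del: of_real_power)
qed

lemma n2_nonneg: "0 <= n2 M f"
 by(simp add: n2_eq)

lemma n2_sq: "(n2 M f)^2 = (LINT x|M. (cmod (f x))^2)"
 by(simp add: n2_eq)

lemma n2_sq_nn: "f : L2 M ==> ennreal ((n2 M f)^2) = (\<integral>\<^sup>+x. ennreal ((cmod (f x))^2) \<partial>M)"
 by(simp add: n2_sq L2_iff nn_integral_eq_integral)

lemma L2_norm_eq: "f : L2 M ==> L2_norm M f = ennreal (n2 M f)"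
 using n2_sq_nn[of f M] n2_nonneg[of M f]
 by(simp add: L2_norm_def epowr_def powr_half_sqrt flip: n2_sq_nn)

lemma n2_cong_AE:
 assumes "AE x in M. f x = g x" "f : bm M" "g : bm M"
 shows "n2 M f = n2 M g"
 unfolding n2_eq using assms by(auto intro!: integral_cong_AE arg_cong[where f = sqrt])

lemma L2_bound:
 assumes "f : L2 M" "g : bm M" "AE x in M. cmod (g x) <= c * cmod (f x)" "c >= 0"
 shows "g : L2 M" "n2 M g <= c * n2 M f"
proof -
 have b: "AE x in M. (cmod (g x))^2 <= c^2 * (cmod (f x))^2"
  using assms(3) by eventually_elim (metis norm_ge_zero power_mono power_mult_distrib)
 have i: "integrable M (%x. c^2 * (cmod (f x))^2)" using assms(1) by(simp add: L2_iff)
 show g: "g : L2 M" unfolding L2_iff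
  using b assms(2) by(auto intro!: Bintble_bound[OF i])
 have "(n2 M g)^2 <= (c * n2 M f)^2"
  using integral_mono_AE[OF _ i b] g by(simp add: n2_sq power_mult_distrib L2_iff)
 thus "n2 M g <= c * n2 M f"
  by(rule power2_le_imp_le) (simp add: assms n2_nonneg)
qed

lemma L2_cong_AE:
 assumes "f : L2 M" "g : bm M" "AE x in M. g x = f x"
 shows "g : L2 M"
proof (rule L2_bound(1)[OF assms(1,2), of 1])
 show "AE x in M. cmod (g x) <= 1 * cmod (f x)" using assms(3) by eventually_elim simp
qed simp

lemma L2_cnj: "f : L2 M ==> (%x. cnj (f x)) : L2 M"
 by(auto simp: L2_iff)

lemma n2_cnj: "n2 M (%x. cnj (f x)) = n2 M f"
 by(simp add: n2_eq)

lemma L2_mult_integrable: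
 assumes "f : L2 M" "g : L2 M"
 shows "integrable M (%x. f x * g x)"
proof (rule Bintble_bound)
 show "integrable M (%x. (cmod (f x))^2 + (cmod (g x))^2)" using assms by(simp add: L2_iff)
 have "cmod (f x * g x) <= (cmod (f x))^2 + (cmod (g x))^2" for x
 proof -
  have "2 * (cmod (f x) * cmod (g x)) <= (cmod (f x))^2 + (cmod (g x))^2"
   using sum_squares_bound[of "cmod (f x)" "cmod (g x)"] by(simp only: mult.assoc)
  moreover have "0 <= cmod (f x) * cmod (g x)" by simp
  ultimately show ?thesis unfolding norm_mult by linarith
 qed
 thus "AE x in M. norm (f x * g x) <= norm ((cmod (f x))^2 + (cmod (g x))^2)" by simp
qed (use assms in measurable)

lemma L2_inner_integrable:
 "f : L2 M ==> g : L2 M ==> integrable M (%x. f x * cnj (g x))"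
 by(rule L2_mult_integrable[OF _ L2_cnj])

lemma L2_inner_cong_AE:
 assumes "AE x in M. f x = f' x" "AE x in M. g x = g' x"
  and "f : L2 M" "f' : L2 M" "g : L2 M" "g' : L2 M"
 shows "L2_inner M f g = L2_inner M f' g'"
 unfolding L2_inner_def
proof (rule integral_cong_AE)
 show "AE x in M. f x * cnj (g x) = f' x * cnj (g' x)" using assms(1,2) by eventually_elim simp
qed (use assms in measurable)

lemma L2_zero: "(%x. 0) : L2 M"
 by(simp add: L2_iff)

lemma L2_lin:
 assumes "f : L2 M" "g : L2 M" shows "(%x. a * f x + b * g x) : L2 M"
 unfolding L2_iff
proof
 show m: "(%x. a * f x + b * g x) : bm M" using assms by measurable
 have i: "integrable M (%x. 2 * (cmod a)^2 * (cmod (f x))^2 + 2 * (cmod b)^2 * (cmod (g x))^2)"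
  using assms by(simp add: L2_iff)
 have "(cmod (a * f x + b * g x))^2 <= 2 * (cmod a)^2 * (cmod (f x))^2 + 2 * (cmod b)^2 * (cmod (g x))^2" for x
 proof -
  have "(cmod (a * f x + b * g x))^2 <= (cmod a * cmod (f x) + cmod b * cmod (g x))^2"
   by(intro power_mono) (metis norm_mult norm_triangle_ineq, simp)
  thus ?thesis
   using sum_squares_bound[of "cmod a * cmod (f x)" "cmod b * cmod (g x)"]
   by(simp add: power2_sum power_mult_distrib)
 qed
 thus "integrable M (%x. (cmod (a * f x + b * g x))^2)"
  by(intro Bintble_bound[OF i]) (use m in auto)
qed

lemma L2_inner_self_Re: "0 <= Re (L2_inner M f f)"
 using n2_eq[of M f] by(simp add: snorm_def)

lemma L2_semi_inner: "semi_inner (L2 M) (L2_inner M)"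
proof
 fix f g h :: "'a => complex" and a b assume *: "f : L2 M" "g : L2 M" "h : L2 M"
 have "L2_inner M (%x. a * f x + b * g x) h
   = (LINT x|M. a * (f x * cnj (h x)) + b * (g x * cnj (h x)))"
  unfolding L2_inner_def by(rule Bint_cong) (auto simp: algebra_simps)
 also have "... = a * L2_inner M f h + b * L2_inner M g h"
  using * L2_inner_integrable[of f M h] L2_inner_integrable[of g M h] by(simp add: L2_inner_def)
 finally show "L2_inner M (%x. a * f x + b * g x) h = a * L2_inner M f h + b * L2_inner M g h" .
next
 fix f g :: "'a => complex"
 show "L2_inner M g f = cnj (L2_inner M f g)"
 proof -
  have "cnj (LINT x|M. f x * cnj (g x)) = (LINT x|M. cnj (f x * cnj (g x)))"
   by(rule Bochner_Integration.integral_cnj[symmetric])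
  thus ?thesis by(simp add: L2_inner_def mult.commute)
 qed
qed (auto simp: L2_zero L2_lin L2_inner_self_Re)

text \<open>Fatou's lemma gives membership in L2 and the norm bound at once. It serves the
  completeness of L2 and, later, the removal of cut-offs from uniform estimates.\<close>

lemma L2_fatou:
 assumes F: "!!n. F n : L2 M" and b: "!!n. n >= n0 ==> n2 M (F n) <= C"
  and lim: "AE x in M. (%n. F n x) ~~> f x" and f: "f : bm M" and C: "C >= 0"
 shows "f : L2 M" "n2 M f <= C"
proof -
 have "(\<integral>\<^sup>+x. ennreal ((cmod (f x))^2) \<partial>M) = (\<integral>\<^sup>+x. liminf (%n. ennreal ((cmod (F n x))^2)) \<partial>M)"
 proof (rule nn_integral_cong_AE)
  show "AE x in M. ennreal ((cmod (f x))^2) = liminf (%n. ennreal ((cmod (F n x))^2))"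
   using lim
  proof eventually_elim
   case (elim x)
   have "(%n. ennreal ((cmod (F n x))^2)) ~~> ennreal ((cmod (f x))^2)"
   by(intro tendsto_intros elim)
   thus ?case by(rule lim_imp_Liminf[OF trivial_limit_sequentially, symmetric])
  qed
 qed
 also have "... <= liminf (%n. \<integral>\<^sup>+x. ennreal ((cmod (F n x))^2) \<partial>M)"
  by(rule nn_integral_liminf) (use F in measurable)
 also have "... <= ennreal (C^2)"
 proof (rule Liminf_le)
  have "(\<integral>\<^sup>+x. ennreal ((cmod (F n x))^2) \<partial>M) <= ennreal (C^2)" if "n >= n0" for n
   using n2_sq_nn[OF F[of n]] b[OF that] n2_nonneg[of M "F n"]
   by(metis ennreal_leI power_mono)
  thus "\<forall>\<^sub>F n in sequentially. (\<integral>\<^sup>+x. ennreal ((cmod (F n x))^2) \<partial>M) <= ennreal (C^2)"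
   by(auto simp: eventually_sequentially)
 qed simp
 finally have le: "(\<integral>\<^sup>+x. ennreal ((cmod (f x))^2) \<partial>M) <= ennreal (C^2)" .
 hence "(\<integral>\<^sup>+x. ennreal ((cmod (f x))^2) \<partial>M) < \<infinity>" using le_less_trans ennreal_less_top by fastforce
 thus L: "f : L2 M" using nn_finite_iff[OF f] f by(simp add: L2_iff)
 have "ennreal ((n2 M f)^2) <= ennreal (C^2)" using le n2_sq_nn[OF L] by simp
 hence "(n2 M f)^2 <= C^2" by(subst (asm) ennreal_le_iff) auto
 thus "n2 M f <= C" using C by(rule power2_le_imp_le)
qed

text \<open>The weights \<open>2\<^sup>n\<close> make almost everywhere summability of the increments of the subsequence a
 consequence of monotone convergence alone.\<close>

lemma L2_complete_AE:
 assumes F: "!!n. F n : L2 M"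
  and cauchy: "!!e. 0 < e ==> EX N. ALL m>=N. ALL n>=N. n2 M (%x. F m x - F n x) < e"
 shows "EX f r. f : L2 M & L2_lim M F f &
  strict_mono (r :: nat => nat) & (AE x in M. (%n. F (r n) x) ~~> f x)"
proof -
 interpret semi_inner "L2 M" "L2_inner M" by(rule L2_semi_inner)
 have "ALL k::nat. EX N. ALL m>=N. ALL n>=N. n2 M (%x. F m x - F n x) < (1/2)^k" using cauchy by simp
 then obtain N where N: "!!k m n. m >= N k ==> n >= N k ==> n2 M (%x. F m x - F n x) < (1/2)^k" by metis
 \<comment> \<open>The sum puts r k beyond N k, and the summand k makes r strictly
   increasing.\<close>
 define r where "r k = (\<Sum>j\<le>k. N j) + k" for k
 have r: "strict_mono r" by(auto simp: r_def strict_mono_Suc_iff)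
 have rN: "r k >= N k" for k unfolding r_def by(simp add: trans_le_add1 member_le_sum)
 have inc: "n2 M (%x. F (r (Suc k)) x - F (r k) x) < (1/2)^k" for k
  using N[of k "r (Suc k)" "r k"] rN[of k] strict_monoD[OF r, of k "Suc k"] by simp
 define d where "d k x = F (r (Suc k)) x - F (r k) x" for k x
 have dL: "d k : L2 M" for k unfolding d_def using F diff_mem by blast
 have "(\<integral>\<^sup>+x. (\<Sum>k. ennreal (2^k * (cmod (d k x))^2)) \<partial>M) = (\<Sum>k. \<integral>\<^sup>+x. ennreal (2^k * (cmod (d k x))^2) \<partial>M)"
  by(rule nn_integral_suminf) (use dL in measurable)
 also have "... <= (\<Sum>k. ennreal ((1/2)^k))"
 proof (rule suminf_le)
  fix k
  have "(\<integral>\<^sup>+x. ennreal (2^k * (cmod (d k x))^2) \<partial>M) = ennreal (2^k) * ennreal ((n2 M (d k))^2)"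
   unfolding n2_sq_nn[OF dL] using dL[of k]
   by(subst nn_integral_cmult[symmetric]) (auto simp: ennreal_mult)
  also have "... = ennreal (2^k * (n2 M (d k))^2)" by(simp add: ennreal_mult)
  also have "... <= ennreal (2^k * ((1/2)^k)^2)"
   using inc[of k] n2_nonneg[of M "d k"]
   by(intro ennreal_leI mult_left_mono power_mono) (auto simp: d_def[abs_def])
  also have "2^k * ((1/2)^k)^2 = ((1/2)^k :: real)"
   by(simp add: power2_eq_square power_divide)
  finally show "(\<integral>\<^sup>+x. ennreal (2^k * (cmod (d k x))^2) \<partial>M) <= ennreal ((1/2)^k)" .
 qed auto
 also have "... < \<infinity>"
 proof -
  have "summable (%k. (1/2::real)^k)" by(rule summable_geometric) auto
  hence "(\<Sum>k. ennreal ((1/2)^k)) = ennreal (\<Sum>k. (1/2)^k)" by(intro suminf_ennreal2) auto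
  thus ?thesis by(simp only: ennreal_less_top infinity_ennreal_def)
 qed
 finally have "AE x in M. (\<Sum>k. ennreal (2^k * (cmod (d k x))^2)) ~= \<infinity>"
  using dL by(intro nn_integral_PInf_AE) auto
 hence AE: "AE x in M. convergent (%n. F (r n) x)"
 proof eventually_elim
  case (elim x)
  hence sm: "summable (%k. 2^k * (cmod (d k x))^2)" by(intro summable_suminf_not_top) auto
  have "\<forall>\<^sub>F k in sequentially. 2^k * (cmod (d k x))^2 < 1"
   using summable_LIMSEQ_zero[OF sm] order_tendstoD(2) zero_less_one by blast
  \<comment> \<open>Summability makes the weighted squares eventually less than 1, which already
    bounds the increments by a convergent geometric series.\<close>
  moreover have "cmod (d k x) <= (1 / sqrt 2)^k" if "2^k * (cmod (d k x))^2 < 1" for k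
  proof (rule power2_le_imp_le)
   have "((1 / sqrt 2)^k)^2 = (1 / 2 ^ k :: real)"
   by(simp add: power_divide real_sqrt_power flip: power_mult) (metis power_even_eq power_mult real_sqrt_pow2 zero_le_numeral mult.commute)
   thus "(cmod (d k x))^2 <= ((1 / sqrt 2)^k)^2" using that by(simp add: field_simps)
  qed simp
  ultimately have ev: "\<forall>\<^sub>F k in sequentially. norm (d k x) <= (1 / sqrt 2)^k"
   by(auto elim: eventually_mono)
  have "summable (%k. (1 / sqrt 2)^k :: real)" by(rule summable_geometric) auto
  hence "summable (%k. d k x)" by(rule summable_comparison_test_ev[OF ev])
  hence "convergent (%n. \<Sum>k<n. d k x)" by(simp add: summable_iff_convergent)
  moreover have "(\<Sum>k<n. d k x) = F (r n) x - F (r 0) x" for n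
   unfolding d_def by(rule sum_lessThan_telescope)
  ultimately have "convergent (%n. F (r n) x - F (r 0) x + F (r 0) x)"
   using convergent_add convergent_const by fastforce
  thus ?case by simp
 qed
 define f where "f x = lim (%n. F (r n) x)" for x
 have f[measurable]: "f : bm M" unfolding f_def using F by measurable
 have lim: "AE x in M. (%n. F (r n) x) ~~> f x"
  using AE by eventually_elim (simp add: f_def convergent_LIMSEQ_iff)
 have est: "(%x. F m x - f x) : L2 M & n2 M (%x. F m x - f x) <= e"
  if "!!n. n >= K ==> n2 M (%x. F m x - F n x) <= e" "e > 0" for m K e
 proof -
  have "AE x in M. (%n. F m x - F (r n) x) ~~> F m x - f x"
   using lim by eventually_elim (intro tendsto_intros)
  moreover have "n2 M (%x. F m x - F (r n) x) <= e" if "n >= K" for n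
   using that \<open>!!n. n >= K ==> _\<close> seq_suble[OF r, of n] by simp
  ultimately show ?thesis
   using L2_fatou[of "%n x. F m x - F (r n) x" M K e "%x. F m x - f x"] F diff_mem \<open>e > 0\<close>
   by(auto simp: L2_measurable)
 qed
 have ev: "EX K. ALL m>=K. (%x. F m x - f x) : L2 M & n2 M (%x. F m x - f x) <= e" if e: "e > 0" for e
 proof -
  obtain K where K: "ALL m>=K. ALL n>=K. n2 M (%x. F m x - F n x) < e" using cauchy[OF e] by blast
  have "(%x. F m x - f x) : L2 M & n2 M (%x. F m x - f x) <= e" if "m >= K" for m
   using K that by(intro est[of K m e] e) (simp add: less_imp_le)
  thus ?thesis by blast
 qed
 obtain K where "(%x. F K x - f x) : L2 M" using ev[of 1] by auto
 hence "(%x. F K x - (F K x - f x)) : L2 M" using F diff_mem by blast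
 hence fL: "f : L2 M" by simp
 have "L2_lim M F f"
 proof (rule LIMSEQ_I)
  fix e :: real assume "e > 0"
  then obtain K where K: "!!m. m >= K ==> n2 M (%x. F m x - f x) <= e/2" using ev[of "e/2"] by auto
  have "norm (n2 M (%x. F n x - f x) - 0) < e" if "n >= K" for n
   using K[OF that] \<open>e > 0\<close> n2_nonneg[of M "%x. F n x - f x"] by simp
  thus "EX no. ALL n>=no. norm (n2 M (%x. F n x - f x) - 0) < e" by blast
 qed
 thus ?thesis using fL r lim by blast
qed

interpretation L2: semi_hilbert "L2 M" "L2_inner M" for M
proof (intro semi_hilbert.intro L2_semi_inner semi_hilbert_axioms.intro)
 fix F :: "nat => 'a => complex"
 assume "!!n. F n : L2 M" "!!e. 0 < e ==> EX N. ALL m>=N. ALL n>=N. n2 M (%x. F m x - F n x) < e"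
 from L2_complete_AE[OF this] show "EX f:L2 M. L2_lim M F f" by blast
qed

lemma L2_cauchy_of_lim:
 assumes F: "!!n. F n : L2 M" and f: "f : L2 M" and lim: "L2_lim M F f" and e: "0 < e"
 shows "EX N. ALL m>=N. ALL n>=N. n2 M (%x. F m x - F n x) < e"
proof -
 have "\<forall>\<^sub>F n in sequentially. n2 M (%x. F n x - f x) < e / 2"
  by(rule order_tendstoD(2)[OF lim]) (use e in simp)
 then obtain N where N: "!!n. n >= N ==> n2 M (%x. F n x - f x) < e / 2" by(auto simp: eventually_sequentially)
 have "n2 M (%x. F m x - F n x) < e" if "m >= N" "n >= N" for m n
  using L2.nrm_triangle_diff[OF F[of m] f F[of n]] L2.nrm_minus[OF f F[of n]] N[OF that(1)] N[OF that(2)] by simp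
 thus ?thesis by blast
qed

lemma n2_zero_iff: "f : L2 M ==> n2 M f = 0 \<longleftrightarrow> (AE x in M. f x = 0)"
 using integral_nonneg_eq_0_iff_AE[of M "%x. (cmod (f x))^2"] by(simp add: n2_eq L2_iff)

section \<open>Singular values and Schatten classes\<close>

text \<open>Gaussian elimination on the last equation: with a pivot k, the unknown at k is expressed
  through the others, which leaves n equations on the index set without k. Without a pivot the
  equation is void.\<close>

lemma underdetermined:
 fixes a :: "'i => nat => complex"
 assumes "finite I" "n < card I"
 shows "EX c. (EX i:I. c i ~= 0) & (ALL j<n. (\<Sum>i\<in>I. c i * a i j) = 0)"
 using assms
proof (induction n arbitrary: I a)
 case 0
 then obtain i where "i : I" by fastforce
 thus ?case by(intro exI[of _ "%_. 1"]) auto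
next
 case (Suc n)
 show ?case
 proof (cases "ALL i:I. a i n = 0")
  case True
  obtain c where "EX i:I. c i ~= 0" "ALL j<n. (\<Sum>i\<in>I. c i * a i j) = 0" using Suc.IH[of I a] Suc.prems by auto
  thus ?thesis using True by(intro exI[of _ c]) (auto simp: less_Suc_eq)
 next
  case False
  then obtain k where k: "k : I" "a k n ~= 0" by blast
  define b where "b i j = a i j - (a i n / a k n) * a k j" for i j
  have "EX c. (EX i:I - {k}. c i ~= 0) & (ALL j<n. (\<Sum>i\<in>I - {k}. c i * b i j) = 0)"
   using Suc.prems k by(intro Suc.IH) auto
  then obtain c where c: "EX i:I - {k}. c i ~= 0" "!!j. j < n ==> (\<Sum>i\<in>I - {k}. c i * b i j) = 0" by blast
  define t where "t = - (\<Sum>i\<in>I - {k}. c i * (a i n / a k n))"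
  have s: "(\<Sum>i\<in>I. (c(k := t)) i * a i j) = (\<Sum>i\<in>I - {k}. c i * b i j)" for j
  proof -
   have "(\<Sum>i\<in>I. (c(k := t)) i * a i j) = t * a k j + (\<Sum>i\<in>I - {k}. c i * a i j)"
   using k Suc.prems(1) by(subst sum.remove[of _ k]) (auto intro!: sum.cong)
   also have "t * a k j = - (\<Sum>i\<in>I - {k}. c i * (a i n / a k n * a k j))"
   unfolding t_def by(simp add: sum_distrib_right mult.assoc)
   finally show ?thesis by(simp add: b_def right_diff_distrib sum_subtractf)
  qed
  have "b i n = 0" for i using k by(simp add: b_def)
  hence "ALL j<Suc n. (\<Sum>i\<in>I. (c(k := t)) i * a i j) = 0"
   unfolding s using c(2) by(auto simp: less_Suc_eq)
  moreover have "EX i:I. (c(k := t)) i ~= 0" using c(1) by auto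
  ultimately show ?thesis by blast
 qed
qed

context semi_inner
begin

lemma sum_mem:
 assumes "finite I" "!!i. i : I ==> e i : S"
 shows "(%x. \<Sum>i\<in>I. c i * e i x) : S"
 using assms
proof (induction I)
 case (insert i I)
 thus ?case using lin[of "e i" "%x. \<Sum>i\<in>I. c i * e i x" "c i" 1] by simp
qed (simp add: zero)

lemma ip_sum:
 assumes "finite I" "!!i. i : I ==> e i : S" "h : S"
 shows "ip (%x. \<Sum>i\<in>I. c i * e i x) h = (\<Sum>i\<in>I. c i * ip (e i) h)"
 using assms
proof (induction I)
 case (insert i I)
 hence "(%x. \<Sum>i\<in>I. c i * e i x) : S" by(intro sum_mem) auto
 with insert show ?case using ip_lin[of "e i" "%x. \<Sum>i\<in>I. c i * e i x" h "c i" 1] by simp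
qed (simp add: ip_zero_left)

lemma ip_sum_ortho:
 assumes I: "finite I" "!!i. i : I ==> e i : S"
  and o: "!!i j. i : I ==> j : I ==> ip (e i) (e j) = of_bool (i = j) * l i"
 shows "ip (%x. \<Sum>i\<in>I. c i * e i x) (%x. \<Sum>i\<in>I. c i * e i x) = (\<Sum>i\<in>I. of_real ((cmod (c i))^2) * l i)"
proof -
 let ?f = "%x. \<Sum>i\<in>I. c i * e i x"
 have f: "?f : S" using I by(rule sum_mem)
 have "ip (e i) ?f = cnj (c i) * l i" if i: "i : I" for i
 proof -
  have "ip ?f (e i) = (\<Sum>j\<in>I. c j * ip (e j) (e i))" using I i by(intro ip_sum) auto
  also have "... = (\<Sum>j\<in>I. if j = i then c i * l i else 0)" using i o by(intro sum.cong) auto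
  also have "... = c i * l i" using I i by simp
  finally have *: "ip ?f (e i) = c i * l i" .
  have "l i = ip (e i) (e i)" using o[OF i i] by simp
  hence "cnj (l i) = l i" using ip_cnj[OF I(2)[OF i] I(2)[OF i]] by metis
  thus ?thesis using * ip_cnj[OF f I(2)[OF i]] by simp
 qed
 thus ?thesis
  using I f by(simp add: ip_sum complex_norm_square[symmetric] mult.assoc[symmetric] del: of_real_power)
qed

end

section \<open>Compact operators and their singular vectors\<close>

locale linear_operator =
 fixes M :: "'a measure" and A :: "('a => complex) => ('a => complex)"
 assumes linear: "linear_op M A"
begin

lemma A_L2: "f : L2 M ==> A f : L2 M"
 using linear by(simp add: linear_op_def)

lemma A_lin: "f : L2 M ==> g : L2 M ==> AE x in M. A (%y. a * f y + b * g y) x = a * A f x + b * A g x"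
 using linear by(simp add: linear_op_def)

lemma A_diff: "f : L2 M ==> g : L2 M ==> AE x in M. A (%y. f y - g y) x = A f x - A g x"
 using A_lin[of f g 1 "-1"] by simp

text \<open>This form plays the role of <A^* A f, g>, so the eigenvectors of A^* A can be treated
  without constructing the adjoint. As a semi-inner product it has its own Cauchy-Schwarz inequality
  and continuity.\<close>

abbreviation ipA where "ipA f g \<equiv> L2_inner M (A f) (A g)"

sublocale ipA: semi_inner "L2 M" ipA
proof
 fix f g h :: "'a => complex" and a b assume *: "f : L2 M" "g : L2 M" "h : L2 M"
 have "ipA (%x. a * f x + b * g x) h = L2_inner M (%x. a * A f x + b * A g x) (A h)"
  using * by(intro L2_inner_cong_AE A_lin A_L2 L2_lin) auto
 thus "ipA (%x. a * f x + b * g x) h = a * ipA f h + b * ipA g h"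
  using L2.ip_lin[OF A_L2[OF *(1)] A_L2[OF *(2)] A_L2[OF *(3)]] by simp
qed (auto simp: L2_zero L2_lin L2_inner_self_Re A_L2 intro!: L2.ip_cnj)

lemma snorm_ipA: "snorm ipA f = n2 M (A f)"
 by(simp add: snorm_def)

lemma n2_A_scale: "f : L2 M ==> n2 M (A (%x. c * f x)) = cmod c * n2 M (A f)"
 using ipA.nrm_scale[of f c] by(simp add: snorm_ipA)

lemma n2_A_diff: "f : L2 M ==> g : L2 M ==> n2 M (A (%x. f x - g x)) = n2 M (%x. A f x - A g x)"
 by(intro n2_cong_AE A_diff L2_measurable A_L2 L2.diff_mem)

lemma singular_ortho:
 assumes "e : singular_space M A s" "e' : singular_space M A s'" "s ~= s'" "s > 0" "s' > 0"
 shows "L2_inner M e e' = 0"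
proof -
 have L: "e : L2 M" "e' : L2 M" using assms by(auto simp: singular_space_def)
 have "ipA e e' = of_real (s^2) * L2_inner M e e'" "ipA e' e = of_real (s'^2) * L2_inner M e' e"
  using assms L by(auto simp: singular_space_def)
 hence "of_real (s^2) * L2_inner M e e' = of_real (s'^2) * L2_inner M e e'"
  using L2.ip_cnj[OF L] ipA.ip_cnj[OF L] by(metis complex_cnj_cnj complex_cnj_complex_of_real complex_cnj_mult)
 moreover have "s^2 ~= s'^2" using assms by(simp add: power2_eq_iff)
 ultimately show ?thesis by(metis mult_cancel_right of_real_eq_iff)
qed

text \<open>The singular values may differ from member to member, and the index set is arbitrary, so
  that orthonormal bases of several singular spaces can be joined into one family.\<close>

definition system where
 "system t I e s \<longleftrightarrow> finite I & (ALL i:I. e i : singular_space M A (s i) & t <= s i) &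
   (ALL i:I. ALL j:I. L2_inner M (e i) (e j) = of_bool (i = j))"

lemma system_card_le_mult:
 assumes "system t I e s" "!!i. i : I ==> s i = r"
 shows "of_nat (card I) <= singular_mult M A r"
proof -
 obtain h where h: "bij_betw h {..<card I} I"
  using ex_bij_betw_nat_finite[of I] assms(1) by(auto simp: system_def atLeast0LessThan)
 have hI: "h i : I" if "i < card I" for i using bij_betwE[OF h] that by auto
 have hij: "h i = h j \<longleftrightarrow> i = j" if "i < card I" "j < card I" for i j
  using inj_onD[OF bij_betw_imp_inj_on[OF h], of i j] that by auto
 have "ALL i<card I. e (h i) : singular_space M A r"
  using assms hI by(auto simp: system_def)
 moreover have "ALL i<card I. ALL j<card I. L2_inner M (e (h i)) (e (h j)) = of_bool (i = j)"
  using assms hI hij by(auto simp: system_def)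
 ultimately show ?thesis unfolding singular_mult_def
  by(intro SUP_upper) (auto intro!: exI[of _ "%i. e (h i)"])
qed

end

locale compact_operator = linear_operator +
 assumes compact: "compact_op M A"
begin

lemma compactD:
 assumes "!!n. F n : L2 M" "!!n. n2 M (F n) <= 1"
 shows "EX r g. strict_mono (r :: nat => nat) & g : L2 M & (%n. n2 M (%x. A (F (r n)) x - g x)) ~~> 0"
proof -
 have "ALL n. F n : L2 M & L2_norm M (F n) <= 1"
  using assms ennreal_leI[OF assms(2)] by(simp add: L2_norm_eq)
 then obtain r :: "nat => nat" and g where *: "strict_mono r" "g : L2 M"
  "(%n. L2_norm M (%x. A (F (r n)) x - g x)) ~~> 0"
  using compact unfolding compact_op_def by blast
 have "(%x. A (F (r n)) x - g x) : L2 M" for n using A_L2 assms * L2.diff_mem by blast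
 hence "(%n. ennreal (n2 M (%x. A (F (r n)) x - g x))) ~~> ennreal 0" using *(3) by(simp add: L2_norm_eq)
 hence "(%n. n2 M (%x. A (F (r n)) x - g x)) ~~> 0"
  by(subst (asm) tendsto_ennreal_iff) (auto simp: n2_nonneg)
 thus ?thesis using * by blast
qed

text \<open>An unbounded operator would map some sequence in the unit ball to vectors of norm at
  least n + 1, and such images have no convergent subsequence.\<close>

lemma bounded: "EX C>0. ALL f:L2 M. n2 M (A f) <= C * n2 M f"
proof (rule ccontr)
 assume "\<not> ?thesis"
 hence "ALL n::nat. EX f:L2 M. n2 M (A f) > real (Suc n) * n2 M f" by(meson not_le of_nat_0_less_iff zero_less_Suc)
 then obtain f where f: "!!n. f n : L2 M" "!!n. n2 M (A (f n)) > real (Suc n) * n2 M (f n)" by metis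
 \<comment> \<open>Linearity alone does not exclude a vector of seminorm 0 with a nonzero image;
   such a vector is scaled until its image has norm \<open>Suc n\<close>.\<close>
 define c where "c n = (if n2 M (f n) = 0 then real (Suc n) / n2 M (A (f n)) else 1 / n2 M (f n))" for n
 define F where "F n x = of_real (c n) * f n x" for n x
 have FL: "F n : L2 M" for n unfolding F_def using f L2.scale_mem by blast
 have pos: "n2 M (A (f n)) > 0" for n using f(2)[of n] n2_nonneg[of M "f n"]
  by(smt (verit) mult_nonneg_nonneg of_nat_0_le_iff)
 have c0: "c n >= 0" for n using pos[of n] n2_nonneg[of M "f n"] by(simp add: c_def)
 have nF: "n2 M (F n) = c n * n2 M (f n)" and nA: "n2 M (A (F n)) = c n * n2 M (A (f n))" for n
  unfolding F_def using L2.nrm_scale[OF f(1)] n2_A_scale[OF f(1)] c0[of n] by simp_all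
 have F1: "n2 M (F n) <= 1" for n using n2_nonneg[of M "f n"] by(simp add: nF c_def)
 have A1: "n2 M (A (F n)) >= real (Suc n)" for n
 proof (cases "n2 M (f n) = 0")
  case True thus ?thesis using pos[of n] by(simp add: nA c_def)
 next
  case False
  hence "n2 M (f n) > 0" using n2_nonneg[of M "f n"] by simp
  thus ?thesis using f(2)[of n] False by(simp add: nA c_def field_simps)
 qed
 obtain r g where r: "strict_mono (r :: nat => nat)" "g : L2 M" "(%n. n2 M (%x. A (F (r n)) x - g x)) ~~> 0"
  using compactD[of F] FL F1 by blast
 have "(%n. n2 M (A (F (r n)))) ~~> n2 M g"
  by(rule L2.nrm_tendsto) (use r FL A_L2 in auto)
 hence "Bseq (%n. n2 M (A (F (r n))))" by(intro convergent_imp_Bseq) (auto simp: convergent_def)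
 then obtain K where K: "!!n. norm (n2 M (A (F (r n)))) <= K" by(auto simp: Bseq_def)
 obtain n :: nat where "K < real n" using reals_Archimedean2 by blast
 moreover have "real n <= real (Suc (r n))" using seq_suble[OF r(1), of n] by simp
 ultimately show False using K[of n] A1[of "r n"] by(simp add: n2_nonneg)
qed

text \<open>The supremum s of |A f| over the unit sphere of \<open>N\<close> is attained. The form
  s^2 <f,g> - <A f,A g> is positive semidefinite on \<open>N\<close>, so its Cauchy-Schwarz
  inequality makes it nearly vanish at near-maximisers. Together with compactness this forces a
  subsequence to converge, and its limit is an eigenvector relative to \<open>N\<close>.\<close>

lemma max_vector:
 assumes "closed_sub (L2 M) (L2_inner M) N" and t: "t > 0" and x: "x : N" "n2 M (A x) > t * n2 M x"
 shows "EX s e. t <= s & e : N & n2 M e = 1 & (ALL y:N. ipA e y = of_real (s^2) * L2_inner M e y)"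
proof -
 interpret N: closed_sub "L2 M" "L2_inner M" N by fact
 have NL: "f : L2 M" if "f : N" for f using that N.sub by auto
 obtain C where C: "C > 0" "!!f. f : L2 M ==> n2 M (A f) <= C * n2 M f" using bounded by blast
 define U where "U = {n2 M (A f) |f. f : N & n2 M f = 1}"
 have bdd: "bdd_above U" using C NL by(fastforce simp: U_def intro!: bdd_aboveI[of _ C])
 have nx: "n2 M x > 0"
  using C(2)[OF NL[OF x(1)]] x(2) n2_nonneg[of M x] by(cases "n2 M x = 0") auto
 define x1 where "x1 y = of_real (1 / n2 M x) * x y" for y
 have x1: "x1 : N" "n2 M x1 = 1"
  using N.linN[OF x(1) x(1), of "of_real (1 / n2 M x)" 0] L2.nrm_scale[OF NL[OF x(1)], of "of_real (1 / n2 M x)"] nx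
  unfolding x1_def by(simp_all add: norm_divide)
 have Ax1: "n2 M (A x1) > t"
  unfolding x1_def n2_A_scale[OF NL[OF x(1)]] using nx x(2) by(simp add: norm_divide field_simps)
 have x1U: "n2 M (A x1) : U" using x1 by(auto simp: U_def)
 define s where "s = Sup U"
 have st: "s > t" unfolding s_def using Ax1 cSup_upper[OF x1U bdd] by simp
 have s1: "n2 M (A f) <= s" if "f : N" "n2 M f = 1" for f
  unfolding s_def using that by(intro cSup_upper bdd) (auto simp: U_def)
 have sb: "n2 M (A f) <= s * n2 M f" if f: "f : N" for f
 proof (cases "n2 M f = 0")
  case True thus ?thesis using C(2)[OF NL[OF f]] by simp
 next
  case False
  hence p: "n2 M f > 0" using n2_nonneg[of M f] by simp
  have "(%y. of_real (1 / n2 M f) * f y) : N" using N.linN[OF f f, of "of_real (1 / n2 M f)" 0] by simp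
  moreover have "n2 M (%y. of_real (1 / n2 M f) * f y) = 1"
   using L2.nrm_scale[OF NL[OF f], of "of_real (1 / n2 M f)"] p by(simp add: norm_divide)
  ultimately have "n2 M (A (%y. of_real (1 / n2 M f) * f y)) <= s" using s1 by blast
  thus ?thesis unfolding n2_A_scale[OF NL[OF f]] using p by(simp add: norm_divide field_simps)
 qed
 have "EX f:N. n2 M f = 1 & n2 M (A f) > s - 1 / real (Suc n)" for n
 proof -
  have "s - 1 / real (Suc n) < Sup U" by(simp add: s_def)
  then obtain u where "u : U" "u > s - 1 / real (Suc n)" using less_cSupD[of U] x1U by blast
  thus ?thesis by(auto simp: U_def)
 qed
 then obtain X where X: "!!n. X n : N" "!!n. n2 M (X n) = 1" "!!n. n2 M (A (X n)) > s - 1 / real (Suc n)" by metis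
 obtain r g where r: "strict_mono (r :: nat => nat)" "g : L2 M" "(%n. n2 M (%x. A (X (r n)) x - g x)) ~~> 0"
  using compactD[of X] X NL by auto
 define Y where "Y n = X (r n)" for n
 have Y: "Y n : N" "n2 M (Y n) = 1" "Y n : L2 M" for n using X NL by(auto simp: Y_def)
 define D where "D n = s^2 - (n2 M (A (Y n)))\<^sup>2" for n
 have "(%n. n2 M (A (X n))) ~~> s"
 proof (rule tendsto_sandwich[OF _ _ _ tendsto_const])
  show "(%n. s - 1 / real (Suc n)) ~~> s"
   using tendsto_diff[OF tendsto_const LIMSEQ_inverse_real_of_nat, of s] by(simp add: inverse_eq_divide)
 qed (use X s1 in \<open>auto intro!: always_eventually less_imp_le\<close>)
 hence "(%n. n2 M (A (Y n))) ~~> s" unfolding Y_def using LIMSEQ_subseq_LIMSEQ[OF _ r(1)] by(auto simp: o_def)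
 hence "(%n. s^2 - (n2 M (A (Y n)))\<^sup>2) ~~> s\<^sup>2 - s\<^sup>2" by(intro tendsto_intros)
 hence Dlim: "D ~~> 0" by(simp add: D_def[abs_def])
 have s0: "s > 0" using st t by simp
 have D0: "D n >= 0" for n using s1[OF Y(1,2)[of n]] by(simp add: D_def n2_nonneg power_mono)
 define ipS where "ipS f h = of_real (s^2) * L2_inner M f h - ipA f h" for f h
 interpret S: semi_inner N ipS
 proof
  fix f assume f: "f : N"
  have "(n2 M (A f))^2 <= (s * n2 M f)^2" using sb[OF f] by(intro power_mono) (auto simp: n2_nonneg)
  thus "0 <= Re (ipS f f)"
   using L2.nrm_sq[OF NL[OF f]] L2.nrm_sq[OF A_L2[OF NL[OF f]]] by(simp add: ipS_def power_mult_distrib)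
 qed (auto simp: ipS_def N.zeroN N.linN NL L2.ip_lin ipA.ip_lin algebra_simps intro: L2.ip_cnj ipA.ip_cnj
   simp flip: L2.ip_cnj ipA.ip_cnj)
 have SD: "Re (ipS (Y n) (Y n)) = D n" for n
  using L2.nrm_sq[OF Y(3)] L2.nrm_sq[OF A_L2[OF Y(3)]] Y(2) by(simp add: ipS_def D_def)
 have SY: "cmod (ipS (Y n) y) <= sqrt (D n) * (s * n2 M y)" if y: "y : N" for n y
 proof -
  have "cmod (ipS (Y n) y) <= snorm ipS (Y n) * snorm ipS y" using S.cauchy_schwarz[OF Y(1) y] .
  also have "snorm ipS (Y n) = sqrt (D n)" by(simp add: snorm_def SD)
  also have "snorm ipS y <= s * n2 M y"
  proof (rule power2_le_imp_le)
   show "(snorm ipS y)^2 <= (s * n2 M y)^2"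
   unfolding S.nrm_sq[OF y]
   using L2.nrm_sq[OF NL[OF y]] ipA.ip_nonneg[OF NL[OF y]] by(simp add: ipS_def power_mult_distrib)
  qed (simp add: s0 less_imp_le n2_nonneg)
  finally show ?thesis using D0 by(simp add: mult_left_mono)
 qed
 \<comment> \<open>For y = Y m - Y n write s^2 <y,y> = \<open>ipS y y\<close> + <A y,A y>. The first
   part is small through the defects \<open>D\<close>, the second through convergence of the
   images.\<close>
 have key: "s^2 * n2 M (%x. Y m x - Y n x) <= s * (sqrt (D m) + sqrt (D n)) + C * n2 M (%x. A (Y m) x - A (Y n) x)" for m n
 proof -
  let ?y = "%x. Y m x - Y n x"
  have y: "?y : N" using N.linN[OF Y(1)[of m] Y(1)[of n], of 1 "-1"] by simp
  have yL: "?y : L2 M" using NL y by blast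
  have "of_real (s^2) * L2_inner M ?y ?y = ipS ?y ?y + ipA ?y ?y" by(simp add: ipS_def)
  also have "ipS ?y ?y = ipS (Y m) ?y - ipS (Y n) ?y" using S.ip_diff[OF Y(1) Y(1) y] .
  finally have "cmod (of_real (s^2) * L2_inner M ?y ?y) <= cmod (ipS (Y m) ?y) + cmod (ipS (Y n) ?y) + cmod (ipA ?y ?y)"
   using norm_triangle_ineq[of "ipS (Y m) ?y - ipS (Y n) ?y" "ipA ?y ?y"]
   norm_triangle_ineq4[of "ipS (Y m) ?y" "ipS (Y n) ?y"] by simp
  moreover have "cmod (of_real (s^2) * L2_inner M ?y ?y) = s^2 * (n2 M ?y)^2"
   unfolding L2.ip_self_nrm[OF yL] by(simp add: norm_mult norm_power)
  moreover have "cmod (ipA ?y ?y) <= C * n2 M (%x. A (Y m) x - A (Y n) x) * n2 M ?y"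
  proof -
   have "cmod (ipA ?y ?y) <= n2 M (A ?y) * n2 M (A ?y)" using L2.cauchy_schwarz A_L2 yL by blast
   also have "... <= n2 M (A ?y) * (C * n2 M ?y)" using C(2)[OF yL] by(intro mult_left_mono) (auto simp: n2_nonneg)
   finally show ?thesis using n2_A_diff[OF Y(3) Y(3)] by(simp add: mult_ac)
  qed
  ultimately have le: "s^2 * (n2 M ?y)^2 <= (s * (sqrt (D m) + sqrt (D n)) + C * n2 M (%x. A (Y m) x - A (Y n) x)) * n2 M ?y"
   using SY[OF y, of m] SY[OF y, of n] by(simp add: algebra_simps)
  show ?thesis
  proof (cases "n2 M ?y = 0")
   case True
   have "0 <= s * (sqrt (D m) + sqrt (D n))" using s0 D0 by(intro mult_nonneg_nonneg add_nonneg_nonneg) auto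
   moreover have "0 <= C * n2 M (%x. A (Y m) x - A (Y n) x)"
   using C(1) n2_nonneg by(intro mult_nonneg_nonneg) auto
   ultimately show ?thesis using True by simp
  next
   case False
   hence "n2 M ?y > 0" using n2_nonneg[of M ?y] by simp
   moreover have "(s^2 * n2 M ?y) * n2 M ?y <= (s * (sqrt (D m) + sqrt (D n)) + C * n2 M (%x. A (Y m) x - A (Y n) x)) * n2 M ?y"
   using le by(simp add: power2_eq_square mult.assoc)
   ultimately show ?thesis by(rule mult_right_le_imp_le[rotated])
  qed
 qed
 have rY: "L2_lim M (%n. A (Y n)) g" using r(3) by(simp add: Y_def)
 have "EX e:L2 M. L2_lim M Y e"
 proof (rule L2.complete[OF Y(3)])
  fix d :: real assume d: "d > 0"
  define d1 where "d1 = s^2 * d / 4"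
  have d1: "d1 > 0" using d s0 by(simp add: d1_def)
  obtain N1 where N1: "ALL m>=N1. ALL n>=N1. n2 M (%x. A (Y m) x - A (Y n) x) < d1 / C"
   using L2_cauchy_of_lim[OF A_L2[OF Y(3)] r(2) rY, of "d1 / C"] d1 C(1) by auto
  have "(%n. s * sqrt (D n)) ~~> s * sqrt 0" by(intro tendsto_intros Dlim)
  hence "\<forall>\<^sub>F n in sequentially. s * sqrt (D n) < d1" using d1 by(intro order_tendstoD(2)) auto
  then obtain N2 where N2: "ALL n>=N2. s * sqrt (D n) < d1" by(auto simp: eventually_sequentially)
  have "n2 M (%x. Y m x - Y n x) < d" if "m >= max N1 N2" "n >= max N1 N2" for m n
  proof -
   have "C * n2 M (%x. A (Y m) x - A (Y n) x) < d1"
   using N1 that C(1) by(simp add: pos_less_divide_eq mult.commute)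
   moreover have "s * sqrt (D m) < d1" "s * sqrt (D n) < d1" using N2 that by auto
   ultimately have "s^2 * n2 M (%x. Y m x - Y n x) < s^2 * d"
   using key[of m n] d1 by(simp add: d1_def algebra_simps)
   thus ?thesis using s0 by simp
  qed
  thus "EX N. ALL m>=N. ALL n>=N. n2 M (%x. Y m x - Y n x) < d" by blast
 qed
 then obtain e where e: "e : L2 M" "L2_lim M Y e" by blast
 have eN: "e : N" using N.closedN[OF Y(1) e] .
 have "(%n. n2 M (Y n)) ~~> n2 M e" by(rule L2.nrm_tendsto[OF Y(3) e])
 hence e1: "n2 M e = 1" using Y(2) by(simp add: LIMSEQ_const_iff)
 have "ipA e y = of_real (s^2) * L2_inner M e y" if y: "y : N" for y
 proof -
  have yL: "y : L2 M" using NL y by blast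
  have 1: "(%n. L2_inner M (Y n) y) ~~> L2_inner M e y" by(rule L2.ip_tendsto[OF Y(3) e(1) yL e(2)])
  have 2: "(%n. ipA (Y n) y) ~~> ipA e y"
  proof (rule ipA.ip_tendsto[OF Y(3) e(1) yL])
   have "(%n. C * n2 M (%x. Y n x - e x)) ~~> 0" using tendsto_mult_left[OF e(2), of C] by simp
   thus "(%n. snorm ipA (%x. Y n x - e x)) ~~> 0"
   unfolding snorm_ipA
   proof (rule Lim_null_comparison[rotated], intro always_eventually allI)
   fix n show "norm (n2 M (A (%x. Y n x - e x))) <= C * n2 M (%x. Y n x - e x)"
   using C(2)[OF L2.diff_mem[OF Y(3) e(1)]] by(simp add: n2_nonneg)
   qed
  qed
  have "(%n. ipS (Y n) y) ~~> of_real (s^2) * L2_inner M e y - ipA e y"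
   unfolding ipS_def by(intro tendsto_intros 1 2)
  moreover have "(%n. ipS (Y n) y) ~~> 0"
  proof (rule Lim_null_comparison)
   show "\<forall>\<^sub>F n in sequentially. norm (ipS (Y n) y) <= sqrt (D n) * (s * n2 M y)" using SY[OF y] by simp
   have "(%n. sqrt (D n) * (s * n2 M y)) ~~> sqrt 0 * (s * n2 M y)" by(intro tendsto_intros Dlim)
   thus "(%n. sqrt (D n) * (s * n2 M y)) ~~> 0" by simp
  qed
  ultimately have "of_real (s^2) * L2_inner M e y - ipA e y = 0" by(rule LIMSEQ_unique)
  thus ?thesis by simp
 qed
 thus ?thesis using st eN e1 by(intro exI[of _ s] exI[of _ e]) auto
qed

end

locale schatten_operator = compact_operator +
 fixes p :: real
 assumes p: "0 < p"
  and fin: "(\<integral>\<^sup>+r. singular_mult M A r * ennreal (r powr p) \<partial>count_space {0<..}) < \<infinity>"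
begin

definition Sp :: real where
 "Sp = enn2real (\<integral>\<^sup>+r. singular_mult M A r * ennreal (r powr p) \<partial>count_space {0<..})"

text \<open>Chebyshev's inequality for counting singular values. The family is grouped by singular
  value because \<open>singular_mult\<close> counts one value at a time.\<close>

lemma system_bound:
 assumes s: "system t I e s" and t: "0 < t"
 shows "real (card I) <= Sp * t powr (-p)"
proof -
 let ?f = "%r. singular_mult M A r * ennreal (r powr p)"
 have I: "finite I" "!!i. i : I ==> t <= s i" using s by(auto simp: system_def)
 have "(of_nat (card I) :: ennreal) = (\<Sum>i\<in>I. 1)" by simp
 also have "... = (\<Sum>r\<in>s ` I. \<Sum>i | i : I & s i = r. 1)"
  by(rule sum.image_gen[OF I(1)])
 also have "... <= (\<Sum>r\<in>s ` I. singular_mult M A r)"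
 proof (rule sum_mono)
  fix r
  have "system t {i : I. s i = r} e s" using s by(auto simp: system_def)
  hence "of_nat (card {i : I. s i = r}) <= singular_mult M A r" by(rule system_card_le_mult) auto
  thus "(\<Sum>i | i : I & s i = r. 1) <= singular_mult M A r" by simp
 qed
 also have "... <= (\<Sum>r\<in>s ` I. ennreal (t powr (-p)) * ?f r)"
 proof (rule sum_mono)
  fix r assume "r : s ` I"
  hence "t <= r" using I by auto
  hence "1 <= t powr (-p) * r powr p"
   using t p powr_mono2[of p t r] by(simp add: powr_minus field_simps)
  hence "1 <= ennreal (t powr (-p)) * ennreal (r powr p)"
   by(metis ennreal_1 ennreal_leI ennreal_mult powr_ge_zero)
  hence "1 * singular_mult M A r <= (ennreal (t powr (-p)) * ennreal (r powr p)) * singular_mult M A r"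
   by(rule mult_right_mono) simp
  thus "singular_mult M A r <= ennreal (t powr (-p)) * ?f r" by(simp add: mult_ac)
 qed
 also have "... = ennreal (t powr (-p)) * (\<Sum>r\<in>s ` I. ?f r)" by(simp add: sum_distrib_left)
 also have "(\<Sum>r\<in>s ` I. ?f r) = (\<integral>\<^sup>+r. ?f r * indicator (s ` I) r \<partial>count_space {0<..})"
  using I t by(subst nn_integral_count_space'[of "s ` I"]) force+
 also have "... <= (\<integral>\<^sup>+r. ?f r \<partial>count_space {0<..})"
  by(rule nn_integral_mono) (simp add: indicator_def)
 also have "... = ennreal Sp" using fin by(simp add: Sp_def)
 finally have "ennreal (real (card I)) <= ennreal (t powr (-p) * Sp)"
  by(simp add: ennreal_mult Sp_def mult_left_mono flip: ennreal_of_nat_eq_real_of_nat)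
 thus ?thesis by(subst (asm) ennreal_le_iff) (auto simp: Sp_def mult.commute)
qed

text \<open>Take a system above t with the largest number of members, which exists by the Chebyshev
  bound. If \<open>A\<close> exceeded t on its orthogonal complement, \<open>max_vector\<close>
  would supply one more member. The conclusion, a bound by t off finitely many directions, mentions
  no spectrum and can therefore be added up for sums of operators.\<close>

lemma gap:
 assumes t: "0 < t"
 shows "EX n e. real n <= Sp * t powr (-p) & (ALL i<n. e i : L2 M) &
  (ALL x:L2 M. (ALL i<n. L2_inner M x (e i) = 0) --> n2 M (A x) <= t * n2 M x)"
proof -
 define P where "P n \<longleftrightarrow> (EX e s. system t {..<n::nat} e s)" for n
 have P0: "P 0" by(auto simp: P_def system_def)
 have Pb: "n <= nat \<lfloor>Sp * t powr (-p)\<rfloor>" if "P n" for n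
  using that system_bound[OF _ t] by(fastforce simp: P_def le_nat_floor)
 define n where "n = Greatest P"
 have "P n" unfolding n_def using P0 Pb by(intro GreatestI_nat[of P 0]) auto
 then obtain e s where sys: "system t {..<n} e s" by(auto simp: P_def)
 have nP: "\<not> P (Suc n)"
 proof
  assume "P (Suc n)"
  hence "Suc n <= Greatest P" by(rule Greatest_le_nat) (rule Pb)
  thus False by(simp add: n_def)
 qed
 have e: "e i : L2 M" "e i : singular_space M A (s i)" if "i < n" for i
  using sys that by(auto simp: system_def singular_space_def)
 have on: "L2_inner M (e i) (e j) = of_bool (i = j)" if "i < n" "j < n" for i j
  using sys that by(auto simp: system_def)
 define N where "N = {x : L2 M. ALL i<n. L2_inner M x (e i) = 0}"
 have N: "closed_sub (L2 M) (L2_inner M) N"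
 proof (intro closed_sub.intro L2.semi_hilbert_axioms closed_sub_axioms.intro)
  fix F f assume *: "!!n. F n : N" "f : L2 M" "L2_lim M F f"
  have "L2_inner M f (e i) = 0" if "i < n" for i
  proof -
   have "(%m. L2_inner M (F m) (e i)) ~~> L2_inner M f (e i)"
   by(rule L2.ip_tendsto) (use * e that in \<open>auto simp: N_def\<close>)
   moreover have "L2_inner M (F m) (e i) = 0" for m using *(1)[of m] that by(simp add: N_def)
   ultimately show ?thesis by(simp add: LIMSEQ_const_iff)
  qed
  thus "f : N" using *(2) by(simp add: N_def)
 qed (use e in \<open>auto simp: N_def L2_zero L2_lin L2.ip_zero_left L2.ip_lin\<close>)
 have "n2 M (A x) <= t * n2 M x" if x: "x : N" for x
 proof (rule ccontr)
  assume "\<not> ?thesis"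
  then obtain s0 e0 where e0: "t <= s0" "e0 : N" "n2 M e0 = 1"
   "!!y. y : N ==> ipA e0 y = of_real (s0^2) * L2_inner M e0 y"
   using max_vector[OF N t x] by auto
  have e0L: "e0 : L2 M" using e0(2) by(simp add: N_def)
  have e0o: "L2_inner M e0 (e i) = 0" "L2_inner M (e i) e0 = 0" if "i < n" for i
   using e0(2) that L2.ip_cnj[OF e0L e(1)[OF that]] by(auto simp: N_def)
  \<comment> \<open>So far the eigenvalue relation is known only against vectors of
    \<open>N\<close>. The component h of g along the system contributes nothing, since both forms
    vanish between e0 and every e i.\<close>
  have "ipA e0 g = of_real (s0^2) * L2_inner M e0 g" if g: "g : L2 M" for g
  proof -
   define c where "c i = L2_inner M g (e i)" for i
   define h where "h x = (\<Sum>i<n. c i * e i x)" for x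
   have h: "h : L2 M" unfolding h_def using e by(intro L2.sum_mem) auto
   have hi: "L2_inner M h (e i) = c i" if "i < n" for i
   proof -
   have "L2_inner M h (e i) = (\<Sum>j<n. c j * L2_inner M (e j) (e i))"
   unfolding h_def using e that by(intro L2.ip_sum) auto
   also have "... = (\<Sum>j<n. if j = i then c i else 0)" using on that by(intro sum.cong) auto
   finally show ?thesis using that by simp
   qed
   have y: "(%x. g x - h x) : N"
   using g h e hi by(auto simp: N_def L2.diff_mem L2.ip_diff c_def)
   have "L2_inner M h e0 = (\<Sum>j<n. c j * L2_inner M (e j) e0)"
   unfolding h_def using e e0L by(intro L2.ip_sum) auto
   hence 1: "L2_inner M e0 h = 0" using e0o L2.ip_cnj[OF h e0L] by simp
   have "ipA (e j) e0 = 0" if "j < n" for j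
   using e(2)[OF that] e0L e0o[OF that] by(simp add: singular_space_def)
   moreover have "ipA h e0 = (\<Sum>j<n. c j * ipA (e j) e0)"
   unfolding h_def using e e0L by(intro ipA.ip_sum) auto
   ultimately have 2: "ipA e0 h = 0" using ipA.ip_cnj[OF h e0L] by simp
   show ?thesis
   using e0(4)[OF y] ipA.ip_diff2[OF g h e0L] L2.ip_diff2[OF g h e0L] 1 2 by simp
  qed
  hence "e0 : singular_space M A s0" using e0L by(simp add: singular_space_def)
  moreover have "L2_inner M e0 e0 = 1" using L2.ip_self_nrm[OF e0L] e0(3) by simp
  ultimately have "system t {..<Suc n} (e(n := e0)) (s(n := s0))"
   using sys e0(1) e0o on by(auto simp: system_def less_Suc_eq)
  thus False using nP by(auto simp: P_def)
 qed
 thus ?thesis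
  using system_bound[OF sys t] e by(intro exI[of _ n] exI[of _ e]) (auto simp: N_def)
qed

end

context compact_operator
begin

lemma singular_value_le:
 assumes L: "!!f. f : L2 M ==> n2 M (A f) <= L * n2 M f" and r: "0 < r" "singular_mult M A r ~= 0"
 shows "r <= L"
proof -
 have "EX (n::nat) e. 0 < n & (ALL i<n. e i : singular_space M A r) &
   (ALL i<n. ALL j<n. L2_inner M (e i) (e j) = of_bool (i = j))"
 proof (rule ccontr)
  assume none: "\<not> ?thesis"
  have "singular_mult M A r <= 0"
   unfolding singular_mult_def
  proof (rule SUP_least)
   fix n assume "n : {n. EX e :: nat => 'a => complex. (ALL i<n. e i : singular_space M A r) &
   (ALL i<n. ALL j<n. L2_inner M (e i) (e j) = of_bool (i = j))}"
   hence "n = 0" using none by blast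
   thus "(of_nat n :: ennreal) <= 0" by simp
  qed
  thus False using r by simp
 qed
 then obtain n :: nat and e where "0 < n" "ALL i<n. e i : singular_space M A r"
  "ALL i<n. ALL j<n. L2_inner M (e i) (e j) = of_bool (i = j)" by(elim exE conjE)
 hence e: "e 0 : singular_space M A r" "L2_inner M (e 0) (e 0) = 1" by auto
 have eL: "e 0 : L2 M" using e by(simp add: singular_space_def)
 have "ipA (e 0) (e 0) = of_real (r^2)" using e eL by(simp add: singular_space_def)
 hence "n2 M (A (e 0)) = r" using r by(simp add: snorm_def power2_eq_square)
 moreover have "n2 M (e 0) = 1" using e by(simp add: snorm_def)
 ultimately show ?thesis using L[OF eL] by simp
qed

text \<open>A converse of \<open>gap\<close>. If an orthonormal system above t had more members than
  the n directions available for t/2, some nonzero combination x would be orthogonal to all these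
  directions, and t |x| <= |A x| <= (t/2) |x| is a contradiction.\<close>

lemma sum_mult_of_gap:
 assumes gap: "!!t. t > 0 ==> EX n e. real n <= C * t powr (-p) & (ALL i<n. e i : L2 M) &
   (ALL x:L2 M. (ALL i<n. L2_inner M x (e i) = 0) --> n2 M (A x) <= t * n2 M x)"
  and t: "t > 0"
 shows "(\<integral>\<^sup>+r. singular_mult M A r * indicator {t..} r \<partial>count_space {0<..}) <= ennreal (C * (t/2) powr (-p))"
proof -
 have card: "real (card I) <= C * (t/2) powr (-p)" if s: "system t I e s" and t: "t > 0"
  for t and I :: "'i set" and e s
 proof (rule ccontr)
  assume n: "\<not> ?thesis"
  obtain n f where f: "real n <= C * (t/2) powr (-p)" "!!i. i < n ==> f i : L2 M"
   "!!x. x : L2 M ==> (ALL i<n. L2_inner M x (f i) = 0) ==> n2 M (A x) <= t/2 * n2 M x"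
   using gap[OF half_gt_zero[OF t]] by blast
  have I: "finite I" "!!i. i : I ==> e i : L2 M" "!!i. i : I ==> t <= s i"
   "!!i. i : I ==> e i : singular_space M A (s i)"
   "!!i j. i : I ==> j : I ==> L2_inner M (e i) (e j) = of_bool (i = j)"
   using s by(auto simp: system_def singular_space_def)
  have "n < card I" using n f(1) by simp
  from underdetermined[OF I(1) this, of "%i j. L2_inner M (e i) (f j)"]
  obtain c where c: "EX i:I. c i ~= 0" "!!j. j < n ==> (\<Sum>i\<in>I. c i * L2_inner M (e i) (f j)) = 0" by blast
  define x where "x y = (\<Sum>i\<in>I. c i * e i y)" for y
  have x: "x : L2 M" unfolding x_def using I by(intro L2.sum_mem) auto
  have "L2_inner M x (f j) = 0" if "j < n" for j
   using c(2)[OF that] L2.ip_sum[of I e M "f j" c, OF I(1,2) f(2)[OF that]] unfolding x_def by simp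
  hence le: "n2 M (A x) <= t/2 * n2 M x" using f(3) x by blast
  have "L2_inner M x x = (\<Sum>i\<in>I. of_real ((cmod (c i))^2) * 1)"
   unfolding x_def using I by(intro L2.ip_sum_ortho) auto
  hence nx: "(n2 M x)^2 = (\<Sum>i\<in>I. (cmod (c i))^2)" using L2.nrm_sq[OF x] by simp
  have "ipA x x = (\<Sum>i\<in>I. of_real ((cmod (c i))^2) * of_real ((s i)^2))"
   unfolding x_def using I by(intro ipA.ip_sum_ortho) (auto simp: singular_space_def)
  hence "(n2 M (A x))^2 = (\<Sum>i\<in>I. (cmod (c i))^2 * (s i)^2)" using L2.nrm_sq[OF A_L2[OF x]] by simp
  also have "... >= (\<Sum>i\<in>I. (cmod (c i))^2 * t^2)"
   using I t by(intro sum_mono mult_left_mono power_mono) auto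
  finally have ge: "t^2 * (n2 M x)^2 <= (n2 M (A x))^2" by(simp add: nx sum_distrib_left mult.commute)
  obtain i where i: "i : I" "c i ~= 0" using c(1) by blast
  hence pos: "0 < (n2 M x)^2" unfolding nx using I(1) by(intro sum_pos2[of I i]) auto
  have "(n2 M (A x))^2 <= (t/2 * n2 M x)^2" using le n2_nonneg by(intro power_mono) auto
  hence "t^2 * (n2 M x)^2 <= t^2 / 4 * (n2 M x)^2" using ge by(simp add: power_mult_distrib power_divide)
  thus False using pos t by simp
 qed
 let ?B = "C * (t/2) powr (-p)"
 define X where "X r = {n. EX e :: nat => 'a => complex. (ALL i<n. e i : singular_space M A r) &
   (ALL i<n. ALL j<n. L2_inner M (e i) (e j) = of_bool (i = j))}" for r
 have Xf: "finite (X r)" if "r > 0" for r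
 proof -
  have "n <= nat \<lfloor>C * (r/2) powr (-p)\<rfloor>" if "n : X r" for n
  proof -
   obtain e :: "nat => 'a => complex" where "ALL i<n. e i : singular_space M A r"
   "ALL i<n. ALL j<n. L2_inner M (e i) (e j) = of_bool (i = j)" using \<open>n : X r\<close> unfolding X_def by blast
   hence "system r {..<n} e (%_. r)" by(simp add: system_def)
   from card[OF this \<open>r > 0\<close>] show ?thesis by(simp add: le_nat_floor)
  qed
  thus ?thesis by(auto intro: finite_subset[of _ "{..nat \<lfloor>C * (r/2) powr (-p)\<rfloor>}"])
 qed
 have X0: "0 : X r" for r by(simp add: X_def)
 \<comment> \<open>The supremum in \<open>singular_mult\<close> is a maximum, so a full orthonormal
   basis of each singular space can be picked and the bases joined.\<close>
 define k where "k r = Max (X r)" for r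
 have kX: "k r : X r" if "r > 0" for r unfolding k_def using Xf[OF that] X0 by(intro Max_in) auto
 have mult: "singular_mult M A r = of_nat (k r)" if "r > 0" for r
 proof (rule antisym)
  show "singular_mult M A r <= of_nat (k r)"
   unfolding singular_mult_def X_def[symmetric] k_def using Xf[OF that]
   by(intro SUP_least) (simp add: Max_ge)
  show "of_nat (k r) <= singular_mult M A r"
   unfolding singular_mult_def X_def[symmetric] using kX[OF that] by(intro SUP_upper)
 qed
 have sum: "(\<Sum>r\<in>F. real (k r)) <= ?B" if F: "finite F" "F \<subseteq> {t..}" for F
 proof -
  have "ALL r:F. EX e. (ALL i<k r. e i : singular_space M A r) &
   (ALL i<k r. ALL j<k r. L2_inner M (e i) (e j) = of_bool (i = j))"
  proof
   fix r assume "r : F"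
   hence "r > 0" using F t by auto
   from kX[OF this] show "EX e. (ALL i<k r. e i : singular_space M A r) &
   (ALL i<k r. ALL j<k r. L2_inner M (e i) (e j) = of_bool (i = j))"
   by(simp add: X_def)
  qed
  from bchoice[OF this] obtain E where E: "!!r i. r : F ==> i < k r ==> E r i : singular_space M A r"
   "!!r i j. r : F ==> i < k r ==> j < k r ==> L2_inner M (E r i) (E r j) = of_bool (i = j)"
   by blast
  have "system t (SIGMA r:F. {..<k r}) (%(r, i). E r i) fst"
   unfolding system_def
  proof (intro conjI ballI)
   show "finite (SIGMA r:F. {..<k r})" using F by auto
   fix a assume a: "a : (SIGMA r:F. {..<k r})"
   show "(case a of (r, i) => E r i) : singular_space M A (fst a)" "t <= fst a" using a E F by auto
   fix b assume b: "b : (SIGMA r:F. {..<k r})"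
   show "L2_inner M (case a of (r, i) => E r i) (case b of (r, i) => E r i) = of_bool (a = b)"
   proof (cases "fst a = fst b")
   case True
   thus ?thesis using a b E(2) by(auto split: prod.splits)
   next
   case False
   have "L2_inner M (E (fst a) (snd a)) (E (fst b) (snd b)) = 0"
   by(rule singular_ortho[OF E(1) E(1)]) (use a b False F t in auto)
   thus ?thesis using False by(auto simp: case_prod_beta)
   qed
  qed
  from card[OF this t] show ?thesis using F by(simp add: card_SigmaI)
 qed
 define U where "U = {r. t <= r & k r ~= 0}"
 have U: "finite U"
 proof (rule ccontr)
  assume "infinite U"
  then obtain F where F: "finite F" "card F = Suc (nat \<lfloor>?B\<rfloor>)" "F \<subseteq> U"
   using infinite_arbitrarily_large by blast
  have "real (card F) = (\<Sum>r\<in>F. 1)" by simp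
  also have "... <= (\<Sum>r\<in>F. real (k r))" using F by(intro sum_mono) (auto simp: U_def)
  also have "... <= ?B" using F by(intro sum) (auto simp: U_def)
  finally show False using F(2) by linarith
 qed
 have "(\<integral>\<^sup>+r. singular_mult M A r * indicator {t..} r \<partial>count_space {0<..}) = (\<Sum>r\<in>U. singular_mult M A r * indicator {t..} r)"
  using U t mult by(intro nn_integral_count_space') (auto simp: U_def indicator_def)
 also have "... = (\<Sum>r\<in>U. of_nat (k r))"
  using mult t by(intro sum.cong) (auto simp: U_def)
 also have "... = ennreal (\<Sum>r\<in>U. real (k r))"
  unfolding ennreal_of_nat_eq_real_of_nat by(rule sum_ennreal) simp
 also have "... <= ennreal ?B" using U by(intro ennreal_leI sum) (auto simp: U_def)
 finally show ?thesis .
qed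

text \<open>A dyadic decomposition turns the weak-type bound into convergence for every larger exponent.\<close>

lemma schatten_finite_of_gap:
 assumes gap: "!!t. t > 0 ==> EX n e. real n <= C * t powr (-p) & (ALL i<n. e i : L2 M) &
   (ALL x:L2 M. (ALL i<n. L2_inner M x (e i) = 0) --> n2 M (A x) <= t * n2 M x)"
  and p: "0 < p" "p < q" and C: "C >= 0"
 shows "(\<integral>\<^sup>+r. singular_mult M A r * ennreal (r powr q) \<partial>count_space {0<..}) < \<infinity>"
proof -
 obtain L where L: "L > 0" "!!f. f : L2 M ==> n2 M (A f) <= L * n2 M f" using bounded by blast
 \<comment> \<open>Dyadic shells from t k to v k = 2 t k. They start at v 0 = L because no singular
   value exceeds a bound of the operator.\<close>
 define t where "t k = L * (1/2)^Suc k" for k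
 define v where "v k = L * (1/2)^k" for k
 have tv: "t k > 0" "v k > 0" for k using L by(auto simp: t_def v_def)
 let ?m = "singular_mult M A"
 let ?f = "%k r. ?m r * indicator {t k..} r * ennreal (v k powr q)"
 have "(\<integral>\<^sup>+r. ?m r * ennreal (r powr q) \<partial>count_space {0<..}) <= (\<integral>\<^sup>+r. (\<Sum>k. ?f k r) \<partial>count_space {0<..})"
 proof (rule nn_integral_mono)
  fix r assume "r : space (count_space {0::real<..})"
  hence r: "r > 0" by simp
  show "?m r * ennreal (r powr q) <= (\<Sum>k. ?f k r)"
  proof (cases "?m r = 0")
   case False
   hence rL: "r <= L" using singular_value_le[OF L(2) r] by simp
   have "(%k. L * (1/2)^k) ~~> L * 0" by(intro tendsto_intros LIMSEQ_power_zero) auto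
   hence "\<forall>\<^sub>F k in sequentially. L * (1/2)^k < r" using r by(intro order_tendstoD(2)) auto
   then obtain j where j: "L * (1/2)^j < r" by(auto simp: eventually_sequentially)
   define k where "k = (LEAST k. t k <= r)"
   have "t j <= r" using j L r by(simp add: t_def)
   hence k1: "t k <= r" unfolding k_def by(rule LeastI)
   have k2: "r <= v k"
   proof (cases k)
   case 0 thus ?thesis using rL by(simp add: v_def)
   next
   case (Suc i)
   hence "\<not> t i <= r" using not_less_Least[of i "%k. t k <= r"] k_def by auto
   thus ?thesis using Suc by(simp add: t_def v_def)
   qed
   have "?m r * ennreal (r powr q) <= ?f k r"
   using k1 k2 r p by(auto intro!: mult_left_mono ennreal_leI powr_mono2)
   also have "... <= (\<Sum>k. ?f k r)"
   using sum_le_suminf[of "%k. ?f k r" "{k}"] by simp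
   finally show ?thesis .
  qed simp
 qed
 also have "... = (\<Sum>k. \<integral>\<^sup>+r. ?f k r \<partial>count_space {0<..})" by(rule nn_integral_suminf) auto
 also have "... <= (\<Sum>k. ennreal ((C * (L/4) powr (-p) * L powr q) * (2 powr (p - q))^k))"
 proof (rule suminf_le)
  fix k
  have "(\<integral>\<^sup>+r. ?f k r \<partial>count_space {0<..}) =
   (\<integral>\<^sup>+r. ?m r * indicator {t k..} r \<partial>count_space {0<..}) * ennreal (v k powr q)"
   by(rule nn_integral_multc) auto
  also have "... <= ennreal (C * (t k/2) powr (-p)) * ennreal (v k powr q)"
   by(intro mult_right_mono sum_mult_of_gap[OF gap tv(1)]) auto
  also have "... = ennreal (C * (t k/2) powr (-p) * v k powr q)" using C by(simp add: ennreal_mult)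
  \<comment> \<open>From one shell to the next the bound shrinks by 2^(p - q) < 1, whence the
    geometric series; L/4 is half of t 0.\<close>
  also have "C * (t k/2) powr (-p) * v k powr q = C * (L/4) powr (-p) * L powr q * (2 powr (p - q))^k"
  proof -
   have h: "(1/2)^k = (2::real) powr (- real k)" by(simp add: powr_minus powr_realpow power_divide inverse_eq_divide)
   have 1: "(t k/2) powr (-p) = (L/4) powr (-p) * 2 powr (real k * p)"
   proof -
   have "t k / 2 = (L/4) * 2 powr (- real k)" by(simp add: t_def h)
   also have "... powr (-p) = (L/4) powr (-p) * (2 powr (- real k)) powr (-p)"
   by(rule powr_mult)
   finally show ?thesis by(simp add: powr_powr)
   qed
   have 2: "v k powr q = L powr q * 2 powr (- real k * q)"
   using L by(simp add: v_def h powr_mult powr_powr)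
   have 3: "(2 powr (p - q))^k = 2 powr (real k * p) * (2::real) powr (- real k * q)"
   by(simp add: powr_realpow[symmetric] powr_powr powr_add[symmetric] algebra_simps)
   show ?thesis unfolding 1 2 3 by simp
  qed
  finally show "(\<integral>\<^sup>+r. ?f k r \<partial>count_space {0<..}) <= ennreal ((C * (L/4) powr (-p) * L powr q) * (2 powr (p - q))^k)" .
 qed auto
 also have "... < \<infinity>"
 proof -
  have "2 powr (p - q) < (2::real) powr 0" using p by(intro powr_less_mono) auto
  hence "summable (%k. (C * (L/4) powr (-p) * L powr q) * (2 powr (p - q))^k)"
   by(intro summable_mult summable_geometric) simp
  hence "(\<Sum>k. ennreal ((C * (L/4) powr (-p) * L powr q) * (2 powr (p - q))^k)) =
   ennreal (\<Sum>k. (C * (L/4) powr (-p) * L powr q) * (2 powr (p - q))^k)"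
   using C by(intro suminf_ennreal2) auto
  thus ?thesis by(simp only: ennreal_less_top infinity_ennreal_def)
 qed
 finally show ?thesis .
qed

end

section \<open>Extension by zero, and the difference of operators on two subdomains\<close>

lemma (in semi_inner) nrm_triangle_minus:
 assumes "f : S" "g : S"
 shows "nrm (%x. f x - g x) <= nrm f + nrm g"
proof -
 have "nrm (%x. f x - g x) = nrm (%x. f x + (-1) * g x)" by simp
 also have "... <= nrm f + nrm (%x. (-1) * g x)"
  using assms by(intro nrm_triangle scale_mem)
 also have "nrm (%x. (-1) * g x) = nrm g" using nrm_scale[OF assms(2), of "-1"] by simp
 finally show ?thesis .
qed

lemma extend_zero_eq: "extend_zero S f = (%x. indicator S x *\<^sub>R f x)"
 by(auto simp: extend_zero_def indicator_def)

lemma extend_zero_idem [simp]: "extend_zero S (extend_zero S f) = extend_zero S f"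
 by(auto simp: extend_zero_def)

lemma L2_restrict_iff:
 assumes "S : sets M"
 shows "f : L2 (restrict_space M S) \<longleftrightarrow> extend_zero S f : L2 M"
proof -
 have S: "S \<inter> space M : sets M" using assms by auto
 have "(cmod (indicator S x *\<^sub>R f x))^2 = indicator S x *\<^sub>R (cmod (f x))\<^sup>2" for x
  by(simp add: indicator_def)
 thus ?thesis
  unfolding L2_iff extend_zero_eq borel_measurable_restrict_space_iff[OF S] integrable_restrict_space[OF S]
  by simp
qed

lemma n2_restrict:
 assumes "S : sets M"
 shows "n2 (restrict_space M S) f = n2 M (extend_zero S f)"
proof -
 have S: "S \<inter> space M : sets M" using assms by auto
 have "(cmod (indicator S x *\<^sub>R f x))^2 = indicator S x *\<^sub>R (cmod (f x))\<^sup>2" for x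
  by(simp add: indicator_def)
 thus ?thesis
  unfolding n2_eq extend_zero_eq integral_restrict_space[OF S] by simp
qed

lemma extend_zero_L2:
 assumes "S : sets M" "f : L2 M"
 shows "extend_zero S f : L2 M" "n2 M (extend_zero S f) <= n2 M f"
  "extend_zero S f : L2 (restrict_space M S)" "n2 (restrict_space M S) (extend_zero S f) <= n2 M f"
proof -
 have m: "extend_zero S f : bm M"
  unfolding extend_zero_eq using assms by measurable
 show 1: "extend_zero S f : L2 M" "n2 M (extend_zero S f) <= n2 M f"
  using L2_bound[OF assms(2) m, of 1] by(auto simp: extend_zero_def)
 show "extend_zero S f : L2 (restrict_space M S)" "n2 (restrict_space M S) (extend_zero S f) <= n2 M f"
  using 1 assms(1) by(simp_all add: L2_restrict_iff n2_restrict)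
qed

lemma L2_inner_extend_zero:
 assumes "S : sets M"
 shows "L2_inner M f (extend_zero S g) = L2_inner (restrict_space M S) (extend_zero S f) g"
proof -
 have S: "S \<inter> space M : sets M" using assms by auto
 show ?thesis unfolding L2_inner_def integral_restrict_space[OF S]
  by(intro Bint_cong) (auto simp: extend_zero_def indicator_def)
qed

lemma compact_of_schatten: "A : schatten_class M p ==> compact_operator M A"
 unfolding schatten_class_def schatten_norm_def
 by(auto split: if_splits intro!: compact_operator.intro linear_operator.intro compact_operator_axioms.intro
   simp: compact_op_def)

lemma epowr_finite_iff: "epowr x a < \<infinity> \<longleftrightarrow> x < \<infinity>"
 by(auto simp: epowr_def less_top)

lemma schatten_operator_of_class: "A : schatten_class M p ==> 0 < p ==> schatten_operator M A p"
 using compact_of_schatten[of A M p] epowr_finite_iff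
 unfolding schatten_class_def schatten_norm_def
 by(auto split: if_splits intro!: schatten_operator.intro schatten_operator_axioms.intro)

locale two_operators =
 fixes M :: "pt measure" and S1 S2 A1 A2
 assumes S: "S1 : sets M" "S2 : sets M"
  and A1: "compact_operator (restrict_space M S1) A1" and A2: "compact_operator (restrict_space M S2) A2"
begin

abbreviation "R1 \<equiv> restrict_space M S1"
abbreviation "R2 \<equiv> restrict_space M S2"

sublocale A1: compact_operator R1 A1 by(rule A1)
sublocale A2: compact_operator R2 A2 by(rule A2)

definition D where
 "D f x = extend_zero S1 (A1 (extend_zero S1 f)) x - extend_zero S2 (A2 (extend_zero S2 f)) x"

lemma part1: "f : L2 M ==> extend_zero S1 (A1 (extend_zero S1 f)) : L2 M"
 using A1.A_L2 extend_zero_L2(3)[OF S(1)] L2_restrict_iff[OF S(1)] by blast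

lemma part2: "f : L2 M ==> extend_zero S2 (A2 (extend_zero S2 f)) : L2 M"
 using A2.A_L2 extend_zero_L2(3)[OF S(2)] L2_restrict_iff[OF S(2)] by blast

lemma D_L2: "f : L2 M ==> D f : L2 M"
 unfolding D_def using part1 part2 L2.diff_mem by blast

lemma n2_D: "f : L2 M ==>
 n2 M (D f) <= n2 R1 (A1 (extend_zero S1 f)) + n2 R2 (A2 (extend_zero S2 f))"
 unfolding D_def n2_restrict[OF S(1)] n2_restrict[OF S(2)]
 using L2.nrm_triangle[OF part1[of f] L2.scale_mem[OF part2[of f], of "-1"]] L2.nrm_scale[OF part2[of f], of "-1"]
 by simp

lemma D_linear: "linear_op M D"
 unfolding linear_op_def
proof (intro conjI ballI allI)
 fix f g a b assume fg: "f : L2 M" "g : L2 M"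
 have e: "extend_zero T (%y. a * f y + b * g y) = (%y. a * extend_zero T f y + b * extend_zero T g y)" for T
  by(auto simp: extend_zero_def)
 have S': "S1 \<inter> space M : sets M" "S2 \<inter> space M : sets M" using S by auto
 have "AE x in M. x : S1 --> A1 (extend_zero S1 (%y. a * f y + b * g y)) x
   = a * A1 (extend_zero S1 f) x + b * A1 (extend_zero S1 g) x"
  using A1.A_lin[OF extend_zero_L2(3)[OF S(1) fg(1)] extend_zero_L2(3)[OF S(1) fg(2)], of a b]
  unfolding e AE_restrict_space_iff[OF S'(1)] .
 moreover have "AE x in M. x : S2 --> A2 (extend_zero S2 (%y. a * f y + b * g y)) x
   = a * A2 (extend_zero S2 f) x + b * A2 (extend_zero S2 g) x"
  using A2.A_lin[OF extend_zero_L2(3)[OF S(2) fg(1)] extend_zero_L2(3)[OF S(2) fg(2)], of a b]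
  unfolding e AE_restrict_space_iff[OF S'(2)] .
 ultimately show "AE x in M. D (%y. a * f y + b * g y) x = a * D f x + b * D g x"
  by eventually_elim (simp add: D_def extend_zero_def algebra_simps)
qed (rule D_L2)

lemma D_compact: "compact_op M D"
 unfolding compact_op_def
proof (intro conjI D_linear allI impI)
 fix F :: "nat => pt => complex" assume "ALL n. F n : L2 M & L2_norm M (F n) <= 1"
 hence F: "F n : L2 M" "n2 M (F n) <= 1" for n
 proof -
  show *: "F n : L2 M" using \<open>ALL n. _ n\<close> by blast
  have "L2_norm M (F n) <= 1" using \<open>ALL n. _ n\<close> by blast
  hence "ennreal (n2 M (F n)) <= ennreal 1" using L2_norm_eq[OF *] by(simp only: ennreal_1)
  thus "n2 M (F n) <= 1" by(subst (asm) ennreal_le_iff) auto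
 qed
 have F1: "extend_zero S1 (F n) : L2 R1" "n2 R1 (extend_zero S1 (F n)) <= 1"
  and F2: "extend_zero S2 (F n) : L2 R2" "n2 R2 (extend_zero S2 (F n)) <= 1" for n
  using extend_zero_L2(3,4)[OF S(1) F(1)[of n]] extend_zero_L2(3,4)[OF S(2) F(1)[of n]] F(2)[of n] by auto
 obtain r1 g1 where r1: "strict_mono (r1 :: nat => nat)" "g1 : L2 R1"
  "(%n. n2 R1 (%x. A1 (extend_zero S1 (F (r1 n))) x - g1 x)) ~~> 0"
  using A1.compactD[of "%n. extend_zero S1 (F n)"] F1 by blast
 obtain r2 g2 where r2: "strict_mono (r2 :: nat => nat)" "g2 : L2 R2"
  "(%n. n2 R2 (%x. A2 (extend_zero S2 (F (r1 (r2 n)))) x - g2 x)) ~~> 0"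
  using A2.compactD[of "%n. extend_zero S2 (F (r1 n))"] F2 by blast
 define r where "r n = r1 (r2 n)" for n
 define g where "g x = extend_zero S1 g1 x - extend_zero S2 g2 x" for x
 have r: "strict_mono r" using r1 r2 by(simp add: r_def strict_mono_def)
 have e: "extend_zero S1 g1 : L2 M" "extend_zero S2 g2 : L2 M" using r1 r2 L2_restrict_iff S by auto
 have g: "g : L2 M" unfolding g_def using e L2.diff_mem by blast
 have Dg: "(%x. D (F n) x - g x) : L2 M" for n using D_L2 F g L2.diff_mem by blast
 have "(%n. n2 R1 (%x. A1 (extend_zero S1 (F (r n))) x - g1 x) + n2 R2 (%x. A2 (extend_zero S2 (F (r n))) x - g2 x)) ~~> 0 + 0"
  unfolding r_def using LIMSEQ_subseq_LIMSEQ[OF r1(3) r2(1)] r2(3) by(intro tendsto_add) (simp_all add: o_def)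
 hence lim: "(%n. n2 R1 (%x. A1 (extend_zero S1 (F (r n))) x - g1 x) + n2 R2 (%x. A2 (extend_zero S2 (F (r n))) x - g2 x)) ~~> 0"
  by simp
 have "n2 M (%x. D (F n) x - g x) <=
   n2 R1 (%x. A1 (extend_zero S1 (F n)) x - g1 x) + n2 R2 (%x. A2 (extend_zero S2 (F n)) x - g2 x)" for n
 proof -
  let ?a = "%x. extend_zero S1 (A1 (extend_zero S1 (F n))) x - extend_zero S1 g1 x"
  let ?b = "%x. extend_zero S2 (A2 (extend_zero S2 (F n))) x - extend_zero S2 g2 x"
  have ab: "?a : L2 M" "?b : L2 M" using e part1 part2 F L2.diff_mem by blast+
  have "(%x. D (F n) x - g x) = (%x. ?a x - ?b x)" by(auto simp: D_def g_def)
  hence "n2 M (%x. D (F n) x - g x) <= n2 M ?a + n2 M ?b"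
   using L2.nrm_triangle_minus[OF ab] by simp
  moreover have "?a = extend_zero S1 (%x. A1 (extend_zero S1 (F n)) x - g1 x)"
   "?b = extend_zero S2 (%x. A2 (extend_zero S2 (F n)) x - g2 x)" by(auto simp: extend_zero_def)
  ultimately show ?thesis unfolding n2_restrict[OF S(1)] n2_restrict[OF S(2)] by simp
 qed
 hence "(%n. n2 M (%x. D (F (r n)) x - g x)) ~~> 0"
  by(intro Lim_null_comparison[OF _ lim]) (simp add: n2_nonneg)
 hence "(%n. L2_norm M (%x. D (F (r n)) x - g x)) ~~> 0"
  unfolding L2_norm_eq[OF Dg] using tendsto_ennrealI by fastforce
 thus "EX r g. strict_mono (r :: nat => nat) & g : L2 M & (%n. L2_norm M (%x. D (F (r n)) x - g x)) ~~> 0"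
  using r g by blast
qed

sublocale D: compact_operator M D
 using D_compact D_linear by unfold_locales auto

text \<open>Off the directions that \<open>gap\<close> gives for each operator at level t/2, the
  difference is bounded by t. The numbers of directions add up, and halving t costs the factor 2^p.
  Orthogonality of x to the extension of e by zero is orthogonality of the restriction of x to
  e.\<close>

lemma schatten_D:
 assumes s1: "schatten_operator R1 A1 p" and s2: "schatten_operator R2 A2 p" and q: "p < q"
 shows "(\<integral>\<^sup>+r. singular_mult M D r * ennreal (r powr q) \<partial>count_space {0<..}) < \<infinity>"
proof -
 interpret s1: schatten_operator R1 A1 p by fact
 interpret s2: schatten_operator R2 A2 p by fact
 have Sp: "s1.Sp >= 0" "s2.Sp >= 0" by(simp_all add: s1.Sp_def s2.Sp_def)
 show ?thesis
 proof (rule D.schatten_finite_of_gap[where C = "(s1.Sp + s2.Sp) * 2 powr p" and p = p])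
  fix t :: real assume t: "t > 0"
  obtain n1 e1 where 1: "real n1 <= s1.Sp * (t/2) powr (-p)" "!!i. i < n1 ==> e1 i : L2 R1"
   "!!x. x : L2 R1 ==> (!!i. i < n1 ==> L2_inner R1 x (e1 i) = 0) ==> n2 R1 (A1 x) <= t/2 * n2 R1 x"
   using s1.gap[OF half_gt_zero[OF t]] by blast
  obtain m2 e2 where 2: "real m2 <= s2.Sp * (t/2) powr (-p)" "!!i. i < m2 ==> e2 i : L2 R2"
   "!!x. x : L2 R2 ==> (!!i. i < m2 ==> L2_inner R2 x (e2 i) = 0) ==> n2 R2 (A2 x) <= t/2 * n2 R2 x"
   using s2.gap[OF half_gt_zero[OF t]] by blast
  define e where "e i = (if i < n1 then extend_zero S1 (e1 i) else extend_zero S2 (e2 (i - n1)))" for i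
  have "(t/2) powr (-p) = 2 powr p * t powr (-p)"
   using t by(simp add: powr_divide powr_minus field_simps)
  hence "real (n1 + m2) <= (s1.Sp + s2.Sp) * 2 powr p * t powr (-p)"
   using 1(1) 2(1) by(simp add: algebra_simps)
  moreover have "ALL i<n1 + m2. e i : L2 M"
   using 1(2) 2(2) L2_restrict_iff S by(auto simp: e_def)
  moreover have "n2 M (D x) <= t * n2 M x" if x: "x : L2 M" "ALL i<n1 + m2. L2_inner M x (e i) = 0" for x
  proof -
   have "n2 R1 (A1 (extend_zero S1 x)) <= t/2 * n2 R1 (extend_zero S1 x)"
   proof (rule 1(3)[OF extend_zero_L2(3)[OF S(1) x(1)]])
   fix i assume "i < n1"
   thus "L2_inner R1 (extend_zero S1 x) (e1 i) = 0"
   using x(2)[rule_format, of i] by(simp add: e_def L2_inner_extend_zero[OF S(1)])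
   qed
   also have "... <= t/2 * n2 M x" using extend_zero_L2(4)[OF S(1) x(1)] t by simp
   finally have a: "n2 R1 (A1 (extend_zero S1 x)) <= t/2 * n2 M x" .
   have "n2 R2 (A2 (extend_zero S2 x)) <= t/2 * n2 R2 (extend_zero S2 x)"
   proof (rule 2(3)[OF extend_zero_L2(3)[OF S(2) x(1)]])
   fix i assume "i < m2"
   thus "L2_inner R2 (extend_zero S2 x) (e2 i) = 0"
   using x(2)[rule_format, of "n1 + i"] by(simp add: e_def L2_inner_extend_zero[OF S(2)])
   qed
   also have "... <= t/2 * n2 M x" using extend_zero_L2(4)[OF S(2) x(1)] t by simp
   finally have b: "n2 R2 (A2 (extend_zero S2 x)) <= t/2 * n2 M x" .
   show ?thesis using n2_D[OF x(1)] a b by simp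
  qed
  ultimately show "EX n e. real n <= (s1.Sp + s2.Sp) * 2 powr p * t powr (-p) & (ALL i<n. e i : L2 M) &
   (ALL x:L2 M. (ALL i<n. L2_inner M x (e i) = 0) --> n2 M (D x) <= t * n2 M x)" by blast
 qed (use s1.p q Sp in auto)
qed

text \<open>When the operator norm vanishes, the right-hand side of the interpolation bound is 0
  whatever the constant, so the Schatten norm itself has to be shown to vanish.\<close>

lemma schatten_norm_D_zero:
 assumes z: "op_norm M D = 0" and q: "0 < q"
 shows "schatten_norm M q D = 0"
proof -
 have "n2 M (D f) <= 0 * n2 M f" if f: "f : L2 M" for f
 proof (rule ccontr)
  assume "\<not> ?thesis"
  hence pos: "n2 M (D f) > 0" by simp
  define c where "c = n2 M (D f) / (2 * (n2 M f + 1))"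
  have nf: "n2 M f >= 0" by(rule n2_nonneg)
  have "c > 0" using pos nf by(simp add: c_def)
  hence "op_norm M D < ennreal c" using z by simp
  then obtain C where C: "ALL f:L2 M. L2_norm M (D f) <= C * L2_norm M f" "C < ennreal c"
   unfolding op_norm_def Inf_less_iff by auto
  have "ennreal (n2 M (D f)) <= C * ennreal (n2 M f)" using C(1) f D_L2 by(simp add: L2_norm_eq)
  also have "... <= ennreal c * ennreal (n2 M f)" using C(2) by(intro mult_right_mono) auto
  also have "... = ennreal (c * n2 M f)" using \<open>c > 0\<close> nf by(simp add: ennreal_mult)
  finally have "n2 M (D f) <= c * n2 M f" using \<open>c > 0\<close> nf by(subst (asm) ennreal_le_iff) auto
  also have "... <= n2 M (D f) / 2"
  proof -
   have "n2 M (D f) * n2 M f <= n2 M (D f) * (n2 M f + 1)" using pos by(intro mult_left_mono) auto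
   thus ?thesis using nf by(simp add: c_def field_simps)
  qed
  finally show False using pos by simp
 qed
 hence "singular_mult M D r = 0" if "r > 0" for r
  using D.singular_value_le[of 0 r] that by fastforce
 hence "(\<integral>\<^sup>+r. singular_mult M D r * ennreal (r powr q) \<partial>count_space {0<..}) = (\<integral>\<^sup>+r. 0 \<partial>count_space {0::real<..})"
  by(intro nn_integral_cong) auto
 thus ?thesis using D_compact by(simp add: schatten_norm_def epowr_def)
qed

text \<open>\<open>Kq\<close> may depend on the operators. For a nonzero difference whose S_q norm y
  is finite, the quotient of y by the power of the operator norm therefore serves; y + 1 is used in
  place of y to keep \<open>Kq\<close> positive.\<close>

lemma schatten_norm_D_le:
 assumes s: "schatten_operator R1 A1 p" "schatten_operator R2 A2 p" and p: "0 < p" "p < q"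
 shows "EX Kq>0. schatten_norm M q D <= ennreal Kq * epowr (op_norm M D) (1 - p/q)"
proof -
 have fin: "schatten_norm M q D < \<infinity>"
  using schatten_D[OF s p(2)] D_compact epowr_finite_iff by(simp add: schatten_norm_def)
 have e: "1 - p/q > 0" using p by(simp add: field_simps)
 consider "op_norm M D = 0" | "op_norm M D = \<infinity>" | x where "x > 0" "op_norm M D = ennreal x"
  by(cases "op_norm M D") (auto simp: less_le ennreal_eq_0_iff)
 thus ?thesis
 proof cases
  case 1
  thus ?thesis using schatten_norm_D_zero p by(intro exI[of _ 1]) auto
 next
  case 2
  thus ?thesis by(intro exI[of _ 1]) (simp add: epowr_def)
 next
  case 3
  define y where "y = enn2real (schatten_norm M q D)"
  have y: "schatten_norm M q D = ennreal y" "y >= 0" using fin by(simp_all add: y_def)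
  define Kq where "Kq = (y + 1) / x powr (1 - p/q)"
  have "Kq > 0" using y 3 by(simp add: Kq_def)
  moreover have "ennreal Kq * epowr (op_norm M D) (1 - p/q) = ennreal (Kq * x powr (1 - p/q))"
   using 3 \<open>Kq > 0\<close> by(simp add: epowr_def ennreal_mult)
  moreover have "Kq * x powr (1 - p/q) = y + 1" using 3 by(simp add: Kq_def)
  ultimately show ?thesis using y by(intro exI[of _ Kq]) (simp add: ennreal_leI)
 qed
qed

end

section \<open>Topology and measure of the space of points\<close>

lemma mem_Rd: "x : Rd d \<longleftrightarrow> (ALL i. i >= d --> x i = undefined)"
 by(auto simp: Rd_def PiE_def extensional_def)

lemma upd_Rd: "x : Rd d ==> i < d ==> x(i := s) : Rd d"
 by(auto simp: mem_Rd)

lemma space_leb [simp]: "space (leb d) = Rd d"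
 by(simp add: leb_def space_PiM Rd_def)

lemma tendsto_pt:
 fixes F :: "nat => pt"
 assumes "!!i. (%n. F n i) ~~> x i" shows "F ~~> x"
proof -
 have "limitin (product_topology (%_. euclidean) UNIV) F x sequentially"
  unfolding limitin_componentwise using assms by(auto simp: extensional_def)
 thus ?thesis by(simp add: euclidean_product_topology)
qed

lemma tendsto_coord:
 fixes F :: "nat => pt"
 assumes "F ~~> x" shows "(%n. F n i) ~~> x i"
 using continuous_on_tendsto_compose[OF continuous_on_product_coordinates assms] by simp

lemma tendsto_Rd:
 assumes "!!n. F n : Rd d" "x : Rd d" "!!i. i < d ==> (%n. F n i) ~~> x i"
 shows "F ~~> x"
proof (rule tendsto_pt)
 fix i show "(%n. F n i) ~~> x i"
  using assms by(cases "i < d") (auto simp: mem_Rd)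
qed

lemma closed_Rd: "closed (Rd d)"
proof -
 have "Rd d = (\<Inter>i\<in>{d..}. {x. x i = undefined})" by(auto simp: mem_Rd)
 moreover have "closed {x :: pt. x i = undefined}" for i
  by(intro closed_Collect_eq) auto
 ultimately show ?thesis by auto
qed

text \<open>This links the product sigma-algebra over d coordinates with the Borel sets of the
  topology on infinite sequences: on \<open>Rd d\<close> the coordinates from d on are
  constant.\<close>

lemma id_measurable: "(%x. x) : bm (leb d)"
proof (rule measurable_coordinatewise_then_product)
 fix i show "(%x. x i) : bm (leb d)"
 proof (cases "i < d")
  case True
  thus ?thesis using measurable_component_singleton[of i "{..<d}" "%_. lborel"] by(simp add: leb_def)
 next
  case False
  hence "(%x. x i) : bm (leb d) \<longleftrightarrow> (%x. undefined :: real) : bm (leb d)"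
   by(intro measurable_cong) (auto simp: mem_Rd)
  thus ?thesis by simp
 qed
qed

lemma borel_sets_leb: "A : sets borel ==> A \<subseteq> Rd d ==> A : sets (leb d)"
 using measurable_sets[OF id_measurable, of A d] by(simp add: Int_absorb2)

lemma compact_sets_leb: "compact K ==> K \<subseteq> Rd d ==> K : sets (leb d)"
 by(intro borel_sets_leb) (auto intro: borel_closed compact_imp_closed)

lemma open_Rd_iff: "open_Rd d Om \<longleftrightarrow> (EX U. open U & Om = Rd d \<inter> U)"
 by(simp add: open_Rd_def openin_open)

lemma open_Rd_sets: "open_Rd d Om ==> Om : sets (leb d)"
 unfolding open_Rd_iff
 by(elim exE conjE, hypsubst) (intro borel_sets_leb sets.Int borel_closed borel_open closed_Rd Int_lower1)

lemma open_Rd_subset: "open_Rd d Om ==> Om \<subseteq> Rd d"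
 by(auto simp: open_Rd_iff)

lemma open_Rd_Un: "open_Rd d A ==> open_Rd d B ==> open_Rd d (A \<union> B)"
 by(simp add: open_Rd_def openin_Un)

lemma open_Rd_Int: "open_Rd d A ==> open_Rd d B ==> open_Rd d (A \<inter> B)"
 by(simp add: open_Rd_def openin_Int)

lemma open_Rd_Diff_closed: "open_Rd d A ==> closed B ==> open_Rd d (A - B)"
 unfolding open_Rd_iff by(metis Diff_eq Int_assoc closed_def open_Int)

lemma continuous_measurable:
 fixes f :: "pt => 'b::real_normed_vector"
 assumes "continuous_on (Rd d) f" shows "f : bm (leb d)"
proof -
 have "(%x. indicator (Rd d) x *\<^sub>R f x) : bm borel"
  by(intro borel_measurable_continuous_on_indicator assms borel_closed closed_Rd)
 from measurable_compose[OF id_measurable this]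
 have "(%x. indicator (Rd d) x *\<^sub>R f x) : bm (leb d)" .
 thus ?thesis by(subst measurable_cong[where g = "%x. indicator (Rd d) x *\<^sub>R f x"]) auto
qed

interpretation lebp: product_sigma_finite "%_::nat. lborel :: real measure"
 by standard

lemma sigma_finite_leb: "sigma_finite_measure (leb d)"
 unfolding leb_def by(rule lebp.sigma_finite) simp

text \<open>Closed cubes of half side r take the place of balls, since the metric of the ambient
  function type is not one of the usual metrics of R^d.\<close>

definition cbx :: "nat => pt => real => pt set" where
 "cbx d x r = {y : Rd d. ALL i<d. \<bar>y i - x i\<bar> <= r}"

lemma compact_cube: "compact {y : Rd d. ALL i<d. \<bar>y i\<bar> <= r}"
proof -
 have "{y : Rd d. ALL i<d. \<bar>y i\<bar> <= r} = PiE UNIV (%i. if i < d then {-r..r} else {undefined})"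
  by(auto simp: mem_Rd PiE_UNIV_domain Pi_iff abs_le_iff split: if_splits)
   (metis atLeastAtMost_iff linorder_not_le minus_le_iff)+
 moreover have "compactin (product_topology (%_. euclidean) UNIV) (PiE UNIV (%i. if i < d then {-r..r} else {undefined::real}))"
  unfolding compactin_PiE by(auto simp: compactin_euclidean_iff)
 ultimately show ?thesis by(simp add: euclidean_product_topology compactin_euclidean_iff)
qed

definition fatten :: "nat => pt set => real => pt set" where
 "fatten d K r = (\<Union>y\<in>K. cbx d y r)"

lemma compact_fatten:
 assumes "compact K" "K \<subseteq> Rd d" shows "compact (fatten d K r)"
proof -
 let ?f = "%(x, z) i. if i < d then x i + z i else (undefined :: real)"
 have "fatten d K r = ?f ` (K \<times> {y : Rd d. ALL i<d. \<bar>y i\<bar> <= r})"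
 proof (intro equalityI subsetI)
  fix y assume "y : fatten d K r"
  then obtain x where x: "x : K" "y : Rd d" "!!i. i < d ==> \<bar>y i - x i\<bar> <= r"
   by(auto simp: fatten_def cbx_def)
  define z where "z i = (if i < d then y i - x i else undefined)" for i
  have "z : {y : Rd d. ALL i<d. \<bar>y i\<bar> <= r}" using x by(auto simp: z_def mem_Rd)
  moreover have "y = ?f (x, z)" using x by(auto simp: z_def mem_Rd fun_eq_iff)
  ultimately show "y : ?f ` (K \<times> {y : Rd d. ALL i<d. \<bar>y i\<bar> <= r})" using x(1) by blast
 next
  fix y assume "y : ?f ` (K \<times> {y : Rd d. ALL i<d. \<bar>y i\<bar> <= r})"
  then obtain x z where xz: "x : K" "!!i. i < d ==> \<bar>z i\<bar> <= r" "y = ?f (x, z)" by auto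
  hence "y : cbx d x r" by(auto simp: cbx_def mem_Rd)
  thus "y : fatten d K r" using xz(1) by(auto simp: fatten_def)
 qed
 moreover have "continuous_on (K \<times> {y : Rd d. ALL i<d. \<bar>y i\<bar> <= r}) ?f"
 proof (rule continuous_on_coordinatewise_then_product)
  fix i
  have c: "continuous_on S (%p. fst p i :: real)" "continuous_on S (%p. snd p i :: real)" for S :: "(pt \<times> pt) set"
   using continuous_on_compose2[OF continuous_on_product_coordinates[of i] continuous_on_fst[OF continuous_on_id], of S]
   continuous_on_compose2[OF continuous_on_product_coordinates[of i] continuous_on_snd[OF continuous_on_id], of S] by auto
  show "continuous_on (K \<times> {y : Rd d. ALL i<d. \<bar>y i\<bar> <= r}) (%p. ?f p i)"
   by(cases "i < d") (auto simp: case_prod_beta intro!: continuous_intros c)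
 qed
 ultimately show ?thesis
  using compact_continuous_image[OF _ compact_Times[OF assms(1) compact_cube], of d r ?f] by simp
qed

text \<open>Otherwise points outside \<open>Om\<close>, coordinatewise within 1/(n+1) of points of
  \<open>K\<close>, would subconverge to a point of \<open>K\<close>, against openness. The r
  obtained is the safety distance for cut-offs and mollifiers.\<close>

lemma compact_margin:
 assumes K: "compact K" "K \<subseteq> Om" and O: "open_Rd d Om"
 shows "EX r>0. fatten d K r \<subseteq> Om"
proof (rule ccontr)
 assume "\<not> ?thesis"
 hence "\<not> fatten d K (inverse (real (Suc n))) \<subseteq> Om" for n
 proof -
  have "inverse (real (Suc n)) > 0" by simp
  thus ?thesis using \<open>\<not> _\<close> by blast
 qed
 hence "ALL n::nat. EX x y. y : K & x : cbx d y (inverse (real (Suc n))) & x ~: Om"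
  unfolding fatten_def by blast
 then obtain x y where xy: "!!n. y n : K" "!!n. x n : cbx d (y n) (inverse (real (Suc n)))" "!!n. x n ~: Om"
  by metis
 obtain l r where l: "l : K" "strict_mono (r :: nat => nat)" "(y \<circ> r) ~~> l"
  using K(1) xy(1) unfolding compact_eq_seq_compact_metric seq_compact_def by blast
 have sub: "Om \<subseteq> Rd d" by(rule open_Rd_subset[OF O])
 have xR: "x n : Rd d" for n using xy(2)[of n] by(simp add: cbx_def)
 have "(%n. x (r n)) ~~> l"
 proof (rule tendsto_Rd[OF xR])
  show "l : Rd d" using l K sub by auto
  fix i assume i: "i < d"
  have "(%n. inverse (real (Suc (r n)))) ~~> 0"
   using LIMSEQ_subseq_LIMSEQ[OF LIMSEQ_inverse_real_of_nat l(2)] by(simp add: o_def)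
  hence "(%n. x (r n) i - y (r n) i) ~~> 0"
   by(rule Lim_null_comparison[rotated]) (use xy(2) i in \<open>auto simp: cbx_def\<close>)
  from tendsto_add[OF this tendsto_coord[OF l(3), of i]]
  show "(%n. x (r n) i) ~~> l i" by(simp add: o_def)
 qed
 moreover obtain U where U: "open U" "Om = Rd d \<inter> U" using O open_Rd_iff by auto
 ultimately have "\<forall>\<^sub>F n in sequentially. x (r n) : U" using l(1) K(2) by(intro topological_tendstoD) auto
 then obtain n where "x (r n) : U" by(auto simp: eventually_sequentially)
 thus False using xy(3)[of "r n"] xR[of "r n"] U by auto
qed

lemma cbx_self: "x : Rd d ==> 0 <= r ==> x : cbx d x r"
 by(simp add: cbx_def)

lemma compact_subset_cube:
 assumes "compact K" "K \<subseteq> Rd d"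
 shows "EX r>0. K \<subseteq> {y : Rd d. ALL i<d. \<bar>y i\<bar> <= r}"
proof -
 have "EX b. ALL x:K. \<bar>x i\<bar> <= b" for i
 proof -
  have "compact ((%x. x i) ` K)"
   by(intro compact_continuous_image assms(1) continuous_on_subset[OF continuous_on_product_coordinates]) auto
  hence "bounded ((%x. x i) ` K)" by(rule compact_imp_bounded)
  thus ?thesis by(auto simp: bounded_iff)
 qed
 then obtain b where b: "!!i x. x : K ==> \<bar>x i\<bar> <= b i" by metis
 have "\<bar>x i\<bar> <= 1 + (\<Sum>j<d. \<bar>b j\<bar>)" if "x : K" "i < d" for x i
 proof -
  have "\<bar>b i\<bar> <= (\<Sum>j<d. \<bar>b j\<bar>)" using that by(intro member_le_sum) auto
  thus ?thesis using b[OF that(1), of i] by linarith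
 qed
 thus ?thesis using assms(2) by(intro exI[of _ "1 + (\<Sum>j<d. \<bar>b j\<bar>)"]) (auto simp: add_pos_nonneg sum_nonneg)
qed

lemma emeasure_cube_finite: "emeasure (leb d) {y : Rd d. ALL i<d. \<bar>y i\<bar> <= r} < \<infinity>"
proof -
 have "{y : Rd d. ALL i<d. \<bar>y i\<bar> <= r} = (\<Pi>\<^sub>E i\<in>{..<d}. {-r..r})"
 proof -
  have *: "a : {-r..r} \<longleftrightarrow> \<bar>a\<bar> <= r" for a :: real
   unfolding atLeastAtMost_iff abs_le_iff by linarith
  have "y : {y : Rd d. ALL i<d. \<bar>y i\<bar> <= r} \<longleftrightarrow> y : (\<Pi>\<^sub>E i\<in>{..<d}. {-r..r})" for y
   unfolding Rd_def PiE_iff * mem_Collect_eq lessThan_iff Ball_def by blast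
  thus ?thesis by blast
 qed
 moreover have "emeasure (leb d) (\<Pi>\<^sub>E i\<in>{..<d}. {-r..r}) = (\<Prod>i<d. emeasure lborel {-r..r})"
  unfolding leb_def by(rule lebp.emeasure_PiM) auto
 moreover have "emeasure lborel {-r..r} < \<infinity>" using emeasure_lborel_cbox_finite[of "-r" r] by simp
 ultimately show ?thesis by(simp add: ennreal_prod_eq_top less_top[symmetric] power_less_top_ennreal power_eq_top_ennreal del: emeasure_lborel_Icc_eq)
qed

lemma emeasure_compact_finite: "compact K ==> K \<subseteq> Rd d ==> emeasure (leb d) K < \<infinity>"
 using compact_subset_cube[of K d] emeasure_mono emeasure_cube_finite
 by(metis (no_types, lifting) compact_cube compact_sets_leb le_less_trans mem_Collect_eq subsetI)

definition obx :: "nat => pt => pt => pt set" where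
 "obx d a b = {x : Rd d. ALL i<d. a i < x i & x i < b i}"

lemma open_obx: "open_Rd d (obx d a b)"
proof -
 have "obx d a b = Rd d \<inter> {x. ALL i:{..<d}. x i : {a i<..<b i}}" by(auto simp: obx_def)
 moreover have "open {x :: pt. ALL i:{..<d}. x i : {a i<..<b i}}"
  by(rule product_topology_basis') auto
 ultimately show ?thesis using open_Rd_iff by blast
qed

lemma obx_sets: "obx d a b : sets (leb d)"
 by(rule open_Rd_sets[OF open_obx])

lemma obx_Int: "obx d a b \<inter> obx d a' b' = obx d (%i. max (a i) (a' i)) (%i. min (b i) (b' i))"
 by(auto simp: obx_def)

lemma sets_leb_generated: "sets (leb d) \<subseteq> sigma_sets (Rd d) (range (%(a, b). obx d a b))"
proof
 fix A assume A: "A : sets (leb d)"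
 let ?S = "sigma (Rd d) (range (%(a, b). obx d a b))"
 have G: "range (%(a, b). obx d a b) \<subseteq> Pow (Rd d)" by(auto simp: obx_def)
 have sp: "space ?S = Rd d" using G by(simp add: space_measure_of_conv)
 have ob: "obx d a b : sets ?S" for a b using G by(auto intro!: sigma_sets.Basic)
 have c: "(%x. x i) : borel_measurable ?S" if i: "i < d" for i
 proof (rule borel_measurable_iff_greater[THEN iffD2], intro allI)
  fix a :: real
  \<comment> \<open>A half-space is a countable union of boxes that grow in every direction except
    at the face x i = a.\<close>
  have "{x : space ?S. a < x i} = (\<Union>n::nat. obx d (%j. if j = i then a else - real n) (%j. real n))"
  proof (intro equalityI subsetI)
   fix x assume x: "x : {x : space ?S. a < x i}"
   obtain n :: nat where n: "(\<Sum>j<d. \<bar>x j\<bar>) < real n" using reals_Archimedean2 by blast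
   have "\<bar>x j\<bar> < real n" if "j < d" for j
   proof -
   have "\<bar>x j\<bar> <= (\<Sum>j<d. \<bar>x j\<bar>)" using that by(intro member_le_sum) auto
   thus ?thesis using n by simp
   qed
   hence "x : obx d (%j. if j = i then a else - real n) (%j. real n)"
   using x sp by(auto simp: obx_def abs_less_iff minus_less_iff)
   thus "x : (\<Union>n::nat. obx d (%j. if j = i then a else - real n) (%j. real n))" by blast
  qed (use i sp in \<open>auto simp: obx_def\<close>)
  thus "{x : space ?S. a < x i} : sets ?S" using ob by auto
 qed
 have "(%x. \<lambda>i\<in>{..<d}. x i) : measurable ?S (leb d)"
  unfolding leb_def by(rule measurable_restrict) (use c in auto)
 from measurable_sets[OF this A] have "(%x. \<lambda>i\<in>{..<d}. x i) -` A \<inter> Rd d : sets ?S" by(simp add: sp)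
 moreover have "(%x. \<lambda>i\<in>{..<d}. x i) -` A \<inter> Rd d = A"
 proof -
  have "(\<lambda>i\<in>{..<d}. x i) = x" if "x : Rd d" for x using that by(auto simp: mem_Rd restrict_def)
  thus ?thesis using sets.sets_into_space[OF A] by auto
 qed
 ultimately show "A : sigma_sets (Rd d) (range (%(a, b). obx d a b))" using G by(simp add: sets_measure_of_conv)
qed

text \<open>Open boxes are stable under intersection and generate the measurable sets, so a Dynkin
  argument extends vanishing integrals from boxes to all measurable sets. The assumption on the
  total integral is what the step for complements consumes.\<close>

lemma AE_zero_of_boxes:
 fixes g :: "pt => complex"
 assumes g: "integrable (leb d) g" and tot: "(LINT x|(leb d). g x) = 0"
  and box: "!!a b. (LINT x|(leb d). indicator (obx d a b) x *\<^sub>R g x) = 0"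
 shows "AE x in leb d. g x = 0"
proof -
 interpret sigma_finite_measure "leb d" by(rule sigma_finite_leb)
 have SG: "sigma_sets (Rd d) (range (%(a, b). obx d a b)) \<subseteq> sets (leb d)"
 proof -
  have "range (%(a, b). obx d a b) \<subseteq> sets (leb d)" using obx_sets by auto
  from sets.sigma_sets_subset[OF this] show ?thesis by simp
 qed
 have si: "set_integrable (leb d) A g" if "A : sets (leb d)" for A
  unfolding set_integrable_def using integrable_mult_indicator[OF that g] .
 have "set_lebesgue_integral (leb d) A g = 0" if A: "A : sets (leb d)" for A
 proof -
  have st: "Int_stable (range (%(a, b). obx d a b))"
   unfolding Int_stable_def by(auto simp: obx_Int)
  have "range (%(a, b). obx d a b) \<subseteq> Pow (Rd d)" "A : sigma_sets (Rd d) (range (%(a, b). obx d a b))"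
   using A sets_leb_generated by(auto simp: obx_def)
  thus ?thesis
  proof (induction rule: sigma_sets_induct_disjoint[OF st, consumes 2, case_names basic empty compl union])
   case (compl A)
   hence A: "A : sets (leb d)" using SG by blast
   have "A \<union> (Rd d - A) = Rd d" using sets.sets_into_space[OF A] by auto
   moreover have "Rd d - A : sets (leb d)" using sets.compl_sets[OF A] by simp
   moreover have "set_lebesgue_integral (leb d) (A \<union> (Rd d - A)) g
   = set_lebesgue_integral (leb d) A g + set_lebesgue_integral (leb d) (Rd d - A) g"
   using A si \<open>Rd d - A : sets (leb d)\<close> by(intro set_integral_Un) auto
   moreover have "set_lebesgue_integral (leb d) (Rd d) g = 0"
   using tot set_integral_space[OF g] by simp
   ultimately show ?case using compl by simp
  next
   case (union A)
   have A: "A i : sets (leb d)" for i using union SG by blast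
   have "set_lebesgue_integral (leb d) (\<Union>i. A i) g = (\<Sum>i. set_lebesgue_integral (leb d) (A i) g)"
   using union(1) A by(intro lebesgue_integral_countable_add si) (auto simp: disjoint_family_on_def)
   thus ?case using union by simp
  qed (use box in \<open>auto simp: set_lebesgue_integral_def obx_def\<close>)
 qed
 thus ?thesis by(rule density_zero[OF g])
qed

section \<open>Smooth functions\<close>

text \<open>The derivative is quantified existentially, so the closure properties follow by
  induction on n without formulas for higher derivatives.\<close>

fun sm1 :: "nat => (real => real) => bool" where
 "sm1 0 g \<longleftrightarrow> True"
| "sm1 (Suc n) g \<longleftrightarrow> (EX g'. (ALL t. (g has_real_derivative g' t) (at t)) & sm1 n g')"

definition smooth1 :: "(real => real) => bool" where
 "smooth1 g \<longleftrightarrow> (ALL n. sm1 n g)"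

lemma sm1_SucD: "sm1 (Suc n) g ==> sm1 n g"
proof (induction n arbitrary: g)
 case (Suc n)
 obtain g' where "ALL t. (g has_real_derivative g' t) (at t)" "sm1 (Suc n) g'"
  using Suc.prems unfolding sm1.simps(2)[of "Suc n" g] by blast
 thus ?case using Suc.IH[of g'] unfolding sm1.simps(2)[of n g] by blast
qed simp

lemma sm1_lin: "sm1 n f ==> sm1 n g ==> sm1 n (%t. a * f t + b * g t)"
proof (induction n arbitrary: f g)
 case (Suc n)
 then obtain f' g' where "!!t. (f has_real_derivative f' t) (at t)" "sm1 n f'"
  "!!t. (g has_real_derivative g' t) (at t)" "sm1 n g'" by auto
 thus ?case
  by(auto intro!: exI[of _ "%t. a * f' t + b * g' t"] Suc.IH derivative_eq_intros)
qed simp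

lemma sm1_mult: "sm1 n f ==> sm1 n g ==> sm1 n (%t. f t * g t)"
proof (induction n arbitrary: f g)
 case (Suc n)
 then obtain f' g' where *: "!!t. (f has_real_derivative f' t) (at t)" "sm1 n f'"
  "!!t. (g has_real_derivative g' t) (at t)" "sm1 n g'" by auto
 have "sm1 n (%t. 1 * (f' t * g t) + 1 * (f t * g' t))"
  using Suc.prems[THEN sm1_SucD] * by(intro sm1_lin Suc.IH) auto
 thus ?case
  using * by(auto intro!: exI[of _ "%t. f' t * g t + f t * g' t"] derivative_eq_intros)
qed simp

lemma sm1_affine: "sm1 n g ==> sm1 n (%t. g (a * t + b))"
proof (induction n arbitrary: g)
 case (Suc n)
 then obtain g' where *: "!!t. (g has_real_derivative g' t) (at t)" "sm1 n g'" by auto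
 have "sm1 n (%t. a * g' (a * t + b) + 0 * g' (a * t + b))" using Suc.IH[OF *(2)] by(intro sm1_lin)
 moreover have "((%t. g (a * t + b)) has_real_derivative a * g' (a * t + b)) (at t)" for t
 proof -
  have "((%t. a * t + b) has_real_derivative a) (at t)" by(auto intro!: derivative_eq_intros)
  from DERIV_chain2[OF *(1) this] show ?thesis by(simp add: mult.commute)
 qed
 ultimately show ?case by(auto intro!: exI[of _ "%t. a * g' (a * t + b)"])
qed simp

lemma smooth1_deriv:
 assumes "smooth1 g"
 shows "(g has_real_derivative deriv g t) (at t)" "smooth1 (deriv g)"
proof -
 have *: "EX g'. (ALL t. (g has_real_derivative g' t) (at t)) & sm1 n g'" for n
  using assms unfolding smooth1_def by(metis sm1.simps(2))
 thus d: "(g has_real_derivative deriv g t) (at t)" for t using DERIV_imp_deriv by metis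
 have "sm1 n (deriv g)" for n
 proof -
  obtain g' where g': "ALL t. (g has_real_derivative g' t) (at t)" "sm1 n g'" using * by blast
  hence "deriv g = g'" using DERIV_imp_deriv by blast
  thus ?thesis using g' by simp
 qed
 thus "smooth1 (deriv g)" by(simp add: smooth1_def)
qed

text \<open>The functions t^(-n) exp (-1/t), continued by 0, have derivatives that are linear
  combinations of members of the same family. Smoothness of exp (-1/t) across 0 thus needs a single
  induction.\<close>

definition flat :: "nat => real => real" where
 "flat n t = (if t > 0 then (1/t)^n * exp (-1/t) else 0)"

lemma flat_deriv: "(flat n has_real_derivative (- real n * flat (Suc n) t + 1 * flat (n + 2) t)) (at t)"
proof -
 consider "t > 0" | "t < 0" | "t = 0" by linarith
 thus ?thesis
 proof cases
  case 1
  have "((%t. (1/t)^n * exp (-1/t)) has_real_derivative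
   (- real n * flat (Suc n) t + 1 * flat (n + 2) t)) (at t)"
  proof -
   have u: "((%t. 1/t) has_real_derivative - ((1/t)^2)) (at t)"
   using 1 by(auto intro!: derivative_eq_intros simp: field_simps power2_eq_square)
   have e: "((%t. exp (-1/t)) has_real_derivative exp (-1/t) * (1/t)^2) (at t)"
   using 1 by(auto intro!: derivative_eq_intros simp: field_simps power2_eq_square)
   have "real n * (- ((1/t)^2) * (1/t)^(n - Suc 0)) * exp (-1/t) + exp (-1/t) * (1/t)^2 * (1/t)^n
   = - real n * flat (Suc n) t + 1 * flat (n + 2) t"
   proof (cases n)
   case (Suc m)
   have "(1/t)^2 * (1/t)^m = (1/t)^Suc n" "(1/t)^2 * (1/t)^n = (1/t)^(n+2)"
   unfolding Suc by(simp_all only: power_add[symmetric]) (simp_all add: numeral_2_eq_2)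
   thus ?thesis using 1 Suc by(simp only: flat_def if_True) (simp add: field_simps)
   qed (use 1 in \<open>simp add: flat_def field_simps power2_eq_square\<close>)
   thus ?thesis using DERIV_mult[OF DERIV_power[OF u, of n] e] by simp
  qed
  thus ?thesis
   by(rule has_field_derivative_transform_within_open[where S = "{0<..}"]) (use 1 in \<open>auto simp: flat_def\<close>)
 next
  case 2
  have "((%t. 0) has_real_derivative (- real n * flat (Suc n) t + 1 * flat (n + 2) t)) (at t)"
   using 2 by(simp add: flat_def)
  thus ?thesis
   by(rule has_field_derivative_transform_within_open[where S = "{..<0}"]) (use 2 in \<open>auto simp: flat_def\<close>)
 next
  case 3
  have "((%h. flat (Suc n) h) \<longlongrightarrow> 0) (at 0)"
  proof (rule filterlim_split_at)
   have "((%h. 0) \<longlongrightarrow> (0::real)) (at_left 0)" by simp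
   thus "((%h. flat (Suc n) h) \<longlongrightarrow> 0) (at_left 0)"
   by(rule Lim_transform_eventually) (auto simp: flat_def eventually_at_filter)
   have "((%h. inverse h ^ Suc n / exp (inverse h)) \<longlongrightarrow> (0::real)) (at_right 0)"
   by(rule filterlim_compose[OF tendsto_power_div_exp_0 filterlim_inverse_at_top_right])
   thus "((%h. flat (Suc n) h) \<longlongrightarrow> 0) (at_right 0)"
   by(rule Lim_transform_eventually)
   (auto simp: flat_def eventually_at_filter exp_minus field_simps)
  qed
  hence "((%h. (flat n h - flat n 0) / h) \<longlongrightarrow> 0) (at 0)"
   by(rule Lim_transform_eventually) (auto simp: flat_def eventually_at_filter)
  thus ?thesis using 3 by(simp add: DERIV_def flat_def)
 qed
qed

lemma smooth1_flat: "smooth1 (flat n)"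
proof -
 have "sm1 m (flat n)" for m
 proof (induction m arbitrary: n)
  case (Suc m)
  hence "sm1 m (%t. - real n * flat (Suc n) t + 1 * flat (n + 2) t)" by(intro sm1_lin)
  thus ?case using flat_deriv unfolding sm1.simps(2)
   by(intro exI[of _ "%t. - real n * flat (Suc n) t + 1 * flat (n + 2) t"]) blast
 qed simp
 thus ?thesis by(simp add: smooth1_def)
qed

lemma flat0_bounds: "0 <= flat 0 t" "flat 0 t <= 1"
 by(auto simp: flat_def)

definition bump1 :: "real => (real => real) => bool" where
 "bump1 r g \<longleftrightarrow> smooth1 g & (ALL t. \<bar>t\<bar> > r --> g t = 0)"

lemma bump1_deriv:
 assumes "bump1 r g" shows "bump1 r (deriv g)"
proof -
 have g: "smooth1 g" using assms by(simp add: bump1_def)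
 have "deriv g t = 0" if "\<bar>t\<bar> > r" for t
 proof -
  have "((%t. 0) has_real_derivative 0) (at t)" by simp
  hence "(g has_real_derivative 0) (at t)"
   by(rule has_field_derivative_transform_within_open[where S = "- {-r..r}"]) (use that assms in \<open>auto simp: bump1_def\<close>)
  thus ?thesis by(rule DERIV_imp_deriv)
 qed
 thus ?thesis using smooth1_deriv[OF g] by(simp add: bump1_def)
qed

lemma bump1_continuous: "bump1 r g ==> isCont g t"
 using smooth1_deriv(1) by(auto simp: bump1_def intro: DERIV_isCont)

lemma bump1_bounded: "bump1 r g ==> EX B>=0. ALL t. \<bar>g t\<bar> <= B"
proof -
 assume g: "bump1 r g"
 have "compact (g ` {-r..r})"
  by(intro compact_continuous_image continuous_at_imp_continuous_on) (auto intro: bump1_continuous[OF g])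
 then obtain B where B: "!!t. t : {-r..r} ==> \<bar>g t\<bar> <= B"
  using compact_imp_bounded by(force simp: bounded_iff)
 have "\<bar>g t\<bar> <= \<bar>B\<bar>" for t
 proof (cases "\<bar>t\<bar> > r")
  case False
  hence "t : {-r..r}" by auto
  thus ?thesis using B[of t] by linarith
 qed (use g in \<open>auto simp: bump1_def\<close>)
 thus ?thesis by(intro exI[of _ "\<bar>B\<bar>"]) auto
qed

lemma bump1_lipschitz: "bump1 r g ==> EX B>=0. ALL s t. \<bar>g s - g t\<bar> <= B * \<bar>s - t\<bar>"
proof -
 assume g: "bump1 r g"
 obtain B where B: "B >= 0" "!!t. \<bar>deriv g t\<bar> <= B" using bump1_bounded[OF bump1_deriv[OF g]] by blast
 have D: "(g has_real_derivative deriv g t) (at t)" for t using g smooth1_deriv(1) by(auto simp: bump1_def)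
 have le: "\<bar>g t - g s\<bar> <= B * \<bar>t - s\<bar>" if st: "s < t" for s t
 proof -
  obtain z where "g t - g s = (t - s) * deriv g z" using MVT2[OF st, of g "deriv g"] D by blast
  thus ?thesis using mult_left_mono[OF B(2)[of z], of "\<bar>t - s\<bar>"] by(simp add: abs_mult mult.commute)
 qed
 have "\<bar>g s - g t\<bar> <= B * \<bar>s - t\<bar>" for s t
  using le[of s t] le[of t s] by(cases s t rule: linorder_cases) (auto simp: abs_minus_commute)
 thus ?thesis using B(1) by blast
qed

text \<open>A grading of \<open>smooth\<close> by the order of differentiation, which makes products
  and convolutions accessible to induction; \<open>smooth\<close> itself speaks of lists of
  derivatives.\<close>

fun smn :: "nat => nat => (pt => complex) => bool" where
 "smn d 0 ph \<longleftrightarrow> continuous_on (Rd d) ph"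
| "smn d (Suc n) ph \<longleftrightarrow> continuous_on (Rd d) ph &
   (ALL i<d. (ALL x:Rd d. (%s. ph (x(i := s))) differentiable at (x i)) & smn d n (partial i ph))"

lemma smooth_partial: "smooth d ph ==> i < d ==> smooth d (partial i ph)"
 unfolding smooth_def
proof (intro allI impI)
 fix "is" :: "nat list" assume *: "ALL is. set is \<subseteq> {..<d} --> continuous_on (Rd d) (foldr partial is ph) &
   (ALL i<d. ALL x:Rd d. (%s. foldr partial is ph (x(i := s))) differentiable at (x i))" "i < d" "set is \<subseteq> {..<d}"
 thus "continuous_on (Rd d) (foldr partial is (partial i ph)) &
   (ALL k<d. ALL x:Rd d. (%s. foldr partial is (partial i ph) (x(k := s))) differentiable at (x k))"
  using *(1)[rule_format, of "is @ [i]"] by auto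
qed

lemma smooth_continuous: "smooth d ph ==> continuous_on (Rd d) ph"
 unfolding smooth_def by(drule spec[of _ "[]"]) simp

lemma smooth_differentiable:
 "smooth d ph ==> i < d ==> x : Rd d ==> (%s. ph (x(i := s))) differentiable at (x i)"
 unfolding smooth_def by(drule spec[of _ "[]"]) simp

lemma smooth_iff: "smooth d ph \<longleftrightarrow> (ALL n. smn d n ph)"
proof
 assume "smooth d ph"
 hence "smn d n ph" for n
 proof (induction n arbitrary: ph)
  case (Suc n)
  thus ?case by(simp add: smooth_continuous smooth_differentiable smooth_partial)
 qed (simp add: smooth_continuous)
 thus "ALL n. smn d n ph" ..
next
 assume *: "ALL n. smn d n ph"
 have "continuous_on (Rd d) (foldr partial is ph) &
   (ALL i<d. ALL x:Rd d. (%s. foldr partial is ph (x(i := s))) differentiable at (x i))"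
  if "set is \<subseteq> {..<d}" for "is" using * that
 \<comment> \<open>The last entry of the list is the derivative that is applied first, so the list
   is peeled from the end to match the recursion of \<open>smn\<close>.\<close>
 proof (induction "is" arbitrary: ph rule: rev_induct)
  case Nil
  thus ?case using Nil.prems(1)[rule_format, of 1]
   unfolding One_nat_def smn.simps foldr_Nil id_apply by blast
 next
  case (snoc i "is")
  have "ALL n. smn d n (partial i ph)"
  proof
   fix n show "smn d n (partial i ph)" using snoc.prems(1)[rule_format, of "Suc n"] snoc.prems(2) by simp
  qed
  thus ?case using snoc.IH[of "partial i ph"] snoc.prems(2) by simp
 qed
 thus "smooth d ph" by(simp add: smooth_def)
qed

lemma partial_eq:
 assumes "((%s. ph (x(i := s))) has_vector_derivative D) (at (x i))" shows "partial i ph x = D"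
 unfolding partial_def using assms by(rule vector_derivative_at)

lemma smooth_has_derivative:
 assumes "smooth d ph" "i < d" "x : Rd d"
 shows "((%s. ph (x(i := s))) has_vector_derivative partial i ph x) (at (x i))"
 unfolding partial_def using smooth_differentiable[OF assms] by(simp add: vector_derivative_works)

lemma partial_cong:
 assumes "!!x. x : Rd d ==> ph x = ps x" "i < d" "x : Rd d"
 shows "partial i ph x = partial i ps x"
 unfolding partial_def using assms upd_Rd by auto

lemma smn_cong:
 assumes "!!x. x : Rd d ==> ph x = ps x" "smn d n ph"
 shows "smn d n ps"
 using assms
proof (induction n arbitrary: ph ps)
 case (Suc n)
 have "smn d n (partial i ps)" if "i < d" for i
  using Suc.IH[of "partial i ph" "partial i ps"] partial_cong[OF Suc.prems(1) that] Suc.prems(2) that by auto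
 moreover have "(%s. ps (x(i := s))) = (%s. ph (x(i := s)))" if "x : Rd d" "i < d" for x i
  by(intro ext Suc.prems(1)[symmetric] upd_Rd that)
 ultimately show ?case using Suc.prems continuous_on_cong[of "Rd d" "Rd d" ph ps] by auto
qed (use continuous_on_cong in fastforce)

lemma smn_SucD: "smn d (Suc n) ph ==> smn d n ph"
 by(induction n arbitrary: ph) auto

lemma smn_partial:
 assumes "smn d (Suc n) ph" "i < d" "x : Rd d"
 shows "((%s. ph (x(i := s))) has_vector_derivative partial i ph x) (at (x i))"
 unfolding partial_def using assms by(auto simp: vector_derivative_works[symmetric])

lemma smn_lin:
 assumes "smn d n ph" "smn d n ps" shows "smn d n (%x. a * ph x + b * ps x)"
 using assms
proof (induction n arbitrary: ph ps)
 case (Suc n)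
 have D: "((%s. a * ph (x(i := s)) + b * ps (x(i := s))) has_vector_derivative
   (a * partial i ph x + b * partial i ps x)) (at (x i))" if "i < d" "x : Rd d" for i x
  using smn_partial[OF Suc.prems(1) that] smn_partial[OF Suc.prems(2) that] by(intro derivative_intros)
 have "smn d n (partial i (%x. a * ph x + b * ps x))" if i: "i < d" for i
 proof (rule smn_cong)
  show "smn d n (%x. a * partial i ph x + b * partial i ps x)" using Suc i by auto
 qed (simp add: partial_eq[OF D[OF i]])
 moreover note differentiableI_vector[OF D]
 ultimately show ?case using Suc.prems unfolding smn.simps(2) by(intro conjI allI impI ballI continuous_intros) auto
qed (auto intro!: continuous_intros)

lemma smn_mult:
 assumes "smn d n ph" "smn d n ps" shows "smn d n (%x. ph x * ps x)"
 using assms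
proof (induction n arbitrary: ph ps)
 case (Suc n)
 have D: "((%s. ph (x(i := s)) * ps (x(i := s))) has_vector_derivative
   (ph x * partial i ps x + partial i ph x * ps x)) (at (x i))" if "i < d" "x : Rd d" for i x
  using has_vector_derivative_mult[OF smn_partial[OF Suc.prems(1) that] smn_partial[OF Suc.prems(2) that]]
  by(simp only: fun_upd_triv)
 have "smn d n (partial i (%x. ph x * ps x))" if i: "i < d" for i
 proof (rule smn_cong)
  have "smn d n (%x. ph x * partial i ps x)" "smn d n (%x. partial i ph x * ps x)"
   using Suc i Suc.prems[THEN smn_SucD] by auto
  from smn_lin[OF this, of 1 1]
  show "smn d n (%x. ph x * partial i ps x + partial i ph x * ps x)" by simp
 qed (simp add: partial_eq[OF D[OF i]])
 moreover note differentiableI_vector[OF D]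
 ultimately show ?case using Suc.prems unfolding smn.simps(2) by(intro conjI allI impI ballI continuous_intros) auto
qed (auto intro!: continuous_intros)

lemma smooth_lin: "smooth d ph ==> smooth d ps ==> smooth d (%x. a * ph x + b * ps x)"
 by(simp add: smooth_iff smn_lin)

lemma smooth_mult: "smooth d ph ==> smooth d ps ==> smooth d (%x. ph x * ps x)"
 by(simp add: smooth_iff smn_mult)

lemma partial_mult:
 assumes "smooth d ph" "smooth d ps" "i < d" "x : Rd d"
 shows "partial i (%x. ph x * ps x) x = ph x * partial i ps x + partial i ph x * ps x"
 by(rule partial_eq)
  (use has_vector_derivative_mult[OF smooth_has_derivative[OF assms(1,3,4)] smooth_has_derivative[OF assms(2,3,4)]]
   in \<open>simp only: fun_upd_triv\<close>)

lemma partial_lin: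
 assumes "smooth d ph" "smooth d ps" "i < d" "x : Rd d"
 shows "partial i (%x. a * ph x + b * ps x) x = a * partial i ph x + b * partial i ps x"
 by(rule partial_eq)
  (use smooth_has_derivative[OF assms(1,3,4)] smooth_has_derivative[OF assms(2,3,4)] in \<open>intro derivative_intros\<close>)

lemma has_vector_derivative_of_quotient:
 fixes F :: "real => complex"
 assumes "((%h. (F (a + h) - F a) / of_real h) \<longlongrightarrow> D) (at 0)"
 shows "(F has_vector_derivative D) (at a)"
 unfolding has_vector_derivative_complex_iff DERIV_def
 using tendsto_Re[OF assms] tendsto_Im[OF assms] by simp

section \<open>Convolution with products of bump functions\<close>

lemma of_real_meas: "f : bm M ==> (%x. of_real (f x) :: complex) : bm M"
 by(rule measurable_compose[OF _ borel_measurable_of_real])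

text \<open>Convolution with a tensor product of bump functions; the measure \<open>\<mu>\<close> may be a point measure,
 in which case this is the tensor product itself.\<close>

definition cv :: "nat => pt measure => (pt => complex) => (nat => real => real) => pt => complex" where
 "cv d \<mu> v g x = (LINT y|\<mu>. v y * of_real (\<Prod>i<d. g i (x i - y i)))"

locale convolution =
 fixes d :: nat and \<mu> :: "pt measure" and v :: "pt => complex" and r :: real
 assumes sets: "sets \<mu> = sets (leb d)" and v: "integrable \<mu> v"
begin

lemma kernel_bound:
 assumes "!!i. i < d ==> bump1 r (g i)"
 shows "EX B>=0. ALL x y. \<bar>\<Prod>i<d. g i (x i - y i)\<bar> <= B"
proof -
 have "ALL i. EX B>=0. i < d --> (ALL t. \<bar>g i t\<bar> <= B)" using bump1_bounded assms by(metis order_refl)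
 then obtain B where B: "!!i. B i >= 0" "!!i t. i < d ==> \<bar>g i t\<bar> <= B i" by metis
 have "\<bar>\<Prod>i<d. g i (x i - y i)\<bar> <= (\<Prod>i<d. B i)" for x y
  unfolding abs_prod using B by(intro prod_mono) auto
 thus ?thesis using B by(intro exI[of _ "\<Prod>i<d. B i"]) (auto intro: prod_nonneg)
qed

lemma coord_meas: "i < d ==> (%y. y i) : borel_measurable \<mu>"
 using measurable_component_singleton[of i "{..<d}" "%_. lborel"]
 unfolding measurable_cong_sets[OF sets refl] leb_def by simp

lemma factor_meas:
 assumes "bump1 r g" "i < d"
 shows "(%y. g (a - y i)) : borel_measurable \<mu>"
proof -
 have "continuous_on UNIV g" by(intro continuous_at_imp_continuous_on) (auto intro: bump1_continuous[OF assms(1)])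
 hence "g : bm borel" by(rule borel_measurable_continuous_onI)
 thus ?thesis using coord_meas[OF assms(2)] by measurable
qed

lemma kernel_meas:
 assumes "!!i. i < d ==> bump1 r (g i)"
 shows "(%y. \<Prod>i<d. g i (x i - y i)) : borel_measurable \<mu>"
 by(intro borel_measurable_prod factor_meas assms) auto

lemma integrand_integrable:
 assumes "!!i. i < d ==> bump1 r (g i)"
 shows "integrable \<mu> (%y. v y * of_real (\<Prod>i<d. g i (x i - y i)))"
proof -
 obtain B where B: "B >= 0" "!!x y. \<bar>\<Prod>i<d. g i (x i - y i)\<bar> <= B" using kernel_bound[of g, OF assms] by blast
 show ?thesis
 proof (rule Bintble_bound[of _ "%y. B * norm (v y)"])
  show "integrable \<mu> (%y. B * norm (v y))" using v by simp
  show "(%y. v y * of_real (\<Prod>i<d. g i (x i - y i))) : borel_measurable \<mu>"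
   by(intro borel_measurable_times of_real_meas kernel_meas assms borel_measurable_integrable[OF v])
  show "AE y in \<mu>. norm (v y * of_real (\<Prod>i<d. g i (x i - y i))) <= norm (B * norm (v y))"
   using B mult_right_mono[OF B(2), of "cmod (v _)"] by(auto simp: norm_mult abs_mult mult.commute simp del: of_real_prod)
 qed
qed

lemma cv_continuous:
 assumes g: "!!i. i < d ==> bump1 r (g i)"
 shows "continuous_on (Rd d) (cv d \<mu> v g)"
 unfolding continuous_on_sequentially
proof (intro allI ballI impI)
 fix X x assume X: "(ALL n. X n : Rd d) & X ~~> x"
 obtain B where B: "B >= 0" "!!x y. \<bar>\<Prod>i<d. g i (x i - y i)\<bar> <= B" using kernel_bound[of g, OF g] by blast
 have "(%n. cv d \<mu> v g (X n)) ~~> cv d \<mu> v g x"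
  unfolding cv_def
 proof (rule integral_dominated_convergence[where w = "%y. B * norm (v y)"])
  show "integrable \<mu> (%y. B * norm (v y))" using v by simp
  show "AE y in \<mu>. (%n. v y * of_real (\<Prod>i<d. g i (X n i - y i))) ~~> v y * of_real (\<Prod>i<d. g i (x i - y i))"
  proof (rule AE_I2)
   fix y
   have "(%n. g i (X n i - y i)) ~~> g i (x i - y i)" if "i < d" for i
   by(rule isCont_tendsto_compose[OF bump1_continuous[OF g[OF that]]])
   (use X tendsto_coord in \<open>intro tendsto_intros, blast\<close>)
   thus "(%n. v y * of_real (\<Prod>i<d. g i (X n i - y i))) ~~> v y * of_real (\<Prod>i<d. g i (x i - y i))"
   by(intro tendsto_mult tendsto_const tendsto_of_real tendsto_prod) auto
  qed
  show "AE y in \<mu>. norm (v y * of_real (\<Prod>i<d. g i (X n i - y i))) <= B * norm (v y)" for n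
   using B mult_right_mono[OF B(2), of "cmod (v _)"] by(auto simp: norm_mult mult.commute simp del: of_real_prod)
 qed (rule borel_measurable_integrable[OF integrand_integrable[of g, OF g]], assumption?)+
 thus "(cv d \<mu> v g \<circ> X) ~~> cv d \<mu> v g x" by(simp add: o_def)
qed

text \<open>Differentiation under the integral by dominated convergence: the difference quotient of
  the factor g j is bounded by its Lipschitz constant, the other factors are bounded. The derivative
  is again a \<open>cv\<close> with one bump replaced by its derivative, so \<open>cv_smooth\<close>
  can iterate.\<close>

lemma cv_deriv:
 assumes g: "!!i. i < d ==> bump1 r (g i)" and j: "j < d"
 shows "((%s. cv d \<mu> v g (x(j := s))) has_vector_derivative cv d \<mu> v (g(j := deriv (g j))) x) (at (x j))"
proof (rule has_vector_derivative_of_quotient)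
 define h where "h i = (if i = j then (%_. 1) else g i)" for i
 have split: "(\<Prod>i<d. f i ((x(j := s)) i - y i)) = f j (s - y j) * (\<Prod>i\<in>{..<d} - {j}. g i (x i - y i))"
  if "!!i. i ~= j ==> f i = g i" for f s and y :: pt
  using j that by(subst prod.remove[of _ j]) (auto intro!: prod.cong)
 define P where "P y = (\<Prod>i\<in>{..<d} - {j}. g i (x i - y i))" for y :: pt
 have "ALL i. EX B>=0. i < d --> (ALL t. \<bar>g i t\<bar> <= B)" using bump1_bounded g by(metis order_refl)
 then obtain b where b: "!!i. b i >= 0" "!!i t. i < d ==> \<bar>g i t\<bar> <= b i" by metis
 define B where "B = (\<Prod>i\<in>{..<d} - {j}. b i)"
 have P: "\<bar>P y\<bar> <= B" for y unfolding P_def B_def abs_prod using b by(intro prod_mono) auto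
 have B0: "B >= 0" unfolding B_def using b by(intro prod_nonneg) auto
 obtain L where L: "L >= 0" "!!s t. \<bar>g j s - g j t\<bar> <= L * \<bar>s - t\<bar>" using bump1_lipschitz[OF g[OF j]] by blast
 have g': "i < d ==> bump1 r ((g(j := deriv (g j))) i)" for i using g bump1_deriv[OF g[OF j]] by auto
 have Dg: "(g j has_real_derivative deriv (g j) t) (at t)" for t
  using g[OF j] smooth1_deriv(1) by(auto simp: bump1_def)
 have eq: "(cv d \<mu> v g (x(j := x j + h)) - cv d \<mu> v g (x(j := x j))) / of_real h =
  (LINT y|\<mu>. v y * of_real ((g j (x j + h - y j) - g j (x j - y j)) / h * P y))" for h
 proof -
  have 1: "cv d \<mu> v g (x(j := x j + h)) - cv d \<mu> v g (x(j := x j)) =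
   (LINT y|\<mu>. v y * of_real (\<Prod>i<d. g i ((x(j := x j + h)) i - y i)) - v y * of_real (\<Prod>i<d. g i ((x(j := x j)) i - y i)))"
   unfolding cv_def
   by(rule Bint_diff[OF integrand_integrable[of g "x(j := x j + h)", OF g]
   integrand_integrable[of g "x(j := x j)", OF g], symmetric])
  have "(cv d \<mu> v g (x(j := x j + h)) - cv d \<mu> v g (x(j := x j))) / of_real h = (LINT y|\<mu>. (v y * of_real (\<Prod>i<d. g i ((x(j := x j + h)) i - y i)) - v y * of_real (\<Prod>i<d. g i ((x(j := x j)) i - y i))) / of_real h)"
   unfolding 1 by simp
  also have "... = (LINT y|\<mu>. v y * of_real ((g j (x j + h - y j) - g j (x j - y j)) / h * P y))"
  proof (rule Bint_cong[OF refl])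
   fix y
   have s: "(\<Prod>i<d. g i ((x(j := s)) i - y i)) = g j (s - y j) * P y" for s
   using split[of g s y] by(simp only: P_def)
   show "(v y * of_real (\<Prod>i<d. g i ((x(j := x j + h)) i - y i)) - v y * of_real (\<Prod>i<d. g i ((x(j := x j)) i - y i))) / of_real h
   = v y * of_real ((g j (x j + h - y j) - g j (x j - y j)) / h * P y)"
   unfolding s by(simp add: left_diff_distrib right_diff_distrib diff_divide_distrib)
  qed
  finally show ?thesis .
 qed
 have eq': "cv d \<mu> v (g(j := deriv (g j))) x = (LINT y|\<mu>. v y * of_real (deriv (g j) (x j - y j) * P y))"
 proof -
  have "(\<Prod>i<d. (g(j := deriv (g j))) i (x i - y i)) = deriv (g j) (x j - y j) * P y" for y
   using split[of "g(j := deriv (g j))" "x j" y] by(simp add: P_def)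
  thus ?thesis unfolding cv_def by(simp only:)
 qed
 have Pm: "P : borel_measurable \<mu>" unfolding P_def
  by(intro borel_measurable_prod factor_meas g) auto
 have m1: "(%y. v y * of_real ((g j (x j + h - y j) - g j (x j - y j)) / h * P y)) : borel_measurable \<mu>" for h
  by(intro borel_measurable_times of_real_meas borel_measurable_divide borel_measurable_diff
   factor_meas[OF g[OF j] j] Pm borel_measurable_const borel_measurable_integrable[OF v])
 have "((%h. (LINT y|\<mu>. v y * of_real ((g j (x j + h - y j) - g j (x j - y j)) / h * P y))) \<longlongrightarrow>
  (LINT y|\<mu>. v y * of_real (deriv (g j) (x j - y j) * P y))) (at 0)"
  unfolding tendsto_at_iff_sequentially
 proof (intro allI impI)
  fix H assume H: "ALL i. H i : UNIV - {0::real}" "H ~~> 0"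
  have "(%n. \<integral>y. v y * of_real ((g j (x j + H n - y j) - g j (x j - y j)) / H n * P y) \<partial>\<mu>) ~~>
   (LINT y|\<mu>. v y * of_real (deriv (g j) (x j - y j) * P y))"
  proof (rule integral_dominated_convergence[where w = "%y. (L * B) * norm (v y)"])
   show "integrable \<mu> (%y. (L * B) * norm (v y))" using v by simp
   show "(%y. v y * of_real (deriv (g j) (x j - y j) * P y)) : borel_measurable \<mu>"
   by(intro borel_measurable_times of_real_meas
   factor_meas[OF bump1_deriv[OF g[OF j]] j] Pm borel_measurable_integrable[OF v])
   show "AE y in \<mu>. (%n. v y * of_real ((g j (x j + H n - y j) - g j (x j - y j)) / H n * P y)) ~~>
   v y * of_real (deriv (g j) (x j - y j) * P y)"
   proof (rule AE_I2)
   fix y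
   have "((%h. (g j (x j - y j + h) - g j (x j - y j)) / h) \<longlongrightarrow> deriv (g j) (x j - y j)) (at 0)"
   using Dg[of "x j - y j"] by(simp add: DERIV_def)
   hence "(%n. (g j (x j - y j + H n) - g j (x j - y j)) / H n) ~~> deriv (g j) (x j - y j)"
   using H unfolding tendsto_at_iff_sequentially by(simp add: o_def)
   hence "(%n. (g j (x j + H n - y j) - g j (x j - y j)) / H n) ~~> deriv (g j) (x j - y j)"
   by(simp add: algebra_simps)
   thus "(%n. v y * of_real ((g j (x j + H n - y j) - g j (x j - y j)) / H n * P y)) ~~>
   v y * of_real (deriv (g j) (x j - y j) * P y)"
   by(intro tendsto_mult tendsto_const tendsto_of_real)
   qed
   show "AE y in \<mu>. norm (v y * of_real ((g j (x j + H n - y j) - g j (x j - y j)) / H n * P y)) <= (L * B) * norm (v y)" for n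
   proof (rule AE_I2)
   fix y
   have "H n ~= 0" using H by auto
   hence "\<bar>(g j (x j + H n - y j) - g j (x j - y j)) / H n\<bar> <= L"
   using L(2)[of "x j + H n - y j" "x j - y j"] by(simp add: pos_divide_le_eq)
   hence "\<bar>(g j (x j + H n - y j) - g j (x j - y j)) / H n\<bar> * \<bar>P y\<bar> <= L * B"
   using P B0 L(1) by(intro mult_mono) auto
   hence "norm (v y) * (\<bar>(g j (x j + H n - y j) - g j (x j - y j)) / H n\<bar> * \<bar>P y\<bar>) <= norm (v y) * (L * B)"
   by(intro mult_left_mono) auto
   thus "norm (v y * of_real ((g j (x j + H n - y j) - g j (x j - y j)) / H n * P y)) <= (L * B) * norm (v y)"
   by(simp only: norm_mult norm_of_real abs_mult mult.commute)
   qed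
  qed (rule m1)
  thus "((%h. (LINT y|\<mu>. v y * of_real ((g j (x j + h - y j) - g j (x j - y j)) / h * P y))) \<circ> H) ~~>
   (LINT y|\<mu>. v y * of_real (deriv (g j) (x j - y j) * P y))" by(simp add: o_def)
 qed
 thus "((%h. (cv d \<mu> v g (x(j := x j + h)) - cv d \<mu> v g (x(j := x j))) / of_real h) \<longlongrightarrow>
  cv d \<mu> v (g(j := deriv (g j))) x) (at 0)"
  unfolding eq eq' .
qed

lemma cv_smooth:
 assumes g: "!!i. i < d ==> bump1 r (g i)"
 shows "smooth d (cv d \<mu> v g)"
proof -
 have "smn d n (cv d \<mu> v g)" for n using g
 proof (induction n arbitrary: g)
  case (Suc n)
  have "smn d n (partial i (cv d \<mu> v g))" if i: "i < d" for i
  proof (rule smn_cong)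
   show "smn d n (cv d \<mu> v (g(i := deriv (g i))))"
   by(rule Suc.IH) (use Suc.prems bump1_deriv[OF Suc.prems[OF i]] in auto)
  next
   fix x show "cv d \<mu> v (g(i := deriv (g i))) x = partial i (cv d \<mu> v g) x"
   by(rule partial_eq[of "cv d \<mu> v g" x i, OF cv_deriv[of g i x, OF Suc.prems i], symmetric])
  qed
  moreover have "(%s. cv d \<mu> v g (x(i := s))) differentiable at (x i)" if "i < d" for i x
   by(rule differentiableI_vector[OF cv_deriv[of g i x, OF Suc.prems that]])
  ultimately show ?case
   using cv_continuous[of g, OF Suc.prems] unfolding smn.simps by blast
 next
  case 0
  thus ?case using cv_continuous[of g] by simp
 qed
 thus ?thesis by(simp add: smooth_iff)
qed

end

text \<open>Against the Dirac measure at z, the \<open>cv\<close> of the constant 1 is the shifted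
  tensor product, so smoothness and the partial derivatives are inherited from convolutions.\<close>

lemma tensor_smooth:
 assumes g: "!!i. i < d ==> bump1 r (g i)" and z: "z : Rd d"
 shows "smooth d (%x. of_real (\<Prod>i<d. g i (x i - z i)))"
  "!!j x. j < d ==> x : Rd d ==> partial j (%x. of_real (\<Prod>i<d. g i (x i - z i))) x
   = of_real (\<Prod>i<d. (g(j := deriv (g j))) i (x i - z i))"
proof -
 let ?mu = "return (leb d) z"
 interpret prob_space ?mu by(rule prob_space_return) (simp add: z)
 interpret convolution d ?mu "%_. 1" r by standard auto
 have eq: "cv d ?mu (%_. 1) g x = of_real (\<Prod>i<d. g i (x i - z i))" if "!!i. i < d ==> bump1 r (g i)" for g x
 proof -
  have "(%y. of_real (\<Prod>i<d. g i (x i - y i)) :: complex) : borel_measurable ?mu"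
   by(rule of_real_meas, rule kernel_meas[of g, OF that])
  from integral_return[OF _ this[unfolded measurable_cong_sets[OF sets_return refl]], of z]
  show ?thesis unfolding cv_def by(simp add: z)
 qed
 have e: "cv d ?mu (%_. 1) g = (%x. of_real (\<Prod>i<d. g i (x i - z i)))" by(rule ext) (rule eq[of g, OF g])
 show "smooth d (%x. of_real (\<Prod>i<d. g i (x i - z i)))" using cv_smooth[of g, OF g] unfolding e .
 fix j x assume j: "j < d" and "x : Rd d"
 have "partial j (cv d ?mu (%_. 1) g) x = cv d ?mu (%_. 1) (g(j := deriv (g j))) x"
  by(rule partial_eq[of "cv d ?mu (%_. 1) g" x j, OF cv_deriv[of g j x, OF g j]])
 also have "... = of_real (\<Prod>i<d. (g(j := deriv (g j))) i (x i - z i))"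
 proof (rule eq)
  fix i assume "i < d"
  thus "bump1 r ((g(j := deriv (g j))) i)" using g bump1_deriv[OF g[OF j]] by(cases "i = j") auto
 qed
 finally show "partial j (%x. of_real (\<Prod>i<d. g i (x i - z i))) x
   = of_real (\<Prod>i<d. (g(j := deriv (g j))) i (x i - z i))" unfolding e .
qed

section \<open>Test functions\<close>

lemma test_funI:
 "smooth d ph ==> compact K ==> K \<subseteq> Om ==> (!!x. x : Rd d ==> x ~: K ==> ph x = 0) ==> ph : test_fun d Om"
 by(auto simp: test_fun_def)

lemma test_fun_mono: "ph : test_fun d A ==> A \<subseteq> B ==> ph : test_fun d B"
 by(auto simp: test_fun_def)

lemma test_fun_smooth: "ph : test_fun d Om ==> smooth d ph"
 by(simp add: test_fun_def)

lemma partial_zero_outside: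
 assumes "closed K" "!!x. x : Rd d ==> x ~: K ==> ph x = 0" "i < d" "x : Rd d" "x ~: K"
 shows "partial i ph x = 0"
proof (rule partial_eq)
 have o: "open ((%s. x(i := s)) -` (- K))"
 proof (rule open_vimage)
  show "continuous_on UNIV (%s. x(i := s))"
  proof (rule continuous_on_coordinatewise_then_product)
   fix j show "continuous_on UNIV (%s. (x(i := s)) j)" by(cases "j = i") auto
  qed
 qed (use assms in auto)
 have v: "((%s. 0) has_vector_derivative (0::complex)) (at (x i))" by simp
 have m: "x i : (%s. x(i := s)) -` (- K)" using assms(5) by simp
 show "((%s. ph (x(i := s))) has_vector_derivative 0) (at (x i))"
 proof (rule has_vector_derivative_transform_within_open[OF v o m])
  fix s assume "s : (%s. x(i := s)) -` (- K)"
  thus "0 = ph (x(i := s))" using assms(2)[OF upd_Rd[OF assms(4,3)], of s] by simp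
 qed
qed

lemma test_fun_partial:
 assumes "ph : test_fun d Om" "i < d" shows "partial i ph : test_fun d Om"
proof -
 obtain K where K: "smooth d ph" "compact K" "K \<subseteq> Om" "!!x. x : Rd d ==> x ~: K ==> ph x = 0"
  using assms(1) by(auto simp: test_fun_def)
 show ?thesis
  by(rule test_funI[OF smooth_partial[OF K(1) assms(2)] K(2,3)])
   (rule partial_zero_outside[OF compact_imp_closed[OF K(2)] K(4) assms(2)])
qed

lemma test_fun_lin:
 assumes "ph : test_fun d Om" "ps : test_fun d Om"
 shows "(%x. a * ph x + b * ps x) : test_fun d Om"
proof -
 obtain K where K: "smooth d ph" "compact K" "K \<subseteq> Om" "!!x. x : Rd d ==> x ~: K ==> ph x = 0"
  using assms(1) by(auto simp: test_fun_def)
 obtain L where L: "smooth d ps" "compact L" "L \<subseteq> Om" "!!x. x : Rd d ==> x ~: L ==> ps x = 0"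
  using assms(2) by(auto simp: test_fun_def)
 show ?thesis
  by(rule test_funI[where K = "K \<union> L"]) (use K L in \<open>auto intro: smooth_lin\<close>)
qed

lemma test_fun_mult:
 assumes "smooth d ph" "ps : test_fun d Om"
 shows "(%x. ph x * ps x) : test_fun d Om"
 using assms unfolding test_fun_def by(auto intro: smooth_mult)

lemma continuous_bounded:
 fixes f :: "pt => complex"
 assumes f: "continuous_on (Rd d) f" and K: "compact K" "K \<subseteq> Rd d" "!!x. x : Rd d ==> x ~: K ==> f x = 0"
 shows "EX B>=0. ALL x:Rd d. cmod (f x) <= B"
proof -
 have "compact (f ` K)" using K f by(intro compact_continuous_image) (auto intro: continuous_on_subset)
 then obtain B where B: "!!x. x : K ==> cmod (f x) <= B" using compact_imp_bounded by(force simp: bounded_iff)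
 have "cmod (f x) <= \<bar>B\<bar>" if "x : Rd d" for x
  using B[of x] K(3)[OF that] by(cases "x : K") auto
 thus ?thesis by(intro exI[of _ "\<bar>B\<bar>"]) auto
qed

lemma integrable_bounded_compact:
 fixes f :: "pt => complex"
 assumes f: "f : bm (leb d)" and K: "compact K" "K \<subseteq> Rd d"
  and z: "!!x. x : Rd d ==> x ~: K ==> f x = 0" and B: "AE x in leb d. cmod (f x) <= B"
 shows "integrable (leb d) f" "f : L2 (leb d)"
proof -
 have i: "integrable (leb d) (%x. indicator K x *\<^sub>R C)" for C :: real
  using emeasure_compact_finite[OF K] compact_sets_leb[OF K] by(intro integrable_indicator) auto
 show "integrable (leb d) f"
 proof (rule Bintble_bound[OF i[of "B"] f])
  show "AE x in leb d. norm (f x) <= norm (indicator K x *\<^sub>R B)"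
   using B AE_space
  proof eventually_elim
   case (elim x)
   thus ?case using z[of x] by(cases "x : K") auto
  qed
 qed
 show "f : L2 (leb d)" unfolding L2_iff
 proof (intro conjI f Bintble_bound[OF i[of "B^2"]])
  show "(%x. (cmod (f x))^2) : bm (leb d)" using f by measurable
  show "AE x in leb d. norm ((cmod (f x))^2) <= norm (indicator K x *\<^sub>R B\<^sup>2)"
   using B AE_space
  proof eventually_elim
   case (elim x)
   thus ?case using z[of x] by(cases "x : K") (auto intro: power_mono)
  qed
 qed
qed

lemma test_fun_props:
 assumes "ph : test_fun d Om" "Om \<subseteq> Rd d"
 shows "ph : bm (leb d)" "EX B>=0. ALL x:Rd d. cmod (ph x) <= B" "ph : L2 (leb d)"
  "integrable (leb d) ph" "!!x. x : Rd d ==> x ~: Om ==> ph x = 0"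
proof -
 obtain K where K: "smooth d ph" "compact K" "K \<subseteq> Om" "!!x. x : Rd d ==> x ~: K ==> ph x = 0"
  using assms(1) by(auto simp: test_fun_def)
 have KR: "K \<subseteq> Rd d" using K(3) assms(2) by blast
 show m: "ph : bm (leb d)" by(rule continuous_measurable[OF smooth_continuous[OF K(1)]])
 show b: "EX B>=0. ALL x:Rd d. cmod (ph x) <= B"
  by(rule continuous_bounded[OF smooth_continuous[OF K(1)] K(2) KR K(4)])
 then obtain B where "ALL x:Rd d. cmod (ph x) <= B" by blast
 hence "AE x in leb d. cmod (ph x) <= B" by(intro AE_I2) simp
 thus "ph : L2 (leb d)" "integrable (leb d) ph"
  using integrable_bounded_compact[OF m K(2) KR K(4)] by blast+
 show "!!x. x : Rd d ==> x ~: Om ==> ph x = 0" using K by blast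
qed

text \<open>Fubini singles out coordinate i, and the fundamental theorem of calculus leaves boundary
  values 0. The derivative ps is a separate argument, so that a product may be used whose derivative
  along one coordinate is known although it has not been shown to be \<open>smooth\<close>.\<close>

lemma integral_derivative_zero:
 fixes ph ps :: "pt => complex"
 assumes K: "compact K" "K \<subseteq> Rd d" and ph0: "!!x. x : Rd d ==> x ~: K ==> ph x = 0"
  and ps0: "!!x. x : Rd d ==> x ~: K ==> ps x = 0" and ps: "continuous_on (Rd d) ps" and i: "i < d"
  and D: "!!x. x : Rd d ==> ((%s. ph (x(i := s))) has_vector_derivative ps x) (at (x i))"
 shows "(LINT x|(leb d). ps x) = 0"
proof -
 let ?J = "{..<d} - {i}"
 have d: "{..<d} = insert i ?J" using i by auto
 obtain B where "ALL x:Rd d. cmod (ps x) <= B" using continuous_bounded[OF ps K ps0] by blast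
 hence "AE x in leb d. cmod (ps x) <= B" by(intro AE_I2) simp
 hence int: "integrable (leb d) ps"
  using integrable_bounded_compact[OF continuous_measurable[OF ps] K ps0] by blast
 obtain r where r: "r > 0" "K \<subseteq> {y : Rd d. ALL i<d. \<bar>y i\<bar> <= r}" using compact_subset_cube[OF K] by blast
 have "(LINT x|(leb d). ps x) = (LINT x|(Pi\<^sub>M ?J (%_. lborel)). (LINT s|lborel. ps (x(i := s))))"
  using lebp.product_integral_insert[of ?J i ps] int unfolding leb_def d[symmetric] by simp
 also have "... = (LINT x|(Pi\<^sub>M ?J (%_. lborel :: real measure)). 0)"
 proof (rule Bint_cong[OF refl])
  fix x assume "x : space (Pi\<^sub>M ?J (%_. lborel :: real measure))"
  hence x: "x(i := s) : Rd d" for s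
   using i by(auto simp: space_PiM PiE_def extensional_def mem_Rd)
  have z: "x(i := s) ~: K" if "\<bar>s\<bar> > r" for s
  proof
   assume "x(i := s) : K"
   hence "\<bar>(x(i := s)) i\<bar> <= r" using r i by blast
   thus False using that by simp
  qed
  have vd: "((%s. ph (x(i := s))) has_vector_derivative ps (x(i := s))) (at s)" for s
   using D[OF x[of s]] by simp
  have c: "continuous_on UNIV (%s. x(i := s))"
  proof (rule continuous_on_coordinatewise_then_product)
   fix j show "continuous_on UNIV (%s. (x(i := s)) j)" by(cases "j = i") auto
  qed
  \<comment> \<open>The margin 1 puts both end points of the interval outside the support, where ph
    vanishes.\<close>
  have "(LINT s|lborel. ps (x(i := s))) = (LINT s|lborel. indicator {-(r+1)..r+1} s *\<^sub>R ps (x(i := s)))"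
  proof (rule Bint_cong[OF refl])
   fix s show "ps (x(i := s)) = indicator {-(r+1)..r+1} s *\<^sub>R ps (x(i := s))"
   proof (cases "\<bar>s\<bar> > r")
   case True
   thus ?thesis using ps0[OF x z[OF True]] by simp
   next
   case False
   hence "s : {-(r+1)..r+1}" using r by auto
   thus ?thesis by simp
   qed
  qed
  also have "... = ph (x(i := r + 1)) - ph (x(i := -(r + 1)))"
  proof (rule integral_FTC_Icc)
   show "continuous_on {-(r+1)..r+1} (%s. ps (x(i := s)))"
   by(rule continuous_on_compose2[OF ps continuous_on_subset[OF c]]) (use x in auto)
   show "((%s. ph (x(i := s))) has_vector_derivative ps (x(i := s))) (at s within {-(r+1)..r+1})" for s
   by(rule has_vector_derivative_at_within[OF vd])
  qed (use r in simp)
  also have "... = 0" using ph0[OF x z] r by simp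
  finally show "(LINT s|lborel. ps (x(i := s))) = 0" .
 qed
 finally show ?thesis by simp
qed

text \<open>Smooth approximations of the indicator of an open box. The factor
  \<open>flat 0 (n t)\<close> tends to 1 for t > 0 and is 0 otherwise, so the support lies in the
  closed box, the values in [0,1], and convergence holds at every point.\<close>

definition bxt :: "nat => pt => pt => nat => pt => complex" where
 "bxt d a b n x = of_real (\<Prod>i<d. flat 0 (real n * (x i - a i)) * flat 0 (real n * (b i - x i)))"

lemma flat0_zero: "t <= 0 ==> flat 0 t = 0"
 by(simp add: flat_def)

lemma bxt_test_fun:
 assumes "{x : Rd d. ALL i<d. a i <= x i & x i <= b i} \<subseteq> Om"
 shows "bxt d a b n : test_fun d Om"
proof (rule test_funI[OF _ _ assms])
 let ?r = "1 + (\<Sum>i<d. \<bar>a i\<bar> + \<bar>b i\<bar>)"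
 have r: "\<bar>a i\<bar> + \<bar>b i\<bar> <= ?r" if "i < d" for i
 proof -
  have "\<bar>a i\<bar> + \<bar>b i\<bar> <= (\<Sum>i<d. \<bar>a i\<bar> + \<bar>b i\<bar>)" using that by(intro member_le_sum) auto
  thus ?thesis by simp
 qed
 define g where "g i t = flat 0 (real n * (t - a i)) * flat 0 (real n * (b i - t))" for i t
 have "bump1 ?r (g i)" if i: "i < d" for i
 proof -
  have "sm1 m (%t. flat 0 (real n * t + - real n * a i) * flat 0 (- real n * t + real n * b i))" for m
   using smooth1_flat by(intro sm1_mult sm1_affine) (auto simp: smooth1_def)
  moreover have "g i = (%t. flat 0 (real n * t + - real n * a i) * flat 0 (- real n * t + real n * b i))"
   by(auto simp: g_def algebra_simps)
  ultimately have "smooth1 (g i)" by(simp add: smooth1_def)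
  moreover have "g i t = 0" if "\<bar>t\<bar> > ?r" for t
  proof (cases "t >= 0")
   case True
   hence "b i - t <= 0" using that r[OF i] by simp
   thus ?thesis by(simp add: g_def flat0_zero mult_nonneg_nonpos)
  next
   case False
   hence "t - a i <= 0" using that r[OF i] by simp
   thus ?thesis by(simp add: g_def flat0_zero mult_nonneg_nonpos)
  qed
  ultimately show ?thesis by(simp add: bump1_def)
 qed
 from tensor_smooth(1)[of d ?r g "%i. if i < d then 0 else undefined", OF this]
 have "smooth d (%x. of_real (\<Prod>i<d. g i (x i - (if i < d then 0 else undefined))))" by(simp add: mem_Rd)
 moreover have "(\<Prod>i<d. g i (x i - (if i < d then 0 else undefined))) = (\<Prod>i<d. g i (x i))" for x :: pt
  by(intro prod.cong) auto
 ultimately have "smooth d (%x. of_real (\<Prod>i<d. g i (x i)))" by(simp only:)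
 thus "smooth d (bxt d a b n)" by(simp add: bxt_def[abs_def] g_def)
 show "compact {x : Rd d. ALL i<d. a i <= x i & x i <= b i}"
 proof -
  have "{x : Rd d. ALL i<d. a i <= x i & x i <= b i} = Rd d \<inter> (\<Inter>i\<in>{..<d}. {x. a i <= x i} \<inter> {x. x i <= b i})" by auto
  moreover have "closed {x :: pt. a i <= x i}" "closed {x :: pt. x i <= b i}" for i
   by(auto intro!: closed_Collect_le)
  ultimately have 1: "closed {x : Rd d. ALL i<d. a i <= x i & x i <= b i}"
   using closed_Rd by(auto intro!: closed_Int closed_INT)
  have 2: "{x : Rd d. ALL i<d. a i <= x i & x i <= b i} \<subseteq> {x : Rd d. ALL i<d. \<bar>x i\<bar> <= ?r}"
  proof (intro subsetI CollectI conjI allI impI)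
   fix x i assume "x : {x : Rd d. ALL i<d. a i <= x i & x i <= b i}" "i < d"
   hence "a i <= x i" "x i <= b i" by auto
   thus "\<bar>x i\<bar> <= ?r" using r[OF \<open>i < d\<close>] by linarith
  qed auto
  show ?thesis using compact_Int_closed[OF compact_cube 1, of d ?r] Int_absorb1[OF 2] by simp
 qed
 fix x assume "x : Rd d" "x ~: {x : Rd d. ALL i<d. a i <= x i & x i <= b i}"
 then obtain i where "i < d" "x i < a i \<or> b i < x i" by auto
 hence "EX i:{..<d}. flat 0 (real n * (x i - a i)) * flat 0 (real n * (b i - x i)) = 0"
  by(intro bexI[of _ i]) (auto simp: flat0_zero mult_nonneg_nonpos)
 hence "(\<Prod>i<d. flat 0 (real n * (x i - a i)) * flat 0 (real n * (b i - x i))) = 0"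
  by(intro prod_zero) auto
 thus "bxt d a b n x = 0" unfolding bxt_def by(simp only: of_real_0)
qed

lemma bxt_bound: "cmod (bxt d a b n x) <= 1"
proof -
 have "\<bar>\<Prod>i<d. flat 0 (real n * (x i - a i)) * flat 0 (real n * (b i - x i))\<bar> <= 1"
  unfolding abs_prod by(rule prod_le_1) (auto simp: abs_mult flat0_bounds intro!: mult_le_one)
 thus ?thesis unfolding bxt_def norm_of_real .
qed

lemma flat0_tendsto:
 "(%n. flat 0 (real n * t)) ~~> (if t > 0 then 1 else 0)"
proof (cases "t > 0")
 case True
 have "(%n. exp (- (1 / t) * inverse (real n))) ~~> exp (- (1 / t) * 0)"
  by(intro tendsto_intros lim_inverse_n)
 hence "(%n. exp (- (1 / t) * inverse (real n))) ~~> 1" by simp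
 moreover have "\<forall>\<^sub>F n in sequentially. exp (- (1 / t) * inverse (real n)) = flat 0 (real n * t)"
  using eventually_gt_at_top[of 0] by eventually_elim (use True in \<open>simp add: flat_def field_simps\<close>)
 ultimately show ?thesis using True by(simp add: Lim_transform_eventually)
next
 case False
 thus ?thesis by(simp add: flat0_zero mult_nonneg_nonpos)
qed

lemma bxt_tendsto:
 assumes "x : Rd d"
 shows "(%n. bxt d a b n x) ~~> indicator (obx d a b) x"
proof -
 have "(%n. \<Prod>i<d. flat 0 (real n * (x i - a i)) * flat 0 (real n * (b i - x i))) ~~>
  (\<Prod>i<d. (if x i - a i > 0 then 1 else 0) * (if b i - x i > 0 then 1 else 0))"
  by(intro tendsto_prod tendsto_mult flat0_tendsto)
 also have "(\<Prod>i<d. (if x i - a i > 0 then 1 else 0) * (if b i - x i > 0 then 1 else 0)) = (indicator (obx d a b) x :: real)"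
 proof (cases "x : obx d a b")
  case True
  thus ?thesis by(auto simp: obx_def intro!: prod.neutral)
 next
  case False
  thus ?thesis using assms by(auto simp: obx_def intro!: prod_zero)
 qed
 finally have "(%n. complex_of_real (\<Prod>i<d. flat 0 (real n * (x i - a i)) * flat 0 (real n * (b i - x i)))) ~~>
  of_real (indicator (obx d a b) x)" by(rule tendsto_of_real)
 moreover have "complex_of_real (indicator (obx d a b) x) = indicator (obx d a b) x" by(simp add: indicator_def)
 ultimately show ?thesis unfolding bxt_def by(simp only:)
qed

lemma open_Rd_sets': "open_Rd d Om ==> Om \<inter> space (leb d) : sets (leb d)"
 using open_Rd_sets[of d Om] open_Rd_subset[of d Om] by(simp add: Int_absorb2)

lemma space_leb_on: "Om \<subseteq> Rd d ==> space (leb_on d Om) = Om"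
 by(auto simp: leb_on_def space_restrict_space)

lemma leb_on_int:
 fixes f :: "pt => complex"
 assumes "open_Rd d Om"
 shows "(LINT x|(leb_on d Om). f x) = (LINT x|(leb d). indicator Om x *\<^sub>R f x)"
 unfolding leb_on_def by(rule integral_restrict_space[OF open_Rd_sets'[OF assms]])

lemma leb_on_AE:
 assumes "open_Rd d Om"
 shows "(AE x in leb_on d Om. P x) \<longleftrightarrow> (AE x in leb d. x : Om --> P x)"
 unfolding leb_on_def by(rule AE_restrict_space_iff[OF open_Rd_sets'[OF assms]])

lemma leb_on_meas:
 fixes f :: "pt => complex"
 assumes "open_Rd d Om"
 shows "f : bm (leb_on d Om) \<longleftrightarrow> (%x. indicator Om x *\<^sub>R f x) : bm (leb d)"
 unfolding leb_on_def by(rule borel_measurable_restrict_space_iff[OF open_Rd_sets'[OF assms]])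

lemma leb_on_integrable:
 fixes f :: "pt => complex"
 assumes "open_Rd d Om"
 shows "integrable (leb_on d Om) f \<longleftrightarrow> integrable (leb d) (%x. indicator Om x *\<^sub>R f x)"
 unfolding leb_on_def by(rule integrable_restrict_space[OF open_Rd_sets'[OF assms]])

lemma test_fun_leb_on:
 assumes O: "open_Rd d Om" and ph: "ph : test_fun d Om"
 shows "ph : L2 (leb_on d Om)" "integrable (leb_on d Om) ph"
proof -
 note p = test_fun_props[OF ph open_Rd_subset[OF O]]
 have "extend_zero Om ph : L2 (leb d)" using extend_zero_L2(1)[OF open_Rd_sets[OF O] p(3)] .
 thus "ph : L2 (leb_on d Om)" unfolding leb_on_def using L2_restrict_iff[OF open_Rd_sets[OF O]] by blast
 show "integrable (leb_on d Om) ph" unfolding leb_on_integrable[OF O]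
  using integrable_mult_indicator[OF open_Rd_sets[OF O] p(4)] .
qed

text \<open>A Lindelof subcover by open cubes, whose closed versions still lie in \<open>Om\<close>,
  reduces an almost everywhere statement to countably many cubes.\<close>

lemma AE_of_cubes:
 assumes O: "open_Rd d Om"
  and P: "!!z r. 0 < r ==> z : Om ==> cbx d z r \<subseteq> Om ==>
   AE x in leb d. x : obx d (%i. z i - r) (%i. z i + r) --> P x"
 shows "AE x in leb_on d Om. P x"
proof -
 have "EX r>0. cbx d z r \<subseteq> Om" if z: "z : Om" for z
  using compact_margin[of "{z}" Om d] z O by(auto simp: fatten_def)
 then obtain r where r: "!!z. z : Om ==> r z > 0" "!!z. z : Om ==> cbx d z (r z) \<subseteq> Om" by metis
 let ?W = "%z. obx d (%i. z i - r z) (%i. z i + r z)"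
 obtain F where F: "F \<subseteq> ?W ` Om" "countable F" "\<Union>F = \<Union>(?W ` Om)"
  using Lindelof_openin[of "?W ` Om" "Rd d"] open_obx unfolding open_Rd_def by blast
 have "AE x in leb d. ALL W:F. x : W --> P x"
  unfolding AE_ball_countable[OF F(2)]
 proof
  fix W assume "W : F"
  then obtain z where "z : Om" "W = ?W z" using F(1) by blast
  thus "AE x in leb d. x : W --> P x" using P[OF r(1) _ r(2)] by simp
 qed
 moreover have "x : \<Union>F" if "x : Om" for x
 proof -
  have "x : ?W x" using that open_Rd_subset[OF O] r(1)[OF that] by(auto simp: obx_def)
  thus ?thesis using that F(3) by blast
 qed
 ultimately have "AE x in leb d. x : Om --> P x" by(auto elim!: eventually_mono)
 thus ?thesis by(simp add: leb_on_AE[OF O])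
qed

text \<open>On a small cube f is integrable. Testing with \<open>bxt\<close> and passing to the
  limit shows that f integrates to 0 over every open box in the cube, and
  \<open>AE_zero_of_boxes\<close> concludes.\<close>

lemma fundamental_lemma:
 assumes O: "open_Rd d Om" and f: "loc_integrable d Om f"
  and z: "!!ph. ph : test_fun d Om ==> (LINT x|(leb_on d Om). f x * ph x) = 0"
 shows "AE x in leb_on d Om. f x = 0"
proof (rule AE_of_cubes[OF O])
 fix z r assume r: "0 < (r::real)" "z : Om" "cbx d z r \<subseteq> Om"
 let ?W = "obx d (%i. z i - r) (%i. z i + r)"
 define g where "g x = indicator ?W x *\<^sub>R f x" for x
 have sub: "?W \<subseteq> cbx d z r" by(auto simp: obx_def cbx_def abs_le_iff)
 have "cbx d z r = fatten d {z} r" by(auto simp: fatten_def)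
 hence "compact (cbx d z r)" using compact_fatten[of "{z}" d r] r(2) open_Rd_subset[OF O] by auto
 hence "set_integrable (leb d) (cbx d z r) f" using f r(3) by(simp add: loc_integrable_def)
 hence g: "integrable (leb d) g" unfolding g_def set_integrable_def[symmetric]
  by(rule set_integrable_subset[OF _ obx_sets sub])
 \<comment> \<open>The restrictions on a and b keep the closed box inside the closed cube, so that
   the approximants are test functions on \<open>Om\<close>.\<close>
 have box: "(LINT x|(leb d). indicator (obx d a b) x *\<^sub>R f x) = 0"
  if ab: "!!i. z i - r <= a i" "!!i. b i <= z i + r" for a b
 proof -
  have C: "{x : Rd d. ALL i<d. a i <= x i & x i <= b i} \<subseteq> cbx d z r"
  proof
   fix x assume x: "x : {x : Rd d. ALL i<d. a i <= x i & x i <= b i}"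
   have "\<bar>x i - z i\<bar> <= r" if "i < d" for i
   proof -
   have "a i <= x i" "x i <= b i" using x that by auto
   thus ?thesis using ab[of i] by linarith
   qed
   thus "x : cbx d z r" using x by(simp add: cbx_def)
  qed
  let ?C = "{x : Rd d. ALL i<d. a i <= x i & x i <= b i}"
  let ?h = "%x. indicator (cbx d z r) x *\<^sub>R f x"
  have h: "integrable (leb d) ?h"
   using \<open>set_integrable (leb d) (cbx d z r) f\<close> by(simp add: set_integrable_def)
  have t: "bxt d a b n : test_fun d Om" "bxt d a b n : test_fun d (cbx d z r)" for n
   using bxt_test_fun C r(3) by blast+
  have cR: "cbx d z r \<subseteq> Rd d" by(auto simp: cbx_def)
  have "(%n. \<integral>x. ?h x * bxt d a b n x \<partial>leb d) ~~> (LINT x|(leb d). ?h x * indicator (obx d a b) x)"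
  proof (rule integral_dominated_convergence[where w = "%x. norm (?h x)"])
   show "AE x in leb d. (%n. ?h x * bxt d a b n x) ~~> ?h x * indicator (obx d a b) x"
   using AE_space by eventually_elim (intro tendsto_intros bxt_tendsto, simp)
   show "AE x in leb d. norm (?h x * bxt d a b n x) <= norm (?h x)" for n
   unfolding norm_mult by(intro AE_I2 mult_left_le bxt_bound norm_ge_zero)
   show "(%x. ?h x * indicator (obx d a b) x) : bm (leb d)"
   by(intro borel_measurable_times borel_measurable_integrable[OF h] borel_measurable_indicator obx_sets)
   show "(%x. ?h x * bxt d a b n x) : bm (leb d)" for n
   by(intro borel_measurable_times borel_measurable_integrable[OF h] test_fun_props(1)[OF t(2) cR])
  qed (rule integrable_norm[OF h])
  moreover have "(LINT x|(leb d). ?h x * bxt d a b n x) = 0" for n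
  proof -
   have "(LINT x|(leb d). ?h x * bxt d a b n x) = (LINT x|(leb d). indicator Om x *\<^sub>R (f x * bxt d a b n x))"
   using test_fun_props(5)[OF t(2) cR] r(3)
   by(intro Bint_cong) (auto simp: indicator_def)
   thus ?thesis using z[OF t(1)] by(simp add: leb_on_int[OF O])
  qed
  ultimately have "(LINT x|(leb d). ?h x * indicator (obx d a b) x) = 0" by(simp add: LIMSEQ_const_iff)
  moreover have "obx d a b \<subseteq> cbx d z r" using C by(auto simp: obx_def intro: less_imp_le)
  hence "(LINT x|(leb d). ?h x * indicator (obx d a b) x) = (LINT x|(leb d). indicator (obx d a b) x *\<^sub>R f x)"
   by(intro Bint_cong) (auto simp: indicator_def)
  ultimately show ?thesis by simp
 qed
 have "AE x in leb d. g x = 0"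
 proof (rule AE_zero_of_boxes[OF g])
  show "(LINT x|(leb d). g x) = 0" unfolding g_def by(rule box) auto
  fix a b
  have "(LINT x|(leb d). indicator (obx d a b) x *\<^sub>R g x) = (LINT x|(leb d). indicator (obx d a b \<inter> ?W) x *\<^sub>R f x)"
   by(intro Bint_cong) (auto simp: g_def indicator_def)
  also have "... = 0" unfolding obx_Int by(rule box) auto
  finally show "(LINT x|(leb d). indicator (obx d a b) x *\<^sub>R g x) = 0" .
 qed
 thus "AE x in leb d. x : ?W --> f x = 0" by(auto simp: g_def elim!: eventually_mono)
qed

section \<open>Weak gradients\<close>

text \<open>Finitely many jointly closed operators T k turn \<open>S\<close> into a semi-Hilbert
  space under the graph norm. The instances are W^(1,2), with gradient and identity, and the form
  domain, with gradient and multiplication by the root of a weight.\<close>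

locale graph_space =
 fixes M :: "'a measure" and K :: "nat set" and S :: "('a => complex) set"
  and T :: "nat => ('a => complex) => ('a => complex)"
 assumes finK: "finite K" and S0: "(%x. 0) : S"
  and Slin: "f : S ==> g : S ==> (%x. a * f x + b * g x) : S"
  and TL2: "k : K ==> f : S ==> T k f : L2 M"
  and Tlin: "k : K ==> f : S ==> g : S ==>
   AE x in M. T k (%y. a * f y + b * g y) x = a * T k f x + b * T k g x"
  and Tclosed: "(!!n :: nat. F n : S) ==> (!!k. k : K ==> h k : L2 M) ==>
   (!!k. k : K ==> L2_lim M (%n. T k (F n)) (h k)) ==>
   EX f:S. ALL k:K. AE x in M. T k f x = h k x"
begin

definition gip where "gip f g = (\<Sum>k\<in>K. L2_inner M (T k f) (T k g))"

lemma T_diff: "k : K ==> f : S ==> g : S ==> AE x in M. T k (%y. f y - g y) x = T k f x - T k g x"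
 using Tlin[of k f g 1 "-1"] by simp

sublocale semi_inner S gip
proof
 fix f g h a b assume *: "f : S" "g : S" "h : S"
 have "L2_inner M (T k (%x. a * f x + b * g x)) (T k h) = a * L2_inner M (T k f) (T k h) + b * L2_inner M (T k g) (T k h)"
  if k: "k : K" for k
 proof -
  have "L2_inner M (T k (%x. a * f x + b * g x)) (T k h) = L2_inner M (%x. a * T k f x + b * T k g x) (T k h)"
   using * k by(intro L2_inner_cong_AE Tlin TL2 L2_lin Slin) auto
  thus ?thesis using L2.ip_lin[OF TL2[OF k *(1)] TL2[OF k *(2)] TL2[OF k *(3)]] by simp
 qed
 thus "gip (%x. a * f x + b * g x) h = a * gip f h + b * gip g h"
  by(simp add: gip_def sum.distrib sum_distrib_left)
next
 fix f g assume *: "f : S" "g : S"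
 show "gip g f = cnj (gip f g)" unfolding gip_def cnj_sum
  by(intro sum.cong refl L2.ip_cnj TL2 *)
qed (auto simp: S0 Slin gip_def intro!: sum_nonneg L2_inner_self_Re)

lemma gnrm_sq: "f : S ==> (snorm gip f)\<^sup>2 = (\<Sum>k\<in>K. (n2 M (T k f))^2)"
 unfolding nrm_sq by(simp add: gip_def L2.nrm_sq[OF TL2])

lemma T_le: "k : K ==> f : S ==> n2 M (T k f) <= snorm gip f"
proof (rule power2_le_imp_le)
 assume "k : K" "f : S"
 thus "(n2 M (T k f))^2 <= (snorm gip f)^2"
  unfolding gnrm_sq[OF \<open>f : S\<close>] by(intro member_le_sum finK) auto
qed (rule nrm_nonneg)

lemma T_diff_n2: "k : K ==> f : S ==> g : S ==> n2 M (T k (%x. f x - g x)) = n2 M (%x. T k f x - T k g x)"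
 by(intro n2_cong_AE T_diff L2_measurable TL2 diff_mem L2.diff_mem)

lemma gnrm_tendsto:
 assumes F: "!!n :: nat. F n : S" and f: "f : S"
  and lim: "!!k. k : K ==> L2_lim M (%n. T k (F n)) (T k f)"
 shows "(%n. snorm gip (%x. F n x - f x)) ~~> 0"
proof -
 have "(%n. (\<Sum>k\<in>K. (n2 M (%x. T k (F n) x - T k f x))^2)) ~~> (\<Sum>k\<in>K. 0^2)"
  by(intro tendsto_sum tendsto_power lim)
 moreover have "(\<Sum>k\<in>K. (n2 M (%x. T k (F n) x - T k f x))^2) = (snorm gip (%x. F n x - f x))^2" for n
  unfolding gnrm_sq[OF diff_mem[OF F f]] by(intro sum.cong refl) (simp add: T_diff_n2[OF _ F f])
 ultimately have "(%n. (snorm gip (%x. F n x - f x))^2) ~~> 0" by simp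
 from tendsto_real_sqrt[OF this] show ?thesis
  using nrm_nonneg[OF diff_mem[OF F f]] by simp
qed

sublocale semi_hilbert S gip
proof (intro semi_hilbert.intro semi_inner_axioms semi_hilbert_axioms.intro)
 fix F :: "nat => 'a => complex"
 assume F: "!!n. F n : S" and C: "!!e. 0 < e ==> EX N. ALL m>=N. ALL n>=N. snorm gip (%x. F m x - F n x) < e"
 have "EX h:L2 M. L2_lim M (%n. T k (F n)) h" if k: "k : K" for k
 proof (rule L2.complete[OF TL2[OF k F]])
  fix e :: real assume "0 < e"
  then obtain N where N: "ALL m>=N. ALL n>=N. snorm gip (%x. F m x - F n x) < e" using C by blast
  have "n2 M (%x. T k (F m) x - T k (F n) x) < e" if "m >= N" "n >= N" for m n
   using N that T_le[OF k diff_mem[OF F[of m] F[of n]]] T_diff_n2[OF k F[of m] F[of n]] by fastforce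
  thus "EX N. ALL m>=N. ALL n>=N. n2 M (%x. T k (F m) x - T k (F n) x) < e" by blast
 qed
 then obtain h where h: "!!k. k : K ==> h k : L2 M" "!!k. k : K ==> L2_lim M (%n. T k (F n)) (h k)"
  by metis
 obtain f where f: "f : S" "!!k. k : K ==> AE x in M. T k f x = h k x" using Tclosed[OF F h] by blast
 have "(%n. snorm gip (%x. F n x - f x)) ~~> 0"
 proof (rule gnrm_tendsto[OF F f(1)])
  fix k assume k: "k : K"
  have "n2 M (%x. T k (F n) x - T k f x) = n2 M (%x. T k (F n) x - h k x)" for n
  proof (rule n2_cong_AE)
   show "AE x in M. T k (F n) x - T k f x = T k (F n) x - h k x" using f(2)[OF k] by eventually_elim simp
  qed (use L2_measurable[OF TL2[OF k F[of n]]] L2_measurable[OF TL2[OF k f(1)]] L2_measurable[OF h(1)[OF k]] in measurable)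
  thus "L2_lim M (%n. T k (F n)) (T k f)" using h(2)[OF k] by simp
 qed
 thus "EX f:S. (%n. snorm gip (%x. F n x - f x)) ~~> 0" using f(1) by blast
qed

end

lemma smooth_const: "smooth d (%_. c)"
proof -
 have "smn d n (%_. c)" for n
 proof (induction n arbitrary: c)
  case (Suc n)
  have "partial i (%_. c) = (%_. 0)" for i by(rule ext) (simp add: partial_def)
  thus ?case using Suc by simp
 qed simp
 thus ?thesis by(simp add: smooth_iff)
qed

lemma test_fun_zero: "(%_. 0) : test_fun d Om"
 by(rule test_funI[OF smooth_const compact_empty]) auto

text \<open>The component of x orthogonal to \<open>N\<close> is itself a test vector. It
  annihilates every F n, hence x in the limit, and so has norm zero.\<close>

lemma (in closed_sub) weakly_closed:
 assumes x: "x : S" and F: "!!n. F n : N" and w: "!!g. g : S ==> (%n. ip (F n) g) ~~> ip x g"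
 shows "x : N"
proof -
 obtain p where p: "p : N" "ALL g:N. ip (%t. x t - p t) g = 0" using projection[OF x] by blast
 have NS: "g : S" if "g : N" for g using that sub by auto
 define v where "v = (%t. x t - p t)"
 have v: "v : S" unfolding v_def using x p NS diff_mem by blast
 have z: "ip g v = 0" if "g : N" for g using p(2) that ip_cnj[OF v NS[OF that]] by(simp add: v_def)
 have "(%n. ip (F n) v) ~~> ip x v" by(rule w[OF v])
 hence "ip x v = 0" using z[OF F] by(simp add: LIMSEQ_const_iff)
 hence "ip v v = 0" using z[OF p(1)] ip_diff[OF x NS[OF p(1)] v] by(simp add: v_def)
 hence "snorm ip v = 0" by(simp add: snorm_def)
 hence "snorm ip (%t. p t - x t) = 0" using nrm_minus[OF x NS[OF p(1)]] by(simp add: v_def)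
 thus ?thesis using closedN[of "%_. p" x] p(1) x by simp
qed

text \<open>Norm boundedness extends convergence of the pairings from a dense set to all vectors. It
  is applied to mollifications, whose convergence is first known only against test
  functions.\<close>

lemma (in semi_inner) weak_of_dense:
 assumes F: "!!n. F n : S" and f: "f : S" and b: "!!n. nrm (F n) <= C"
  and T: "T \<subseteq> S" "!!ph. ph : T ==> (%n. ip (F n) ph) ~~> ip f ph"
  and dense: "!!e. 0 < e ==> EX ph:T. nrm (%x. g x - ph x) < e" and g: "g : S"
 shows "(%n. ip (F n) g) ~~> ip f g"
proof (rule LIMSEQ_I)
 fix e :: real assume e: "0 < e"
 have C0: "C >= 0" using b[of 0] nrm_nonneg[OF F[of 0]] by linarith
 define D where "D = C + nrm f + 1"
 have D: "D > 0" "C + nrm f <= D" using C0 nrm_nonneg[OF f] by(auto simp: D_def)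
 obtain ph where ph: "ph : T" "nrm (%x. g x - ph x) < e / (2 * D)" using dense[of "e / (2 * D)"] e D by auto
 have phS: "ph : S" using ph(1) T(1) by blast
 have gp: "(%x. g x - ph x) : S" using g phS diff_mem by blast
 obtain n0 where n0: "!!n. n >= n0 ==> cmod (ip (F n) ph - ip f ph) < e/2"
  using LIMSEQ_D[OF T(2)[OF ph(1)], of "e/2"] e by auto
 have "cmod (ip (F n) g - ip f g) < e" if "n >= n0" for n
 proof -
  have eq: "ip (F n) g - ip f g = (ip (F n) ph - ip f ph) + ip (F n) (%x. g x - ph x) - ip f (%x. g x - ph x)"
   using ip_diff2[OF g phS F[of n]] ip_diff2[OF g phS f] by simp
  have tri: "cmod (a + b - c) <= cmod a + cmod b + cmod c" for a b c :: complex
   using norm_triangle_ineq4[of "a + b" c] norm_triangle_ineq[of a b] by linarith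
  have "cmod (ip (F n) g - ip f g) <= cmod (ip (F n) ph - ip f ph) + cmod (ip (F n) (%x. g x - ph x)) + cmod (ip f (%x. g x - ph x))"
   unfolding eq by(rule tri)
  also have "... < e/2 + D * nrm (%x. g x - ph x)"
  proof -
   have "cmod (ip (F n) (%x. g x - ph x)) <= C * nrm (%x. g x - ph x)"
   using cauchy_schwarz[OF F gp] mult_right_mono[OF b nrm_nonneg[OF gp]] by(rule order_trans)
   moreover have "cmod (ip f (%x. g x - ph x)) <= nrm f * nrm (%x. g x - ph x)" by(rule cauchy_schwarz[OF f gp])
   moreover have "(C + nrm f) * nrm (%x. g x - ph x) <= D * nrm (%x. g x - ph x)"
   using D(2) nrm_nonneg[OF gp] by(rule mult_right_mono)
   ultimately show ?thesis using n0[OF that] by(simp add: distrib_right)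
  qed
  also have "... <= e" using ph(2) D(1) by(simp add: field_simps)
  finally show ?thesis .
 qed
 thus "EX no. ALL n>=no. norm (ip (F n) g - ip f g) < e" by blast
qed

locale domain =
 fixes d :: nat and Om :: "pt set"
 assumes O: "open_Rd d Om"
begin

abbreviation "M \<equiv> leb_on d Om"

lemma sub: "Om \<subseteq> Rd d" by(rule open_Rd_subset[OF O])

lemma space_M: "space M = Om" by(rule space_leb_on[OF sub])

lemma meas_leb: "f : bm (leb d) ==> f : bm M"
 unfolding leb_on_def by(rule measurable_restrict_space1)

lemma int_leb:
 fixes f :: "pt => complex"
 assumes "!!x. x : Rd d ==> x ~: Om ==> f x = 0"
 shows "(LINT x|M. f x) = (LINT x|(leb d). f x)"
 unfolding leb_on_int[OF O] using assms by(intro Bint_cong) (auto simp: indicator_def)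

lemma compact_bounded_mult:
 assumes f: "loc_integrable d Om f" and ph: "ph : bm (leb d)"
  and K: "compact K" "K \<subseteq> Om" "!!x. x : Rd d ==> x ~: K ==> ph x = 0" and B: "!!x. x : Rd d ==> cmod (ph x) <= B"
 shows "integrable M (%x. f x * ph x)"
 unfolding leb_on_integrable[OF O]
proof (rule Bintble_bound)
 have i: "integrable (leb d) (%x. indicator K x *\<^sub>R f x)"
  using f K by(simp add: loc_integrable_def set_integrable_def)
 thus "integrable (leb d) (%x. B * norm (indicator K x *\<^sub>R f x))" by(intro integrable_mult_right integrable_norm)
 have e: "indicator Om x *\<^sub>R (f x * ph x) = (indicator K x *\<^sub>R f x) * ph x" if "x : Rd d" for x
  using K that by(auto simp: indicator_def)
 show "(%x. indicator Om x *\<^sub>R (f x * ph x)) : bm (leb d)"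
 proof (subst measurable_cong)
  show "(%x. (indicator K x *\<^sub>R f x) * ph x) : bm (leb d)"
   by(intro borel_measurable_times borel_measurable_integrable[OF i] ph)
 qed (use e in simp)
 show "AE x in leb d. norm (indicator Om x *\<^sub>R (f x * ph x)) <= norm (B * norm (indicator K x *\<^sub>R f x))"
 proof (rule AE_I2)
  fix x assume "x : space (leb d)"
  hence x: "x : Rd d" by simp
  have "B >= 0" using B[OF x] norm_ge_zero[of "ph x"] by linarith
  thus "norm (indicator Om x *\<^sub>R (f x * ph x)) <= norm (B * norm (indicator K x *\<^sub>R f x))"
   unfolding e[OF x] norm_mult using B[OF x] mult_right_mono[OF B[OF x], of "norm (indicator K x *\<^sub>R f x)"]
   by(simp add: mult.commute)
 qed
qed

lemma loc_mult_integrable: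
 assumes f: "loc_integrable d Om f" and ph: "ph : test_fun d Om"
 shows "integrable M (%x. f x * ph x)"
proof -
 obtain K where K: "compact K" "K \<subseteq> Om" "!!x. x : Rd d ==> x ~: K ==> ph x = 0"
  using ph by(auto simp: test_fun_def)
 obtain B where "ALL x:Rd d. cmod (ph x) <= B" using test_fun_props(2)[OF ph sub] by blast
 thus ?thesis using compact_bounded_mult[OF f test_fun_props(1)[OF ph sub] K] by blast
qed

lemma L2_loc:
 assumes f: "f : L2 M" shows "loc_integrable d Om f"
 unfolding loc_integrable_def
proof (intro conjI allI impI)
 show "f : bm M" using f by(rule L2_measurable)
 fix K assume K: "compact K & K \<subseteq> Om"
 have KR: "K \<subseteq> Rd d" using K sub by blast
 have f0: "extend_zero Om f : L2 (leb d)" using f L2_restrict_iff[OF open_Rd_sets[OF O]] by(simp add: leb_on_def)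
 have "(%x. indicator K x :: complex) : L2 (leb d)"
 proof (rule integrable_bounded_compact(2)[where K = K and B = 1])
  show "(%x. indicator K x :: complex) : bm (leb d)"
   using compact_sets_leb[of K d] K KR by(intro borel_measurable_indicator) auto
 qed (use K KR in \<open>auto simp: indicator_def\<close>)
 from L2_mult_integrable[OF this f0] have "integrable (leb d) (%x. indicator K x * extend_zero Om f x)" .
 moreover have "(%x. indicator K x * extend_zero Om f x) = (%x. indicator K x *\<^sub>R f x)"
 proof
  fix x show "indicator K x * extend_zero Om f x = indicator K x *\<^sub>R f x"
   using K by(cases "x : K") (auto simp: extend_zero_def)
 qed
 ultimately show "set_integrable (leb d) K f" by(simp add: set_integrable_def)
qed

lemma loc_lin:
 assumes "loc_integrable d Om f" "loc_integrable d Om g"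
 shows "loc_integrable d Om (%x. a * f x + b * g x)"
 using assms unfolding loc_integrable_def
proof (intro conjI allI impI)
 fix K assume K: "compact K & K \<subseteq> Om"
 hence "integrable (leb d) (%x. indicator K x *\<^sub>R f x)" "integrable (leb d) (%x. indicator K x *\<^sub>R g x)"
  using assms unfolding loc_integrable_def set_integrable_def by blast+
 hence "integrable (leb d) (%x. a * (indicator K x *\<^sub>R f x) + b * (indicator K x *\<^sub>R g x))"
  by(intro Bintble_add integrable_mult_right)
 moreover have "(%x. a * (indicator K x *\<^sub>R f x) + b * (indicator K x *\<^sub>R g x)) = (%x. indicator K x *\<^sub>R (a * f x + b * g x))"
  by(auto simp: indicator_def)
 ultimately show "set_integrable (leb d) K (%x. a * f x + b * g x)" by(simp add: set_integrable_def)
qed (use assms in \<open>auto simp: loc_integrable_def\<close>)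

lemma loc_mult_smooth:
 assumes f: "loc_integrable d Om f" and t: "smooth d th"
 shows "loc_integrable d Om (%x. th x * f x)"
 unfolding loc_integrable_def
proof (intro conjI allI impI)
 have tm: "th : bm (leb d)" by(rule continuous_measurable[OF smooth_continuous[OF t]])
 show "(%x. th x * f x) : bm M"
  using meas_leb[OF tm] f by(auto simp: loc_integrable_def)
 fix K assume K: "compact K & K \<subseteq> Om"
 hence KR: "K \<subseteq> Rd d" using sub by blast
 have "compact (th ` K)" using K KR smooth_continuous[OF t]
  by(intro compact_continuous_image) (auto intro: continuous_on_subset)
 then obtain B where B: "!!x. x : K ==> cmod (th x) <= B" using compact_imp_bounded by(force simp: bounded_iff)
 have i: "integrable (leb d) (%x. indicator K x *\<^sub>R f x)"
  using f K by(simp add: loc_integrable_def set_integrable_def)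
 have "integrable (leb d) (%x. th x * (indicator K x *\<^sub>R f x))"
 proof (rule Bintble_bound)
  show "integrable (leb d) (%x. B * norm (indicator K x *\<^sub>R f x))" using i by(intro integrable_mult_right integrable_norm)
  show "(%x. th x * (indicator K x *\<^sub>R f x)) : bm (leb d)"
   by(intro borel_measurable_times tm borel_measurable_integrable[OF i])
  show "AE x in leb d. norm (th x * (indicator K x *\<^sub>R f x)) <= norm (B * norm (indicator K x *\<^sub>R f x))"
  proof (rule AE_I2)
   fix x show "norm (th x * (indicator K x *\<^sub>R f x)) <= norm (B * norm (indicator K x *\<^sub>R f x))"
   proof (cases "x : K")
   case True
   hence "0 <= B" using B[of x] norm_ge_zero[of "th x"] by linarith
   thus ?thesis using True B[of x] by(simp add: norm_mult mult_right_mono)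
   qed simp
  qed
 qed
 moreover have "(%x. th x * (indicator K x *\<^sub>R f x)) = (%x. indicator K x *\<^sub>R (th x * f x))"
  by(auto simp: indicator_def)
 ultimately show "set_integrable (leb d) K (%x. th x * f x)" by(simp add: set_integrable_def)
qed

lemma weak_gradD:
 assumes "weak_grad d Om f G"
 shows "loc_integrable d Om f" "!!i. i < d ==> loc_integrable d Om (G i)"
  "!!i ph. i < d ==> ph : test_fun d Om ==> (LINT x|M. f x * partial i ph x) = - (LINT x|M. G i x * ph x)"
 using assms by(auto simp: weak_grad_def)

lemma weak_grad_cong:
 assumes w: "weak_grad d Om f G" and f: "AE x in M. f' x = f x" "f' : bm M"
  and G: "!!i. i < d ==> AE x in M. G' i x = G i x" "!!i. i < d ==> G' i : bm M"
 shows "weak_grad d Om f' G'"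
proof -
 have loc: "loc_integrable d Om h'" if h: "loc_integrable d Om h" and e: "AE x in M. h' x = h x" and m: "h' : bm M" for h h'
  unfolding loc_integrable_def
 proof (intro conjI m allI impI)
  fix K assume K: "compact K & K \<subseteq> Om"
  have i: "integrable (leb d) (%x. indicator K x *\<^sub>R h x)" using h K by(simp add: loc_integrable_def set_integrable_def)
  have "K : sets (leb d)" using K sub compact_sets_leb by blast
  have m': "(%x. indicator K x *\<^sub>R (indicator Om x *\<^sub>R h' x)) : bm (leb d)"
   by(rule borel_measurable_scaleR[OF borel_measurable_indicator[OF \<open>K : _\<close>] m[unfolded leb_on_meas[OF O]]])
  have e': "(%x. indicator K x *\<^sub>R (indicator Om x *\<^sub>R h' x)) = (%x. indicator K x *\<^sub>R h' x)"
  proof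
   fix x show "indicator K x *\<^sub>R (indicator Om x *\<^sub>R h' x) = indicator K x *\<^sub>R h' x"
   using K by(cases "x : K") auto
  qed
  have ae: "AE x in leb d. indicator K x *\<^sub>R h' x = indicator K x *\<^sub>R h x"
   using e K unfolding leb_on_AE[OF O] by(auto elim!: eventually_mono simp: indicator_def)
  show "set_integrable (leb d) K h'" unfolding set_integrable_def
   by(subst integrable_cong_AE[OF m'[unfolded e'] borel_measurable_integrable[OF i] ae]) (rule i)
 qed
 have int: "(LINT x|M. h' x * ph x) = (LINT x|M. h x * ph x)"
  if h: "loc_integrable d Om h" and e: "AE x in M. h' x = h x" and m: "h' : bm M" and ph: "ph : test_fun d Om" for h h' ph
 proof (rule integral_cong_AE)
  show "AE x in M. h' x * ph x = h x * ph x" using e by eventually_elim simp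
  show "(%x. h' x * ph x) : bm M"
   by(intro borel_measurable_times m meas_leb test_fun_props(1)[OF ph sub])
  show "(%x. h x * ph x) : bm M"
   by(rule borel_measurable_integrable[OF loc_mult_integrable[OF h ph]])
 qed
 show ?thesis unfolding weak_grad_def
 proof (intro conjI allI impI ballI)
  show "loc_integrable d Om f'" by(rule loc[OF weak_gradD(1)[OF w] f])
  fix i assume i: "i < d"
  show "loc_integrable d Om (G' i)" by(rule loc[OF weak_gradD(2)[OF w i] G[OF i]])
  fix ph assume ph: "ph : test_fun d Om"
  show "(LINT x|M. f' x * partial i ph x) = - (LINT x|M. G' i x * ph x)"
   using int[OF weak_gradD(1)[OF w] f test_fun_partial[OF ph i]] int[OF weak_gradD(2)[OF w i] G[OF i] ph]
   weak_gradD(3)[OF w i ph] by simp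
 qed
qed

lemma weak_grad_lin:
 assumes "weak_grad d Om f G" "weak_grad d Om f' G'"
 shows "weak_grad d Om (%x. a * f x + b * f' x) (%i x. a * G i x + b * G' i x)"
 unfolding weak_grad_def
proof (intro conjI allI impI ballI loc_lin)
 fix i ph assume i: "i < d" and ph: "ph : test_fun d Om"
 have l: "(LINT x|M. (a * h x + b * h' x) * ps x) = a * (LINT x|M. h x * ps x) + b * (LINT x|M. h' x * ps x)"
  if "loc_integrable d Om h" "loc_integrable d Om h'" "ps : test_fun d Om" for h h' ps
 proof -
  have "(LINT x|M. (a * h x + b * h' x) * ps x) = (LINT x|M. a * (h x * ps x) + b * (h' x * ps x))"
   by(intro Bint_cong) (auto simp: algebra_simps)
  thus ?thesis using loc_mult_integrable[OF that(1,3)] loc_mult_integrable[OF that(2,3)] by simp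
 qed
 show "(LINT x|M. (a * f x + b * f' x) * partial i ph x) = - (LINT x|M. (a * G i x + b * G' i x) * ph x)"
  using l[OF weak_gradD(1)[OF assms(1)] weak_gradD(1)[OF assms(2)] test_fun_partial[OF ph i]]
   l[OF weak_gradD(2)[OF assms(1) i] weak_gradD(2)[OF assms(2) i] ph]
   weak_gradD(3)[OF assms(1) i ph] weak_gradD(3)[OF assms(2) i ph] by simp
qed (use assms in \<open>auto simp: weak_grad_def\<close>)

lemma weak_grad_unique:
 assumes "weak_grad d Om f G" "weak_grad d Om f G'" "i < d"
 shows "AE x in M. G i x = G' i x"
proof -
 have w: "weak_grad d Om (%x. 1 * f x + (-1) * f x) (%i x. 1 * G i x + (-1) * G' i x)"
  by(rule weak_grad_lin[OF assms(1,2)])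
 have "AE x in M. 1 * G i x + (-1) * G' i x = 0"
 proof (rule fundamental_lemma[OF O weak_gradD(2)[OF w assms(3)]])
  fix ph assume "ph : test_fun d Om"
  from weak_gradD(3)[OF w assms(3) this] show "(LINT x|M. (1 * G i x + (-1) * G' i x) * ph x) = 0" by simp
 qed
 thus ?thesis by eventually_elim simp
qed

lemma weak_grad_grad: "weakly_differentiable d Om f ==> weak_grad d Om f (grad d Om f)"
 using someI_ex[of "weak_grad d Om f"] by(simp add: weakly_differentiable_def grad_def)

lemma weak_grad_mult:
 assumes w: "weak_grad d Om f G" and t: "smooth d th"
 shows "weak_grad d Om (%x. th x * f x) (%i x. th x * G i x + partial i th x * f x)"
 unfolding weak_grad_def
proof (intro conjI allI impI ballI)
 show "loc_integrable d Om (%x. th x * f x)" by(rule loc_mult_smooth[OF weak_gradD(1)[OF w] t])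
 fix i assume i: "i < d"
 have l: "loc_integrable d Om (%x. th x * G i x)" "loc_integrable d Om (%x. partial i th x * f x)"
  by(rule loc_mult_smooth[OF weak_gradD(2)[OF w i] t], rule loc_mult_smooth[OF weak_gradD(1)[OF w] smooth_partial[OF t i]])
 show "loc_integrable d Om (%x. th x * G i x + partial i th x * f x)" using loc_lin[OF l, of 1 1] by simp
 fix ph assume ph: "ph : test_fun d Om"
 have tph: "(%x. th x * ph x) : test_fun d Om" by(rule test_fun_mult[OF t ph])
 have t2: "(%x. partial i th x * ph x) : test_fun d Om" by(rule test_fun_mult[OF smooth_partial[OF t i] ph])
 have "(LINT x|M. th x * f x * partial i ph x) = (LINT x|M. f x * partial i (%x. th x * ph x) x - f x * (partial i th x * ph x))"
  using partial_mult[OF t test_fun_smooth[OF ph] i] sub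
  by(intro Bint_cong) (auto simp: space_M algebra_simps)
 also have "... = (LINT x|M. f x * partial i (%x. th x * ph x) x) - (LINT x|M. f x * (partial i th x * ph x))"
  by(intro Bint_diff loc_mult_integrable[OF weak_gradD(1)[OF w]] t2 test_fun_partial[OF tph i])
 also have "... = - ((LINT x|M. G i x * (th x * ph x)) + (LINT x|M. f x * (partial i th x * ph x)))"
  using weak_gradD(3)[OF w i tph] by simp
 also have "(LINT x|M. G i x * (th x * ph x)) + (LINT x|M. f x * (partial i th x * ph x)) =
   (LINT x|M. G i x * (th x * ph x) + f x * (partial i th x * ph x))"
  by(intro Bint_add[symmetric] loc_mult_integrable weak_gradD(1)[OF w] weak_gradD(2)[OF w i] t2 tph)
 also have "... = (LINT x|M. (th x * G i x + partial i th x * f x) * ph x)"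
  by(intro Bint_cong) (auto simp: algebra_simps)
 finally show "(LINT x|M. th x * f x * partial i ph x) = - (LINT x|M. (th x * G i x + partial i th x * f x) * ph x)" .
qed

lemma weak_grad_test:
 assumes ph: "ph : test_fun d Om"
 shows "weak_grad d Om ph (%i. partial i ph)"
 unfolding weak_grad_def
proof (intro conjI allI impI ballI)
 show "loc_integrable d Om ph" by(rule L2_loc[OF test_fun_leb_on(1)[OF O ph]])
 fix i assume i: "i < d"
 note p = test_fun_partial[OF ph i]
 show l: "loc_integrable d Om (partial i ph)" by(rule L2_loc[OF test_fun_leb_on(1)[OF O p]])
 fix ps assume ps: "ps : test_fun d Om"
 have m: "(%x. ph x * ps x) : test_fun d Om" by(rule test_fun_mult[OF test_fun_smooth[OF ph] ps])
 obtain K where K: "compact K" "K \<subseteq> Om" "!!x. x : Rd d ==> x ~: K ==> ph x * ps x = 0"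
  using m by(auto simp: test_fun_def)
 have "(LINT x|(leb d). partial i (%x. ph x * ps x) x) = 0"
 proof (rule integral_derivative_zero[where ph = "%x. ph x * ps x", OF K(1) _ K(3) _ _ i])
  show "K \<subseteq> Rd d" using K(2) sub by blast
  show "partial i (%x. ph x * ps x) x = 0" if "x : Rd d" "x ~: K" for x
   by(rule partial_zero_outside[OF compact_imp_closed[OF K(1)] K(3) i that])
  show "continuous_on (Rd d) (partial i (%x. ph x * ps x))"
   by(rule smooth_continuous[OF test_fun_smooth[OF test_fun_partial[OF m i]]])
 qed (assumption, assumption, rule smooth_has_derivative[OF test_fun_smooth[OF m] i])
 hence "(LINT x|M. partial i (%x. ph x * ps x) x) = 0"
  using int_leb[of "partial i (%x. ph x * ps x)"] test_fun_props(5)[OF test_fun_partial[OF m i] sub] by simp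
 moreover have "(LINT x|M. partial i (%x. ph x * ps x) x) = (LINT x|M. ph x * partial i ps x + partial i ph x * ps x)"
  using partial_mult[OF test_fun_smooth[OF ph] test_fun_smooth[OF ps] i] sub
  by(intro Bint_cong) (auto simp: space_M)
 moreover have "... = (LINT x|M. ph x * partial i ps x) + (LINT x|M. partial i ph x * ps x)"
  by(intro Bint_add loc_mult_integrable l ps test_fun_partial[OF ps i] \<open>loc_integrable d Om ph\<close>)
 ultimately show "(LINT x|M. ph x * partial i ps x) = - (LINT x|M. partial i ph x * ps x)"
  by(simp add: eq_neg_iff_add_eq_0)
qed

lemma L2_int_tendsto:
 assumes F: "!!n. F n : L2 M" "f : L2 M" "L2_lim M F f" and g: "g : L2 M"
 shows "(%n. \<integral>x. F n x * g x \<partial>M) ~~> (LINT x|M. f x * g x)"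
 using L2.ip_tendsto[OF F(1,2) L2_cnj[OF g] F(3)] by(simp add: L2_inner_def)

lemma weak_grad_closed:
 assumes w: "!!n. weak_grad d Om (F n) (G n)" and F: "!!n. F n : L2 M" "f : L2 M" "L2_lim M F f"
  and G: "!!n i. i < d ==> G n i : L2 M" "!!i. i < d ==> g i : L2 M" "!!i. i < d ==> L2_lim M (%n. G n i) (g i)"
 shows "weak_grad d Om f g"
 unfolding weak_grad_def
proof (intro conjI allI impI ballI L2_loc F G)
 fix i ph assume i: "i < d" and ph: "ph : test_fun d Om"
 have 1: "(%n. \<integral>x. F n x * partial i ph x \<partial>M) ~~> (LINT x|M. f x * partial i ph x)"
  by(rule L2_int_tendsto[OF F test_fun_leb_on(1)[OF O test_fun_partial[OF ph i]]])
 have 2: "(%n. \<integral>x. G n i x * ph x \<partial>M) ~~> (LINT x|M. g i x * ph x)"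
  by(rule L2_int_tendsto[OF G(1)[OF i] G(2)[OF i] G(3)[OF i] test_fun_leb_on(1)[OF O ph]])
 show "(LINT x|M. f x * partial i ph x) = - (LINT x|M. g i x * ph x)"
  by(rule LIMSEQ_unique[OF 1]) (use tendsto_minus[OF 2] weak_gradD(3)[OF w i ph] in simp)
qed auto

text \<open>Membership in W^(1,2)_0 with the gradient \<open>G\<close> carried along. The function
  \<open>grad\<close> is a choice, determined only up to null sets, so computations use a known
  representative; \<open>h10_grad\<close> and \<open>W12_0_iff\<close> translate back.\<close>

definition h10 :: "(pt => complex) => (nat => pt => complex) => bool" where
 "h10 f G \<longleftrightarrow> f : L2 M & (ALL i<d. G i : L2 M) &
   (ALL e>0. EX ph:test_fun d Om. n2 M (%x. ph x - f x) < e & (ALL i<d. n2 M (%x. partial i ph x - G i x) < e))"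

lemma h10_L2: "h10 f G ==> f : L2 M" "h10 f G ==> i < d ==> G i : L2 M"
 by(auto simp: h10_def)

lemma h10_seq:
 assumes "h10 f G"
 shows "EX ph. (ALL n. ph n : test_fun d Om) & L2_lim M ph f &
  (ALL i<d. L2_lim M (%n. partial i (ph n)) (G i))"
proof -
 have "ALL n. EX ph:test_fun d Om. n2 M (%x. ph x - f x) < inverse (real (Suc n)) & (ALL i<d. n2 M (%x. partial i ph x - G i x) < inverse (real (Suc n)))"
  using assms by(simp add: h10_def)
 then obtain ph where ph: "!!n. ph n : test_fun d Om" "!!n. n2 M (%x. ph n x - f x) < inverse (real (Suc n))"
  "!!n i. i < d ==> n2 M (%x. partial i (ph n) x - G i x) < inverse (real (Suc n))" by metis
 have "(%n. n2 M (h n)) ~~> 0" if "!!n. n2 M (h n) < inverse (real (Suc n))" for h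
  by(rule Lim_null_comparison[OF _ LIMSEQ_inverse_real_of_nat])
   (use that in \<open>auto simp: n2_nonneg intro!: always_eventually less_imp_le\<close>)
 thus ?thesis using ph by(intro exI[of _ ph]) auto
qed

lemma h10_of_seq:
 assumes L: "f : L2 M" "!!i. i < d ==> G i : L2 M" and ph: "!!n. ph n : test_fun d Om"
  and lim: "L2_lim M ph f" "!!i. i < d ==> L2_lim M (%n. partial i (ph n)) (G i)"
 shows "h10 f G"
 unfolding h10_def
proof (intro conjI allI impI L)
 fix e :: real assume e: "0 < e"
 have "\<forall>\<^sub>F n in sequentially. ALL i:{..<d}. n2 M (%x. partial i (ph n) x - G i x) < e"
  using lim(2) e by(intro eventually_ball_finite ballI order_tendstoD(2)) auto
 moreover have "\<forall>\<^sub>F n in sequentially. n2 M (%x. ph n x - f x) < e" using lim(1) e by(rule order_tendstoD(2))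
 ultimately have "\<forall>\<^sub>F n in sequentially. n2 M (%x. ph n x - f x) < e & (ALL i<d. n2 M (%x. partial i (ph n) x - G i x) < e)"
  by eventually_elim auto
 thus "EX ph:test_fun d Om. n2 M (%x. ph x - f x) < e & (ALL i<d. n2 M (%x. partial i ph x - G i x) < e)"
  using ph by(auto simp: eventually_sequentially)
qed

lemma test_L2: "ph : test_fun d Om ==> ph : L2 M"
 by(rule test_fun_leb_on(1)[OF O])

lemma h10_test: "ph : test_fun d Om ==> h10 ph (%i. partial i ph)"
 by(rule h10_of_seq[of _ _ "%_. ph"]) (auto intro: test_L2 test_fun_partial simp: n2_eq)

lemma h10_closed:
 assumes h: "!!n. h10 (F n) (G n)" and L: "f : L2 M" "!!i. i < d ==> g i : L2 M"
  and lim: "L2_lim M F f" "!!i. i < d ==> L2_lim M (%n. G n i) (g i)"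
 shows "h10 f g"
 unfolding h10_def
proof (intro conjI allI impI L)
 fix e :: real assume e: "0 < e"
 have "\<forall>\<^sub>F n in sequentially. ALL i:{..<d}. n2 M (%x. G n i x - g i x) < e/2"
  using lim(2) e by(intro eventually_ball_finite ballI order_tendstoD(2)) auto
 moreover have "\<forall>\<^sub>F n in sequentially. n2 M (%x. F n x - f x) < e/2" by(rule order_tendstoD(2)[OF lim(1)]) (use e in simp)
 ultimately have "\<forall>\<^sub>F n in sequentially. n2 M (%x. F n x - f x) < e/2 & (ALL i<d. n2 M (%x. G n i x - g i x) < e/2)"
  by eventually_elim auto
 then obtain n where n: "n2 M (%x. F n x - f x) < e/2" "!!i. i < d ==> n2 M (%x. G n i x - g i x) < e/2"
  by(auto simp: eventually_sequentially)
 obtain ph where ph: "ph : test_fun d Om" "n2 M (%x. ph x - F n x) < e/2" "!!i. i < d ==> n2 M (%x. partial i ph x - G n i x) < e/2"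
  using h[of n] e unfolding h10_def by(meson half_gt_zero)
 have "n2 M (%x. ph x - f x) < e"
  using L2.nrm_triangle_diff[OF test_L2[OF ph(1)] h10_L2(1)[OF h[of n]] L(1)] n ph by simp
 moreover have "n2 M (%x. partial i ph x - g i x) < e" if i: "i < d" for i
  using L2.nrm_triangle_diff[OF test_L2[OF test_fun_partial[OF ph(1) i]] h10_L2(2)[OF h[of n] i] L(2)[OF i]] n(2)[OF i] ph(3)[OF i] by simp
 ultimately show "EX ph:test_fun d Om. n2 M (%x. ph x - f x) < e & (ALL i<d. n2 M (%x. partial i ph x - g i x) < e)"
  using ph(1) by blast
qed

lemma n2_lin_le:
 assumes "f : L2 M" "g : L2 M" "f' : L2 M" "g' : L2 M"
 shows "n2 M (%x. a * f x + b * g x - (a * f' x + b * g' x)) <= cmod a * n2 M (%x. f x - f' x) + cmod b * n2 M (%x. g x - g' x)"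
proof -
 have "(%x. a * f x + b * g x - (a * f' x + b * g' x)) = (%x. a * (f x - f' x) + b * (g x - g' x))"
  by(auto simp: algebra_simps)
 thus ?thesis
  using L2.nrm_triangle[OF L2.scale_mem[OF L2.diff_mem[OF assms(1,3)], of a] L2.scale_mem[OF L2.diff_mem[OF assms(2,4)], of b]]
   L2.nrm_scale[OF L2.diff_mem[OF assms(1,3)], of a] L2.nrm_scale[OF L2.diff_mem[OF assms(2,4)], of b] by simp
qed

lemma h10_lin:
 assumes h: "h10 f G" "h10 f' G'"
 shows "h10 (%x. a * f x + b * f' x) (%i x. a * G i x + b * G' i x)"
proof -
 obtain ph where ph: "!!n. ph n : test_fun d Om" "L2_lim M ph f"
  "!!i. i < d ==> L2_lim M (%n. partial i (ph n)) (G i)" using h10_seq[OF h(1)] by blast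
 obtain ps where ps: "!!n. ps n : test_fun d Om" "L2_lim M ps f'"
  "!!i. i < d ==> L2_lim M (%n. partial i (ps n)) (G' i)" using h10_seq[OF h(2)] by blast
 have lim: "(%n. n2 M (%x. a * u n x + b * v n x - (a * u' x + b * v' x))) ~~> 0"
  if "!!n. u n : L2 M" "!!n. v n : L2 M" "u' : L2 M" "v' : L2 M"
   "L2_lim M u u'" "L2_lim M v v'" for u v u' v'
 proof (rule Lim_null_comparison)
  show "\<forall>\<^sub>F n in sequentially. norm (n2 M (%x. a * u n x + b * v n x - (a * u' x + b * v' x))) <=
   cmod a * n2 M (%x. u n x - u' x) + cmod b * n2 M (%x. v n x - v' x)"
   using n2_lin_le[OF that(1) that(2) that(3,4)] by(simp add: n2_nonneg)
  have "(%n. cmod a * n2 M (%x. u n x - u' x) + cmod b * n2 M (%x. v n x - v' x)) ~~> cmod a * 0 + cmod b * 0"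
   by(intro tendsto_intros that)
  thus "(%n. cmod a * n2 M (%x. u n x - u' x) + cmod b * n2 M (%x. v n x - v' x)) ~~> 0" by simp
 qed
 show ?thesis
 proof (rule h10_of_seq[of _ _ "%n x. a * ph n x + b * ps n x"])
  show "(%x. a * ph n x + b * ps n x) : test_fun d Om" for n by(rule test_fun_lin[OF ph(1) ps(1)])
  show "(%n. n2 M (%x. a * ph n x + b * ps n x - (a * f x + b * f' x))) ~~> 0"
   by(rule lim[OF test_L2[OF ph(1)] test_L2[OF ps(1)] h10_L2(1)[OF h(1)] h10_L2(1)[OF h(2)] ph(2) ps(2)])
  fix i assume i: "i < d"
  have "n2 M (%x. partial i (%x. a * ph n x + b * ps n x) x - (a * G i x + b * G' i x))
   = n2 M (%x. a * partial i (ph n) x + b * partial i (ps n) x - (a * G i x + b * G' i x))" for n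
   unfolding n2_eq using partial_lin[OF test_fun_smooth[OF ph(1)] test_fun_smooth[OF ps(1)] i] sub
   by(intro arg_cong[where f = sqrt] Bint_cong) (auto simp: space_M)
  thus "(%n. n2 M (%x. partial i (%x. a * ph n x + b * ps n x) x - (a * G i x + b * G' i x))) ~~> 0"
   using lim[OF test_L2[OF test_fun_partial[OF ph(1) i]] test_L2[OF test_fun_partial[OF ps(1) i]]
   h10_L2(2)[OF h(1) i] h10_L2(2)[OF h(2) i] ph(3)[OF i] ps(3)[OF i]] by simp
 qed (use h in \<open>auto simp: h10_def intro: L2_lin\<close>)
qed

lemma h10_weak_grad:
 assumes "h10 f G" shows "weak_grad d Om f G"
proof -
 obtain ph where ph: "!!n. ph n : test_fun d Om" "L2_lim M ph f"
  "!!i. i < d ==> L2_lim M (%n. partial i (ph n)) (G i)" using h10_seq[OF assms] by blast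
 show ?thesis
  by(rule weak_grad_closed[OF weak_grad_test[OF ph(1)] test_L2[OF ph(1)] h10_L2(1)[OF assms] ph(2)
   test_L2[OF test_fun_partial[OF ph(1)]] h10_L2(2)[OF assms] ph(3)])
qed

lemma h10_cong:
 assumes h: "h10 f G" and f: "f' : bm M" "AE x in M. f' x = f x"
  and G: "!!i. i < d ==> G' i : bm M" "!!i. i < d ==> AE x in M. G' i x = G i x"
 shows "h10 f' G'"
proof -
 have e: "n2 M (%x. ph x - g' x) = n2 M (%x. ph x - g x)"
  if "ph : L2 M" "g : L2 M" "g' : bm M" "AE x in M. g' x = g x" for ph g g'
  by(rule n2_cong_AE) (use that in \<open>auto intro: eventually_mono\<close>)
 obtain ph where ph: "!!n. ph n : test_fun d Om" "L2_lim M ph f"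
  "!!i. i < d ==> L2_lim M (%n. partial i (ph n)) (G i)" using h10_seq[OF h] by blast
 show ?thesis
 proof (rule h10_of_seq[OF _ _ ph(1)])
  show "f' : L2 M" by(rule L2_cong_AE[OF h10_L2(1)[OF h] f])
  show "L2_lim M ph f'"
   unfolding e[OF test_L2[OF ph(1)] h10_L2(1)[OF h] f] by(rule ph(2))
  fix i assume i: "i < d"
  show "G' i : L2 M" by(rule L2_cong_AE[OF h10_L2(2)[OF h i] G(1)[OF i] G(2)[OF i]])
  show "L2_lim M (%n. partial i (ph n)) (G' i)"
   unfolding e[OF test_L2[OF test_fun_partial[OF ph(1) i]] h10_L2(2)[OF h i] G(1)[OF i] G(2)[OF i]] by(rule ph(3)[OF i])
 qed
qed

lemma h10_grad: "h10 f G ==> i < d ==> AE x in M. grad d Om f i x = G i x"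
 using h10_weak_grad weak_grad_grad weak_grad_unique by(meson weakly_differentiable_def)

lemma L2_norm_tendsto:
 assumes "!!n. F n : L2 M" "f : L2 M"
 shows "(%n. L2_norm M (%x. F n x - f x)) ~~> 0 \<longleftrightarrow> L2_lim M F f"
 using tendsto_ennreal_iff[of "%n. n2 M (%x. F n x - f x)" sequentially 0]
 by(simp add: L2_norm_eq[OF L2.diff_mem[OF assms(1) assms(2)]] n2_nonneg)

lemma W12_0_iff: "f : W12_0 d Om \<longleftrightarrow> (EX G. h10 f G)" and W12_0_grad: "f : W12_0 d Om ==> h10 f (grad d Om f)"
proof -
 show 1: "f : W12_0 d Om ==> h10 f (grad d Om f)"
 proof -
  assume "f : W12_0 d Om"
  then obtain ph where f: "f : L2 M" "!!i. i < d ==> grad d Om f i : L2 M" and ph: "!!n. ph n : test_fun d Om"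
   "(%n. L2_norm M (%x. ph n x - f x)) ~~> 0"
   "!!i. i < d ==> (%n. L2_norm M (%x. partial i (ph n) x - grad d Om f i x)) ~~> 0"
   by(auto simp: W12_0_def W12_def)
  show ?thesis
  proof (rule h10_of_seq[OF f ph(1)])
   show "L2_lim M ph f"
   using ph(2) L2_norm_tendsto[of ph f, OF test_L2[OF ph(1)] f(1)] by blast
   fix i assume i: "i < d"
   show "L2_lim M (%n. partial i (ph n)) (grad d Om f i)"
   using ph(3)[OF i] L2_norm_tendsto[of "%n. partial i (ph n)", OF test_L2[OF test_fun_partial[OF ph(1) i]] f(2)[OF i]] by blast
  qed
 qed
 show "f : W12_0 d Om \<longleftrightarrow> (EX G. h10 f G)"
 proof
  assume "EX G. h10 f G"
  then obtain G where G: "h10 f G" by blast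
  have wd: "weakly_differentiable d Om f" using h10_weak_grad[OF G] by(auto simp: weakly_differentiable_def)
  have gm: "grad d Om f i : bm M" if "i < d" for i
   using weak_gradD(2)[OF weak_grad_grad[OF wd] that] by(simp add: loc_integrable_def)
  have h: "h10 f (grad d Om f)"
   by(rule h10_cong[OF G]) (use L2_measurable[OF h10_L2(1)[OF G]] gm h10_grad[OF G] in auto)
  obtain ph where ph: "!!n. ph n : test_fun d Om" "L2_lim M ph f"
   "!!i. i < d ==> L2_lim M (%n. partial i (ph n)) (grad d Om f i)" using h10_seq[OF h] by blast
  show "f : W12_0 d Om" unfolding W12_0_def W12_def
  proof (intro CollectI conjI exI[of _ ph] allI impI wd ph(1) h10_L2[OF h])
   show "(%n. L2_norm M (%x. ph n x - f x)) ~~> 0"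
   using ph(2) L2_norm_tendsto[of ph f, OF test_L2[OF ph(1)] h10_L2(1)[OF h]] by blast
   fix i assume i: "i < d"
   show "(%n. L2_norm M (%x. partial i (ph n) x - grad d Om f i x)) ~~> 0"
   using ph(3)[OF i] L2_norm_tendsto[of "%n. partial i (ph n)", OF test_L2[OF test_fun_partial[OF ph(1) i]] h10_L2(2)[OF h i]] by blast
  qed
 qed (use 1 in blast)
qed

text \<open>The closure \<open>N\<close> of the test functions is a closed subspace, and the part of
  g orthogonal to it vanishes by the fundamental lemma. This Hilbert space argument gives density
  before any mollifier is available.\<close>

lemma test_dense:
 assumes g: "g : L2 M" and e: "0 < e"
 shows "EX ph:test_fun d Om. n2 M (%x. g x - ph x) < e"
proof -
 define N where "N = {g : L2 M. ALL e>0. EX ph:test_fun d Om. n2 M (%x. g x - ph x) < e}"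
 have tN: "ph : N" if "ph : test_fun d Om" for ph
  using that test_L2[OF that] by(auto simp: N_def n2_eq intro!: bexI[of _ ph])
 interpret closed_sub "L2 M" "L2_inner M" N
 proof (intro closed_sub.intro L2.semi_hilbert_axioms closed_sub_axioms.intro)
  show "(%x. 0) : N" by(rule tN[OF test_fun_zero])
 next
  fix f g :: "pt => complex" and a b assume f: "f : N" and g: "g : N"
  have L: "f : L2 M" "g : L2 M" using f g by(auto simp: N_def)
  have "EX ph:test_fun d Om. n2 M (%x. a * f x + b * g x - ph x) < e" if e: "0 < e" for e
  proof -
   define D where "D = cmod a + cmod b + 1"
   have D: "D > 0" by(simp add: D_def add_nonneg_pos)
   obtain ph ps where p: "ph : test_fun d Om" "n2 M (%x. f x - ph x) < e / D" "ps : test_fun d Om" "n2 M (%x. g x - ps x) < e / D"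
   using f g divide_pos_pos[OF e D] unfolding N_def by blast
   have "n2 M (%x. a * f x + b * g x - (a * ph x + b * ps x)) <= cmod a * (e / D) + cmod b * (e / D)"
   using n2_lin_le[OF L test_L2[OF p(1)] test_L2[OF p(3)], of a b] p(2,4)
   mult_left_mono[OF less_imp_le[OF p(2)] norm_ge_zero[of a]] mult_left_mono[OF less_imp_le[OF p(4)] norm_ge_zero[of b]] by linarith
   also have "... = (cmod a + cmod b) * (e / D)" by(simp only: distrib_right)
   also have "... < D * (e / D)" using e D by(intro mult_strict_right_mono) (auto simp: D_def)
   also have "... = e" using D by simp
   finally show ?thesis by(rule bexI[OF _ test_fun_lin[OF p(1,3), of a b]])
  qed
  thus "(%x. a * f x + b * g x) : N" using L L2_lin by(auto simp: N_def)
 next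
  fix F f assume F: "!!n. F n : N" and f: "f : L2 M" and lim: "L2_lim M F f"
  have "EX ph:test_fun d Om. n2 M (%x. f x - ph x) < e" if e: "0 < e" for e
  proof -
   have "\<forall>\<^sub>F n in sequentially. n2 M (%x. F n x - f x) < e/2" by(rule order_tendstoD(2)[OF lim]) (use e in simp)
   then obtain n where n: "n2 M (%x. F n x - f x) < e/2" by(auto simp: eventually_sequentially)
   have FL: "F n : L2 M" using F by(auto simp: N_def)
   obtain ph where ph: "ph : test_fun d Om" "n2 M (%x. F n x - ph x) < e/2" using F[of n] half_gt_zero[OF e] unfolding N_def by blast
   have "n2 M (%x. f x - ph x) < e"
   using L2.nrm_triangle_diff[OF f FL test_L2[OF ph(1)]] L2.nrm_minus[OF f FL] n ph(2) by simp
   thus ?thesis using ph(1) by blast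
  qed
  thus "f : N" using f by(simp add: N_def)
 qed (auto simp: N_def)
 obtain p where p: "p : N" "ALL h:N. L2_inner M (%t. g t - p t) h = 0" using projection[OF g] by blast
 have pL: "p : L2 M" using p(1) by(simp add: N_def)
 have w: "(%t. cnj (g t - p t)) : L2 M" by(rule L2_cnj[OF L2.diff_mem[OF g pL]])
 have "AE x in M. cnj (g x - p x) = 0"
 proof (rule fundamental_lemma[OF O L2_loc[OF w]])
  fix ph assume ph: "ph : test_fun d Om"
  have "(LINT x|M. cnj (g x - p x) * ph x) = cnj (L2_inner M (%t. g t - p t) ph)"
   unfolding L2_inner_def Bochner_Integration.integral_cnj[symmetric] by simp
  thus "(LINT x|M. cnj (g x - p x) * ph x) = 0" using p(2) tN[OF ph] by simp
 qed
 hence ae: "AE x in M. g x = p x" by eventually_elim simp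
 obtain ph where ph: "ph : test_fun d Om" "n2 M (%x. p x - ph x) < e" using p(1) e unfolding N_def by blast
 have "n2 M (%x. g x - ph x) = n2 M (%x. p x - ph x)"
  by(rule n2_cong_AE) (use ae g pL test_L2[OF ph(1)] in \<open>auto intro: eventually_mono\<close>)
 thus ?thesis using ph(2) by(intro bexI[OF _ ph(1)]) (simp only:)
qed

end

section \<open>Mollification and multipliers\<close>

lemma norm_integral_le_AE:
 fixes f :: "'a => complex"
 assumes "integrable M f" "integrable M g" "AE x in M. norm (f x) <= g x"
 shows "norm (LINT x|M. f x) <= (LINT x|M. g x)"
 by(rule order_trans[OF integral_norm_bound integral_mono_AE[OF integrable_norm[OF assms(1)] assms(2,3)]])

definition moll_base :: "real => real" where
 "moll_base t = flat 0 (1 + t) * flat 0 (1 - t)"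

lemma bump1_moll_base: "bump1 1 moll_base"
proof -
 have "sm1 m (%t. flat 0 (1 * t + 1) * flat 0 (- 1 * t + 1))" for m
  using smooth1_flat by(intro sm1_mult sm1_affine) (auto simp: smooth1_def)
 hence "smooth1 moll_base" by(simp add: smooth1_def moll_base_def[abs_def] add.commute)
 moreover have "moll_base t = 0" if "\<bar>t\<bar> > 1" for t
  using that by(cases "t > 0") (auto simp: moll_base_def flat0_zero)
 ultimately show ?thesis by(simp add: bump1_def)
qed

lemma moll_base_props: "0 <= moll_base t" "moll_base (- t) = moll_base t" "moll_base 0 > 0"
 by(auto simp: moll_base_def flat0_bounds mult.commute flat_def)

lemma bump1_integrable:
 assumes "bump1 r g" shows "integrable lborel g"
proof -
 have "continuous_on {-r..r} g" by(intro continuous_at_imp_continuous_on) (auto intro: bump1_continuous[OF assms])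
 hence "integrable lborel (%t. indicator {-r..r} t *\<^sub>R g t)" by(rule borel_integrable_compact[OF compact_Icc])
 moreover have "(%t. indicator {-r..r} t *\<^sub>R g t) = g"
 proof
  fix t show "indicator {-r..r} t *\<^sub>R g t = g t"
  proof (cases "t : {-r..r}")
   case False
   hence "\<bar>t\<bar> > r" by auto
   thus ?thesis using assms False by(simp add: bump1_def)
  qed simp
 qed
 ultimately show ?thesis by simp
qed

definition moll_mass :: real where
 "moll_mass = (LINT t|lborel. moll_base t)"

lemma moll_mass_pos: "moll_mass > 0"
proof -
 have i: "integrable lborel moll_base" by(rule bump1_integrable[OF bump1_moll_base])
 have "moll_mass ~= 0"
 proof
  assume "moll_mass = 0"
  hence ae: "AE t in lborel. moll_base t = 0"
   using integral_nonneg_eq_0_iff_AE[OF i] moll_base_props(1) by(simp add: moll_mass_def)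
  have "\<forall>\<^sub>F t in at 0. moll_base t > 0"
   using bump1_continuous[OF bump1_moll_base, of 0] moll_base_props(3) unfolding isCont_def by(rule order_tendstoD(1))
  then obtain e where e: "e > 0" "!!t. t ~= 0 ==> \<bar>t\<bar> < e ==> moll_base t > 0"
   by(auto simp: eventually_at dist_real_def)
  have "AE t in lborel. t ~: {0<..<e}"
   using ae
  proof eventually_elim
   case (elim t)
   show ?case
   proof
   assume "t : {0<..<e}"
   hence "moll_base t > 0" by(intro e(2)) auto
   thus False using elim by simp
   qed
  qed
  hence "{0<..<e} : null_sets lborel" using AE_iff_null_sets[of "{0<..<e}" lborel] by auto
  thus False using e(1) by(simp add: null_sets_def)
 qed
 moreover have "0 <= moll_mass" unfolding moll_mass_def
  by(intro Bochner_Integration.integral_nonneg moll_base_props)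
 ultimately show ?thesis by simp
qed

definition moll :: "nat => real => real" where
 "moll n t = (real (Suc n) / moll_mass) * moll_base (real (Suc n) * t)"

lemma bump1_moll: "bump1 (1 / real (Suc n)) (moll n)"
proof -
 have s: "smooth1 moll_base" using bump1_moll_base by(simp add: bump1_def)
 have "sm1 m (%t. (real (Suc n) / moll_mass) * moll_base (real (Suc n) * t + 0) + 0 * moll_base (real (Suc n) * t + 0))" for m
  using s by(intro sm1_lin sm1_affine) (auto simp: smooth1_def)
 hence "smooth1 (moll n)" by(simp add: smooth1_def moll_def[abs_def])
 moreover have "moll n t = 0" if t: "\<bar>t\<bar> > 1 / real (Suc n)" for t
 proof -
  have "\<bar>real (Suc n) * t\<bar> > 1" using t by(simp add: abs_mult field_simps)
  thus ?thesis using bump1_moll_base unfolding bump1_def moll_def by auto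
 qed
 ultimately show ?thesis by(simp add: bump1_def)
qed

lemma moll_nonneg: "0 <= moll n t"
 using moll_mass_pos moll_base_props(1) by(simp add: moll_def)

lemma moll_even: "moll n (- t) = moll n t"
 using moll_base_props(2)[of "real (Suc n) * t"] by(simp add: moll_def)

lemma moll_integral: "(LINT t|lborel. moll n (a - t)) = 1" "(LINT t|lborel. moll n (t - a)) = 1"
proof -
 have 1: "(LINT t|lborel. moll n t) = 1"
 proof -
  have "moll_mass = \<bar>real (Suc n)\<bar> *\<^sub>R (LINT t|lborel. moll_base (0 + real (Suc n) * t))"
   unfolding moll_mass_def by(rule lborel_integral_real_affine) simp
  hence "moll_mass = (LINT t|lborel. real (Suc n) * moll_base (real (Suc n) * t))" by simp
  moreover have "(LINT t|lborel. moll n t) = (LINT t|lborel. real (Suc n) * moll_base (real (Suc n) * t)) / moll_mass"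
   by(simp add: moll_def)
  ultimately show ?thesis using moll_mass_pos by simp
 qed
 have "(LINT t|lborel. moll n t) = \<bar>-1\<bar> *\<^sub>R (LINT t|lborel. moll n (a + -1 * t))" by(rule lborel_integral_real_affine) simp
 thus "(LINT t|lborel. moll n (a - t)) = 1" using 1 by simp
 have "(LINT t|lborel. moll n t) = \<bar>1\<bar> *\<^sub>R (LINT t|lborel. moll n (- a + 1 * t))" by(rule lborel_integral_real_affine) simp
 thus "(LINT t|lborel. moll n (t - a)) = 1" using 1 by simp
qed

definition mk :: "nat => nat => pt => pt => real" where
 "mk d n x y = (\<Prod>i<d. moll n (x i - y i))"

lemma mk_nonneg: "0 <= mk d n x y"
 unfolding mk_def by(intro prod_nonneg ballI moll_nonneg)

lemma mk_sym: "mk d n x y = mk d n y x"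
 unfolding mk_def by(intro prod.cong refl) (metis minus_diff_eq moll_even)

lemma mk_zero:
 assumes "y ~: cbx d x (1 / real (Suc n))" "y : Rd d" shows "mk d n x y = 0"
proof -
 obtain i where "i < d" "\<bar>y i - x i\<bar> > 1 / real (Suc n)" using assms by(auto simp: cbx_def not_le)
 hence "moll n (x i - y i) = 0" using bump1_moll[of n] by(auto simp: bump1_def abs_minus_commute)
 thus ?thesis unfolding mk_def using \<open>i < d\<close> by(intro prod_zero) auto
qed

lemma mk_integral: "integrable (leb d) (%y. mk d n x y)" "(LINT y|(leb d). mk d n x y) = 1"
proof -
 have i: "integrable lborel (%t. moll n (a - t))" for a
  using lborel_integrable_real_affine[OF bump1_integrable[OF bump1_moll[of n]], of "-1" a] by simp
 show "integrable (leb d) (%y. mk d n x y)" unfolding mk_def leb_def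
  by(rule lebp.product_integrable_prod) (auto intro: i)
 have "(LINT y|(leb d). mk d n x y) = (\<Prod>i<d. \<integral>t. moll n (x i - t) \<partial>lborel)" unfolding mk_def leb_def
  by(rule lebp.product_integral_prod) (auto intro: i)
 thus "(LINT y|(leb d). mk d n x y) = 1" by(simp add: moll_integral)
qed

definition mol :: "nat => nat => (pt => complex) => pt => complex" where
 "mol d n v x = (LINT y|(leb d). v y * of_real (mk d n x y))"

lemma mol_cv: "mol d n v = cv d (leb d) v (%_. moll n)"
 by(rule ext) (simp add: mol_def cv_def mk_def)

lemma mk_bound: "EX B>=0. ALL x y. \<bar>mk d n x y\<bar> <= B"
proof -
 obtain B where B: "B >= 0" "!!t. \<bar>moll n t\<bar> <= B" using bump1_bounded[OF bump1_moll[of n]] by blast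
 have "\<bar>mk d n x y\<bar> <= (\<Prod>i<d. B)" for x y
  unfolding mk_def abs_prod using B by(intro prod_mono) auto
 thus ?thesis using B(1) by(intro exI[of _ "B ^ d"]) auto
qed

lemma mol_smooth: "integrable (leb d) v ==> smooth d (mol d n v)"
 unfolding mol_cv
proof (rule convolution.cv_smooth[of d "leb d" v "1 / real (Suc n)"])
 show "integrable (leb d) v ==> convolution d (leb d) v" by(simp add: convolution_def)
qed (rule bump1_moll)

lemma mol_zero:
 assumes z: "!!y. y : Rd d ==> y ~: K ==> v y = 0" and x: "x : Rd d" "x ~: fatten d K (1 / real (Suc n))"
 shows "mol d n v x = 0"
proof -
 have "(LINT y|(leb d). v y * of_real (mk d n x y)) = (LINT y|(leb d). 0)"
 proof (rule Bint_cong[OF refl])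
  fix y assume "y : space (leb d)"
  hence y: "y : Rd d" by simp
  show "v y * of_real (mk d n x y) = 0"
  proof (cases "y : K")
   case True
   hence "x ~: cbx d y (1 / real (Suc n))" using x by(auto simp: fatten_def)
   hence "mk d n y x = 0" using mk_zero x(1) by blast
   thus ?thesis by(simp add: mk_sym)
  qed (use z y in simp)
 qed
 thus ?thesis by(simp add: mol_def)
qed

lemma mol_bound:
 assumes v: "integrable (leb d) v" and B: "AE y in leb d. cmod (v y) <= B"
 shows "cmod (mol d n v x) <= B"
proof -
 have "cmod (mol d n v x) <= (LINT y|(leb d). B * mk d n x y)"
  unfolding mol_def
 proof (rule norm_integral_le_AE)
  have "convolution d (leb d) v" by(simp add: convolution_def v)
  from convolution.integrand_integrable[OF this, of "1 / real (Suc n)" "%_. moll n" x, OF bump1_moll]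
  show "integrable (leb d) (%y. v y * of_real (mk d n x y))" unfolding mk_def .
  show "integrable (leb d) (%y. B * mk d n x y)" using mk_integral(1) by simp
  show "AE y in leb d. norm (v y * of_real (mk d n x y)) <= B * mk d n x y"
   using B by eventually_elim (simp add: norm_mult mk_nonneg mult_right_mono)
 qed
 also have "... = B" using mk_integral(2) by simp
 finally show ?thesis .
qed

interpretation leb_pair: pair_sigma_finite "leb d" "leb d" for d
 by(intro pair_sigma_finite.intro sigma_finite_leb)

lemma mk_measurable_pair: "(%p. mk d n (fst p) (snd p)) : bm (leb d \<Otimes>\<^sub>M leb d)"
proof -
 have c: "(%x. x i) : bm (leb d)" if "i < d" for i
  using measurable_component_singleton[of i "{..<d}" "%_. lborel"] that by(simp add: leb_def)
 have "continuous_on UNIV (moll n)" by(intro continuous_at_imp_continuous_on) (auto intro: bump1_continuous[OF bump1_moll])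
 hence m: "moll n : bm borel" by(rule borel_measurable_continuous_onI)
 have "(%p. moll n (fst p i - snd p i)) : bm (leb d \<Otimes>\<^sub>M leb d)" if "i < d" for i
  by(rule measurable_compose[OF borel_measurable_diff[OF measurable_compose[OF measurable_fst c[OF that]]
   measurable_compose[OF measurable_snd c[OF that]]] m])
 thus ?thesis unfolding mk_def by(intro borel_measurable_prod) auto
qed

text \<open>Fubini and the symmetry of the kernel move the mollification onto the test function.
  There it converges pointwise by continuity and stays bounded, so dominated convergence applies
  with the integrable v as majorant.\<close>

lemma mol_weak:
 assumes v: "integrable (leb d) v" and ph: "ph : test_fun d (Rd d)"
 shows "(%n. \<integral>x. mol d n v x * ph x \<partial>leb d) ~~> (LINT y|(leb d). v y * ph y)"
proof -
 note php = test_fun_props[OF ph subset_refl]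
 obtain B where B: "B >= 0" "!!x. x : Rd d ==> cmod (ph x) <= B" using php(2) by blast
 have int: "integrable (leb d) (%x. ph x * of_real (mk d n y x))" for n y
 proof -
  have "convolution d (leb d) ph" by(simp add: convolution_def php(4))
  from convolution.integrand_integrable[OF this, of "1 / real (Suc n)" "%_. moll n" y, OF bump1_moll]
  show ?thesis unfolding mk_def .
 qed
 have swap: "(LINT x|(leb d). mol d n v x * ph x) = (LINT y|(leb d). v y * mol d n ph y)" for n
 proof -
  obtain C where C: "C >= 0" "!!x y. \<bar>mk d n x y\<bar> <= C" using mk_bound[of d n] by blast
  let ?F = "%p. v (snd p) * of_real (mk d n (fst p) (snd p)) * ph (fst p)"
  have Fm: "?F : bm (leb d \<Otimes>\<^sub>M leb d)"
   by(intro borel_measurable_times of_real_meas mk_measurable_pair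
   measurable_compose[OF measurable_snd borel_measurable_integrable[OF v]]
   measurable_compose[OF measurable_fst php(1)])
  have Fi: "integrable (leb d \<Otimes>\<^sub>M leb d) ?F"
  proof (rule Bintble_bound[OF _ Fm])
   show "integrable (leb d \<Otimes>\<^sub>M leb d) (%p. C * (cmod (ph (fst p)) * cmod (v (snd p))))"
   proof (intro integrable_mult_right leb_pair.Fubini_integrable)
   show "(%p. cmod (ph (fst p)) * cmod (v (snd p))) : bm (leb d \<Otimes>\<^sub>M leb d)"
   by(intro borel_measurable_times
   measurable_compose[OF measurable_snd borel_measurable_integrable[OF integrable_norm[OF v]]]
   measurable_compose[OF measurable_fst borel_measurable_integrable[OF integrable_norm[OF php(4)]]])
   show "integrable (leb d) (%x. \<integral>y. norm (cmod (ph (fst (x, y))) * cmod (v (snd (x, y)))) \<partial>leb d)"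
   using php(4) by simp
   show "AE x in leb d. integrable (leb d) (%y. cmod (ph (fst (x, y))) * cmod (v (snd (x, y))))"
   using v by simp
   qed
   show "AE p in leb d \<Otimes>\<^sub>M leb d. norm (?F p) <= norm (C * (cmod (ph (fst p)) * cmod (v (snd p))))"
   proof (rule AE_I2)
   fix p
   have "cmod (v (snd p)) * \<bar>mk d n (fst p) (snd p)\<bar> * cmod (ph (fst p)) <= cmod (v (snd p)) * C * cmod (ph (fst p))"
   by(intro mult_right_mono mult_left_mono C) auto
   thus "norm (?F p) <= norm (C * (cmod (ph (fst p)) * cmod (v (snd p))))"
   using C(1) by(simp add: norm_mult abs_mult mult_ac)
   qed
  qed
  have "(LINT x|(leb d). mol d n v x * ph x) = (LINT x|(leb d). (LINT y|(leb d). ?F (x, y)))"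
   by(simp add: mol_def)
  also have "... = (LINT y|(leb d). (LINT x|(leb d). ?F (x, y)))"
  proof -
   have "integrable (leb d \<Otimes>\<^sub>M leb d) (case_prod (%x y. ?F (x, y)))" using Fi by(simp add: case_prod_beta')
   from leb_pair.Fubini_integral[OF this] show ?thesis by(rule sym)
  qed
  also have "... = (LINT y|(leb d). v y * mol d n ph y)"
  proof (rule Bint_cong[OF refl])
   fix y
   have "(LINT x|(leb d). ?F (x, y)) = (LINT x|(leb d). v y * (ph x * of_real (mk d n y x)))"
   by(intro Bint_cong) (auto simp: mk_sym[of d n y] mult_ac)
   thus "(LINT x|(leb d). ?F (x, y)) = v y * mol d n ph y" by(simp add: mol_def)
  qed
  finally show ?thesis .
 qed
 have ae: "AE y in leb d. cmod (ph y) <= B" using B by(intro AE_I2) simp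
 have "(%n. \<integral>y. v y * mol d n ph y \<partial>leb d) ~~> (LINT y|(leb d). v y * ph y)"
 proof (rule integral_dominated_convergence[where w = "%y. B * norm (v y)"])
  show "integrable (leb d) (%y. B * norm (v y))" using v by simp
  show "(%y. v y * ph y) : bm (leb d)"
   by(intro borel_measurable_times borel_measurable_integrable[OF v] php(1))
  show "(%y. v y * mol d n ph y) : bm (leb d)" for n
   by(intro borel_measurable_times borel_measurable_integrable[OF v]
   continuous_measurable[OF smooth_continuous[OF mol_smooth[OF php(4)]]])
  show "AE y in leb d. norm (v y * mol d n ph y) <= B * norm (v y)" for n
   using mult_left_mono[OF mol_bound[OF php(4) ae], of "cmod (v _)"] by(simp add: norm_mult mult.commute)
  show "AE y in leb d. (%n. v y * mol d n ph y) ~~> v y * ph y"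
  proof (rule AE_I2, rule tendsto_mult[OF tendsto_const])
   fix y assume "y : space (leb d)"
   hence y: "y : Rd d" by simp
   show "(%n. mol d n ph y) ~~> ph y"
   proof (rule LIMSEQ_I)
   fix e :: real assume e: "0 < e"
   have "open_Rd d (Rd d \<inter> ph -` ball (ph y) (e/2))"
   unfolding open_Rd_def
   using smooth_continuous[OF test_fun_smooth[OF ph]] continuous_on_open_gen[of ph "Rd d" UNIV]
   by(metis continuous_openin_preimage_gen open_ball)
   then obtain r where r: "r > 0" "fatten d {y} r \<subseteq> Rd d \<inter> ph -` ball (ph y) (e/2)"
   using compact_margin[of "{y}" "Rd d \<inter> ph -` ball (ph y) (e/2)" d] y e by auto
   obtain n0 where n0: "1 / real (Suc n0) < r" using reals_Archimedean[OF r(1)] by(auto simp: inverse_eq_divide)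
   have "norm (mol d n ph y - ph y) < e" if n: "n >= n0" for n
   proof -
   have "1 / real (Suc n) <= 1 / real (Suc n0)" using n by(intro divide_left_mono) auto
   hence nr: "1 / real (Suc n) < r" using n0 by linarith
   have "mol d n ph y - ph y = (LINT x|(leb d). ph x * of_real (mk d n y x)) - (LINT x|(leb d). ph y * of_real (mk d n y x))"
   using mk_integral(2)[of d n y] by(simp add: mol_def)
   also have "... = (LINT x|(leb d). ph x * of_real (mk d n y x) - ph y * of_real (mk d n y x))"
   using int mk_integral(1)[of d n y] by(intro Bint_diff[symmetric]) auto
   finally have eq: "mol d n ph y - ph y = (LINT x|(leb d). ph x * of_real (mk d n y x) - ph y * of_real (mk d n y x))" .
   have "cmod (mol d n ph y - ph y) <= (LINT x|(leb d). (e/2) * mk d n y x)"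
   unfolding eq
   proof (rule norm_integral_le_AE)
   show "integrable (leb d) (%x. ph x * of_real (mk d n y x) - ph y * of_real (mk d n y x))"
   using int mk_integral(1)[of d n y] by auto
   show "integrable (leb d) (%x. (e/2) * mk d n y x)" using mk_integral(1)[of d n y] by auto
   show "AE x in leb d. norm (ph x * of_real (mk d n y x) - ph y * of_real (mk d n y x)) <= (e/2) * mk d n y x"
   proof (rule AE_I2)
   fix x assume "x : space (leb d)"
   hence x: "x : Rd d" by simp
   have *: "norm (ph x * of_real (mk d n y x) - ph y * of_real (mk d n y x)) = cmod (ph x - ph y) * mk d n y x"
   unfolding left_diff_distrib[symmetric] norm_mult by(simp add: mk_nonneg)
   show "norm (ph x * of_real (mk d n y x) - ph y * of_real (mk d n y x)) <= (e/2) * mk d n y x"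
   proof (cases "x : cbx d y (1 / real (Suc n))")
   case True
   hence "x : fatten d {y} r" using nr by(force simp: fatten_def cbx_def)
   hence "cmod (ph x - ph y) < e/2" using r(2) by(auto simp: dist_norm norm_minus_commute)
   thus ?thesis unfolding * by(intro mult_right_mono mk_nonneg) simp
   next
   case False
   thus ?thesis using mk_zero[OF False x] by simp
   qed
   qed
   qed
   also have "... = e/2" using mk_integral(2)[of d n y] by simp
   finally show ?thesis using e by simp
   qed
   thus "EX no. ALL n>=no. norm (mol d n ph y - ph y) < e" by blast
   qed
  qed
 qed
 thus ?thesis unfolding swap .
qed

section \<open>W^(1,2) as a Hilbert space, and membership in W^(1,2)_0 through mollification\<close>

context domain
begin

definition W where "W = {f : L2 M. EX G. weak_grad d Om f G & (ALL i<d. G i : L2 M)}"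

text \<open>Index d is the slot of the function itself, so that \<open>{..d}\<close> enumerates all
  contributions to the W^(1,2) norm.\<close>

definition tw :: "nat => (pt => complex) => pt => complex" where
 "tw k f = (if k < d then grad d Om f k else f)"

lemma W_grad:
 assumes "f : W" shows "f : L2 M" "weak_grad d Om f (grad d Om f)" "!!i. i < d ==> grad d Om f i : L2 M"
proof -
 obtain G where G: "f : L2 M" "weak_grad d Om f G" "!!i. i < d ==> G i : L2 M" using assms by(auto simp: W_def)
 show "f : L2 M" by fact
 show w: "weak_grad d Om f (grad d Om f)" by(rule weak_grad_grad) (use G in \<open>auto simp: weakly_differentiable_def\<close>)
 fix i assume i: "i < d"
 show "grad d Om f i : L2 M"
  by(rule L2_cong_AE[OF G(3)[OF i] _ weak_grad_unique[OF w G(2) i]])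
   (use weak_gradD(2)[OF w i] in \<open>simp add: loc_integrable_def\<close>)
qed

lemma W_I: "f : L2 M ==> weak_grad d Om f G ==> (!!i. i < d ==> G i : L2 M) ==> f : W"
 by(auto simp: W_def)

lemma grad_AE: "weak_grad d Om f G ==> i < d ==> AE x in M. grad d Om f i x = G i x"
 by(rule weak_grad_unique[OF weak_grad_grad]) (auto simp: weakly_differentiable_def)

sublocale Wsp: graph_space M "{..d}" W tw
proof
 show "(%x. 0) : W"
  by(rule W_I[OF test_L2[OF test_fun_zero] weak_grad_test[OF test_fun_zero] test_L2[OF test_fun_partial[OF test_fun_zero]]])
 fix f g a b assume f: "f : W" and g: "g : W"
 have w: "weak_grad d Om (%x. a * f x + b * g x) (%i x. a * grad d Om f i x + b * grad d Om g i x)"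
  by(rule weak_grad_lin[OF W_grad(2)[OF f] W_grad(2)[OF g]])
 thus "(%x. a * f x + b * g x) : W"
  by(rule W_I[OF L2_lin[OF W_grad(1)[OF f] W_grad(1)[OF g]]]) (intro L2_lin W_grad f g)
 show "AE x in M. tw k (%y. a * f y + b * g y) x = a * tw k f x + b * tw k g x" for k
  using grad_AE[OF w, of k] by(simp add: tw_def)
next
 fix F :: "nat => pt => complex" and h
 assume F: "!!n. F n : W" and h: "!!k. k : {..d} ==> h k : L2 M"
  and lim: "!!k. k : {..d} ==> L2_lim M (%n. tw k (F n)) (h k)"
 have w: "weak_grad d Om (h d) h"
 proof (rule weak_grad_closed[OF W_grad(2)[OF F] W_grad(1)[OF F] h _ W_grad(3)[OF F] h])
  show "L2_lim M F (h d)" using lim[of d] by(simp add: tw_def)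
  show "L2_lim M (%n. grad d Om (F n) i) (h i)" if "i < d" for i
   using lim[of i] that by(simp add: tw_def)
 qed auto
 show "EX f:W. ALL k:{..d}. AE x in M. tw k f x = h k x"
  using grad_AE[OF w] h by(intro bexI[OF _ W_I[OF _ w]]) (auto simp: tw_def)
qed (auto simp: tw_def W_grad)

lemma h10_W: "h10 f G ==> f : W"
 using h10_weak_grad h10_L2 by(intro W_I) auto

lemma W12_0_closed_sub: "closed_sub W Wsp.gip (W12_0 d Om)"
proof (intro closed_sub.intro Wsp.semi_hilbert_axioms closed_sub_axioms.intro)
 show "W12_0 d Om \<subseteq> W" using h10_W W12_0_iff by auto
 show "(%x. 0) : W12_0 d Om" using h10_test[OF test_fun_zero] W12_0_iff by auto
 show "(%x. a * f x + b * g x) : W12_0 d Om" if "f : W12_0 d Om" "g : W12_0 d Om" for f g a b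
  using that h10_lin unfolding W12_0_iff by blast
 fix F f assume F: "!!n. F n : W12_0 d Om" and f: "f : W" and lim: "(%n. snorm Wsp.gip (%x. F n x - f x)) ~~> 0"
 have FW: "F n : W" for n using F h10_W W12_0_iff by auto
 have l: "L2_lim M (%n. tw k (F n)) (tw k f)" if k: "k <= d" for k
 proof (rule Lim_null_comparison[OF _ lim], intro always_eventually allI)
  fix n show "norm (n2 M (%x. tw k (F n) x - tw k f x)) <= snorm Wsp.gip (%x. F n x - f x)"
   using Wsp.T_le[OF _ Wsp.diff_mem[OF FW[of n] f], of k] Wsp.T_diff_n2[OF _ FW[of n] f, of k] k
   by(simp add: n2_nonneg)
 qed
 have "h10 f (grad d Om f)"
 proof (rule h10_closed[OF W12_0_grad[OF F] W_grad(1)[OF f] W_grad(3)[OF f]])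
  show "L2_lim M F f" using l[of d] by(simp add: tw_def)
  show "L2_lim M (%n. grad d Om (F n) i) (grad d Om f i)" if "i < d" for i
   using l[of i] that by(simp add: tw_def)
 qed
 thus "f : W12_0 d Om" using W12_0_iff by blast
qed

lemma bounded_cpt_L2:
 assumes "v : bm (leb d)" "compact K" "K \<subseteq> Om" "!!x. x : Rd d ==> x ~: K ==> v x = 0"
  and "AE x in leb d. cmod (v x) <= B"
 shows "integrable (leb d) v" "v : L2 M"
proof -
 have KR: "K \<subseteq> Rd d" using assms(3) sub by blast
 note i = integrable_bounded_compact[OF assms(1,2) KR assms(4,5)]
 show "integrable (leb d) v" by(rule i)
 have "extend_zero Om v : L2 (leb d)" by(rule extend_zero_L2(1)[OF open_Rd_sets[OF O] i(2)])
 thus "v : L2 M" unfolding leb_on_def using L2_restrict_iff[OF open_Rd_sets[OF O]] by blast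
qed

text \<open>Mollifications of a bounded function with bounded weak gradient and compact support are
 bounded in \<open>W\<^sup>1\<^sup>,\<^sup>2\<close> and converge weakly; a closed subspace is weakly closed.\<close>

lemma bounded_compact_h10:
 assumes K: "compact K" "K \<subseteq> Om"
  and v: "v : bm (leb d)" "!!x. x : Rd d ==> x ~: K ==> v x = 0" "AE x in leb d. cmod (v x) <= B"
  and G: "!!i. i < d ==> G i : bm (leb d)" "!!i x. i < d ==> x : Rd d ==> x ~: K ==> G i x = 0"
   "!!i. i < d ==> AE x in leb d. cmod (G i x) <= B"
  and w: "weak_grad d Om v G"
 shows "h10 v G"
proof -
 note vL = bounded_cpt_L2[OF v(1) K v(2,3)]
 have GL: "integrable (leb d) (G i)" "G i : L2 M" if "i < d" for i
  using bounded_cpt_L2[OF G(1)[OF that] K G(2)[OF that] G(3)[OF that]] by auto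
 obtain r where r: "r > 0" "fatten d K r \<subseteq> Om" using compact_margin[OF K O] by blast
 \<comment> \<open>Supports then grow by less than r/2 and stay in a fixed compact subset of
   \<open>Om\<close>; the other half of the margin keeps kernels centred in that subset inside
   \<open>Om\<close>.\<close>
 obtain n0 where n0: "1 / real (Suc n0) < r/2" using reals_Archimedean[of "r/2"] r(1) by(auto simp: inverse_eq_divide)
 define V where "V n = mol d (n0 + n) v" for n
 define e where "e n = 1 / real (Suc (n0 + n))" for n
 have e: "0 < e n" "e n < r/2" for n
 proof -
  have "1 / real (Suc (n0 + n)) <= 1 / real (Suc n0)" by(intro divide_left_mono) auto
  thus "0 < e n" "e n < r/2" using n0 by(auto simp: e_def)
 qed
 have fat: "fatten d K a \<subseteq> fatten d K r" if "a <= r" for a using that by(force simp: fatten_def cbx_def)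
 have KR: "K \<subseteq> Rd d" using K(2) sub by blast
 have cf: "compact (fatten d K (r/2))" "fatten d K (r/2) \<subseteq> Om"
  using compact_fatten[OF K(1) KR] fat[of "r/2"] r by auto
 have fe: "fatten d K (e n) \<subseteq> fatten d K (r/2)" for n using e(2)[of n] by(force simp: fatten_def cbx_def)
 have z: "mol d (n0 + n) u x = 0" if "!!y. y : Rd d ==> y ~: K ==> u y = 0" "x : Rd d" "x ~: fatten d K (r/2)" for u n x
  by(rule mol_zero[of d K]) (use that fe[of n] in \<open>auto simp: e_def\<close>)
 have Vt: "V n : test_fun d Om" for n
  unfolding V_def by(rule test_funI[OF mol_smooth[OF vL(1)] cf z[OF v(2)]])
 \<comment> \<open>For x near \<open>K\<close> the kernel, as a function of y, is a test function on
   \<open>Om\<close>, so the defining identity of the weak gradient applies to it. For the remaining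
   x both sides are 0.\<close>
 have dV: "partial i (V n) x = mol d (n0 + n) (G i) x" if i: "i < d" and x: "x : Rd d" for i n x
 proof (cases "x : fatten d K (r/2)")
  case False
  have "partial i (V n) x = 0"
   unfolding V_def by(rule partial_zero_outside[OF compact_imp_closed[OF cf(1)] z[OF v(2)] i x False])
  thus ?thesis using z[OF G(2)[OF i] x False] by simp
 next
  case True
  let ?n = "n0 + n" let ?m = "%_. moll (n0 + n)"
  have b: "bump1 (e n) (moll ?n)" unfolding e_def by(rule bump1_moll)
  have conv: "convolution d (leb d) v" by(simp add: convolution_def vL(1))
  have "partial i (V n) x = cv d (leb d) v ((%_. moll ?n)(i := deriv (moll ?n))) x"
   unfolding V_def mol_cv
   by(rule partial_eq[of "cv d (leb d) v ?m" x i, OF convolution.cv_deriv[OF conv, of "e n" ?m i x, OF b i]])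
  also have "... = (LINT y|(leb d). v y * of_real (\<Prod>j<d. ((%_. moll ?n)(i := deriv (moll ?n))) j (x j - y j)))"
   by(simp only: cv_def)
  also have "... = - (LINT y|(leb d). v y * partial i (%y. of_real (\<Prod>j<d. moll ?n (y j - x j))) y)"
  proof -
   \<comment> \<open>The bump is even, hence its derivative odd; this turns the derivative of the
     kernel in x into minus its derivative in y.\<close>
   have dodd: "deriv (moll ?n) (- t) = - deriv (moll ?n) t" for t
   proof -
   have D: "(moll ?n has_real_derivative deriv (moll ?n) t) (at t)" for t
   using b smooth1_deriv(1) by(auto simp: bump1_def)
   have "((%t. moll ?n (- t)) has_real_derivative deriv (moll ?n) (- t) * (-1)) (at t)"
   by(rule DERIV_chain2[OF D]) (auto intro!: derivative_eq_intros)
   hence "(moll ?n has_real_derivative - deriv (moll ?n) (- t)) (at t)" by(simp add: moll_even)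
   thus ?thesis using DERIV_unique[OF D[of t]] by fastforce
   qed
   have "of_real (\<Prod>j<d. ((%_. moll ?n)(i := deriv (moll ?n))) j (x j - y j)) =
   - partial i (%y. of_real (\<Prod>j<d. moll ?n (y j - x j))) y" if y: "y : Rd d" for y
   proof -
   have s: "moll ?n (x j - y j) = moll ?n (y j - x j)" "deriv (moll ?n) (x j - y j) = - deriv (moll ?n) (y j - x j)" for j
   using moll_even[of ?n "y j - x j"] dodd[of "y j - x j"] by auto
   have "(\<Prod>j<d. (?m(i := deriv (moll ?n))) j (x j - y j)) = - (\<Prod>j<d. (?m(i := deriv (moll ?n))) j (y j - x j))"
   using i by(subst (1 2) prod.remove[of "{..<d}" i]) (auto simp: s intro!: prod.cong)
   thus ?thesis using tensor_smooth(2)[of d "e n" ?m x i y, OF b x i y] by simp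
   qed
   hence "(LINT y|(leb d). v y * of_real (\<Prod>j<d. ((%_. moll ?n)(i := deriv (moll ?n))) j (x j - y j)))
   = (LINT y|(leb d). - (v y * partial i (%y. of_real (\<Prod>j<d. moll ?n (y j - x j))) y))"
   by(intro Bint_cong) (auto simp del: of_real_prod)
   thus ?thesis by simp
  qed
  also have "... = (LINT y|(leb d). G i y * of_real (\<Prod>j<d. moll ?n (y j - x j)))"
  proof -
   obtain k where k: "k : K" "x : cbx d k (r/2)" using True by(auto simp: fatten_def)
   have "cbx d x (e n) \<subseteq> cbx d k r"
   proof
   fix y assume y: "y : cbx d x (e n)"
   have "\<bar>y j - k j\<bar> <= r" if "j < d" for j
   proof -
   have "\<bar>y j - x j\<bar> <= e n" "\<bar>x j - k j\<bar> <= r/2" using y k(2) that by(auto simp: cbx_def)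
   thus ?thesis using e(2)[of n] by linarith
   qed
   thus "y : cbx d k r" using y by(simp add: cbx_def)
   qed
   hence cx: "cbx d x (e n) \<subseteq> Om" using k(1) r(2) by(auto simp: fatten_def)
   have t: "(%y. of_real (\<Prod>j<d. moll ?n (y j - x j))) : test_fun d Om"
   proof (rule test_funI[OF tensor_smooth(1)[of d "e n" ?m x, OF b x] _ cx])
   show "compact (cbx d x (e n))" using compact_fatten[of "{x}" d "e n"] x by(simp add: fatten_def)
   fix y assume y: "y : Rd d" "y ~: cbx d x (e n)"
   have "mk d ?n x y = 0" using y by(intro mk_zero) (auto simp: e_def)
   hence "mk d ?n y x = 0" by(simp add: mk_sym)
   thus "complex_of_real (\<Prod>j<d. moll ?n (y j - x j)) = 0" by(simp only: mk_def of_real_0)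
   qed
   have vz: "v y * u y = 0" if "y : Rd d" "y ~: Om" for y and u :: "pt => complex" using v(2)[of y] that K(2) by auto
   have gz: "G i y * u y = 0" if "y : Rd d" "y ~: Om" for y and u :: "pt => complex" using G(2)[OF i, of y] that K(2) by auto
   let ?t = "%y. complex_of_real (\<Prod>j<d. moll ?n (y j - x j))"
   have a: "(LINT y|M. v y * partial i ?t y) = (LINT y|(leb d). v y * partial i ?t y)" by(rule int_leb[OF vz])
   have b: "(LINT y|M. G i y * ?t y) = (LINT y|(leb d). G i y * ?t y)" by(rule int_leb[OF gz])
   have "(LINT y|(leb d). v y * partial i ?t y) = - (LINT y|(leb d). G i y * ?t y)"
   using weak_gradD(3)[OF w i t] unfolding a b .
   thus ?thesis by(simp only: minus_minus)
  qed
  also have "... = mol d ?n (G i) x"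
   unfolding mol_def mk_sym[of d ?n x] by(simp only: mk_def)
  finally show ?thesis .
 qed
 have B0: "0 <= \<bar>B\<bar>" by simp
 have bd: "n2 M (mol d (n0 + n) u) <= n2 M (%x. indicator (fatten d K (r/2)) x * of_real \<bar>B\<bar>)"
  if u: "integrable (leb d) u" "AE x in leb d. cmod (u x) <= B" "!!y. y : Rd d ==> y ~: K ==> u y = 0" for u n
 proof -
  have im: "(%x. indicator (fatten d K (r/2)) x * complex_of_real \<bar>B\<bar>) : bm (leb d)"
   using compact_sets_leb[OF cf(1)] cf(2) sub by(intro borel_measurable_times borel_measurable_indicator) auto
  have iL: "(%x. indicator (fatten d K (r/2)) x * complex_of_real \<bar>B\<bar>) : L2 M"
   by(rule bounded_cpt_L2(2)[OF im cf, where B = "\<bar>B\<bar>"]) (auto simp: indicator_def)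
  have mm: "mol d (n0 + n) u : bm M"
   by(intro meas_leb continuous_measurable smooth_continuous mol_smooth u)
  have "AE x in M. cmod (mol d (n0 + n) u x) <= 1 * cmod (indicator (fatten d K (r/2)) x * complex_of_real \<bar>B\<bar>)"
  proof (rule AE_I2)
   fix x assume "x : space M"
   hence x: "x : Rd d" using space_M sub by auto
   have "cmod (mol d (n0 + n) u x) <= \<bar>B\<bar>" using mol_bound[OF u(1,2), where n = "n0 + n" and x = x] by linarith
   thus "cmod (mol d (n0 + n) u x) <= 1 * cmod (indicator (fatten d K (r/2)) x * complex_of_real \<bar>B\<bar>)"
   using z[OF u(3) x, where n = n] by(cases "x : fatten d K (r/2)") auto
  qed
  from L2_bound(2)[OF iL mm this] show ?thesis by simp
 qed
 have wk: "(%n. L2_inner M (mol d (n0 + n) u) g) ~~> L2_inner M u g"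
  if u: "integrable (leb d) u" "u : L2 M" "AE x in leb d. cmod (u x) <= B" "!!y. y : Rd d ==> y ~: K ==> u y = 0"
   and g: "g : L2 M" for u g
 proof (rule L2.weak_of_dense[where T = "(%ph x. cnj (ph x)) ` test_fun d Om"])
  have mt: "mol d (n0 + n) u : test_fun d Om" for n
   by(rule test_funI[OF mol_smooth[OF u(1)] cf z[OF u(4)]])
  show "mol d (n0 + n) u : L2 M" for n by(rule test_L2[OF mt])
  show "n2 M (mol d (n0 + n) u) <= n2 M (%x. indicator (fatten d K (r/2)) x * of_real \<bar>B\<bar>)" for n
   by(rule bd[OF u(1,3,4)])
  show "(%ph x. cnj (ph x)) ` test_fun d Om \<subseteq> L2 M" using test_L2 L2_cnj by blast
  fix ps assume "ps : (%ph x. cnj (ph x)) ` test_fun d Om"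
  then obtain ph where ph: "ph : test_fun d Om" "ps = (%x. cnj (ph x))" by blast
  have "(%n. \<integral>x. mol d (n + n0) u x * ph x \<partial>leb d) ~~> (LINT y|(leb d). u y * ph y)"
   using mol_weak[OF u(1) test_fun_mono[OF ph(1) sub]] by(rule LIMSEQ_ignore_initial_segment)
  moreover have "L2_inner M h ps = (LINT x|(leb d). h x * ph x)" for h
   unfolding L2_inner_def ph(2) using int_leb[of "%x. h x * ph x"] test_fun_props(5)[OF ph(1) sub] by simp
  ultimately show "(%n. L2_inner M (mol d (n0 + n) u) ps) ~~> L2_inner M u ps" by(simp add: add.commute)
 next
  fix a :: real assume "0 < a"
  then obtain ph where ph: "ph : test_fun d Om" "n2 M (%x. cnj (g x) - ph x) < a" using test_dense[OF L2_cnj[OF g]] by blast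
  have "n2 M (%x. g x - cnj (ph x)) = n2 M (%x. cnj (g x) - ph x)"
   using n2_cnj[of M "%x. cnj (g x) - ph x"] by simp
  thus "EX ps:(%ph x. cnj (ph x)) ` test_fun d Om. n2 M (%x. g x - ps x) < a"
   using ph(2) by(intro bexI[OF _ imageI[OF ph(1)]]) (simp only:)
 qed (use u g in auto)
 interpret closed_sub W Wsp.gip "W12_0 d Om" by(rule W12_0_closed_sub)
 have vW: "v : W" by(rule W_I[OF vL(2) w GL(2)])
 have VW: "V n : W" for n by(rule h10_W[OF h10_test[OF Vt]])
 have "v : W12_0 d Om"
 proof (rule weakly_closed[OF vW])
  show "V n : W12_0 d Om" for n using h10_test[OF Vt] W12_0_iff by blast
  fix g assume g: "g : W"
  show "(%n. Wsp.gip (V n) g) ~~> Wsp.gip v g"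
   unfolding Wsp.gip_def
  proof (rule tendsto_sum)
   fix k assume k: "k : {..d}"
   have gL: "tw k g : L2 M" by(rule Wsp.TL2[OF k g])
   show "(%n. L2_inner M (tw k (V n)) (tw k g)) ~~> L2_inner M (tw k v) (tw k g)"
   proof (cases "k < d")
   case False
   thus ?thesis using wk[OF vL v(3) v(2) gL] by(simp add: tw_def V_def)
   next
   case True
   have "L2_inner M (tw k (V n)) (tw k g) = L2_inner M (mol d (n0 + n) (G k)) (tw k g)" for n
   proof (rule L2_inner_cong_AE[OF _ AE_I2[OF refl]])
   have "AE x in M. mol d (n0 + n) (G k) x = partial k (V n) x"
   using dV[OF True] open_Rd_subset[OF O] by(intro AE_I2) (auto simp: space_M)
   thus "AE x in M. tw k (V n) x = mol d (n0 + n) (G k) x"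
   using grad_AE[OF weak_grad_test[OF Vt] True, of n] by eventually_elim (simp add: tw_def True)
   show "mol d (n0 + n) (G k) : L2 M"
   by(intro test_L2 test_funI[OF mol_smooth[OF GL(1)[OF True]] cf z[OF G(2)[OF True]]])
   qed (use gL Wsp.TL2[OF k VW] in auto)
   moreover have "L2_inner M (tw k v) (tw k g) = L2_inner M (G k) (tw k g)"
   by(rule L2_inner_cong_AE[OF _ AE_I2[OF refl]])
   (use grad_AE[OF w True] gL GL(2)[OF True] Wsp.TL2[OF k vW] True in \<open>auto simp: tw_def\<close>)
   ultimately show ?thesis using wk[OF GL(1)[OF True] GL(2)[OF True] G(3)[OF True] G(2)[OF True] gL] by simp
   qed
  qed
 qed
 hence h: "h10 v (grad d Om v)" by(rule W12_0_grad)
 show ?thesis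
 proof (rule h10_cong[OF h])
  fix i assume i: "i < d"
  show "AE x in M. G i x = grad d Om v i x" using grad_AE[OF w i] by eventually_elim simp
  show "G i : bm M" by(rule meas_leb[OF G(1)[OF i]])
 qed (use meas_leb[OF v(1)] in auto)
qed

end

section \<open>The bracket <z> = sqrt (1 + |z|^2) and its chain rule for weak gradients\<close>

definition jap :: "complex => real" where
 "jap z = sqrt (1 + (cmod z)^2)"

lemma jap_ge: "1 <= jap z" "cmod z <= jap z" "jap z <= 1 + cmod z" "0 < jap z"
proof -
 show 1: "1 <= jap z" by(simp add: jap_def)
 thus "0 < jap z" by linarith
 show "cmod z <= jap z" unfolding jap_def by(rule real_le_rsqrt) simp
 show "jap z <= 1 + cmod z" unfolding jap_def by(rule real_le_lsqrt) (auto simp: power2_sum)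
qed

lemma jap_sq: "(jap z)^2 = 1 + (cmod z)^2"
 by(simp add: jap_def add_nonneg_nonneg)

lemma jap_lipschitz: "\<bar>jap z - jap w\<bar> <= cmod (z - w)"
proof -
 have p: "0 < jap z + jap w" using jap_ge(4)[of z] jap_ge(4)[of w] by linarith
 have "(jap z - jap w) * (jap z + jap w) = (cmod z - cmod w) * (cmod z + cmod w)"
  using jap_sq[of z] jap_sq[of w] by(simp add: power2_eq_square algebra_simps)
 hence "\<bar>jap z - jap w\<bar> * (jap z + jap w) = \<bar>cmod z - cmod w\<bar> * (cmod z + cmod w)"
  using p by(metis abs_mult abs_of_nonneg add_nonneg_nonneg less_imp_le norm_ge_zero)
 also have "... <= cmod (z - w) * (jap z + jap w)"
  using norm_triangle_ineq3[of z w] jap_ge(2)[of z] jap_ge(2)[of w] by(intro mult_mono) auto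
 finally show ?thesis using p by simp
qed

text \<open>The directional derivative of \<open>jap\<close> at z along v, typed as a complex number
  so that it can serve as a component of a weak gradient.\<close>

definition japd :: "complex => complex => complex" where
 "japd z v = of_real (Re (cnj z * v) / jap z)"

lemma japd_le: "cmod (japd z v) <= cmod v"
proof -
 have "\<bar>Re (cnj z * v)\<bar> <= cmod z * cmod v" using abs_Re_le_cmod[of "cnj z * v"] by(simp add: norm_mult)
 also have "... <= jap z * cmod v" by(intro mult_right_mono jap_ge) auto
 finally have "\<bar>Re (cnj z * v)\<bar> / jap z <= cmod v" using jap_ge(4)[of z] by(simp add: pos_divide_le_eq mult.commute)
 thus ?thesis unfolding japd_def norm_of_real abs_divide abs_of_pos[OF jap_ge(4)] .
qed

text \<open>The dependence on the direction is uniformly Lipschitz, while a change of the base point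
  costs a factor |u|. A passage to the limit with this estimate therefore asks for bounded limit
  gradients.\<close>

lemma japd_diff: "cmod (japd z v - japd w u) <= cmod (v - u) + 2 * cmod (z - w) * cmod u"
proof -
 have 1: "japd z v - japd z u = japd z (v - u)" by(simp add: japd_def algebra_simps diff_divide_distrib)
 have "cmod (japd z u - japd w u) <= 2 * cmod (z - w) * cmod u"
 proof -
  have "Re (cnj z * u) / jap z - Re (cnj w * u) / jap w
   = Re (cnj (z - w) * u) / jap z + Re (cnj w * u) / jap w * ((jap w - jap z) / jap z)"
   using jap_ge(4)[of z] jap_ge(4)[of w] by(simp add: field_simps)
  hence "\<bar>Re (cnj z * u) / jap z - Re (cnj w * u) / jap w\<bar>
   <= \<bar>Re (cnj (z - w) * u) / jap z\<bar> + \<bar>Re (cnj w * u) / jap w\<bar> * \<bar>(jap w - jap z) / jap z\<bar>"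
   by(simp only: abs_mult[symmetric] abs_triangle_ineq)
  also have "\<bar>Re (cnj (z - w) * u) / jap z\<bar> <= cmod (z - w) * cmod u"
  proof -
   have "\<bar>Re (cnj (z - w) * u)\<bar> <= cmod (z - w) * cmod u"
   using abs_Re_le_cmod[of "cnj (z - w) * u"] by(simp only: norm_mult complex_mod_cnj)
   also have "... <= cmod (z - w) * cmod u * jap z"
   using mult_left_mono[OF jap_ge(1)[of z], of "cmod (z - w) * cmod u"] by simp
   finally show ?thesis using jap_ge(4)[of z] by(simp add: pos_divide_le_eq)
  qed
  also have "\<bar>Re (cnj w * u) / jap w\<bar> * \<bar>(jap w - jap z) / jap z\<bar> <= cmod u * cmod (z - w)"
  proof (intro mult_mono)
   show "\<bar>Re (cnj w * u) / jap w\<bar> <= cmod u" using japd_le[of w u] by(simp only: japd_def norm_of_real)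
   have "\<bar>jap w - jap z\<bar> <= cmod (z - w)" using jap_lipschitz[of w z] by(simp add: norm_minus_commute)
   also have "... <= cmod (z - w) * jap z"
   using mult_left_mono[OF jap_ge(1)[of z], of "cmod (z - w)"] by simp
   finally show "\<bar>(jap w - jap z) / jap z\<bar> <= cmod (z - w)" using jap_ge(4)[of z] by(simp add: pos_divide_le_eq)
  qed auto
  finally have "\<bar>Re (cnj z * u) / jap z - Re (cnj w * u) / jap w\<bar> <= cmod (z - w) * cmod u + cmod u * cmod (z - w)"
   by simp
  hence "\<bar>Re (cnj z * u) / jap z - Re (cnj w * u) / jap w\<bar> <= 2 * cmod (z - w) * cmod u"
   by(simp only: mult.commute[of "cmod u"] mult_2 distrib_right)
  thus ?thesis by(simp only: japd_def of_real_diff[symmetric] norm_of_real)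
 qed
 moreover have e: "japd z v - japd w u = japd z (v - u) + (japd z u - japd w u)" by(simp add: 1[symmetric])
 ultimately show ?thesis unfolding e
  using norm_triangle_ineq[of "japd z (v - u)" "japd z u - japd w u"] japd_le[of z "v - u"] by linarith
qed

lemma jap_deriv:
 fixes f :: "real => complex"
 assumes "(f has_vector_derivative D) (at s)"
 shows "((%s. complex_of_real (jap (f s) - 1)) has_vector_derivative japd (f s) D) (at s)"
proof -
 have R: "((%s. Re (f s)) has_real_derivative Re D) (at s)" "((%s. Im (f s)) has_real_derivative Im D) (at s)"
  using assms by(auto simp: has_vector_derivative_complex_iff)
 have pos: "0 < 1 + ((Re (f s))^2 + (Im (f s))^2)" by(simp add: add_pos_nonneg)
 have "((%s. sqrt (1 + ((Re (f s))^2 + (Im (f s))^2)) - 1) has_real_derivative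
   (2 * Re (f s) * Re D + 2 * Im (f s) * Im D) / (2 * sqrt (1 + ((Re (f s))^2 + (Im (f s))^2)))) (at s)"
  using pos by(auto intro!: derivative_eq_intros assms simp: field_simps)
 moreover have "(2 * Re (f s) * Re D + 2 * Im (f s) * Im D) / (2 * sqrt (1 + ((Re (f s))^2 + (Im (f s))^2)))
   = Re (cnj (f s) * D) / jap (f s)" using pos by(simp add: jap_def cmod_power2 field_simps)
 ultimately have "((%s. jap (f s) - 1) has_real_derivative Re (cnj (f s) * D) / jap (f s)) (at s)"
  by(simp add: jap_def cmod_power2)
 thus ?thesis unfolding has_vector_derivative_complex_iff by(simp add: japd_def)
qed

lemma jap_measurable [measurable]: "jap : bm borel"
 unfolding jap_def[abs_def] by measurable

lemma japd_measurable:
 "f : bm M ==> g : bm M ==> (%x. japd (f x) (g x)) : bm M"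
 unfolding japd_def
 by(intro of_real_meas borel_measurable_divide measurable_compose[OF _ jap_measurable]
  measurable_compose[OF _ borel_measurable_Re] borel_measurable_times borel_measurable_cnj)

lemma japd_continuous:
 fixes f g :: "pt => complex"
 assumes "continuous_on S f" "continuous_on S g"
 shows "continuous_on S (%x. japd (f x) (g x))"
 unfolding japd_def jap_def using assms
 by(intro continuous_intros) (auto simp: add_nonneg_eq_0_iff)

context domain
begin

definition locbd :: "(pt => complex) => (nat => pt => complex) => bool" where
 "locbd w V \<longleftrightarrow> (ALL K. compact K & K \<subseteq> Om -->
   (EX B>=0. AE x in M. x : K --> cmod (w x) <= B & (ALL i<d. cmod (V i x) <= B)))"

text \<open>The product is bounded with bounded gradient and compact support. It is first extended
  by zero to a function measurable for \<open>leb d\<close>, the form that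
  \<open>bounded_compact_h10\<close> takes.\<close>

lemma test_mult_h10:
 assumes w: "weak_grad d Om w V" and b: "locbd w V" and ph: "ph : test_fun d Om"
 shows "h10 (%x. ph x * w x) (%i x. ph x * V i x + partial i ph x * w x)"
proof -
 obtain K where K: "compact K" "K \<subseteq> Om" "!!x. x : Rd d ==> x ~: K ==> ph x = 0"
  using ph by(auto simp: test_fun_def)
 have pz: "partial i ph x = 0" if "i < d" "x : Rd d" "x ~: K" for i x
  by(rule partial_zero_outside[OF compact_imp_closed[OF K(1)] K(3) that])
 obtain B where B: "B >= 0" "AE x in M. x : K --> cmod (w x) <= B & (ALL i<d. cmod (V i x) <= B)"
  using b K(1,2) unfolding locbd_def by blast
 obtain c where c: "c >= 0" "!!x. x : Rd d ==> cmod (ph x) <= c" using test_fun_props(2)[OF ph sub] by blast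
 have "ALL i. EX c>=0. i < d --> (ALL x:Rd d. cmod (partial i ph x) <= c)"
  using test_fun_props(2)[OF test_fun_partial[OF ph] sub] by(metis order_refl)
 then obtain ci where ci: "!!i. ci i >= 0" "!!i x. i < d ==> x : Rd d ==> cmod (partial i ph x) <= ci i" by metis
 define C where "C = c + (\<Sum>i<d. ci i)"
 have C0: "C >= 0" using c(1) ci(1) by(simp add: C_def sum_nonneg)
 have C1: "cmod (ph x) <= C" if "x : Rd d" for x using c(2)[OF that] ci(1) by(simp add: C_def add_increasing2 sum_nonneg)
 have C2: "cmod (partial i ph x) <= C" if "i < d" "x : Rd d" for i x
 proof -
  have "ci i <= (\<Sum>i<d. ci i)" using that ci(1) by(intro member_le_sum) auto
  thus ?thesis using ci(2)[OF that] c(1) by(simp add: C_def)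
 qed
 let ?v = "%x. ph x * w x" let ?G = "%i x. ph x * V i x + partial i ph x * w x"
 have wg: "weak_grad d Om ?v ?G" by(rule weak_grad_mult[OF w test_fun_smooth[OF ph]])
 have e: "AE x in M. extend_zero Om f x = f x" for f by(rule AE_I2) (simp add: space_M extend_zero_def)
 have m: "extend_zero Om ?v : bm (leb d)" "i < d ==> extend_zero Om (?G i) : bm (leb d)" for i
  using weak_gradD(1)[OF wg] weak_gradD(2)[OF wg, of i] unfolding loc_integrable_def leb_on_meas[OF O] extend_zero_eq by auto
 have wg': "weak_grad d Om (extend_zero Om ?v) (%i. extend_zero Om (?G i))"
  by(rule weak_grad_cong[OF wg e meas_leb[OF m(1)] e meas_leb[OF m(2)]])
 have "h10 (extend_zero Om ?v) (%i. extend_zero Om (?G i))"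
 proof (rule bounded_compact_h10[OF K(1,2) m(1) _ _ m(2) _ _ wg', where B = "2 * (C * B)"])
  show "extend_zero Om ?v x = 0" if "x : Rd d" "x ~: K" for x using K(3)[OF that] by(simp add: extend_zero_def)
  show "extend_zero Om (?G i) x = 0" if "i < d" "x : Rd d" "x ~: K" for i x
   using K(3)[OF that(2,3)] pz[OF that] by(simp add: extend_zero_def)
  have ae: "AE x in leb d. x : K --> cmod (w x) <= B & (ALL i<d. cmod (V i x) <= B)"
   using B(2) K(2) unfolding leb_on_AE[OF O] by(auto elim!: eventually_mono)
  have CB: "0 <= C * B" using C0 B(1) by simp
  show "AE x in leb d. cmod (extend_zero Om ?v x) <= 2 * (C * B)"
   using ae AE_space
  proof eventually_elim
   case (elim x)
   hence x: "x : Rd d" by simp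
   show ?case
   proof (cases "x : K")
   case True
   hence "cmod (ph x) * cmod (w x) <= C * B" using elim C1[OF x] C0 by(intro mult_mono) auto
   thus ?thesis using CB by(simp add: extend_zero_def norm_mult)
   qed (use K(3)[OF x] CB in \<open>simp add: extend_zero_def\<close>)
  qed
  fix i assume i: "i < d"
  show "AE x in leb d. cmod (extend_zero Om (?G i) x) <= 2 * (C * B)"
   using ae AE_space
  proof eventually_elim
   case (elim x)
   hence x: "x : Rd d" by simp
   show ?case
   proof (cases "x : K")
   case True
   hence "cmod (ph x) * cmod (V i x) <= C * B" "cmod (partial i ph x) * cmod (w x) <= C * B"
   using elim C1[OF x] C2[OF i x] C0 i by(auto intro!: mult_mono)
   hence "cmod (ph x * V i x + partial i ph x * w x) <= 2 * (C * B)"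
   using norm_triangle_ineq[of "ph x * V i x" "partial i ph x * w x"] by(simp add: norm_mult)
   thus ?thesis using CB by(simp add: extend_zero_def)
   qed (use K(3)[OF x] pz[OF i x] CB in \<open>simp add: extend_zero_def\<close>)
  qed
 qed
 thus ?thesis
 proof (rule h10_cong)
  show "AE x in M. ?v x = extend_zero Om ?v x" using e[of ?v] by eventually_elim simp
  show "AE x in M. ?G i x = extend_zero Om (?G i) x" for i using e[of "?G i"] by eventually_elim simp
 qed (use weak_gradD(1,2)[OF wg] in \<open>auto simp: loc_integrable_def\<close>)
qed

text \<open>Approximate u by test functions. Their products with w are covered by
  \<open>test_mult_h10\<close>, and boundedness of w and of its gradient makes multiplication by w
  continuous in the W^(1,2) norm.\<close>

lemma mult_h10:
 assumes u: "h10 u G" and w: "weak_grad d Om w V" and B: "0 <= B" "AE x in M. cmod (w x) <= B"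
  "!!i. i < d ==> AE x in M. cmod (V i x) <= B"
 shows "h10 (%x. w x * u x) (%i x. w x * G i x + V i x * u x)"
proof -
 have ae: "AE x in M. ALL i:{..<d}. cmod (V i x) <= B" using B(3) by(intro AE_finite_allI) auto
 have b: "locbd w V" unfolding locbd_def
 proof (intro allI impI exI[of _ B] conjI B(1))
  fix K show "AE x in M. x : K --> cmod (w x) <= B & (ALL i<d. cmod (V i x) <= B)"
   using ae B(2) by eventually_elim auto
 qed
 have wm: "w : bm M" and Vm: "i < d ==> V i : bm M" for i
  using weak_gradD(1,2)[OF w] by(auto simp: loc_integrable_def)
 have mb: "(%x. g x * f x) : L2 M & n2 M (%x. g x * f x) <= B * n2 M f"
  if f: "f : L2 M" and g: "g : bm M" "AE x in M. cmod (g x) <= B" for f g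
 proof -
  have "AE x in M. cmod (g x * f x) <= B * cmod (f x)"
   using g(2) by eventually_elim (simp add: norm_mult mult_right_mono)
  from L2_bound[OF f borel_measurable_times[OF g(1) L2_measurable[OF f]] this B(1)] show ?thesis by blast
 qed
 note mw = mb[OF _ wm B(2)]
 have mV: "(%x. V i x * f x) : L2 M & n2 M (%x. V i x * f x) <= B * n2 M f" if f: "f : L2 M" and i: "i < d" for f i
  by(rule mb[OF f Vm[OF i] B(3)[OF i]])
 obtain ph where ph: "!!n. ph n : test_fun d Om" "L2_lim M ph u"
  "!!i. i < d ==> L2_lim M (%n. partial i (ph n)) (G i)" using h10_seq[OF u] by blast
 have uL: "u : L2 M" "!!i. i < d ==> G i : L2 M" using h10_L2[OF u] by auto
 have phL: "ph n : L2 M" "i < d ==> partial i (ph n) : L2 M" for n i using ph(1) test_L2 test_fun_partial by auto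
 show ?thesis
 proof (rule h10_closed[where F = "%n x. ph n x * w x" and G = "%n i x. ph n x * V i x + partial i (ph n) x * w x"])
  show "h10 (%x. ph n x * w x) (%i x. ph n x * V i x + partial i (ph n) x * w x)" for n
   by(rule test_mult_h10[OF w b ph(1)])
  show "(%x. w x * u x) : L2 M" using mw uL by blast
  show "(%x. w x * G i x + V i x * u x) : L2 M" if "i < d" for i
   using mw[OF uL(2)[OF that]] mV[OF uL(1) that] L2.add_mem by blast
  have 1: "n2 M (%x. ph n x * w x - w x * u x) <= B * n2 M (%x. ph n x - u x)" for n
   using mw[OF L2.diff_mem[OF phL(1)[of n] uL(1)]] by(simp add: algebra_simps)
  have "(%n. B * n2 M (%x. ph n x - u x)) ~~> 0" using tendsto_mult_left[OF ph(2), of B] by simp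
  thus "(%n. n2 M (%x. ph n x * w x - w x * u x)) ~~> 0"
   by(rule Lim_null_comparison[rotated]) (use 1 in \<open>simp add: n2_nonneg\<close>)
  fix i assume i: "i < d"
  have 2: "n2 M (%x. ph n x * V i x + partial i (ph n) x * w x - (w x * G i x + V i x * u x))
   <= B * n2 M (%x. partial i (ph n) x - G i x) + B * n2 M (%x. ph n x - u x)" for n
  proof -
   note a = mw[OF L2.diff_mem[OF phL(2)[OF i, of n] uL(2)[OF i]]] and b = mV[OF L2.diff_mem[OF phL(1)[of n] uL(1)] i]
   have "(%x. ph n x * V i x + partial i (ph n) x * w x - (w x * G i x + V i x * u x))
   = (%x. w x * (partial i (ph n) x - G i x) + V i x * (ph n x - u x))" by(auto simp: algebra_simps)
   thus ?thesis using L2.nrm_triangle[of _ M, OF a[THEN conjunct1] b[THEN conjunct1]] a b by simp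
  qed
  have "(%n. B * n2 M (%x. partial i (ph n) x - G i x) + B * n2 M (%x. ph n x - u x)) ~~> B * 0 + B * 0"
   by(intro tendsto_intros ph(2) ph(3)[OF i])
  hence "(%n. B * n2 M (%x. partial i (ph n) x - G i x) + B * n2 M (%x. ph n x - u x)) ~~> 0" by simp
  thus "(%n. n2 M (%x. ph n x * V i x + partial i (ph n) x * w x - (w x * G i x + V i x * u x))) ~~> 0"
   by(rule Lim_null_comparison[rotated]) (use 2 in \<open>simp add: n2_nonneg\<close>)
 qed
qed

text \<open>A mollified indicator of a neighbourhood of \<open>K\<close>. It equals 1 on a smaller
  neighbourhood and not merely on \<open>K\<close>, which is why its gradient vanishes on
  \<open>K\<close>.\<close>

lemma cutoff:
 assumes K: "compact K" "K \<subseteq> Om"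
 shows "EX \<kappa>:test_fun d Om. ALL x:K. \<kappa> x = 1 & (ALL i<d. partial i \<kappa> x = 0)"
proof -
 obtain r where r: "r > 0" "fatten d K r \<subseteq> Om" using compact_margin[OF K O] by blast
 \<comment> \<open>One fattening by a for the indicator and one for the mollifier fit into the
   margin r. A kernel radius below a/2 leaves a neighbourhood of half side a/2 on which the value is
   1.\<close>
 define a where "a = r / 2"
 have a: "a > 0" using r(1) by(simp add: a_def)
 have KR: "K \<subseteq> Rd d" using K(2) sub by blast
 have c: "compact (fatten d K a)" "fatten d K a \<subseteq> Rd d"
  using compact_fatten[OF K(1) KR] by(auto simp: fatten_def cbx_def)
 let ?v = "%x. indicator (fatten d K a) x :: complex"
 have v: "integrable (leb d) ?v"
 proof (rule integrable_bounded_compact(1)[OF _ c, where B = 1])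
  show "?v : bm (leb d)" using compact_sets_leb[OF c] by(intro borel_measurable_indicator)
 qed (auto simp: indicator_def)
 obtain n where n: "1 / real (Suc n) < a/2" using reals_Archimedean[of "a/2"] a by(auto simp: inverse_eq_divide)
 let ?\<kappa> = "mol d n ?v"
 have sub2: "cbx d x b \<subseteq> fatten d K e" if xf: "x : fatten d K b'" and "b + b' <= e" for x b b' e
 proof
  obtain k where k: "k : K" "x : cbx d k b'" using xf by(auto simp: fatten_def)
  fix y assume y: "y : cbx d x b"
  have "\<bar>y i - k i\<bar> <= e" if i: "i < d" for i
  proof -
   have "\<bar>y i - x i\<bar> <= b" "\<bar>x i - k i\<bar> <= b'" using y k(2) i by(auto simp: cbx_def)
   thus ?thesis using \<open>b + b' <= e\<close> by linarith
  qed
  thus "y : fatten d K e" using y k(1) by(auto simp: fatten_def cbx_def)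
 qed
 have "?\<kappa> : test_fun d Om"
 proof (rule test_funI[OF mol_smooth[OF v] compact_fatten[OF c, of a]])
  have "fatten d (fatten d K a) a \<subseteq> fatten d K r"
  proof
   fix x assume "x : fatten d (fatten d K a) a"
   then obtain y where "y : fatten d K a" "x : cbx d y a" unfolding fatten_def[of d "fatten d K a"] by blast
   thus "x : fatten d K r" using sub2[of y a a r] by(auto simp: a_def)
  qed
  thus "fatten d (fatten d K a) a \<subseteq> Om" using r(2) by blast
  fix x assume x: "x : Rd d" "x ~: fatten d (fatten d K a) a"
  have "fatten d (fatten d K a) (1 / real (Suc n)) \<subseteq> fatten d (fatten d K a) a"
   using n a by(force simp: fatten_def[of d "fatten d K a"] cbx_def)
  thus "?\<kappa> x = 0" using x by(intro mol_zero[of d "fatten d K a"]) auto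
 qed
 moreover have one: "?\<kappa> x = 1" if x: "x : fatten d K (a/2)" for x
 proof -
  have s: "cbx d x (1 / real (Suc n)) \<subseteq> fatten d K a" using sub2[OF x, of "1 / real (Suc n)" a] n by simp
  have "?\<kappa> x = (LINT y|(leb d). of_real (mk d n x y))"
   unfolding mol_def
  proof (rule Bint_cong[OF refl])
   fix y assume "y : space (leb d)"
   thus "?v y * of_real (mk d n x y) = of_real (mk d n x y)"
   using mk_zero[of y d x n] s by(cases "y : fatten d K a") auto
  qed
  thus ?thesis using mk_integral(2)[of d n x] by simp
 qed
 moreover have "?\<kappa> x = 1 & (ALL i<d. partial i ?\<kappa> x = 0)" if x: "x : K" for x
 proof (intro conjI allI impI)
  have xR: "x : Rd d" using x KR by blast
  hence "x : cbx d x (a/2)" using a by(simp add: cbx_self)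
  thus "?\<kappa> x = 1" using x by(intro one) (auto simp: fatten_def)
  fix i assume i: "i < d"
  have v: "((%s. 1) has_vector_derivative (0::complex)) (at (x i))" by simp
  have "((%s. ?\<kappa> (x(i := s))) has_vector_derivative 0) (at (x i))"
  proof (rule has_vector_derivative_transform_within_open[OF v, where S = "ball (x i) (a/2)"])
   fix s assume s: "s : ball (x i) (a/2)"
   have "x(i := s) : cbx d x (a/2)"
   using s upd_Rd[OF xR i] a by(auto simp: cbx_def dist_real_def abs_minus_commute)
   thus "1 = ?\<kappa> (x(i := s))" using x one[of "x(i := s)"] by(auto simp: fatten_def)
  qed (use a in auto)
  thus "partial i ?\<kappa> x = 0" by(rule partial_eq)
 qed
 ultimately show ?thesis by blast
qed

text \<open>Subtracting 1 makes the composition square integrable, since |<z> - 1| <= |z|.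
  Integration by parts rests on the chain rule along each coordinate line and on continuity of the
  resulting derivative.\<close>

lemma jap_test_weak_grad:
 assumes ph: "ph : test_fun d Om"
 shows "weak_grad d Om (%x. of_real (jap (ph x) - 1)) (%i x. japd (ph x) (partial i ph x))"
  "(%x. complex_of_real (jap (ph x) - 1)) : L2 M" "!!i. i < d ==> (%x. japd (ph x) (partial i ph x)) : L2 M"
proof -
 let ?f = "%x. complex_of_real (jap (ph x) - 1)" let ?D = "%i x. japd (ph x) (partial i ph x)"
 have cf: "continuous_on (Rd d) ?f" unfolding jap_def
  by(intro continuous_intros smooth_continuous[OF test_fun_smooth[OF ph]])
 have cD: "continuous_on (Rd d) (?D i)" if "i < d" for i
  by(rule japd_continuous[OF smooth_continuous[OF test_fun_smooth[OF ph]]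
   smooth_continuous[OF test_fun_smooth[OF test_fun_partial[OF ph that]]]])
 have jm: "\<bar>jap z - 1\<bar> <= 1 * cmod z" for z using jap_ge(1,3)[of z] by simp
 show fL: "?f : L2 M"
  by(rule L2_bound(1)[OF test_L2[OF ph] meas_leb[OF continuous_measurable[OF cf]], of 1])
   (simp_all only: norm_of_real jm AE_I2 zero_le_one)
 show DL: "?D i : L2 M" if i: "i < d" for i
  by(rule L2_bound(1)[OF test_L2[OF test_fun_partial[OF ph i]] meas_leb[OF continuous_measurable[OF cD[OF i]]], of 1])
   (auto simp: japd_le)
 show "weak_grad d Om ?f ?D"
  unfolding weak_grad_def
 proof (intro conjI allI impI ballI L2_loc fL DL)
  fix i ps assume i: "i < d" and ps: "ps : test_fun d Om"
  obtain K where K: "compact K" "K \<subseteq> Om" "!!x. x : Rd d ==> x ~: K ==> ps x = 0"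
   using ps by(auto simp: test_fun_def)
  have pz: "partial i ps x = 0" if "x : Rd d" "x ~: K" for x
   by(rule partial_zero_outside[OF compact_imp_closed[OF K(1)] K(3) i that])
  have "(LINT x|(leb d). ?f x * partial i ps x + ?D i x * ps x) = 0"
  proof (rule integral_derivative_zero[where ph = "%x. ?f x * ps x" and K = K and i = i])
   show "((%s. ?f (x(i := s)) * ps (x(i := s))) has_vector_derivative ?f x * partial i ps x + ?D i x * ps x) (at (x i))"
   if x: "x : Rd d" for x
   using has_vector_derivative_mult[OF jap_deriv[OF smooth_has_derivative[OF test_fun_smooth[OF ph] i x]]
   smooth_has_derivative[OF test_fun_smooth[OF ps] i x]] by(simp only: fun_upd_triv)
   show "continuous_on (Rd d) (%x. ?f x * partial i ps x + ?D i x * ps x)"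
   by(intro continuous_on_add continuous_on_mult cf cD i smooth_continuous[OF test_fun_smooth[OF ps]]
   smooth_continuous[OF test_fun_smooth[OF test_fun_partial[OF ps i]]])
   show "K \<subseteq> Rd d" using K(2) sub by blast
  qed (use K pz i in auto)
  hence "(LINT x|M. ?f x * partial i ps x + ?D i x * ps x) = 0"
  proof -
   have "?f x * partial i ps x + ?D i x * ps x = 0" if "x : Rd d" "x ~: Om" for x
   proof -
   have "x ~: K" using that(2) K(2) by blast
   thus ?thesis using K(3)[OF that(1)] pz[OF that(1)] by simp
   qed
   from int_leb[of "%x. ?f x * partial i ps x + ?D i x * ps x", OF this] show ?thesis
   using \<open>(LINT x|(leb d). ?f x * partial i ps x + ?D i x * ps x) = 0\<close> by(rule trans)
  qed
  moreover have "(LINT x|M. ?f x * partial i ps x + ?D i x * ps x) = (LINT x|M. ?f x * partial i ps x) + (LINT x|M. ?D i x * ps x)"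
   by(intro Bint_add L2_mult_integrable fL DL i test_L2 test_fun_partial ps)
  ultimately show "(LINT x|M. ?f x * partial i ps x) = - (LINT x|M. ?D i x * ps x)"
   by(simp only: eq_neg_iff_add_eq_0)
 qed
qed

text \<open>Test functions converging to v in W^(1,2) carry the previous case over, because weak
  gradients are closed; the bound \<open>B\<close> controls the factor |u| in
  \<open>japd_diff\<close>.\<close>

lemma jap_h10_weak_grad:
 assumes h: "h10 v G" and B: "!!i. i < d ==> AE x in M. cmod (G i x) <= B"
 shows "weak_grad d Om (%x. of_real (jap (v x) - 1)) (%i x. japd (v x) (G i x))"
proof -
 obtain ph where ph: "!!n. ph n : test_fun d Om" "L2_lim M ph v"
  "!!i. i < d ==> L2_lim M (%n. partial i (ph n)) (G i)" using h10_seq[OF h] by blast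
 note vL = h10_L2(1)[OF h] and GL = h10_L2(2)[OF h]
 have fm: "(%x. complex_of_real (jap (v x) - 1)) : bm M"
  by(intro of_real_meas borel_measurable_diff measurable_compose[OF L2_measurable[OF vL] jap_measurable] borel_measurable_const)
 have fL: "(%x. complex_of_real (jap (v x) - 1)) : L2 M"
 proof (rule L2_bound(1)[OF vL fm, of 1])
  have "\<bar>jap z - 1\<bar> <= 1 * cmod z" for z using jap_ge(1,3)[of z] by simp
  thus "AE x in M. cmod (complex_of_real (jap (v x) - 1)) <= 1 * cmod (v x)" by(simp only: norm_of_real AE_I2)
 qed simp
 have DL: "(%x. japd (v x) (G i x)) : L2 M" if i: "i < d" for i
  by(rule L2_bound(1)[OF GL[OF i] japd_measurable[OF L2_measurable[OF vL] L2_measurable[OF GL[OF i]]], of 1])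
   (auto simp: japd_le)
 show ?thesis
 proof (rule weak_grad_closed[OF jap_test_weak_grad(1)[OF ph(1)] jap_test_weak_grad(2)[OF ph(1)] fL _
   jap_test_weak_grad(3)[OF ph(1)] DL])
  have d0: "(%x. ph n x - v x) : L2 M" for n by(rule L2.diff_mem[OF test_L2[OF ph(1)] vL])
  have "n2 M (%x. complex_of_real (jap (ph n x) - 1) - of_real (jap (v x) - 1)) <= 1 * n2 M (%x. ph n x - v x)" for n
  proof (rule L2_bound(2)[OF d0])
   have "cmod (complex_of_real (jap z - 1) - of_real (jap w - 1)) <= 1 * cmod (z - w)" for z w
   using jap_lipschitz[of z w] unfolding of_real_diff[symmetric] norm_of_real by simp
   thus "AE x in M. cmod (complex_of_real (jap (ph n x) - 1) - of_real (jap (v x) - 1)) <= 1 * cmod (ph n x - v x)"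
   by(simp only: AE_I2)
   show "(%x. complex_of_real (jap (ph n x) - 1) - of_real (jap (v x) - 1)) : bm M"
   by(rule borel_measurable_diff[OF L2_measurable[OF jap_test_weak_grad(2)[OF ph(1)]] fm])
  qed simp
  thus "(%n. n2 M (%x. complex_of_real (jap (ph n x) - 1) - of_real (jap (v x) - 1))) ~~> 0"
   by(intro Lim_null_comparison[OF _ ph(2)]) (simp add: n2_nonneg)
  fix i assume i: "i < d"
  have d1: "(%x. partial i (ph n) x - G i x) : L2 M" for n by(rule L2.diff_mem[OF test_L2[OF test_fun_partial[OF ph(1) i]] GL[OF i]])
  have le: "n2 M (%x. japd (ph n x) (partial i (ph n) x) - japd (v x) (G i x))
   <= n2 M (%x. partial i (ph n) x - G i x) + 2 * \<bar>B\<bar> * n2 M (%x. ph n x - v x)" for n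
  proof -
   let ?s = "%x. of_real (cmod (partial i (ph n) x - G i x)) + complex_of_real (2 * \<bar>B\<bar>) * of_real (cmod (ph n x - v x))"
   have a: "(%x. complex_of_real (cmod (f x))) : L2 M" "n2 M (%x. complex_of_real (cmod (f x))) = n2 M f" if "f : L2 M" for f
   using that L2_measurable[OF that] by(auto simp: L2_iff n2_eq intro!: of_real_meas)
   have s: "?s : L2 M" "n2 M ?s <= n2 M (%x. partial i (ph n) x - G i x) + 2 * \<bar>B\<bar> * n2 M (%x. ph n x - v x)"
   using L2.add_mem[OF a(1)[OF d1] L2.scale_mem[OF a(1)[OF d0]]]
   L2.nrm_triangle[OF a(1)[OF d1] L2.scale_mem[OF a(1)[OF d0]], of n "of_real (2 * \<bar>B\<bar>)" n]
   L2.nrm_scale[OF a(1)[OF d0], of "of_real (2 * \<bar>B\<bar>)" n] a(2)[OF d1] a(2)[OF d0] by(simp_all add: norm_mult)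
   have "n2 M (%x. japd (ph n x) (partial i (ph n) x) - japd (v x) (G i x)) <= 1 * n2 M ?s"
   proof (rule L2_bound(2)[OF s(1)])
   show "(%x. japd (ph n x) (partial i (ph n) x) - japd (v x) (G i x)) : bm M"
   by(intro borel_measurable_diff L2_measurable[OF jap_test_weak_grad(3)[OF ph(1) i]] L2_measurable[OF DL[OF i]])
   show "AE x in M. cmod (japd (ph n x) (partial i (ph n) x) - japd (v x) (G i x)) <= 1 * cmod (?s x)"
   using B[OF i]
   proof eventually_elim
   case (elim x)
   have "?s x = of_real (cmod (partial i (ph n) x - G i x) + 2 * \<bar>B\<bar> * cmod (ph n x - v x))" by simp
   hence "cmod (?s x) = cmod (partial i (ph n) x - G i x) + 2 * \<bar>B\<bar> * cmod (ph n x - v x)"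
   by(simp only: norm_of_real) simp
   moreover have "2 * cmod (ph n x - v x) * cmod (G i x) <= 2 * cmod (ph n x - v x) * \<bar>B\<bar>"
   using elim by(intro mult_left_mono) auto
   ultimately show ?case using japd_diff[of "ph n x" "partial i (ph n) x" "v x" "G i x"] by(simp add: mult_ac)
   qed
   qed simp
   thus ?thesis using s(2) by simp
  qed
  have "(%n. n2 M (%x. partial i (ph n) x - G i x) + 2 * \<bar>B\<bar> * n2 M (%x. ph n x - v x)) ~~> 0 + 2 * \<bar>B\<bar> * 0"
   by(intro tendsto_intros ph(2) ph(3)[OF i])
  hence lim: "(%n. n2 M (%x. partial i (ph n) x - G i x) + 2 * \<bar>B\<bar> * n2 M (%x. ph n x - v x)) ~~> 0" by simp
  show "(%n. n2 M (%x. japd (ph n x) (partial i (ph n) x) - japd (v x) (G i x))) ~~> 0"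
  proof (rule Lim_null_comparison[OF always_eventually lim], intro allI)
   fix n show "norm (n2 M (%x. japd (ph n x) (partial i (ph n) x) - japd (v x) (G i x)))
   <= n2 M (%x. partial i (ph n) x - G i x) + 2 * \<bar>B\<bar> * n2 M (%x. ph n x - v x)"
   using le[of n] by(simp only: real_norm_def abs_of_nonneg[OF n2_nonneg])
  qed
 qed auto
qed

lemma loc_integrable_le:
 assumes f: "loc_integrable d Om f" and g: "g : bm M" "AE x in M. cmod (g x) <= cmod (f x)"
 shows "loc_integrable d Om g"
 unfolding loc_integrable_def
proof (intro conjI g allI impI)
 fix K assume K: "compact K & K \<subseteq> Om"
 have KR: "K : sets (leb d)" using K sub compact_sets_leb by blast
 have i: "integrable (leb d) (%x. indicator K x *\<^sub>R f x)" using f K by(simp add: loc_integrable_def set_integrable_def)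
 have m: "(%x. indicator K x *\<^sub>R (indicator Om x *\<^sub>R g x)) : bm (leb d)"
  by(rule borel_measurable_scaleR[OF borel_measurable_indicator[OF KR] g(1)[unfolded leb_on_meas[OF O]]])
 have e: "(%x. indicator K x *\<^sub>R (indicator Om x *\<^sub>R g x)) = (%x. indicator K x *\<^sub>R g x)"
 proof
  fix x show "indicator K x *\<^sub>R (indicator Om x *\<^sub>R g x) = indicator K x *\<^sub>R g x"
   using K by(cases "x : K") auto
 qed
 show "set_integrable (leb d) K g" unfolding set_integrable_def
 proof (rule Bintble_bound[OF i m[unfolded e]])
  show "AE x in leb d. norm (indicator K x *\<^sub>R g x) <= norm (indicator K x *\<^sub>R f x)"
   using g(2) K unfolding leb_on_AE[OF O] by(auto elim!: eventually_mono simp: indicator_def)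
 qed
qed

text \<open>Against a fixed test function only values on its support K matter. There Q can be
  replaced by \<kappa> Q with \<kappa> = 1 and vanishing gradient on K; this product lies in
  W^(1,2)_0 and has a bounded gradient.\<close>

lemma jap_weak_grad:
 assumes w: "weak_grad d Om Q V" and b: "locbd Q V"
 shows "weak_grad d Om (%x. of_real (jap (Q x) - 1)) (%i x. japd (Q x) (V i x))"
 unfolding weak_grad_def
proof (intro conjI allI impI ballI)
 have Qm: "Q : bm M" and Vm: "i < d ==> V i : bm M" for i
  using weak_gradD(1,2)[OF w] by(auto simp: loc_integrable_def)
 show "loc_integrable d Om (%x. of_real (jap (Q x) - 1))"
 proof (rule loc_integrable_le[OF weak_gradD(1)[OF w]])
  show "(%x. complex_of_real (jap (Q x) - 1)) : bm M"
   by(intro of_real_meas borel_measurable_diff measurable_compose[OF Qm jap_measurable] borel_measurable_const)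
  have "\<bar>jap z - 1\<bar> <= cmod z" for z using jap_ge(1,3)[of z] by simp
  thus "AE x in M. cmod (complex_of_real (jap (Q x) - 1)) <= cmod (Q x)" by(simp only: norm_of_real AE_I2)
 qed
 fix i assume i: "i < d"
 show "loc_integrable d Om (%x. japd (Q x) (V i x))"
  by(rule loc_integrable_le[OF weak_gradD(2)[OF w i] japd_measurable[OF Qm Vm[OF i]]]) (simp add: japd_le)
 fix ps assume ps: "ps : test_fun d Om"
 obtain K where K: "compact K" "K \<subseteq> Om" "!!x. x : Rd d ==> x ~: K ==> ps x = 0" using ps by(auto simp: test_fun_def)
 have pz: "partial i ps x = 0" if "x : Rd d" "x ~: K" for x
  by(rule partial_zero_outside[OF compact_imp_closed[OF K(1)] K(3) i that])
 obtain \<kappa> where \<kappa>: "\<kappa> : test_fun d Om" "!!x. x : K ==> \<kappa> x = 1" "!!x i. x : K ==> i < d ==> partial i \<kappa> x = 0"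
  using cutoff[OF K(1,2)] by blast
 let ?v = "%x. \<kappa> x * Q x" let ?G = "%i x. \<kappa> x * V i x + partial i \<kappa> x * Q x"
 have h: "h10 ?v ?G" by(rule test_mult_h10[OF w b \<kappa>(1)])
 obtain L where L: "compact L" "L \<subseteq> Om" "!!x. x : Rd d ==> x ~: L ==> \<kappa> x = 0" using \<kappa>(1) by(auto simp: test_fun_def)
 obtain B where B: "B >= 0" "AE x in M. x : L --> cmod (Q x) <= B & (ALL i<d. cmod (V i x) <= B)"
  using b L(1,2) unfolding locbd_def by blast
 have "EX C. ALL j<d. AE x in M. cmod (?G j x) <= C"
 proof -
  obtain c where c: "c >= 0" "!!x. x : Rd d ==> cmod (\<kappa> x) <= c" using test_fun_props(2)[OF \<kappa>(1) sub] by blast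
  have "ALL j. EX c>=0. j < d --> (ALL x:Rd d. cmod (partial j \<kappa> x) <= c)"
   using test_fun_props(2)[OF test_fun_partial[OF \<kappa>(1)] sub] by(metis order_refl)
  then obtain cj where cj: "!!j. cj j >= 0" "!!j x. j < d ==> x : Rd d ==> cmod (partial j \<kappa> x) <= cj j" by metis
  have "AE x in M. cmod (?G j x) <= c * B + (\<Sum>j<d. cj j) * B" if j: "j < d" for j
   using B(2) AE_space
  proof eventually_elim
   case (elim x)
   hence x: "x : Rd d" using space_M sub by auto
   have "cj j <= (\<Sum>j<d. cj j)" using j cj(1) by(intro member_le_sum) auto
   hence cs: "cmod (partial j \<kappa> x) <= (\<Sum>j<d. cj j)" "0 <= (\<Sum>j<d. cj j)" using cj(2)[OF j x] cj(1) by(auto intro: sum_nonneg)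
   show ?case
   proof (cases "x : L")
   case True
   hence "cmod (\<kappa> x) * cmod (V j x) <= c * B" "cmod (partial j \<kappa> x) * cmod (Q x) <= (\<Sum>j<d. cj j) * B"
   using elim c(2)[OF x] c(1) cs j by(auto intro!: mult_mono)
   thus ?thesis using norm_triangle_ineq[of "\<kappa> x * V j x" "partial j \<kappa> x * Q x"] by(simp add: norm_mult)
   next
   case False
   have "partial j \<kappa> x = 0" by(rule partial_zero_outside[OF compact_imp_closed[OF L(1)] L(3) j x False])
   thus ?thesis using L(3)[OF x False] c(1) cs(2) B(1) by simp
   qed
  qed
  thus ?thesis by blast
 qed
 then obtain C where C: "!!j. j < d ==> AE x in M. cmod (?G j x) <= C" by blast
 note wg = weak_gradD(3)[OF jap_h10_weak_grad[OF h C] i ps]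
 have "(LINT x|M. complex_of_real (jap (Q x) - 1) * partial i ps x) = (LINT x|M. of_real (jap (?v x) - 1) * partial i ps x)"
  "(LINT x|M. japd (Q x) (V i x) * ps x) = (LINT x|M. japd (?v x) (?G i x) * ps x)"
 proof (rule Bint_cong[OF refl], goal_cases)
  case (1 x)
  hence "x : Rd d" using space_M sub by auto
  thus ?case using pz[of x] \<kappa>(2)[of x] by(cases "x : K") simp_all
 next
  show "(LINT x|M. japd (Q x) (V i x) * ps x) = (LINT x|M. japd (?v x) (?G i x) * ps x)"
  proof (rule Bint_cong[OF refl])
   fix x assume "x : space M"
   hence "x : Rd d" using space_M sub by auto
   thus "japd (Q x) (V i x) * ps x = japd (?v x) (?G i x) * ps x"
   using K(3)[of x] \<kappa>(2)[of x] \<kappa>(3)[of x i, OF _ i] by(cases "x : K") simp_all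
  qed
 qed
 thus "(LINT x|M. complex_of_real (jap (Q x) - 1) * partial i ps x) = - (LINT x|M. japd (Q x) (V i x) * ps x)"
  using wg by(simp only:)
qed

end

section \<open>Admissible potentials\<close>

text \<open>For |t| < 1 the exponent satisfies 1/(1+t) + 1/(1-t) = 2/(1-t^2) >= 2, with equality at
  0. Division by the value at 0 therefore produces cut-offs with values in [0,1].\<close>

lemma moll_base_le: "moll_base t <= moll_base 0"
proof (cases "\<bar>t\<bar> < 1")
 case True
 hence p: "1 + t > 0" "1 - t > 0" "0 < 1 - t\<^sup>2" by(auto simp: abs_square_less_1)
 have "2 <= 1 / (1 + t) + 1 / (1 - t)"
 proof -
  have "1 / (1 + t) + 1 / (1 - t) = 2 / (1 - t\<^sup>2)" using p by(simp add: field_simps power2_eq_square)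
  also have "... >= 2 / 1" using p by(intro divide_left_mono) auto
  finally show ?thesis by simp
 qed
 hence "exp (- (1 / (1 + t)) + - (1 / (1 - t))) <= exp (-2)" by simp
 hence "exp (- (1 / (1 + t))) * exp (- (1 / (1 - t))) <= exp (-2)" by(simp only: exp_add)
 moreover have "exp (-1) * exp (-1) = exp (-2 :: real)" by(simp add: exp_add[symmetric])
 ultimately show ?thesis using p by(simp add: moll_base_def flat_def)
next
 case False
 hence "moll_base t = 0" by(cases "t > 0") (auto simp: moll_base_def flat0_zero)
 thus ?thesis using moll_base_props(1) by simp
qed

text \<open>Dilated tensor bumps. The dilation absorbs d, so the Euclidean length of the gradient is
  at most 1 in every dimension; this keeps the separation constant free of d. The supports are
  bounded but may meet the boundary of a domain, in line with potentials that are bounded on bounded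
  subsets up to the boundary.\<close>

lemma cutoff_seq:
 "EX th :: nat => pt => real. ALL n. smooth d (%x. of_real (th n x)) & (ALL x. 0 <= th n x & th n x <= 1) &
   (ALL x:Rd d. L2_set (%i. cmod (partial i (%x. of_real (th n x)) x)) {..<d} <= 1) &
   (EX r. ALL x:Rd d. r < L2_set x {..<d} --> th n x = 0 & (ALL i<d. partial i (%x. of_real (th n x)) x = 0)) &
   (ALL x:Rd d. (%n. th n x) ~~> 1)"
proof -
 obtain L where L: "L >= 0" "!!t. \<bar>deriv moll_base t\<bar> <= L" using bump1_bounded[OF bump1_deriv[OF bump1_moll_base]] by blast
 define m0 where "m0 = moll_base 0"
 have m0: "m0 > 0" using moll_base_props(3) by(simp add: m0_def)
 \<comment> \<open>Each partial derivative is at most L / (m0 s n), so their sum is at most (d L /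
   m0) / s n <= 1. The summand 1 keeps s n positive when d L = 0.\<close>
 define s where "s n = real (Suc n) * (real d * L / m0 + 1)" for n
 have s: "s n > 0" "real d * L / m0 <= s n" for n
 proof -
  have c: "real d * L / m0 >= 0" using L(1) m0 by simp
  show "s n > 0" unfolding s_def by(rule mult_pos_pos) (use c in linarith)+
  have "1 * (real d * L / m0 + 1) <= s n" unfolding s_def using c by(intro mult_right_mono) auto
  thus "real d * L / m0 <= s n" by simp
 qed
 define g where "g n t = (1 / m0) * moll_base (1 / s n * t + 0) + 0 * moll_base (1 / s n * t + 0)" for n t
 have gs: "g n t = moll_base (t / s n) / m0" for n t by(simp add: g_def)
 have b: "bump1 (s n) (g n)" for n
 proof -
  have "sm1 k (g n)" for k unfolding g_def
   using bump1_moll_base by(intro sm1_lin sm1_affine) (auto simp: bump1_def smooth1_def)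
  moreover have "g n t = 0" if "\<bar>t\<bar> > s n" for t
  proof -
   have "\<bar>t / s n\<bar> > 1" using that s(1)[of n] by(simp only: abs_divide abs_of_pos less_divide_eq_1_pos)
   thus ?thesis using bump1_moll_base by(simp add: gs bump1_def)
  qed
  ultimately show ?thesis by(simp add: bump1_def smooth1_def)
 qed
 have g01: "0 <= g n t" "g n t <= 1" for n t
  using m0 moll_base_props(1) moll_base_le[of "t / s n"] by(auto simp: gs m0_def)
 have dg: "\<bar>deriv (g n) t\<bar> <= L / (m0 * s n)" for n t
 proof -
  have D: "(moll_base has_real_derivative deriv moll_base u) (at u)" for u
   using bump1_moll_base smooth1_deriv(1) by(auto simp: bump1_def)
  have "((%t. moll_base (t / s n)) has_real_derivative deriv moll_base (t / s n) * (1 / s n)) (at t)"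
   by(rule DERIV_chain2[OF D]) (use s(1)[of n] in \<open>auto intro!: derivative_eq_intros\<close>)
  hence "(g n has_real_derivative deriv moll_base (t / s n) * (1 / s n) / m0) (at t)"
   unfolding gs[abs_def] by(rule DERIV_cdivide)
  hence "deriv (g n) t = deriv moll_base (t / s n) / (m0 * s n)" by(subst DERIV_imp_deriv) (auto simp: field_simps)
  moreover have "\<bar>deriv moll_base (t / s n) / (m0 * s n)\<bar> = \<bar>deriv moll_base (t / s n)\<bar> / (m0 * s n)"
   using m0 s(1)[of n] by(simp add: abs_mult)
  ultimately show ?thesis using L(2)[of "t / s n"] m0 s(1)[of n] by(simp add: divide_right_mono)
 qed
 define z where "z = (%i. if i < d then 0 else undefined :: real)"
 have zR: "z : Rd d" by(simp add: z_def mem_Rd)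
 define th where "th n x = (\<Prod>i<d. g n (x i - z i))" for n x
 have 1: "smooth d (%x. of_real (th n x))" for n
  unfolding th_def by(rule tensor_smooth(1)[of d "s n" "%_. g n", OF b zR])
 have 2: "0 <= th n x & th n x <= 1" for n x
  unfolding th_def using g01 by(auto intro!: prod_nonneg prod_le_1)
 have 3: "L2_set (%i. cmod (partial i (%x. of_real (th n x)) x)) {..<d} <= 1" if x: "x : Rd d" for n x
 proof -
  have "cmod (partial i (%x. of_real (th n x)) x) <= L / (m0 * s n)" if i: "i < d" for i
  proof -
   have "partial i (%x. of_real (th n x)) x = of_real (\<Prod>j<d. ((%_. g n)(i := deriv (g n))) j (x j - z j))"
   unfolding th_def using tensor_smooth(2)[of d "s n" "%_. g n" z i x, OF b zR i x] by simp
   moreover have "\<bar>\<Prod>j<d. ((%_. g n)(i := deriv (g n))) j (x j - z j)\<bar> <= \<bar>deriv (g n) (x i - z i)\<bar> * 1"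
   proof -
   have "(\<Prod>j<d. ((%_. g n)(i := deriv (g n))) j (x j - z j)) = deriv (g n) (x i - z i) * (\<Prod>j\<in>{..<d} - {i}. g n (x j - z j))"
   using i by(subst prod.remove[of "{..<d}" i]) (auto intro!: prod.cong)
   moreover have "\<bar>\<Prod>j\<in>{..<d} - {i}. g n (x j - z j)\<bar> <= 1"
   unfolding abs_prod using g01 by(intro prod_le_1) (auto simp: abs_le_iff)
   ultimately show ?thesis by(simp only: abs_mult) (intro mult_left_mono, auto)
   qed
   ultimately show ?thesis using dg[of n "x i - z i"] by(simp only: norm_of_real)
  qed
  hence "(\<Sum>i<d. cmod (partial i (%x. of_real (th n x)) x)) <= (\<Sum>i<d. L / (m0 * s n))" by(intro sum_mono) auto
  also have "... = (real d * L / m0) / s n" by simp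
  also have "... <= 1" using s[of n] by(simp only: divide_le_eq_1_pos)
  finally show ?thesis using L2_set_le_sum[of "{..<d}" "%i. cmod (partial i (%x. of_real (th n x)) x)"] by simp
 qed
 have 4: "EX r. ALL x:Rd d. r < L2_set x {..<d} --> th n x = 0 & (ALL i<d. partial i (%x. of_real (th n x)) x = 0)" for n
 proof (intro exI[of _ "real d * s n"] ballI impI)
  fix x assume x: "x : Rd d" and r: "real d * s n < L2_set x {..<d}"
  let ?K = "{y : Rd d. ALL i<d. \<bar>y i\<bar> <= s n}"
  have xK: "x ~: ?K"
  proof
   assume "x : ?K"
   hence "(\<Sum>i<d. \<bar>x i\<bar>) <= (\<Sum>i<d. s n)" by(intro sum_mono) auto
   moreover have "L2_set x {..<d} <= (\<Sum>i<d. \<bar>x i\<bar>)" by(rule L2_set_le_sum_abs)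
   ultimately show False using r by simp
  qed
  have z0: "th n y = 0" if "y : Rd d" "y ~: ?K" for y
  proof -
   obtain i where "i < d" "\<bar>y i\<bar> > s n" using \<open>y : Rd d\<close> \<open>y ~: ?K\<close> by auto
   hence "g n (y i - z i) = 0" using b[of n] by(simp add: z_def bump1_def)
   thus ?thesis unfolding th_def using \<open>i < d\<close> by(intro prod_zero) auto
  qed
  show "th n x = 0 & (ALL i<d. partial i (%x. of_real (th n x)) x = 0)"
  proof (intro conjI allI impI)
   have z1: "complex_of_real (th n y) = 0" if "y : Rd d" "y ~: ?K" for y using z0[OF that] by simp
   show "partial i (%x. of_real (th n x)) x = 0" if "i < d" for i
   by(rule partial_zero_outside[where ph = "%x. of_real (th n x)", OF compact_imp_closed[OF compact_cube[of d "s n"]] z1 that x xK])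
  qed (rule z0[OF x xK])
 qed
 have 5: "(%n. th n x) ~~> 1" if "x : Rd d" for x
 proof -
  have "(%n. g n (x i - z i)) ~~> 1" for i
  proof -
   have "(%n. (x i - z i) / (real d * L / m0 + 1) * inverse (real (Suc n))) ~~> (x i - z i) / (real d * L / m0 + 1) * 0"
   by(intro tendsto_intros LIMSEQ_inverse_real_of_nat)
   hence "(%n. (x i - z i) / s n) ~~> 0" by(simp add: s_def divide_inverse mult_ac)
   hence "(%n. moll_base ((x i - z i) / s n)) ~~> moll_base 0"
   by(rule isCont_tendsto_compose[OF bump1_continuous[OF bump1_moll_base]])
   hence "(%n. moll_base ((x i - z i) / s n) / m0) ~~> moll_base 0 / m0" by(intro tendsto_divide tendsto_const) (use m0 in auto)
   thus ?thesis using m0 by(simp add: gs m0_def)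
  qed
  hence "(%n. \<Prod>i<d. g n (x i - z i)) ~~> (\<Prod>i<d. 1)" by(intro tendsto_prod)
  thus ?thesis by(simp add: th_def)
 qed
 show ?thesis using 1 2 3 4 5 by(intro exI[of _ th]) blast
qed

lemma (in domain) weak_grad_const: "weak_grad d Om (%_. 1) (%_ _. 0)"
 unfolding weak_grad_def
proof (intro conjI allI impI ballI)
 show "loc_integrable d Om (%_. 1)" unfolding loc_integrable_def
 proof (intro conjI allI impI)
  fix K assume K: "compact K & K \<subseteq> Om"
  have KR: "K \<subseteq> Rd d" using K sub by blast
  show "set_integrable (leb d) K (%_. 1 :: complex)"
   unfolding set_integrable_def using emeasure_compact_finite[of K d] compact_sets_leb[of K d] K KR
   by(intro integrable_scaleR_left integrable_real_indicator) auto
 qed auto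
 show "loc_integrable d Om (%_. 0)" by(simp add: loc_integrable_def set_integrable_def)
 fix i ph assume i: "i < d" and ph: "ph : test_fun d Om"
 obtain K where K: "compact K" "K \<subseteq> Om" "!!x. x : Rd d ==> x ~: K ==> ph x = 0" using ph by(auto simp: test_fun_def)
 have "(LINT x|(leb d). partial i ph x) = 0"
 proof (rule integral_derivative_zero[where ph = ph and K = K and i = i, OF K(1)])
  show "partial i ph x = 0" if "x : Rd d" "x ~: K" for x
   by(rule partial_zero_outside[OF compact_imp_closed[OF K(1)] K(3) i that])
  show "continuous_on (Rd d) (partial i ph)" by(rule smooth_continuous[OF test_fun_smooth[OF test_fun_partial[OF ph i]]])
  show "((%s. ph (x(i := s))) has_vector_derivative partial i ph x) (at (x i))" if "x : Rd d" for x
   by(rule smooth_has_derivative[OF test_fun_smooth[OF ph] i that])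
 qed (use K sub i in auto)
 thus "(LINT x|M. 1 * partial i ph x) = - (LINT x|M. 0 * ph x)"
  using int_leb[of "partial i ph", OF test_fun_props(5)[OF test_fun_partial[OF ph i] sub]] by simp
qed

locale adm = domain +
 fixes Q :: "pt => complex" and e m :: real
 assumes adm: "admissible d Om Q e m"
begin

abbreviation "V i x \<equiv> grad d Om Q i x"
abbreviation "jp x \<equiv> jap (Q x)"

text \<open>By 2 - sqrt 2 < 1 one has e < 1, which is what absorbs the cross terms in the separation
  argument.\<close>

lemma em: "0 <= e" "e < 1" "0 <= m"
proof -
 have "1 < sqrt 2" by simp
 thus "0 <= e" "e < 1" "0 <= m" using adm unfolding admissible_def by linarith+
qed

lemma Q_weak: "weak_grad d Om Q (grad d Om Q)"
 using adm by(intro weak_grad_grad) (auto simp: admissible_def W1inf_loc_def)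

lemma Q_meas: "Q : bm M"
 using weak_gradD(1,2)[OF Q_weak] by(auto simp: loc_integrable_def)

lemma jp_meas: "(%x. jp x) : bm M"
 by(rule measurable_compose[OF Q_meas jap_measurable])

lemma Q_bounded: "EX C>=0. AE x in M. L2_set x {..<d} <= r --> cmod (Q x) <= C & (ALL i<d. cmod (V i x) <= C)"
proof -
 obtain C where C: "AE x in M. L2_set x {..<d} <= r --> cmod (Q x) <= C & grad_length d Om Q x <= C"
  using adm unfolding admissible_def W1inf_loc_def by blast
 have "AE x in M. L2_set x {..<d} <= r --> cmod (Q x) <= \<bar>C\<bar> & (ALL i<d. cmod (V i x) <= \<bar>C\<bar>)"
  using C
 proof eventually_elim
  case (elim x)
  have "cmod (V i x) <= grad_length d Om Q x" if "i < d" for i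
   unfolding grad_length_def using member_le_L2_set[of "{..<d}" i "%i. cmod (V i x)"] that by simp
  hence "ALL i<d. L2_set x {..<d} <= r --> cmod (V i x) <= \<bar>C\<bar>" using elim abs_ge_self[of C] by(meson order_trans)
  moreover have "L2_set x {..<d} <= r --> cmod (Q x) <= \<bar>C\<bar>" using elim abs_ge_self[of C] by linarith
  ultimately show ?case by blast
 qed
 thus ?thesis by(intro exI[of _ "\<bar>C\<bar>"]) simp
qed

text \<open>From here on |Q| is replaced by \<open>jp\<close>, a larger weight that is bounded below
  by 1 and inherits a weak gradient no longer than that of Q.\<close>

lemma Q_AE: "AE x in M. 0 <= Re (Q x) & grad_length d Om Q x <= e * jp x powr (3/2) + m"
proof -
 have "AE x in M. 0 <= Re (Q x) & grad_length d Om Q x <= e * cmod (Q x) powr (3/2) + m"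
  using adm by(simp add: admissible_def)
 thus ?thesis
 proof eventually_elim
  case (elim x)
  have "cmod (Q x) powr (3/2) <= jp x powr (3/2)" by(intro powr_mono2 jap_ge) auto
  from mult_left_mono[OF this em(1)] show ?case using elim by linarith
 qed
qed

lemma Q_locbd: "locbd Q (grad d Om Q)"
 unfolding locbd_def
proof (intro allI impI)
 fix K assume K: "compact K & K \<subseteq> Om"
 have KR: "K \<subseteq> Rd d" using K sub by blast
 obtain r where r: "r > 0" "K \<subseteq> {y : Rd d. ALL i<d. \<bar>y i\<bar> <= r}" using compact_subset_cube[of K d] K KR by blast
 have le: "L2_set x {..<d} <= real d * r" if "x : K" for x
 proof -
  have "(\<Sum>i<d. \<bar>x i\<bar>) <= (\<Sum>i<d. r)" using r(2) that by(intro sum_mono) auto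
  thus ?thesis using L2_set_le_sum_abs[of x "{..<d}"] by simp
 qed
 obtain C where C: "C >= 0" "AE x in M. L2_set x {..<d} <= real d * r --> cmod (Q x) <= C & (ALL i<d. cmod (V i x) <= C)"
  using Q_bounded[of "real d * r"] by blast
 thus "EX B>=0. AE x in M. x : K --> cmod (Q x) <= B & (ALL i<d. cmod (V i x) <= B)"
  using le by(intro exI[of _ C]) (auto elim!: eventually_mono)
qed

lemma jp_weak: "weak_grad d Om (%x. of_real (jp x)) (%i x. japd (Q x) (V i x))"
 using weak_grad_lin[OF jap_weak_grad[OF Q_weak Q_locbd] weak_grad_const, of 1 1] by simp

text \<open>The weight |Q|^(1/2) of the form domain is replaced by <Q>^(1/2). As <Q> lies between
  |Q| and 1 + |Q|, the domain stays the same, while the weighted norm alone now dominates the L2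
  norm.\<close>

definition sq :: "(pt => complex) => pt => complex" where
 "sq u x = of_real (sqrt (jp x)) * u x"

lemma sqrt_jp_meas: "(%x. sqrt (jp x)) : bm M"
 by(rule measurable_compose[OF jp_meas borel_measurable_sqrt])

lemma sqrt_Q_meas: "(%x. sqrt (cmod (Q x))) : bm M"
 by(rule measurable_compose[OF measurable_compose[OF Q_meas borel_measurable_continuous_onI[OF continuous_on_norm[OF continuous_on_id]]] borel_measurable_sqrt])

lemma jp_mult_meas: "f : bm M ==> sq f : bm M"
 "f : bm M ==> (%x. of_real (jp x) * f x) : bm M"
proof -
 assume f: "f : bm M"
 show "sq f : bm M" unfolding sq_def[abs_def] by(rule borel_measurable_times[OF of_real_meas[OF sqrt_jp_meas] f])
 show "(%x. of_real (jp x) * f x) : bm M" by(rule borel_measurable_times[OF of_real_meas[OF jp_meas] f])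
qed

lemma sqrt_jp: "1 <= sqrt (jp x)" "sqrt (jp x) <= jp x" "sqrt (jp x) * sqrt (jp x) = jp x"
proof -
 show 1: "1 <= sqrt (jp x)" using jap_ge(1)[of "Q x"] by simp
 show 2: "sqrt (jp x) * sqrt (jp x) = jp x" using jap_ge(4)[of "Q x"] by simp
 show "sqrt (jp x) <= jp x" using mult_left_mono[OF 1, of "sqrt (jp x)"] 1 unfolding 2 by simp
qed

lemma form_dom_iff: "f : form_dom d Om Q \<longleftrightarrow> f : W12_0 d Om & sq f : L2 M"
proof
 assume f: "f : form_dom d Om Q"
 hence L: "f : L2 M" "(%x. of_real (sqrt (cmod (Q x))) * f x) : L2 M" by(auto simp: form_dom_def)
 have i: "integrable M (%x. (cmod (f x))^2 + (cmod (of_real (sqrt (cmod (Q x))) * f x))^2)"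
  using L by(intro Bintble_add) (simp_all add: L2_iff)
 have "sq f : L2 M" unfolding L2_iff
 proof (intro conjI Bintble_bound[OF i])
  show "sq f : bm M" by(rule jp_mult_meas(1)[OF L2_measurable[OF L(1)]])
  thus "(%x. (cmod (sq f x))^2) : bm M" by measurable
  have "(cmod (sq f x))^2 <= (cmod (f x))^2 + (cmod (of_real (sqrt (cmod (Q x))) * f x))^2" for x
  proof -
   have "(cmod (sq f x))^2 = jp x * (cmod (f x))^2"
   using jap_ge(4)[of "Q x"] by(simp add: sq_def norm_mult power_mult_distrib)
   also have "... <= (1 + cmod (Q x)) * (cmod (f x))^2" by(intro mult_right_mono jap_ge) simp
   finally show ?thesis by(simp add: norm_mult power_mult_distrib distrib_right)
  qed
  thus "AE x in M. norm ((cmod (sq f x))^2) <= norm ((cmod (f x))^2 + (cmod (of_real (sqrt (cmod (Q x))) * f x))^2)"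
   by(intro AE_I2) (simp add: abs_of_nonneg add_nonneg_nonneg del: norm_mult)
 qed
 thus "f : W12_0 d Om & sq f : L2 M" using f by(simp add: form_dom_def)
next
 assume f: "f : W12_0 d Om & sq f : L2 M"
 hence L: "f : L2 M" using W12_0_iff h10_L2(1) by blast
 have "(%x. of_real (sqrt (cmod (Q x))) * f x) : L2 M"
 proof (rule L2_bound(1)[of "sq f" M _ 1])
  show "(%x. of_real (sqrt (cmod (Q x))) * f x) : bm M"
   by(rule borel_measurable_times[OF of_real_meas[OF sqrt_Q_meas] L2_measurable[OF L]])
  have "sqrt (cmod (Q x)) * cmod (f x) <= sqrt (jp x) * cmod (f x)" for x by(intro mult_right_mono real_sqrt_le_mono jap_ge) simp
  thus "AE x in M. cmod (of_real (sqrt (cmod (Q x))) * f x) <= 1 * cmod (sq f x)"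
   using sqrt_jp(1) by(intro AE_I2) (simp add: sq_def norm_mult abs_of_nonneg order_trans[OF zero_le_one])
 qed (use f in auto)
 thus "f : form_dom d Om Q" using f L by(simp add: form_dom_def)
qed

abbreviation "VV \<equiv> form_dom d Om Q"

definition tv :: "nat => (pt => complex) => pt => complex" where
 "tv k f = (if k < d then grad d Om f k else sq f)"

lemma VV_h10: "f : VV ==> h10 f (grad d Om f)"
 using form_dom_iff W12_0_grad by blast

lemma VV_L2: "f : VV ==> f : L2 M" "f : VV ==> i < d ==> grad d Om f i : L2 M" "f : VV ==> sq f : L2 M"
 using VV_h10 h10_L2 form_dom_iff by blast+

lemma VV_I: "h10 f G ==> sq f : L2 M ==> f : VV"
 using form_dom_iff W12_0_iff by blast

sublocale Vsp: graph_space M "{..d}" VV tv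
proof
 have s0: "sq (%x. 0) = (%x. 0)" by(rule ext) (simp add: sq_def)
 show "(%x. 0) : VV" by(rule VV_I[OF h10_test[OF test_fun_zero]]) (simp add: s0 L2_zero)
 fix f g a b assume f: "f : VV" and g: "g : VV"
 have sl: "sq (%x. a * f x + b * g x) = (%x. a * sq f x + b * sq g x)" by(rule ext) (simp add: sq_def algebra_simps)
 have h: "h10 (%x. a * f x + b * g x) (%i x. a * grad d Om f i x + b * grad d Om g i x)"
  by(rule h10_lin[OF VV_h10[OF f] VV_h10[OF g]])
 show "(%x. a * f x + b * g x) : VV"
  by(rule VV_I[OF h]) (simp only: sl L2_lin VV_L2(3)[OF f] VV_L2(3)[OF g])
 show "AE x in M. tv k (%y. a * f y + b * g y) x = a * tv k f x + b * tv k g x" for k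
  using h10_grad[OF h, of k] by(simp add: tv_def sl)
next
 fix F :: "nat => pt => complex" and h
 assume F: "!!n. F n : VV" and h: "!!k. k : {..d} ==> h k : L2 M"
  and lim: "!!k. k : {..d} ==> L2_lim M (%n. tv k (F n)) (h k)"
 \<comment> \<open>The limit of the weighted functions determines the limit function: the weight is
   at least 1 and can be divided out without losing convergence.\<close>
 define f where "f x = of_real (1 / sqrt (jp x)) * h d x" for x
 have hd: "h d : L2 M" using h by simp
 have inv: "1 / sqrt (jp x) <= 1" "0 <= 1 / sqrt (jp x)" for x using sqrt_jp(1)[of x] by(auto simp: divide_le_eq_1 intro: order_trans[OF zero_le_one])
 have c1: "cmod (of_real (1 / sqrt (jp x)) * y) <= 1 * cmod y" for x y
  unfolding norm_mult norm_of_real abs_of_nonneg[OF inv(2)] by(intro mult_right_mono inv) simp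
 have fm: "f : bm M" unfolding f_def
  by(intro borel_measurable_times of_real_meas borel_measurable_divide borel_measurable_const sqrt_jp_meas L2_measurable[OF hd])
 have fL: "f : L2 M"
  by(rule L2_bound(1)[OF hd fm, of 1]) (simp_all only: f_def c1 AE_I2 zero_le_one)
 have sf: "sq f = h d"
 proof
  fix x have "sqrt (jp x) ~= 0" using sqrt_jp(1)[of x] by linarith
  thus "sq f x = h d x" by(simp add: sq_def f_def)
 qed
 have 1: "L2_lim M F f"
 proof (rule Lim_null_comparison[OF always_eventually])
  show "L2_lim M (%n. sq (F n)) (h d)" using lim[of d] by(simp add: tv_def)
  show "ALL n. norm (n2 M (%x. F n x - f x)) <= n2 M (%x. sq (F n) x - h d x)"
  proof
   fix n
   have "n2 M (%x. F n x - f x) <= 1 * n2 M (%x. sq (F n) x - h d x)"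
   proof (rule L2_bound(2)[OF L2.diff_mem[OF VV_L2(3)[OF F] hd]])
   have "F n x - f x = of_real (1 / sqrt (jp x)) * (sq (F n) x - h d x)" for x
   proof -
   have "sqrt (jp x) ~= 0" using sqrt_jp(1)[of x] by linarith
   thus ?thesis by(simp add: sq_def f_def field_simps)
   qed
   thus "AE x in M. cmod (F n x - f x) <= 1 * cmod (sq (F n) x - h d x)" by(simp only: c1 AE_I2)
   qed (use L2_measurable[OF VV_L2(1)[OF F]] fm in \<open>auto intro: borel_measurable_diff\<close>)
   thus "norm (n2 M (%x. F n x - f x)) <= n2 M (%x. sq (F n) x - h d x)" by(simp add: n2_nonneg)
  qed
 qed
 have hh: "h10 f h"
 proof (rule h10_closed[OF VV_h10[OF F] fL _ 1])
  show "L2_lim M (%n. grad d Om (F n) i) (h i)" if "i < d" for i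
   using lim[of i] that by(simp add: tv_def)
 qed (use h in auto)
 have "f : VV" by(rule VV_I[OF hh]) (simp add: sf hd)
 moreover have "AE x in M. tv k f x = h k x" if "k <= d" for k
  using h10_grad[OF hh, of k] that by(cases "k < d") (auto simp: tv_def sf)
 ultimately show "EX f:VV. ALL k:{..d}. AE x in M. tv k f x = h k x" by auto
qed (auto simp: tv_def VV_L2)

end

lemma L2_prod:
 assumes "f : L2 M" "g : L2 M"
 shows "integrable M (%x. cmod (f x) * cmod (g x))" "(LINT x|M. cmod (f x) * cmod (g x)) <= n2 M f * n2 M g"
proof -
 have i: "integrable M (%x. cmod (f x * g x))" by(rule integrable_norm[OF L2_mult_integrable[OF assms]])
 thus "integrable M (%x. cmod (f x) * cmod (g x))" by(simp only: norm_mult)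
 have L: "(%x. of_real (cmod (h x)) :: complex) : L2 M" if "h : L2 M" for h
  by(rule L2_bound(1)[OF that of_real_meas[OF measurable_compose[OF L2_measurable[OF that] borel_measurable_norm]], of 1]) auto
 have "cmod (L2_inner M (%x. of_real (cmod (f x))) (%x. of_real (cmod (g x))))
   <= n2 M (%x. of_real (cmod (f x))) * n2 M (%x. of_real (cmod (g x)))"
  by(rule L2.cauchy_schwarz[OF L[OF assms(1)] L[OF assms(2)]])
 moreover have "L2_inner M (%x. of_real (cmod (f x))) (%x. of_real (cmod (g x))) = of_real (LINT x|M. cmod (f x) * cmod (g x))"
  unfolding L2_inner_def complex_cnj_complex_of_real of_real_mult[symmetric] by(rule integral_of_real[OF i[unfolded norm_mult]])
 moreover have "n2 M (%x. of_real (cmod (h x))) = n2 M h" for h :: "'a => complex" unfolding n2_eq by simp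
 ultimately show "(LINT x|M. cmod (f x) * cmod (g x)) <= n2 M f * n2 M g"
  by(simp only: norm_of_real)
qed

lemma L2_mult_bounded:
 assumes "f : L2 M" "g : bm M" "AE x in M. cmod (g x) <= B"
 shows "(%x. g x * f x) : L2 M"
proof (rule L2_bound(1)[OF assms(1), of _ "\<bar>B\<bar>"])
 show "(%x. g x * f x) : bm M" by(rule borel_measurable_times[OF assms(2) L2_measurable[OF assms(1)]])
 show "AE x in M. cmod (g x * f x) <= \<bar>B\<bar> * cmod (f x)"
  using assms(3) by eventually_elim (simp add: norm_mult mult_right_mono)
qed simp

text \<open>With c = 1 - e, adding both inequalities and using 2 a b <= a^2 + b^2 gives c a^2 <= (2
  m + 1) H^2 + 6 a H; then 12 c a H <= c^2 a^2 + 36 H^2 removes the linear term. In the application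
  a is the norm of \<theta> <Q> u, b that of \<theta> <Q>^(1/2) grad u, and H that of the
  datum.\<close>

lemma AM_GM_split:
 fixes a b H e m :: real
 assumes e: "0 <= e" "e < 1" and nn: "0 <= a" "0 <= H"
  and a: "a^2 <= e * a * b + m * H^2 + 3 * a * H + H^2" and b: "b^2 <= e * a * b + m * H^2 + 3 * a * H"
 shows "a <= sqrt (2 / (1 - e) * (2 * m + 1 + 18 / (1 - e))) * H"
proof -
 define c where "c = 1 - e"
 have c: "c > 0" using e by(simp add: c_def)
 have "0 <= (a - b)^2" by simp
 hence "2 * (a * b) <= a^2 + b^2" by(simp add: power2_diff)
 from mult_left_mono[OF this e(1)] have "2 * (e * a * b) <= e * a^2 + e * b^2" by(simp add: algebra_simps)
 hence "c * a^2 + c * b^2 <= (2 * m + 1) * H^2 + 6 * a * H" using a b by(simp add: c_def algebra_simps)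
 moreover have "0 <= c * b^2" using c by simp
 ultimately have 1: "c * a^2 <= (2 * m + 1) * H^2 + 6 * a * H" by linarith
 have "0 <= (c * a - 6 * H)^2" by simp
 hence "12 * c * a * H <= c^2 * a^2 + 36 * H^2" by(simp add: power2_diff power_mult_distrib)
 moreover have "2 * c * (c * a^2) <= 2 * c * ((2 * m + 1) * H^2 + 6 * a * H)" using mult_left_mono[OF 1, of "2 * c"] c by simp
 ultimately have "c^2 * a^2 <= (2 * c * (2 * m + 1) + 36) * H^2" by(simp add: algebra_simps power2_eq_square)
 hence "a^2 <= (2 * c * (2 * m + 1) + 36) * H^2 / c^2" using c by(simp add: pos_le_divide_eq mult.commute)
 also have "(2 * c * (2 * m + 1) + 36) * H^2 / c^2 = 2 / c * (2 * m + 1 + 18 / c) * H^2"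
  using c by(simp add: field_simps power2_eq_square)
 finally have "sqrt (a^2) <= sqrt (2 / c * (2 * m + 1 + 18 / c) * H^2)" by(rule real_sqrt_le_mono)
 thus ?thesis using nn unfolding real_sqrt_mult c_def by simp
qed

section \<open>Weak solutions, energy bounds and the separation estimate\<close>

context adm begin

text \<open>The length of the gradient, typed as a complex function so that the facts about
  \<open>L2\<close> and \<open>n2\<close> apply to it.\<close>

definition DD :: "(pt => complex) => pt => complex" where
 "DD u x = of_real (L2_set (%i. cmod (grad d Om u i x)) {..<d})"

lemma DD_sq: "(cmod (DD u x))^2 = (\<Sum>i<d. (cmod (grad d Om u i x))^2)"
 by(simp add: DD_def L2_set_def sum_nonneg)

lemma DD_L2: assumes u: "u : VV" shows "DD u : L2 M" "(n2 M (DD u))^2 = (\<Sum>i<d. (n2 M (grad d Om u i))^2)"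
proof -
 have i: "integrable M (%x. (cmod (grad d Om u i x))^2)" and me: "grad d Om u i : bm M" if "i < d" for i
  using VV_L2(2)[OF u that] by(auto simp: L2_iff)
 have "(%x. sqrt (\<Sum>i<d. (cmod (grad d Om u i x))^2)) : bm M"
  by(intro borel_measurable_sqrt[THEN measurable_compose[rotated]] borel_measurable_sum borel_measurable_integrable[OF i]) auto
 hence "DD u : bm M" unfolding DD_def[abs_def] L2_set_def by(rule of_real_meas)
 thus "DD u : L2 M" unfolding L2_iff DD_sq using i by auto
 show "(n2 M (DD u))^2 = (\<Sum>i<d. (n2 M (grad d Om u i))^2)"
  unfolding n2_sq DD_sq by(rule Bint_sum) (use i in auto)
qed

text \<open>The zeroth-order coefficient of T + 1 + dl <Q>; the problem of interest is dl =
  0.\<close>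

definition PP :: "real => pt => complex" where
 "PP dl x = Q x + of_real (dl * jp x) + 1"

text \<open>The regularising term \<open>dl * jp\<close> makes the form coercive on the form domain; it is removed
 in the limit \<open>dl \<rightarrow> 0\<close>.\<close>

definition wsol :: "real => (pt => complex) => (pt => complex) => bool" where
 "wsol dl h u \<longleftrightarrow> u : VV & (ALL g:VV. (\<Sum>i<d. L2_inner M (grad d Om u i) (grad d Om g i)) +
   (LINT x|M. PP dl x * u x * cnj (g x)) = L2_inner M h g)"

lemma PP_meas: "PP dl : bm M"
 unfolding PP_def[abs_def] by(intro borel_measurable_add Q_meas of_real_meas borel_measurable_times jp_meas borel_measurable_const)

lemma PP_le: "cmod (PP dl x) <= (2 + \<bar>dl\<bar>) * jp x"
proof -
 have "cmod (PP dl x) <= cmod (Q x) + cmod (of_real (dl * jp x)) + cmod 1"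
  unfolding PP_def by(rule order_trans[OF norm_triangle_ineq add_right_mono[OF norm_triangle_ineq]])
 hence "cmod (PP dl x) <= cmod (Q x) + \<bar>dl * jp x\<bar> + 1" by(simp only: norm_of_real norm_one)
 thus ?thesis using jap_ge[of "Q x"] by(simp add: abs_mult algebra_simps)
qed

text \<open>Splitting <Q> into two square roots shows that every multiplier dominated by <Q> defines
  a bounded form on the form domain.\<close>

lemma VV_mult_integrable:
 assumes u: "u : VV" and g: "g : VV" and p: "p : bm M" "!!x. cmod (p x) <= C * jp x"
 shows "integrable M (%x. p x * u x * cnj (g x))"
  "cmod (LINT x|M. p x * u x * cnj (g x)) <= C * n2 M (sq u) * n2 M (sq g)"
proof -
 have i: "integrable M (%x. C * (cmod (sq u x) * cmod (sq g x)))"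
  by(rule integrable_mult_right[OF L2_prod(1)[OF VV_L2(3)[OF u] VV_L2(3)[OF g]]])
 have le: "cmod (p x * u x * cnj (g x)) <= C * (cmod (sq u x) * cmod (sq g x))" for x
 proof -
  have "cmod (sq u x) * cmod (sq g x) = sqrt (jp x) * sqrt (jp x) * (cmod (u x) * cmod (g x))"
   using jap_ge(4)[of "Q x"] by(simp only: sq_def norm_mult norm_of_real abs_of_nonneg real_sqrt_ge_zero less_imp_le mult_ac)
  hence e: "C * (cmod (sq u x) * cmod (sq g x)) = C * jp x * (cmod (u x) * cmod (g x))" by(simp only: sqrt_jp(3) mult.assoc)
  have "cmod (p x) * (cmod (u x) * cmod (g x)) <= C * jp x * (cmod (u x) * cmod (g x))" by(intro mult_right_mono p(2)) simp
  thus ?thesis unfolding e by(simp only: norm_mult complex_mod_cnj mult.assoc)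
 qed
 show 1: "integrable M (%x. p x * u x * cnj (g x))"
 proof (rule Bintble_bound[OF i])
  show "(%x. p x * u x * cnj (g x)) : bm M"
   by(intro borel_measurable_times p borel_measurable_cnj L2_measurable VV_L2(1) u g)
  show "AE x in M. norm (p x * u x * cnj (g x)) <= norm (C * (cmod (sq u x) * cmod (sq g x)))"
   unfolding real_norm_def by(intro AE_I2 order_trans[OF le abs_ge_self])
 qed
 have "cmod (LINT x|M. p x * u x * cnj (g x)) <= (LINT x|M. C * (cmod (sq u x) * cmod (sq g x)))"
  by(rule norm_integral_le_AE[OF 1 i]) (rule AE_I2[OF le])
 also have "... = C * (LINT x|M. cmod (sq u x) * cmod (sq g x))" by(rule integral_mult_right_zero)
 also have "... <= C * (n2 M (sq u) * n2 M (sq g))"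
 proof (rule mult_left_mono[OF L2_prod(2)[OF VV_L2(3)[OF u] VV_L2(3)[OF g]]])
  have "0 <= C * jp undefined" by(rule order_trans[OF norm_ge_zero p(2)])
  thus "0 <= C" using jap_ge(4)[of "Q undefined"] by(simp add: zero_le_mult_iff)
 qed
 finally show "cmod (LINT x|M. p x * u x * cnj (g x)) <= C * n2 M (sq u) * n2 M (sq g)" by(simp only: mult.assoc)
qed

lemmas PP_integrable = VV_mult_integrable[OF _ _ PP_meas PP_le]

lemma wsol_D: "wsol dl h u ==> u : VV"
 "wsol dl h u ==> g : VV ==> (\<Sum>i<d. L2_inner M (grad d Om u i) (grad d Om g i)) +
   (LINT x|M. PP dl x * u x * cnj (g x)) = L2_inner M h g"
 by(auto simp: wsol_def)

text \<open>Re Q >= 0 leaves the gradient, the mass term and dl times the weighted norm. For dl = 0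
  this lower bound says nothing about <Q>^(1/2) u, which is the failure of coercivity that the
  regularisation repairs.\<close>

lemma energy_coer:
 assumes u: "u : VV" and dl: "0 <= dl"
 shows "(n2 M (DD u))^2 + (n2 M u)^2 + dl * (n2 M (sq u))^2 <=
  Re ((\<Sum>i<d. L2_inner M (grad d Om u i) (grad d Om u i)) + (LINT x|M. PP dl x * u x * cnj (u x)))"
proof -
 have 1: "Re (\<Sum>i<d. L2_inner M (grad d Om u i) (grad d Om u i)) = (n2 M (DD u))^2"
  unfolding DD_L2(2)[OF u] Re_sum by(intro sum.cong refl) (simp add: L2.nrm_sq[OF VV_L2(2)[OF u]])
 have i: "integrable M (%x. (cmod (u x))^2)" "integrable M (%x. (cmod (sq u x))^2)"
  using VV_L2(1,3)[OF u] by(auto simp: L2_iff)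
 have "(LINT x|M. (cmod (u x))^2 + dl * (cmod (sq u x))^2) <= (LINT x|M. Re (PP dl x * u x * cnj (u x)))"
 proof (rule integral_mono_AE)
  show "AE x in M. (cmod (u x))^2 + dl * (cmod (sq u x))^2 <= Re (PP dl x * u x * cnj (u x))"
   using Q_AE
  proof eventually_elim
   case (elim x)
   have a: "PP dl x * u x * cnj (u x) = PP dl x * of_real ((cmod (u x))^2)" by(simp only: mult.assoc complex_norm_square)
   have s: "(cmod (sq u x))^2 = jp x * (cmod (u x))^2"
   using jap_ge(4)[of "Q x"] by(simp add: sq_def norm_mult power_mult_distrib)
   have "(1 + dl * jp x) * (cmod (u x))^2 <= Re (PP dl x) * (cmod (u x))^2"
   using elim by(intro mult_right_mono) (auto simp: PP_def)
   moreover have "Re (PP dl x * of_real ((cmod (u x))^2)) = Re (PP dl x) * (cmod (u x))^2" by(simp del: of_real_power)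
   ultimately show ?case unfolding a s by(simp add: algebra_simps)
  qed
  show "integrable M (%x. Re (PP dl x * u x * cnj (u x)))" by(rule integrable_Re[OF PP_integrable(1)[OF u u]])
 qed (use i in auto)
 moreover have "(LINT x|M. (cmod (u x))^2 + dl * (cmod (sq u x))^2) = (n2 M u)^2 + dl * (n2 M (sq u))^2"
  unfolding n2_sq using i by simp
 moreover have "(LINT x|M. Re (PP dl x * u x * cnj (u x))) = Re (LINT x|M. PP dl x * u x * cnj (u x))"
  by(rule integral_Re[OF PP_integrable(1)[OF u u]])
 ultimately show ?thesis using 1 by simp
qed

lemma energy:
 assumes u: "wsol dl h u" and h: "h : L2 M" and dl: "0 <= dl"
 shows "n2 M u <= n2 M h" "n2 M (DD u) <= n2 M h"
proof -
 have "Re (L2_inner M h u) <= n2 M h * n2 M u"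
  by(rule order_trans[OF complex_Re_le_cmod L2.cauchy_schwarz[OF h VV_L2(1)[OF wsol_D(1)[OF u]]]])
 moreover have "0 <= dl * (n2 M (sq u))^2" using dl by simp
 ultimately have 1: "(n2 M (DD u))^2 + (n2 M u)^2 <= n2 M h * n2 M u"
  using energy_coer[OF wsol_D(1)[OF u] dl] unfolding wsol_D(2)[OF u wsol_D(1)[OF u]] by linarith
 hence "n2 M u * n2 M u <= n2 M h * n2 M u" using zero_le_power2[of "n2 M (DD u)"] unfolding power2_eq_square by linarith
 thus 2: "n2 M u <= n2 M h" using n2_nonneg[of M h] n2_nonneg[of M u] by(metis mult_right_le_imp_le order_le_less)
 have "n2 M h * n2 M u <= n2 M h * n2 M h" by(intro mult_left_mono 2 n2_nonneg)
 hence "(n2 M (DD u))^2 <= (n2 M h)^2" using 1 zero_le_power2[of "n2 M u"] unfolding power2_eq_square by linarith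
 thus "n2 M (DD u) <= n2 M h" by(rule power2_le_imp_le[OF _ n2_nonneg])
qed

end

text \<open>The constant delivered by \<open>AM_GM_split\<close>; it contains neither the dimension,
  nor dl, nor the cut-off.\<close>

definition sep_const :: "real => real => real" where
 "sep_const e m = sqrt (2 / (1 - e) * (2 * m + 1 + 18 / (1 - e)))"

lemma Re_of_real_times: "Re (of_real r * z) = r * Re z"
 by simp

text \<open>The cut-off \<open>th\<close> makes the multipliers th^2 Q and th^2 <Q> bounded, so that
  their products with u are admissible test functions. The resulting bound has to be free of
  \<open>th\<close> and dl.\<close>

locale sep = adm +
 fixes th :: "pt => real" and dl :: real and h u :: "pt => complex"
 assumes t_smooth: "smooth d (%x. of_real (th x))" and t01: "!!x. 0 <= th x" "!!x. th x <= 1"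
  and t_grad: "!!x. x : Rd d ==> L2_set (%i. cmod (partial i (%x. of_real (th x)) x)) {..<d} <= 1"
  and t_supp: "EX r. ALL x:Rd d. r < L2_set x {..<d} --> th x = 0 & (ALL i<d. partial i (%x. of_real (th x)) x = 0)"
  and u: "wsol dl h u" and h: "h : L2 M" and dl: "0 <= dl"
begin

abbreviation "dt i x \<equiv> partial i (%x. of_real (th x)) x"
abbreviation "a \<equiv> n2 M (%x. of_real (th x * jp x) * u x)"
abbreviation "b \<equiv> n2 M (%x. of_real (th x * sqrt (jp x)) * DD u x)"
abbreviation "H \<equiv> n2 M h"

lemma uV: "u : VV" and uL: "u : L2 M" and DL: "DD u : L2 M"
 using wsol_D(1)[OF u] VV_L2(1) DD_L2(1) by blast+

lemma t_meas: "th : bm M"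
proof -
 have "(%x. complex_of_real (th x)) : bm M" by(rule meas_leb[OF continuous_measurable[OF smooth_continuous[OF t_smooth]]])
 from measurable_compose[OF this borel_measurable_Re] show ?thesis by simp
qed

text \<open>\<open>th\<close> vanishes together with its derivatives off some ball, and on the part
  of \<open>Om\<close> inside that ball the potential is bounded, even close to the boundary of
  \<open>Om\<close>.\<close>

lemma jp_cut: "EX B>=0. AE x in M. th x * jp x <= B & th x <= B * th x / jp x & (jp x <= B \<or> th x = 0 & (ALL i<d. dt i x = 0))"
proof -
 obtain r where r: "!!x. x : Rd d ==> r < L2_set x {..<d} ==> th x = 0 & (ALL i<d. dt i x = 0)" using t_supp by blast
 obtain C where C: "C >= 0" "AE x in M. L2_set x {..<d} <= r --> cmod (Q x) <= C & (ALL i<d. cmod (V i x) <= C)"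
  using Q_bounded by blast
 have "AE x in M. th x * jp x <= 1 + C & th x <= (1 + C) * th x / jp x & (jp x <= 1 + C \<or> th x = 0 & (ALL i<d. dt i x = 0))"
  using C(2) AE_space
 proof eventually_elim
  case (elim x)
  show ?case
  proof (cases "L2_set x {..<d} <= r")
   case True
   hence j: "jp x <= 1 + C" using elim(1) jap_ge(3)[of "Q x"] by auto
   moreover have "th x * jp x <= 1 * (1 + C)" using t01 j jap_ge(4)[of "Q x"] by(intro mult_mono) auto
   moreover have "th x * jp x <= (1 + C) * th x" using mult_left_mono[OF j t01(1)[of x]] by(simp only: mult.commute)
   ultimately show ?thesis using jap_ge(4)[of "Q x"] by(simp add: pos_le_divide_eq)
  next
   case False
   moreover have "x : Rd d" using elim(2) sub by(auto simp: space_M)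
   ultimately have "th x = 0 & (ALL i<d. dt i x = 0)" using r[of x] by auto
   thus ?thesis using C(1) by auto
  qed
 qed
 thus ?thesis using C(1) by(intro exI[of _ "1 + C"]) auto
qed

lemma cut_L2: assumes f: "f : L2 M" and p: "p : bm M" "!!x. cmod (p x) <= jp x"
 shows "(%x. of_real (th x) * p x * f x) : L2 M"
proof -
 obtain B where B: "AE x in M. th x * jp x <= B & th x <= B * th x / jp x & (jp x <= B \<or> th x = 0 & (ALL i<d. dt i x = 0))"
  using jp_cut by blast
 show ?thesis
 proof (rule L2_mult_bounded[OF f borel_measurable_times[OF of_real_meas[OF t_meas] p(1)]])
  show "AE x in M. cmod (of_real (th x) * p x) <= B" using B
  proof eventually_elim
   case (elim x)
   have "cmod (of_real (th x) * p x) <= th x * jp x"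
   unfolding norm_mult norm_of_real abs_of_nonneg[OF t01(1)] by(rule mult_left_mono[OF p(2) t01(1)])
   thus ?case using elim by linarith
  qed
 qed
qed

lemma a_L2: "(%x. of_real (th x * jp x) * u x) : L2 M"
 using cut_L2[OF uL of_real_meas[OF jp_meas]] jap_ge(4) by(simp add: abs_of_pos)

lemma b_L2: "(%x. of_real (th x * sqrt (jp x)) * DD u x) : L2 M"
proof -
 have "cmod (of_real (sqrt (jp x))) <= jp x" for x using sqrt_jp(1,2)[of x] by(simp add: order_trans[OF zero_le_one])
 from cut_L2[OF DL of_real_meas[OF sqrt_jp_meas] this] show ?thesis by simp
qed

text \<open>Test with th^2 q u, where q will be Q or <Q>; \<open>F\<close> collects the terms in
  which the multiplier is not differentiated. The datum against th^2 q u gives a H. In grad u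
  against u grad (th^2 q), the part with grad q gives e a b + m H^2 and the part with grad th gives
  2 a H.\<close>

lemma sep_test:
 assumes q: "weak_grad d Om q Vq" "!!x. cmod (q x) <= jp x"
  and Vq: "AE x in M. L2_set (%i. cmod (Vq i x)) {..<d} <= e * jp x powr (3/2) + m"
 defines "F \<equiv> %x. cnj (of_real (th x * th x) * q x) * (of_real ((cmod (DD u x))^2) + PP dl x * of_real ((cmod (u x))^2))"
 shows "integrable M F" "cmod (LINT x|M. F x) <= e * a * b + m * H^2 + 3 * a * H"
proof -
 define w where "w x = of_real (th x) * (of_real (th x) * q x)" for x
 define W where "W i x = of_real (th x) * (of_real (th x) * Vq i x + dt i x * q x) + dt i x * (of_real (th x) * q x)" for i x
 have ww: "weak_grad d Om w W" unfolding w_def W_def by(rule weak_grad_mult[OF weak_grad_mult[OF q(1) t_smooth] t_smooth])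
 have wm: "w : bm M" and Wm: "i < d ==> W i : bm M" for i
  using weak_gradD(1,2)[OF ww] by(auto simp: loc_integrable_def)
 have wle: "cmod (w x) <= th x * jp x" for x
 proof -
  have "th x * cmod (q x) <= 1 * jp x" by(intro mult_mono t01 q) auto
  from mult_left_mono[OF this t01(1)[of x]] show ?thesis
   unfolding w_def norm_mult norm_of_real abs_of_nonneg[OF t01(1)] by simp
 qed
 let ?E = "%x. e * jp x powr (3/2) + m"
 have Wle: "AE x in M. L2_set (%i. cmod (W i x)) {..<d} <= th x * th x * ?E x + 2 * (th x * jp x)"
  using Vq AE_space
 proof eventually_elim
  case (elim x)
  have xR: "x : Rd d" using elim(2) sub by(auto simp: space_M)
  have "cmod (W i x) <= th x * th x * cmod (Vq i x) + 2 * (th x * jp x) * cmod (dt i x)" for i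
  proof -
   have "W i x = of_real (th x * th x) * Vq i x + of_real (2 * th x) * (q x * dt i x)"
   by(simp add: W_def algebra_simps)
   hence "cmod (W i x) <= cmod (of_real (th x * th x) * Vq i x) + cmod (of_real (2 * th x) * (q x * dt i x))"
   by(simp only: norm_triangle_ineq)
   also have "cmod (of_real (th x * th x) * Vq i x) = th x * th x * cmod (Vq i x)"
   unfolding norm_mult norm_of_real using t01(1)[of x] by simp
   also have "cmod (of_real (2 * th x) * (q x * dt i x)) = (2 * th x) * (cmod (q x) * cmod (dt i x))"
   unfolding norm_mult norm_of_real using t01(1)[of x] by simp
   also have "(2 * th x) * (cmod (q x) * cmod (dt i x)) <= (2 * th x) * (jp x * cmod (dt i x))"
   by(intro mult_left_mono mult_right_mono q) (use t01(1)[of x] in auto)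
   finally show ?thesis by(simp add: mult_ac)
  qed
  hence "L2_set (%i. cmod (W i x)) {..<d} <= L2_set (%i. th x * th x * cmod (Vq i x) + 2 * (th x * jp x) * cmod (dt i x)) {..<d}"
   by(intro L2_set_mono) auto
  also have "... <= L2_set (%i. th x * th x * cmod (Vq i x)) {..<d} + L2_set (%i. 2 * (th x * jp x) * cmod (dt i x)) {..<d}"
   by(rule L2_set_triangle_ineq)
  also have "L2_set (%i. th x * th x * cmod (Vq i x)) {..<d} = th x * th x * L2_set (%i. cmod (Vq i x)) {..<d}"
   by(rule L2_set_right_distrib[symmetric]) (use t01(1)[of x] in simp)
  also have "L2_set (%i. 2 * (th x * jp x) * cmod (dt i x)) {..<d} = 2 * (th x * jp x) * L2_set (%i. cmod (dt i x)) {..<d}"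
   by(rule L2_set_right_distrib[symmetric]) (use t01(1)[of x] jap_ge(4)[of "Q x"] in simp)
  also have "th x * th x * L2_set (%i. cmod (Vq i x)) {..<d} + 2 * (th x * jp x) * L2_set (%i. cmod (dt i x)) {..<d}
   <= th x * th x * ?E x + 2 * (th x * jp x) * 1"
   by(intro add_mono mult_left_mono elim(1) t_grad xR) (use t01(1)[of x] jap_ge(4)[of "Q x"] in auto)
  finally show ?case by simp
 qed
 obtain B where B: "B >= 0" "AE x in M. th x * jp x <= B & th x <= B * th x / jp x & (jp x <= B \<or> th x = 0 & (ALL i<d. dt i x = 0))"
  using jp_cut by blast
 \<comment> \<open>This bound depends on the cut-off. It serves only to place w u in the form domain
   and does not enter the final estimate.\<close>
 define C where "C = e * B powr (3/2) + m + 2 * B"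
 have C0: "0 <= C" "B <= C" using em B(1) by(auto simp: C_def)
 have Wb: "AE x in M. ALL i<d. cmod (W i x) <= C" using Wle B(2)
 proof eventually_elim
  case (elim x)
  show ?case
  proof (cases "jp x <= B")
   case True
   have "th x * th x <= 1 * 1" by(intro mult_mono t01) (simp_all add: t01)
   moreover have "?E x <= e * B powr (3/2) + m"
   using True em jap_ge(4)[of "Q x"] by(intro add_right_mono mult_left_mono powr_mono2) auto
   moreover have "0 <= ?E x" using em by simp
   ultimately have "th x * th x * ?E x <= 1 * (e * B powr (3/2) + m)" by(intro mult_mono) auto
   moreover have "th x * jp x <= B" using elim(2) by blast
   ultimately have "th x * th x * ?E x + 2 * (th x * jp x) <= C" unfolding C_def mult_1 by(intro add_mono) auto
   with elim(1) have "L2_set (%i. cmod (W i x)) {..<d} <= C" by(rule order_trans)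
   moreover have "cmod (W i x) <= L2_set (%i. cmod (W i x)) {..<d}" if "i < d" for i
   using member_le_L2_set[of "{..<d}" i "%i. cmod (W i x)"] that by simp
   ultimately show ?thesis by(meson order_trans)
  next
   case False
   thus ?thesis using elim(2) C0 by(auto simp: W_def)
  qed
 qed
 have wb: "AE x in M. cmod (w x) <= C" using B(2)
 proof eventually_elim
  case (elim x) thus ?case using wle[of x] C0 by linarith
 qed
 have wu: "h10 (%x. w x * u x) (%i x. w x * grad d Om u i x + W i x * u x)"
  by(rule mult_h10[OF VV_h10[OF uV] ww C0(1) wb]) (use Wb in \<open>auto elim!: eventually_mono\<close>)
 have wuV: "(%x. w x * u x) : VV"
 proof (rule VV_I[OF wu])
  have "(%x. w x * sq u x) : L2 M" by(rule L2_mult_bounded[OF VV_L2(3)[OF uV] wm wb])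
  thus "sq (%x. w x * u x) : L2 M" unfolding sq_def[abs_def] by(simp only: mult_ac)
 qed
 have gL: "(%x. w x * grad d Om u i x) : L2 M" "(%x. W i x * u x) : L2 M" if i: "i < d" for i
  by(rule L2_mult_bounded[OF VV_L2(2)[OF uV i] wm wb])
   (rule L2_mult_bounded[OF uL Wm[OF i]], use Wb i in \<open>auto elim!: eventually_mono\<close>)
 let ?G1 = "%i x. grad d Om u i x * cnj (w x * grad d Om u i x)"
 let ?G2 = "%i x. grad d Om u i x * cnj (W i x * u x)"
 let ?p = "%x. PP dl x * u x * cnj (w x * u x)"
 have i1: "integrable M (?G1 i)" and i2: "integrable M (?G2 i)" if "i < d" for i
  using L2_inner_integrable[OF VV_L2(2)[OF uV that] gL(1)[OF that]] L2_inner_integrable[OF VV_L2(2)[OF uV that] gL(2)[OF that]] by auto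
 have ip: "integrable M ?p" by(rule PP_integrable(1)[OF uV wuV])
 have "L2_inner M (grad d Om u i) (grad d Om (%x. w x * u x) i) = (LINT x|M. ?G1 i x) + (LINT x|M. ?G2 i x)" if i: "i < d" for i
 proof -
  have "L2_inner M (grad d Om u i) (grad d Om (%x. w x * u x) i) = L2_inner M (grad d Om u i) (%x. w x * grad d Om u i x + W i x * u x)"
   by(intro L2_inner_cong_AE AE_I2 refl h10_grad[OF wu i] VV_L2(2)[OF uV i] VV_L2(2)[OF wuV i] L2.add_mem gL i)
  also have "... = L2_inner M (grad d Om u i) (%x. w x * grad d Om u i x) + L2_inner M (grad d Om u i) (%x. W i x * u x)"
   using L2.ip_lin2[OF gL(1)[OF i] gL(2)[OF i] VV_L2(2)[OF uV i], of 1 1] by simp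
  finally show ?thesis unfolding L2_inner_def .
 qed
 hence "(\<Sum>i<d. L2_inner M (grad d Om u i) (grad d Om (%x. w x * u x) i)) = (\<Sum>i<d. (LINT x|M. ?G1 i x)) + (\<Sum>i<d. \<integral>x. ?G2 i x \<partial>M)"
  unfolding sum.distrib[symmetric] by(intro sum.cong) auto
 also have "(\<Sum>i<d. (LINT x|M. ?G1 i x)) = (LINT x|M. (\<Sum>i<d. ?G1 i x))" using i1 by(intro Bint_sum[symmetric]) auto
 also have "(\<Sum>i<d. (LINT x|M. ?G2 i x)) = (LINT x|M. (\<Sum>i<d. ?G2 i x))" using i2 by(intro Bint_sum[symmetric]) auto
 finally have eq: "(LINT x|M. (\<Sum>i<d. ?G1 i x)) + (LINT x|M. (\<Sum>i<d. ?G2 i x)) + (LINT x|M. ?p x) = L2_inner M h (%x. w x * u x)"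
  using wsol_D(2)[OF u wuV] by simp
 have Fe: "F x = (\<Sum>i<d. ?G1 i x) + ?p x" for x
 proof -
  have "(\<Sum>i<d. ?G1 i x) = cnj (w x) * of_real ((cmod (DD u x))^2)"
   unfolding DD_sq of_real_sum sum_distrib_left complex_norm_square by(intro sum.cong refl) simp
  moreover have "?p x = cnj (w x) * (PP dl x * of_real ((cmod (u x))^2))" unfolding complex_norm_square by simp
  moreover have "w x = of_real (th x * th x) * q x" by(simp add: w_def)
  ultimately show ?thesis by(simp only: F_def distrib_left)
 qed
 have is1: "integrable M (%x. \<Sum>i<d. ?G1 i x)" and is2: "integrable M (%x. \<Sum>i<d. ?G2 i x)" using i1 i2 by auto
 show Fi: "integrable M F" unfolding Fe[abs_def] by(rule Bintble_add[OF is1 ip])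
 have "(LINT x|M. F x) = (LINT x|M. (\<Sum>i<d. ?G1 i x)) + (LINT x|M. ?p x)"
  unfolding Fe by(rule Bint_add[OF is1 ip])
 hence "(LINT x|M. F x) = L2_inner M h (%x. w x * u x) - (LINT x|M. (\<Sum>i<d. ?G2 i x))"
  using eq by(simp add: algebra_simps)
 hence t1: "cmod (LINT x|M. F x) <= cmod (L2_inner M h (%x. w x * u x)) + cmod (LINT x|M. (\<Sum>i<d. ?G2 i x))"
  by(simp only: norm_triangle_ineq4)
 have "n2 M (%x. w x * u x) <= 1 * a"
 proof (rule L2_bound(2)[OF a_L2 L2_measurable[OF VV_L2(1)[OF wuV]]])
  have "cmod (w x * u x) <= 1 * cmod (of_real (th x * jp x) * u x)" for x
  proof -
   have p: "0 <= th x * jp x" using t01(1)[of x] jap_ge(4)[of "Q x"] by simp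
   show ?thesis unfolding norm_mult norm_of_real[of "th x * jp x"] abs_of_nonneg[OF p]
   using mult_right_mono[OF wle[of x] norm_ge_zero[of "u x"]] by simp
  qed
  thus "AE x in M. cmod (w x * u x) <= 1 * cmod (of_real (th x * jp x) * u x)" by(rule AE_I2)
 qed simp
 hence "n2 M (%x. w x * u x) <= a" by simp
 hence t2: "cmod (L2_inner M h (%x. w x * u x)) <= H * a"
  using L2.cauchy_schwarz[OF h VV_L2(1)[OF wuV]] mult_left_mono[OF _ n2_nonneg[of M h]] by(meson order_trans)
 let ?f = "%x. of_real (th x * jp x) * u x" and ?g = "%x. of_real (th x * sqrt (jp x)) * DD u x"
 have ptw: "AE x in M. cmod (\<Sum>i<d. ?G2 i x) <= e * (cmod (?g x) * cmod (?f x)) + (m * (cmod (DD u x) * cmod (u x)) + 2 * (cmod (DD u x) * cmod (?f x)))"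
  using Wle
 proof eventually_elim
  case (elim x)
  have D0: "cmod (DD u x) = L2_set (%i. cmod (grad d Om u i x)) {..<d}" "0 <= cmod (DD u x)" by(simp_all add: DD_def)
  have "cmod (\<Sum>i<d. ?G2 i x) <= (\<Sum>i<d. cmod (grad d Om u i x) * cmod (W i x) * cmod (u x))"
   by(rule order_trans[OF norm_sum]) (simp add: norm_mult mult.assoc)
  also have "... = (\<Sum>i<d. \<bar>cmod (grad d Om u i x)\<bar> * \<bar>cmod (W i x)\<bar>) * cmod (u x)" by(simp add: sum_distrib_right)
  also have "... <= (cmod (DD u x) * L2_set (%i. cmod (W i x)) {..<d}) * cmod (u x)"
   unfolding D0(1) by(intro mult_right_mono L2_set_mult_ineq) simp
  also have "... <= (cmod (DD u x) * (th x * th x * ?E x + 2 * (th x * jp x))) * cmod (u x)"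
   by(intro mult_right_mono mult_left_mono elim) auto
  also have "... <= e * (cmod (?g x) * cmod (?f x)) + (m * (cmod (DD u x) * cmod (u x)) + 2 * (cmod (DD u x) * cmod (?f x)))"
  proof -
   have g: "cmod (?g x) = th x * sqrt (jp x) * cmod (DD u x)" and f: "cmod (?f x) = th x * jp x * cmod (u x)"
   unfolding norm_mult norm_of_real using t01(1)[of x] jap_ge(4)[of "Q x"] by(simp_all add: abs_mult)
   \<comment> \<open>The exponent 3/2 of admissibility splits exactly into the power 1/2 that
     accompanies grad u in b and the power 1 that accompanies u in a.\<close>
   have pw: "jp x powr (3/2) = sqrt (jp x) * jp x"
   proof -
   have "jp x powr (1/2 + 1) = jp x powr (1/2) * jp x powr 1" by(rule powr_add)
   thus ?thesis using jap_ge(4)[of "Q x"] by(simp add: powr_half_sqrt)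
   qed
   have "th x * th x <= 1 * 1" by(intro mult_mono t01) (simp_all add: t01)
   hence "m * (th x * th x) <= m * 1" using em(3) by(intro mult_left_mono) auto
   hence "m * (th x * th x) * (cmod (DD u x) * cmod (u x)) <= m * 1 * (cmod (DD u x) * cmod (u x))" by(intro mult_right_mono) auto
   thus ?thesis unfolding g f pw by(simp add: algebra_simps)
  qed
  finally show ?case .
 qed
 note pr1 = L2_prod[OF b_L2 a_L2] and pr2 = L2_prod[OF DL uL] and pr3 = L2_prod[OF DL a_L2]
 have "cmod (LINT x|M. (\<Sum>i<d. ?G2 i x)) <= (LINT x|M. e * (cmod (?g x) * cmod (?f x)) + (m * (cmod (DD u x) * cmod (u x)) + 2 * (cmod (DD u x) * cmod (?f x))))"
  by(rule norm_integral_le_AE[OF is2 _ ptw]) (intro Bintble_add integrable_mult_right pr1 pr2 pr3)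
 also have "... = e * (LINT x|M. cmod (?g x) * cmod (?f x)) + (m * (LINT x|M. cmod (DD u x) * cmod (u x)) + 2 * (LINT x|M. cmod (DD u x) * cmod (?f x)))"
  by(simp only: Bint_add Bintble_add integrable_mult_right pr1(1) pr2(1) pr3(1) integral_mult_right_zero)
 also have "... <= e * (b * a) + (m * (n2 M (DD u) * n2 M u) + 2 * (n2 M (DD u) * a))"
  using em by(intro add_mono mult_left_mono pr1 pr2 pr3) auto
 also have "... <= e * (b * a) + (m * (H * H) + 2 * (H * a))"
  using em energy[OF u h dl] n2_nonneg[of M] by(intro add_mono mult_left_mono mult_mono mult_right_mono) auto
 finally show "cmod (LINT x|M. F x) <= e * a * b + m * H^2 + 3 * a * H" using t1 t2 by(simp add: power2_eq_square algebra_simps)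
qed

text \<open>The real parts of both tests are bounded below. For q = Q the terms with Re Q |grad u|^2
  and with 1 + dl <Q> are nonnegative, and th^2 |Q|^2 |u|^2 remains; for q = <Q> the term th^2 <Q>
  |grad u|^2 remains. Each estimate contains the product a b, so the two are closed jointly.\<close>

lemma sep_cut: "a <= sep_const e m * H"
 unfolding sep_const_def
proof (rule AM_GM_split[OF em(1,2) n2_nonneg n2_nonneg])
 have Qj: "cmod (complex_of_real (jp x)) <= jp x" for x using jap_ge(4)[of "Q x"] by simp
 have V1: "AE x in M. L2_set (%i. cmod (V i x)) {..<d} <= e * jp x powr (3/2) + m"
  using Q_AE unfolding grad_length_def by eventually_elim auto
 have V2: "AE x in M. L2_set (%i. cmod (japd (Q x) (V i x))) {..<d} <= e * jp x powr (3/2) + m"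
  using V1
 proof eventually_elim
  case (elim x)
  have "L2_set (%i. cmod (japd (Q x) (V i x))) {..<d} <= L2_set (%i. cmod (V i x)) {..<d}"
   by(intro L2_set_mono japd_le) auto
  thus ?case using elim by linarith
 qed
 note s1 = sep_test[OF Q_weak jap_ge(2) V1]
 note s2 = sep_test[OF jp_weak Qj V2]
 have QL: "(%x. of_real (th x) * Q x * u x) : L2 M" by(rule cut_L2[OF uL Q_meas jap_ge(2)])
 have ReP: "AE x in M. 0 <= Re (PP dl x) & 0 <= Re (cnj (Q x) * (PP dl x - Q x)) & 0 <= Re (Q x)"
  using Q_AE
 proof eventually_elim
  case (elim x)
  have p: "0 <= dl * jp x" using dl jap_ge(4)[of "Q x"] by simp
  hence "Re (cnj (Q x) * (PP dl x - Q x)) = Re (Q x) * (dl * jp x + 1)" by(simp add: PP_def distrib_left)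
  thus ?case using elim p by(simp add: PP_def)
 qed
 have "(LINT x|M. (cmod (of_real (th x) * Q x * u x))^2) <=
  (LINT x|M. Re (cnj (of_real (th x * th x) * Q x) * (of_real ((cmod (DD u x))^2) + PP dl x * of_real ((cmod (u x))^2))))"
 proof (rule integral_mono_AE)
  show "AE x in M. (cmod (of_real (th x) * Q x * u x))^2 <=
   Re (cnj (of_real (th x * th x) * Q x) * (of_real ((cmod (DD u x))^2) + PP dl x * of_real ((cmod (u x))^2)))"
   using ReP
  proof eventually_elim
   case (elim x)
   define D U t where "D = (cmod (DD u x))^2" and "U = (cmod (u x))^2" and "t = th x * th x"
   have nn: "0 <= D" "0 <= U" "0 <= t" by(simp_all add: D_def U_def t_def)
   have "cnj (of_real t * Q x) * (of_real D + PP dl x * of_real U) =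
   of_real (t * D) * cnj (Q x) + of_real (t * U) * (cnj (Q x) * (PP dl x - Q x)) + of_real (t * U) * (Q x * cnj (Q x))"
   by(simp add: algebra_simps)
   hence "Re (cnj (of_real t * Q x) * (of_real D + PP dl x * of_real U)) =
   t * D * Re (Q x) + t * U * Re (cnj (Q x) * (PP dl x - Q x)) + t * U * (cmod (Q x))^2"
   unfolding complex_norm_square[symmetric] of_real_mult[symmetric] plus_complex.sel Re_complex_of_real Re_of_real_times by simp
   moreover have "(cmod (of_real (th x) * Q x * u x))^2 = t * U * (cmod (Q x))^2"
   by(simp add: norm_mult power_mult_distrib t_def U_def power2_eq_square)
   moreover have "0 <= t * D * Re (Q x)" "0 <= t * U * Re (cnj (Q x) * (PP dl x - Q x))" using nn elim by simp_all
   ultimately show ?case unfolding D_def[symmetric] U_def[symmetric] t_def[symmetric] by linarith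
  qed
  show "integrable M (%x. (cmod (of_real (th x) * Q x * u x))^2)" using QL by(simp only: L2_iff)
  show "integrable M (%x. Re (cnj (of_real (th x * th x) * Q x) * (of_real ((cmod (DD u x))^2) + PP dl x * of_real ((cmod (u x))^2))))"
   by(rule integrable_Re[OF s1(1)])
 qed
 also have "... <= e * a * b + m * H^2 + 3 * a * H"
  unfolding integral_Re[OF s1(1)] by(rule order_trans[OF complex_Re_le_cmod s1(2)])
 finally have Qb: "(LINT x|M. (cmod (of_real (th x) * Q x * u x))^2) <= e * a * b + m * H^2 + 3 * a * H" .
 \<comment> \<open>This uses <Q>^2 = 1 + |Q|^2 and th <= 1; the extra |u|^2 becomes the summand H^2
   in the first hypothesis of \<open>AM_GM_split\<close>.\<close>
 have "a^2 <= (LINT x|M. (cmod (u x))^2 + (cmod (of_real (th x) * Q x * u x))^2)"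
  unfolding n2_sq
 proof (rule integral_mono)
  show "integrable M (%x. (cmod (of_real (th x * jp x) * u x))^2)" using a_L2 by(simp only: L2_iff)
  show "integrable M (%x. (cmod (u x))^2 + (cmod (of_real (th x) * Q x * u x))^2)"
   using QL uL by(intro Bintble_add) (simp_all only: L2_iff)
  fix x
  have "(jp x)^2 = 1 + (cmod (Q x))^2" by(simp add: jap_def)
  moreover have "(th x)^2 <= 1" using t01[of x] by(simp add: power_le_one)
  hence "(th x)^2 * (cmod (u x))^2 <= 1 * (cmod (u x))^2" by(intro mult_right_mono) auto
  ultimately show "(cmod (of_real (th x * jp x) * u x))^2 <= (cmod (u x))^2 + (cmod (of_real (th x) * Q x * u x))^2"
   unfolding norm_mult norm_of_real power_mult_distrib power2_abs by(simp add: algebra_simps)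
 qed
 also have "... = (n2 M u)^2 + (LINT x|M. (cmod (of_real (th x) * Q x * u x))^2)"
  unfolding n2_sq using QL uL by(intro Bint_add) (simp_all only: L2_iff)
 also have "(n2 M u)^2 <= H^2" by(intro power_mono energy(1)[OF u h dl] n2_nonneg)
 finally show "a^2 <= e * a * b + m * H^2 + 3 * a * H + H^2" using Qb by linarith
 have "b^2 <= (LINT x|M. Re (cnj (of_real (th x * th x) * of_real (jp x)) * (of_real ((cmod (DD u x))^2) + PP dl x * of_real ((cmod (u x))^2))))"
  unfolding n2_sq
 proof (rule integral_mono_AE)
  show "integrable M (%x. (cmod (of_real (th x * sqrt (jp x)) * DD u x))^2)" using b_L2 by(simp only: L2_iff)
  show "integrable M (%x. Re (cnj (of_real (th x * th x) * of_real (jp x)) * (of_real ((cmod (DD u x))^2) + PP dl x * of_real ((cmod (u x))^2))))"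
   by(rule integrable_Re[OF s2(1)])
  show "AE x in M. (cmod (of_real (th x * sqrt (jp x)) * DD u x))^2 <=
   Re (cnj (of_real (th x * th x) * of_real (jp x)) * (of_real ((cmod (DD u x))^2) + PP dl x * of_real ((cmod (u x))^2)))"
   using ReP
  proof eventually_elim
   case (elim x)
   define D U t where "D = (cmod (DD u x))^2" and "U = (cmod (u x))^2" and "t = th x * th x"
   have nn: "0 <= D" "0 <= U" "0 <= t" by(simp_all add: D_def U_def t_def)
   have j: "0 <= jp x" using jap_ge(4)[of "Q x"] by simp
   have "cnj (of_real t * of_real (jp x)) * (of_real D + PP dl x * of_real U) = of_real (t * jp x * D) + of_real (t * jp x * U) * PP dl x"
   by(simp add: algebra_simps)
   hence "Re (cnj (of_real t * of_real (jp x)) * (of_real D + PP dl x * of_real U)) = t * jp x * D + t * jp x * U * Re (PP dl x)"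
   unfolding plus_complex.sel Re_complex_of_real Re_of_real_times by simp
   moreover have "(cmod (of_real (th x * sqrt (jp x)) * DD u x))^2 = t * jp x * D"
   using j by(simp only: norm_mult norm_of_real power2_abs power_mult_distrib real_sqrt_pow2 t_def D_def power2_eq_square[of "th x"])
   moreover have "0 <= t * jp x * U * Re (PP dl x)" using nn elim j by simp
   ultimately show ?case unfolding D_def[symmetric] U_def[symmetric] t_def[symmetric] by linarith
  qed
 qed
 also have "... <= e * a * b + m * H^2 + 3 * a * H"
  unfolding integral_Re[OF s2(1)] by(rule order_trans[OF complex_Re_le_cmod s2(2)])
 finally show "b^2 <= e * a * b + m * H^2 + 3 * a * H" .
qed

end

context adm begin

lemma sep_const_nonneg: "0 <= sep_const e m"
 unfolding sep_const_def using em by(intro real_sqrt_ge_zero mult_nonneg_nonneg add_nonneg_nonneg divide_nonneg_nonneg) auto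

text \<open>The bound of \<open>sep_cut\<close> is the same for all cut-offs, so Fatou's lemma
  removes them. Its uniformity in dl is what the construction of solutions for dl = 0
  exploits.\<close>

theorem separation:
 assumes u: "wsol dl h u" and h: "h : L2 M" and dl: "0 <= dl"
 shows "(%x. of_real (jp x) * u x) : L2 M" "n2 M (%x. of_real (jp x) * u x) <= sep_const e m * n2 M h"
proof -
 obtain th :: "nat => pt => real" where t: "!!n. smooth d (%x. of_real (th n x))" "!!n x. 0 <= th n x" "!!n x. th n x <= 1"
  "!!n x. x : Rd d ==> L2_set (%i. cmod (partial i (%x. of_real (th n x)) x)) {..<d} <= 1"
  "!!n. EX r. ALL x:Rd d. r < L2_set x {..<d} --> th n x = 0 & (ALL i<d. partial i (%x. of_real (th n x)) x = 0)"
  "!!x. x : Rd d ==> (%n. th n x) ~~> 1"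
  using cutoff_seq[of d] by metis
 have s: "sep d Om Q e m (th n) dl h u" for n
  using t(1-3,5)[of n] t(4)[where n = n] u h dl by unfold_locales auto
 have c: "(%n. of_real (th n x * jp x) * u x) ~~> of_real (jp x) * u x" if "x : Rd d" for x
 proof -
  have "(%n. of_real (th n x * jp x) * u x) ~~> of_real (1 * jp x) * u x"
   by(intro tendsto_mult tendsto_of_real tendsto_const t(6) that)
  thus ?thesis by simp
 qed
 have lim: "AE x in M. (%n. of_real (th n x * jp x) * u x) ~~> of_real (jp x) * u x"
  using sub by(intro AE_I2 c) (auto simp: space_M)
 note f = L2_fatou[where F = "%n x. of_real (th n x * jp x) * u x" and ?n0.0 = 0, OF sep.a_L2[OF s] sep.sep_cut[OF s] lim
  jp_mult_meas(2)[OF L2_measurable[OF VV_L2(1)[OF wsol_D(1)[OF u]]]] mult_nonneg_nonneg[OF sep_const_nonneg n2_nonneg]]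
 show "(%x. of_real (jp x) * u x) : L2 M" "n2 M (%x. of_real (jp x) * u x) <= sep_const e m * n2 M h" by(rule f)+
qed

end

section \<open>The resolvent\<close>

lemma partial_cnj:
 assumes "((%s. ph (x(i := s))) has_vector_derivative D) (at (x i))"
 shows "((%s. cnj (ph (x(i := s)))) has_vector_derivative cnj D) (at (x i))" "partial i (%x. cnj (ph x)) x = cnj D"
proof -
 show "((%s. cnj (ph (x(i := s)))) has_vector_derivative cnj D) (at (x i))"
  by(rule bounded_linear.has_vector_derivative[OF bounded_linear_cnj assms])
 thus "partial i (%x. cnj (ph x)) x = cnj D" by(rule partial_eq)
qed

lemma smn_cnj: "smn d n ph ==> smn d n (%x. cnj (ph x))"
proof (induction n arbitrary: ph)
 case 0
 thus ?case by(simp add: continuous_on_cnj)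
next
 case (Suc n)
 have D: "((%s. ph (x(i := s))) has_vector_derivative partial i ph x) (at (x i))" if "i < d" "x : Rd d" for i x
  using Suc.prems that unfolding partial_def by(auto simp: vector_derivative_works[symmetric])
 have "smn d n (partial i (%x. cnj (ph x)))" if i: "i < d" for i
 proof (rule smn_cong[OF _ Suc.IH])
  show "smn d n (partial i ph)" using Suc.prems i by simp
  show "cnj (partial i ph x) = partial i (%x. cnj (ph x)) x" if "x : Rd d" for x by(rule partial_cnj(2)[OF D[OF i that], symmetric])
 qed
 moreover have "(%s. cnj (ph (x(i := s)))) differentiable at (x i)" if "i < d" "x : Rd d" for i x
  using partial_cnj(1)[OF D[OF that]] by(rule differentiableI_vector)
 ultimately show ?case using Suc.prems by(simp add: continuous_on_cnj)
qed

lemma test_fun_cnj: assumes "ph : test_fun d Om" shows "(%x. cnj (ph x)) : test_fun d Om"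
 using assms smn_cnj by(fastforce simp: test_fun_def smooth_iff)

lemma (in domain) h10_cnj: assumes "h10 u G" shows "h10 (%x. cnj (u x)) (%i x. cnj (G i x))"
proof -
 obtain ph where ph: "!!n. ph n : test_fun d Om" "L2_lim M ph u"
  "!!i. i < d ==> L2_lim M (%n. partial i (ph n)) (G i)" using h10_seq[OF assms] by blast
 show ?thesis
 proof (rule h10_of_seq[of _ _ "%n x. cnj (ph n x)"])
  show "(%n. n2 M (%x. cnj (ph n x) - cnj (u x))) ~~> 0" using ph(2) by(simp only: complex_cnj_diff[symmetric] n2_cnj)
  fix i assume i: "i < d"
  have "n2 M (%x. partial i (%x. cnj (ph n x)) x - cnj (G i x)) = n2 M (%x. cnj (partial i (ph n) x - G i x))" for n
   unfolding n2_eq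
  proof (intro arg_cong[where f = sqrt] Bint_cong refl)
   fix x assume "x : space M"
   hence xR: "x : Rd d" using sub by(auto simp: space_M)
   show "(cmod (partial i (%x. cnj (ph n x)) x - cnj (G i x)))^2 = (cmod (cnj (partial i (ph n) x - G i x)))^2"
   using partial_cnj(2)[where ph = "ph n" and x = x and i = i, OF smooth_has_derivative[OF test_fun_smooth[OF ph(1)] i xR]] by simp
  qed
  thus "(%n. n2 M (%x. partial i (%x. cnj (ph n x)) x - cnj (G i x))) ~~> 0" using ph(3)[OF i] by(simp only: n2_cnj)
 qed (auto intro!: L2_cnj test_fun_cnj ph(1) h10_L2[OF assms])
qed

context adm begin

text \<open>With p = \<open>pj dl\<close> this is the difference between the form of T + 1 + dl <Q>
  and the inner product of the form domain, whose weight is <Q>. Lax-Milgram is applied to that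
  inner product plus this bounded perturbation.\<close>

definition mp :: "(pt => complex) => (pt => complex) => (pt => complex) => complex" where
 "mp p f g = (LINT x|M. p x * f x * cnj (g x))"

abbreviation "pj dl x \<equiv> PP dl x - of_real (jp x)"

lemma pj_meas: "(%x. pj dl x) : bm M"
 by(intro borel_measurable_diff PP_meas of_real_meas jp_meas)

lemma pj_le: "cmod (pj dl x) <= (3 + \<bar>dl\<bar>) * jp x"
 using norm_triangle_ineq4[of "PP dl x" "of_real (jp x)"] PP_le[of dl x] jap_ge(4)[of "Q x"] by(simp add: algebra_simps)

lemma jpc_le: "cmod (of_real (jp x)) <= 1 * jp x"
 using jap_ge(4)[of "Q x"] by simp

lemmas pj_bound = VV_mult_integrable[OF _ _ pj_meas pj_le]
lemmas jp_bound = VV_mult_integrable[OF _ _ of_real_meas[OF jp_meas] jpc_le]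

lemma mp_lin:
 assumes V: "f : VV" "g : VV" "k : VV" and p: "p : bm M" "!!x. cmod (p x) <= C * jp x"
 shows "mp p (%x. a * f x + b * g x) k = a * mp p f k + b * mp p g k"
  "mp p k (%x. a * f x + b * g x) = cnj a * mp p k f + cnj b * mp p k g"
proof -
 note i = VV_mult_integrable(1)[OF _ _ p]
 have "(%x. p x * (a * f x + b * g x) * cnj (k x)) = (%x. a * (p x * f x * cnj (k x)) + b * (p x * g x * cnj (k x)))"
  by(rule ext) (simp add: algebra_simps)
 thus "mp p (%x. a * f x + b * g x) k = a * mp p f k + b * mp p g k"
  unfolding mp_def using i[OF V(1,3)] i[OF V(2,3)] by simp
 have "(%x. p x * k x * cnj (a * f x + b * g x)) = (%x. cnj a * (p x * k x * cnj (f x)) + cnj b * (p x * k x * cnj (g x)))"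
  by(rule ext) (simp add: algebra_simps)
 thus "mp p k (%x. a * f x + b * g x) = cnj a * mp p k f + cnj b * mp p k g"
  unfolding mp_def using i[OF V(3,1)] i[OF V(3,2)] by simp
qed

lemma VV_diff: "u : VV ==> v : VV ==> (%x. u x - v x) : VV"
 by(rule Vsp.diff_mem)

lemma tv_sum: "(\<Sum>k\<le>d. f (tv k u)) = (\<Sum>i<d. f (grad d Om u i)) + f (sq u)" for f :: "_ => 'a :: comm_monoid_add"
 unfolding lessThan_Suc_atMost[symmetric] by(simp add: tv_def)

lemma tv_sum2: "(\<Sum>k\<le>d. f (tv k u) (tv k v)) = (\<Sum>i<d. f (grad d Om u i) (grad d Om v i)) + f (sq u) (sq v)"
 for f :: "_ => _ => 'a :: comm_monoid_add"
 unfolding lessThan_Suc_atMost[symmetric] by(simp add: tv_def)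

lemma gip_eq:
 assumes u: "u : VV" and g: "g : VV"
 shows "(\<Sum>i<d. L2_inner M (grad d Om u i) (grad d Om g i)) + mp (PP dl) u g = Vsp.gip u g + mp (pj dl) u g"
proof -
 have "Vsp.gip u g = (\<Sum>i<d. L2_inner M (grad d Om u i) (grad d Om g i)) + L2_inner M (sq u) (sq g)"
  unfolding Vsp.gip_def by(rule tv_sum2)
 moreover have "L2_inner M (sq u) (sq g) = mp (%x. of_real (jp x)) u g"
  unfolding L2_inner_def mp_def
 proof (intro Bint_cong refl)
  fix x
  have "sq u x * cnj (sq g x) = of_real (sqrt (jp x) * sqrt (jp x)) * u x * cnj (g x)"
   by(simp only: sq_def complex_cnj_mult complex_cnj_complex_of_real of_real_mult mult_ac)
  thus "sq u x * cnj (sq g x) = of_real (jp x) * u x * cnj (g x)" by(simp only: sqrt_jp(3))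
 qed
 moreover have "mp (pj dl) u g = mp (PP dl) u g - mp (%x. of_real (jp x)) u g"
  unfolding mp_def left_diff_distrib by(rule Bint_diff[OF PP_integrable(1)[OF u g] jp_bound(1)[OF u g]])
 ultimately show ?thesis by simp
qed

lemma wsol_gip: "wsol dl h u \<longleftrightarrow> u : VV & (ALL g:VV. Vsp.gip u g + mp (pj dl) u g = L2_inner M h g)"
 unfolding wsol_def mp_def[symmetric] using gip_eq by auto

abbreviation "vnrm \<equiv> snorm Vsp.gip"

lemma vnrm_sq: "u : VV ==> (vnrm u)\<^sup>2 = (n2 M (DD u))^2 + (n2 M (sq u))^2"
 unfolding Vsp.gnrm_sq DD_L2(2) by(rule tv_sum)

lemma n2_le_sq: assumes u: "u : VV" shows "n2 M u <= n2 M (sq u)" "n2 M (sq u) <= vnrm u"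
proof -
 have "n2 M u <= 1 * n2 M (sq u)"
 proof (rule L2_bound(2)[OF VV_L2(3)[OF u] L2_measurable[OF VV_L2(1)[OF u]]])
  have "cmod (u x) <= 1 * cmod (sq u x)" for x
  proof -
   have "1 * cmod (u x) <= sqrt (jp x) * cmod (u x)" by(intro mult_right_mono sqrt_jp) simp
   thus ?thesis using jap_ge(4)[of "Q x"] by(simp add: sq_def norm_mult)
  qed
  thus "AE x in M. cmod (u x) <= 1 * cmod (sq u x)" by(rule AE_I2)
 qed simp
 thus "n2 M u <= n2 M (sq u)" by simp
 show "n2 M (sq u) <= vnrm u" using Vsp.T_le[OF _ u, of d] by(simp add: tv_def)
qed

lemma sq_le_jp: assumes u: "u : VV" and j: "(%x. of_real (jp x) * u x) : L2 M" shows "n2 M (sq u) <= n2 M (%x. of_real (jp x) * u x)"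
proof -
 have "n2 M (sq u) <= 1 * n2 M (%x. of_real (jp x) * u x)"
 proof (rule L2_bound(2)[OF j L2_measurable[OF VV_L2(3)[OF u]]])
  have "cmod (sq u x) <= 1 * cmod (of_real (jp x) * u x)" for x
  proof -
   have "sqrt (jp x) * cmod (u x) <= jp x * cmod (u x)" by(intro mult_right_mono sqrt_jp) simp
   thus ?thesis using jap_ge(4)[of "Q x"] by(simp add: sq_def norm_mult)
  qed
  thus "AE x in M. cmod (sq u x) <= 1 * cmod (of_real (jp x) * u x)" by(rule AE_I2)
 qed simp
 thus ?thesis by simp
qed

text \<open>For dl > 0 the form is coercive in the norm of the form domain with constant min 1 dl.
  Riesz represents the datum in that space, and Lax-Milgram solves the equation.\<close>

lemma wsol_exists_pos:
 assumes dl: "0 < dl" and h: "h : L2 M" shows "EX u. wsol dl h u"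
proof -
 have "EX z:VV. ALL f:VV. L2_inner M f h = Vsp.gip f z"
 proof (rule Vsp.riesz[of _ "n2 M h"])
  show "L2_inner M (%x. a * f x + b * g x) h = a * L2_inner M f h + b * L2_inner M g h" if "f : VV" "g : VV" for f g a b
   by(rule L2.ip_lin[OF VV_L2(1)[OF that(1)] VV_L2(1)[OF that(2)] h])
  show "cmod (L2_inner M f h) <= n2 M h * vnrm f" if f: "f : VV" for f
  proof -
   have "n2 M f * n2 M h <= vnrm f * n2 M h" using n2_le_sq[OF f] by(intro mult_right_mono n2_nonneg) linarith
   thus ?thesis using L2.cauchy_schwarz[OF VV_L2(1)[OF f] h] by(simp add: mult.commute)
  qed
 qed
 then obtain z where z: "z : VV" "!!f. f : VV ==> L2_inner M f h = Vsp.gip f z" by blast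
 have "EX u:VV. ALL v:VV. Vsp.gip u v + mp (pj dl) u v = Vsp.gip z v"
 proof (rule Vsp.lax_milgram[of _ "4 + \<bar>dl\<bar>" "min 1 dl"])
  fix f g k a b assume V: "f : VV" "g : VV" "k : VV"
  show "Vsp.gip (%x. a * f x + b * g x) k + mp (pj dl) (%x. a * f x + b * g x) k =
   a * (Vsp.gip f k + mp (pj dl) f k) + b * (Vsp.gip g k + mp (pj dl) g k)"
   unfolding Vsp.ip_lin[OF V] mp_lin(1)[OF V pj_meas pj_le] by(simp add: algebra_simps)
  show "Vsp.gip k (%x. a * f x + b * g x) + mp (pj dl) k (%x. a * f x + b * g x) =
   cnj a * (Vsp.gip k f + mp (pj dl) k f) + cnj b * (Vsp.gip k g + mp (pj dl) k g)"
   unfolding Vsp.ip_lin2[OF V] mp_lin(2)[OF V pj_meas pj_le] by(simp add: algebra_simps)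
 next
  fix f g assume V: "f : VV" "g : VV"
  have "n2 M (sq f) * n2 M (sq g) <= vnrm f * vnrm g" by(intro mult_mono n2_le_sq V n2_nonneg Vsp.nrm_nonneg)
  from mult_left_mono[OF this, of "3 + \<bar>dl\<bar>"] have "cmod (mp (pj dl) f g) <= (3 + \<bar>dl\<bar>) * (vnrm f * vnrm g)"
   using pj_bound(2)[OF V, of dl] unfolding mp_def by(simp add: mult.assoc)
  hence "cmod (Vsp.gip f g) + cmod (mp (pj dl) f g) <= (4 + \<bar>dl\<bar>) * vnrm f * vnrm g"
   using Vsp.cauchy_schwarz[OF V] by(simp add: algebra_simps)
  thus "cmod (Vsp.gip f g + mp (pj dl) f g) <= (4 + \<bar>dl\<bar>) * vnrm f * vnrm g"
   by(rule order_trans[OF norm_triangle_ineq])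
 next
  fix f assume f: "f : VV"
  have "min 1 dl * (vnrm f)^2 = min 1 dl * (n2 M (DD f))^2 + min 1 dl * (n2 M (sq f))^2" unfolding vnrm_sq[OF f] by(rule distrib_left)
  moreover have "min 1 dl * (n2 M (DD f))^2 <= 1 * (n2 M (DD f))^2" by(intro mult_right_mono) auto
  moreover have "min 1 dl * (n2 M (sq f))^2 <= dl * (n2 M (sq f))^2" by(intro mult_right_mono) auto
  moreover have "0 <= (n2 M f)^2" by simp
  moreover have "(n2 M (DD f))^2 + (n2 M f)^2 + dl * (n2 M (sq f))^2 <= Re (Vsp.gip f f + mp (pj dl) f f)"
   using energy_coer[OF f less_imp_le[OF dl]] unfolding mp_def[symmetric] gip_eq[OF f f] .
  ultimately have "min 1 dl * (vnrm f)^2 <= Re (Vsp.gip f f + mp (pj dl) f f)" by linarith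
  thus "min 1 dl * (vnrm f)^2 <= cmod (Vsp.gip f f + mp (pj dl) f f)" by(rule order_trans[OF _ complex_Re_le_cmod])
 qed (use dl z in auto)
 then obtain u where u: "u : VV" "!!v. v : VV ==> Vsp.gip u v + mp (pj dl) u v = Vsp.gip z v" by blast
 have "Vsp.gip z v = L2_inner M h v" if v: "v : VV" for v
  using z(2)[OF v] Vsp.ip_cnj[OF v z(1)] L2.ip_cnj[OF VV_L2(1)[OF v] h] by simp
 thus ?thesis using u wsol_gip by auto
qed

text \<open>Moving dl <Q> u to the right makes u an exact solution for dl = 0, with a datum that is
  in L2 by separation. Solutions for different dl then solve one linear problem and can be
  subtracted.\<close>

lemma wsol_shift:
 assumes u: "wsol dl h u" and h: "h : L2 M" and j: "(%x. of_real (jp x) * u x) : L2 M"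
 shows "wsol 0 (%x. h x - of_real dl * (of_real (jp x) * u x)) u"
 unfolding wsol_def mp_def[symmetric]
proof (intro conjI ballI wsol_D(1)[OF u])
 fix g assume g: "g : VV"
 note V = wsol_D(1)[OF u] g
 have "mp (PP 0) u g = mp (PP dl) u g - of_real dl * L2_inner M (%x. of_real (jp x) * u x) g"
 proof -
  have "mp (PP 0) u g = (LINT x|M. PP dl x * u x * cnj (g x) - of_real dl * (of_real (jp x) * u x * cnj (g x)))"
   unfolding mp_def by(intro Bint_cong refl) (simp add: PP_def algebra_simps)
  also have "... = (LINT x|M. PP dl x * u x * cnj (g x)) - (LINT x|M. of_real dl * (of_real (jp x) * u x * cnj (g x)))"
   by(rule Bint_diff[OF PP_integrable(1)[OF V] integrable_mult_right[OF jp_bound(1)[OF V]]])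
  finally show ?thesis unfolding mp_def L2_inner_def by(simp only: integral_mult_right_zero)
 qed
 moreover have "L2_inner M (%x. h x - of_real dl * (of_real (jp x) * u x)) g = L2_inner M h g - of_real dl * L2_inner M (%x. of_real (jp x) * u x) g"
  unfolding L2.ip_diff[OF h L2.scale_mem[OF j] VV_L2(1)[OF g]] L2.ip_scale[OF j VV_L2(1)[OF g]] ..
 ultimately show "(\<Sum>i<d. L2_inner M (grad d Om u i) (grad d Om g i)) + mp (PP 0) u g = L2_inner M (%x. h x - of_real dl * (of_real (jp x) * u x)) g"
  using wsol_D(2)[OF u g] unfolding mp_def[symmetric] by(simp only: add_diff_eq)
qed

lemma wsol_diff:
 assumes u: "wsol 0 h u" "wsol 0 h' u'" and h: "h : L2 M" "h' : L2 M"
 shows "wsol 0 (%x. h x - h' x) (%x. u x - u' x)"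
 unfolding wsol_gip
proof (intro conjI ballI VV_diff wsol_D(1)[OF u(1)] wsol_D(1)[OF u(2)])
 fix g assume g: "g : VV"
 note V = wsol_D(1)[OF u(1)] wsol_D(1)[OF u(2)] g
 have m: "mp (pj 0) (%x. u x - u' x) g = mp (pj 0) u g - mp (pj 0) u' g"
  using mp_lin(1)[OF V pj_meas pj_le, of 0 1 "-1"] by simp
 have eq: "Vsp.gip u g + mp (pj 0) u g = L2_inner M h g" "Vsp.gip u' g + mp (pj 0) u' g = L2_inner M h' g"
  using u g unfolding wsol_gip by blast+
 show "Vsp.gip (%x. u x - u' x) g + mp (pj 0) (%x. u x - u' x) g = L2_inner M (%x. h x - h' x) g"
  unfolding Vsp.ip_diff[OF V] L2.ip_diff[OF h VV_L2(1)[OF g]] m eq[symmetric] by simp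
qed

text \<open>The substitute for coercivity at dl = 0: the energy bounds the gradient and separation
  bounds <Q>^(1/2) u, so the datum controls the form norm of a solution.\<close>

lemma vnrm_wsol:
 assumes u: "wsol 0 h u" and h: "h : L2 M" shows "vnrm u <= (1 + sep_const e m) * n2 M h"
proof -
 note V = wsol_D(1)[OF u]
 have "n2 M (sq u) <= sep_const e m * n2 M h"
  using sq_le_jp[OF V separation(1)[OF u h]] separation(2)[OF u h] by simp
 moreover have "vnrm u <= n2 M (DD u) + n2 M (sq u)"
 proof (rule power2_le_imp_le)
  show "(vnrm u)^2 <= (n2 M (DD u) + n2 M (sq u))^2"
   unfolding vnrm_sq[OF V] power2_sum using mult_nonneg_nonneg[OF n2_nonneg[of M "DD u"] n2_nonneg[of M "sq u"]] by linarith
 qed (intro add_nonneg_nonneg n2_nonneg)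
 ultimately show ?thesis using energy(2)[OF u h] by(simp add: algebra_simps)
qed

text \<open>The shifted data differ from h by at most dl C |h| in norm. By \<open>vnrm_wsol\<close>
  the regularised solutions are then Cauchy in the form norm, and both sides of the equation pass to
  the limit.\<close>

lemma wsol_exists: assumes h: "h : L2 M" shows "EX u. wsol 0 h u"
proof -
 define dl where "dl n = inverse (real (Suc n))" for n
 have dl: "0 < dl n" "dl ~~> 0" for n
  unfolding dl_def[abs_def] by(simp, rule LIMSEQ_inverse_real_of_nat)
 obtain u where u: "!!n. wsol (dl n) h (u n)" using wsol_exists_pos[OF dl(1) h] by metis
 define C where "C = sep_const e m"
 have C: "0 <= C" unfolding C_def by(rule sep_const_nonneg)
 define k where "k n x = h x - of_real (dl n) * (of_real (jp x) * u n x)" for n x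
 note J = separation[OF u h less_imp_le[OF dl(1)]]
 have kL: "k n : L2 M" for n unfolding k_def by(intro L2.diff_mem L2.scale_mem h J)
 have ku: "wsol 0 (k n) (u n)" for n unfolding k_def by(rule wsol_shift[OF u h J(1)])
 have kh: "n2 M (%x. k n x - h x) <= dl n * (C * n2 M h)" for n
 proof -
  have "n2 M (%x. k n x - h x) = n2 M (%x. of_real (dl n) * (of_real (jp x) * u n x))" unfolding n2_eq k_def by simp
  also have "... = dl n * n2 M (%x. of_real (jp x) * u n x)" unfolding L2.nrm_scale[OF J(1)] using dl(1)[of n] by simp
  also have "... <= dl n * (C * n2 M h)" unfolding C_def by(intro mult_left_mono J less_imp_le[OF dl(1)])
  finally show ?thesis .
 qed
 define c where "c n = (1 + C) * (dl n * (C * n2 M h))" for n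
 have c0: "c ~~> 0"
 proof -
  have "(%n. (1 + C) * (dl n * (C * n2 M h))) ~~> (1 + C) * (0 * (C * n2 M h))" by(intro tendsto_intros dl)
  thus ?thesis by(simp add: c_def[abs_def])
 qed
 have cau: "vnrm (%x. u i x - u j x) <= c i + c j" for i j
 proof -
  have "n2 M (%x. k i x - k j x) <= n2 M (%x. k i x - h x) + n2 M (%x. h x - k j x)" by(rule L2.nrm_triangle_diff[OF kL h kL])
  also have "n2 M (%x. h x - k j x) = n2 M (%x. k j x - h x)" unfolding n2_eq by(simp only: norm_minus_commute)
  finally have le: "n2 M (%x. k i x - k j x) <= dl i * (C * n2 M h) + dl j * (C * n2 M h)" using kh[of i] kh[of j] by linarith
  have "vnrm (%x. u i x - u j x) <= (1 + C) * n2 M (%x. k i x - k j x)"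
   unfolding C_def by(rule vnrm_wsol[OF wsol_diff[OF ku ku kL kL] L2.diff_mem[OF kL kL]])
  also have "... <= (1 + C) * (dl i * (C * n2 M h) + dl j * (C * n2 M h))" using le C by(intro mult_left_mono) auto
  finally show ?thesis by(simp only: c_def distrib_left)
 qed
 have uV: "u n : VV" for n by(rule wsol_D(1)[OF u])
 obtain v where v: "v : VV" "(%n. vnrm (%x. u n x - v x)) ~~> 0"
 proof -
  have "EX N. ALL i>=N. ALL j>=N. vnrm (%x. u i x - u j x) < r" if r: "0 < r" for r
  proof -
   obtain N where N: "!!n. n >= N ==> norm (c n - 0) < r / 2" using LIMSEQ_D[OF c0, of "r / 2"] r by auto
   show ?thesis
   proof (intro exI[of _ N] allI impI)
   fix i j assume "N <= i" "N <= j"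
   hence "c i < r / 2" "c j < r / 2" using N[of i] N[of j] by auto
   thus "vnrm (%x. u i x - u j x) < r" using cau[of i j] by linarith
   qed
  qed
  from Vsp.complete[of u, OF uV this] show thesis using that by blast
 qed
 have "Vsp.gip v g + mp (pj 0) v g = L2_inner M h g" if g: "g : VV" for g
 proof (rule LIMSEQ_unique)
  have 1: "(%n. Vsp.gip (u n) g) ~~> Vsp.gip v g" by(rule Vsp.ip_tendsto[OF uV v(1) g v(2)])
  have 2: "(%n. mp (pj 0) (u n) g) ~~> mp (pj 0) v g"
  proof (rule Lim_transform2[OF tendsto_const])
   have "(%n. 3 * vnrm (%x. u n x - v x) * n2 M (sq g)) ~~> 3 * 0 * n2 M (sq g)" by(intro tendsto_intros v)
   hence l: "(%n. 3 * vnrm (%x. u n x - v x) * n2 M (sq g)) ~~> 0" by simp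
   show "(%n. mp (pj 0) v g - mp (pj 0) (u n) g) ~~> 0"
   proof (rule Lim_null_comparison[OF always_eventually l], rule allI)
   fix n
   have "mp (pj 0) (%x. u n x - v x) g = mp (pj 0) (u n) g - mp (pj 0) v g"
   using mp_lin(1)[OF uV[of n] v(1) g pj_meas pj_le, of 0 1 "-1"] by simp
   hence "cmod (mp (pj 0) v g - mp (pj 0) (u n) g) = cmod (mp (pj 0) (%x. u n x - v x) g)" by(simp only: norm_minus_commute)
   also have "... <= 3 * n2 M (sq (%x. u n x - v x)) * n2 M (sq g)"
   using pj_bound(2)[OF VV_diff[OF uV v(1)] g, of 0] unfolding mp_def by simp
   also have "... <= 3 * vnrm (%x. u n x - v x) * n2 M (sq g)"
   by(intro mult_right_mono mult_left_mono n2_le_sq(2) VV_diff uV v(1) n2_nonneg) simp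
   finally show "norm (mp (pj 0) v g - mp (pj 0) (u n) g) <= 3 * vnrm (%x. u n x - v x) * n2 M (sq g)" .
   qed
  qed
  show "(%n. Vsp.gip (u n) g + mp (pj 0) (u n) g) ~~> Vsp.gip v g + mp (pj 0) v g" by(rule tendsto_add[OF 1 2])
  have "L2_lim M k h"
  proof (rule Lim_null_comparison[OF always_eventually])
   have "(%n. dl n * (C * n2 M h)) ~~> 0 * (C * n2 M h)" by(intro tendsto_intros dl)
   thus "(%n. dl n * (C * n2 M h)) ~~> 0" by simp
   show "ALL n. norm (n2 M (%x. k n x - h x)) <= dl n * (C * n2 M h)" using kh by(simp add: n2_nonneg)
  qed
  from L2.ip_tendsto[OF kL h VV_L2(1)[OF g] this] have "(%n. L2_inner M (k n) g) ~~> L2_inner M h g" .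
  moreover have "L2_inner M (k n) g = Vsp.gip (u n) g + mp (pj 0) (u n) g" for n using ku[of n] g unfolding wsol_gip by auto
  ultimately show "(%n. Vsp.gip (u n) g + mp (pj 0) (u n) g) ~~> L2_inner M h g" by simp
 qed
 thus ?thesis using v(1) wsol_gip by blast
qed

lemma test_VV: assumes ph: "ph : test_fun d Om" shows "ph : VV"
proof (rule VV_I[OF h10_test[OF ph]])
 obtain K where K: "compact K" "K \<subseteq> Om" "!!x. x : Rd d ==> x ~: K ==> ph x = 0" using ph by(auto simp: test_fun_def)
 obtain B where B: "B >= 0" "AE x in M. x : K --> cmod (Q x) <= B & (ALL i<d. cmod (V i x) <= B)"
  using Q_locbd K(1,2) unfolding locbd_def by blast
 show "sq ph : L2 M"
 proof (rule L2_bound(1)[OF test_L2[OF ph] jp_mult_meas(1)[OF L2_measurable[OF test_L2[OF ph]]], of "1 + B"])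
  show "AE x in M. cmod (sq ph x) <= (1 + B) * cmod (ph x)" using B(2) AE_space
  proof eventually_elim
   case (elim x)
   have xR: "x : Rd d" using elim(2) sub by(auto simp: space_M)
   show ?case
   proof (cases "x : K")
   case True
   hence "sqrt (jp x) <= 1 + B" using elim(1) sqrt_jp(2)[of x] jap_ge(3)[of "Q x"] by auto
   from mult_right_mono[OF this norm_ge_zero[of "ph x"]] show ?thesis using jap_ge(4)[of "Q x"] by(simp add: sq_def norm_mult)
   next
   case False
   thus ?thesis using K(3)[OF xR] by(simp add: sq_def)
   qed
  qed
 qed (use B in simp)
qed

text \<open>Test functions belong to the form domain and are dense, so <f,f> = <f, f - ph> can be
  made arbitrarily small compared with |f|.\<close>

lemma L2_zero_of_VV: assumes f: "f : L2 M" and z: "!!g. g : VV ==> L2_inner M f g = 0" shows "n2 M f = 0"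
proof -
 have "(n2 M f)^2 <= n2 M f * r" if r: "0 < r" for r
 proof -
  obtain ph where ph: "ph : test_fun d Om" "n2 M (%x. f x - ph x) < r" using test_dense[OF f r] by blast
  have "L2_inner M f f = L2_inner M f (%x. f x - ph x)" unfolding L2.ip_diff2[OF f test_L2[OF ph(1)] f] using z[OF test_VV[OF ph(1)]] by simp
  hence "(n2 M f)^2 <= n2 M f * n2 M (%x. f x - ph x)"
   unfolding L2.nrm_sq[OF f] by(metis complex_Re_le_cmod L2.cauchy_schwarz[OF f L2.diff_mem[OF f test_L2[OF ph(1)]]] order_trans)
  also have "... <= n2 M f * r" using ph(2) by(intro mult_left_mono n2_nonneg) simp
  finally show ?thesis .
 qed
 from this[of "n2 M f / 2"] have "\<not> 0 < n2 M f" by(auto simp: power2_eq_square)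
 thus ?thesis using n2_nonneg[of M f] by linarith
qed

lemma represents_iff:
 assumes u: "u : VV"
 shows "represents d Om Q u \<eta> \<longleftrightarrow> \<eta> : L2 M & wsol 0 (%x. \<eta> x + u x) u"
proof -
 have A: "form d Om Q u g + L2_inner M u g = (\<Sum>i<d. L2_inner M (grad d Om u i) (grad d Om g i)) + (LINT x|M. PP 0 x * u x * cnj (g x))"
  if g: "g : VV" for g
 proof -
  have "(LINT x|M. (\<Sum>i<d. grad d Om u i x * cnj (grad d Om g i x))) = (\<Sum>i<d. L2_inner M (grad d Om u i) (grad d Om g i))"
   unfolding L2_inner_def by(rule Bint_sum) (auto intro: L2_inner_integrable VV_L2(2) u g)
  moreover have "(LINT x|M. PP 0 x * u x * cnj (g x)) = (LINT x|M. Q x * u x * cnj (g x) + u x * cnj (g x))"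
   by(intro Bint_cong refl) (simp add: PP_def algebra_simps)
  moreover have "(LINT x|M. Q x * u x * cnj (g x) + u x * cnj (g x)) = (LINT x|M. Q x * u x * cnj (g x)) + L2_inner M u g"
   unfolding L2_inner_def
  proof (rule Bint_add[OF _ L2_inner_integrable[OF VV_L2(1)[OF u] VV_L2(1)[OF g]]])
   have "cmod (Q x) <= 1 * jp x" for x using jap_ge(2)[of "Q x"] by simp
   thus "integrable M (%x. Q x * u x * cnj (g x))" by(rule VV_mult_integrable(1)[OF u g Q_meas])
  qed
  ultimately show ?thesis unfolding form_def by simp
 qed
 have B: "L2_inner M (%x. \<eta> x + u x) g = L2_inner M \<eta> g + L2_inner M u g" if "g : VV" "\<eta> : L2 M" for g
  by(rule L2.ip_add[OF that(2) VV_L2(1)[OF u] VV_L2(1)[OF that(1)]])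
 have "form d Om Q u g = L2_inner M \<eta> g \<longleftrightarrow>
   (\<Sum>i<d. L2_inner M (grad d Om u i) (grad d Om g i)) + (LINT x|M. PP 0 x * u x * cnj (g x)) = L2_inner M (%x. \<eta> x + u x) g"
  if "g : VV" "\<eta> : L2 M" for g unfolding A[OF that(1), symmetric] B[OF that] by simp
 thus ?thesis unfolding represents_def wsol_def using u by blast
qed

text \<open>\<open>resolvent\<close> chooses u, and within that \<open>schr\<close> chooses a
  representing function. A weak solution u satisfies the selection criterion, because representing
  functions agree almost everywhere by density of the form domain. Conversely, whatever function is
  selected solves the weak equation with datum h.\<close>

lemma resolvent_wsol:
 assumes h: "h : L2 M"
 shows "wsol 0 h (resolvent d Om Q (-1) h)" "resolvent d Om Q (-1) h : schr_dom d Om Q"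
proof -
 obtain u where u: "wsol 0 h u" using wsol_exists[OF h] by blast
 note uV = wsol_D(1)[OF u]
 have r: "represents d Om Q u (%x. h x - u x)" unfolding represents_iff[OF uV] using u L2.diff_mem[OF h VV_L2(1)[OF uV]] by simp
 hence s: "represents d Om Q u (schr d Om Q u)" unfolding schr_def by(rule someI[of "represents d Om Q u"])
 have L: "(%x. h x - u x) : L2 M" "schr d Om Q u : L2 M" using r s by(simp_all add: represents_def)
 have "n2 M (%x. schr d Om Q u x - (h x - u x)) = 0"
 proof (rule L2_zero_of_VV[OF L2.diff_mem[OF L(2,1)]])
  fix g assume g: "g : VV"
  show "L2_inner M (%x. schr d Om Q u x - (h x - u x)) g = 0"
   unfolding L2.ip_diff[OF L(2,1) VV_L2(1)[OF g]] using r s g by(simp add: represents_def)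
 qed
 hence "AE x in M. schr d Om Q u x - (h x - u x) = 0" using n2_zero_iff[OF L2.diff_mem[OF L(2,1)]] by blast
 hence "AE x in M. schr d Om Q u x - (-1) * u x = h x" by eventually_elim (simp add: algebra_simps)
 moreover have "u : schr_dom d Om Q" using uV r by(auto simp: schr_dom_def)
 ultimately have ex: "u : schr_dom d Om Q & (AE x in M. schr d Om Q u x - (-1) * u x = h x)" by blast
 define v where "v = resolvent d Om Q (-1) h"
 have v: "v : schr_dom d Om Q" "AE x in M. schr d Om Q v x - (-1) * v x = h x"
  using someI[of "%u. u : schr_dom d Om Q & (AE x in M. schr d Om Q u x - (-1) * u x = h x)", OF ex]
  unfolding v_def resolvent_def by blast+
 hence vV: "v : VV" by(simp add: schr_dom_def)
 obtain \<eta> where "represents d Om Q v \<eta>" using v(1) by(auto simp: schr_dom_def)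
 hence "represents d Om Q v (schr d Om Q v)" unfolding schr_def by(rule someI[of "represents d Om Q v"])
 hence w: "wsol 0 (%x. schr d Om Q v x + v x) v" "schr d Om Q v : L2 M" unfolding represents_iff[OF vV] by auto
 have "L2_inner M (%x. schr d Om Q v x + v x) g = L2_inner M h g" if g: "g : VV" for g
  using v(2) by(intro L2_inner_cong_AE h L2.add_mem w(2) VV_L2(1) vV g) (auto elim: eventually_mono)
 hence "wsol 0 h v" using w(1) by(simp add: wsol_def)
 thus "wsol 0 h (resolvent d Om Q (-1) h)" "resolvent d Om Q (-1) h : schr_dom d Om Q" using v(1) by(simp_all add: v_def)
qed

lemma VV_cnj: assumes u: "u : VV" shows "(%x. cnj (u x)) : VV" "i < d ==> AE x in M. grad d Om (%x. cnj (u x)) i x = cnj (grad d Om u i x)"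
proof -
 note h = h10_cnj[OF VV_h10[OF u]]
 show "i < d ==> AE x in M. grad d Om (%x. cnj (u x)) i x = cnj (grad d Om u i x)" by(rule h10_grad[OF h])
 have "sq (%x. cnj (u x)) = (%x. cnj (sq u x))" by(rule ext) (simp add: sq_def)
 thus "(%x. cnj (u x)) : VV" by(intro VV_I[OF h]) (simp add: L2_cnj VV_L2(3)[OF u])
qed

text \<open>Testing with complex conjugates turns the sesquilinear equation into a bilinear, symmetric one.\<close>

definition bil :: "(pt => complex) => (pt => complex) => complex" where
 "bil u v = (\<Sum>i<d. (LINT x|M. grad d Om u i x * grad d Om v i x)) + (LINT x|M. (Q x + 1) * (u x * v x))"

lemma bil_integrable:
 assumes u: "u : VV" and v: "v : VV" shows "integrable M (%x. (Q x + 1) * (u x * v x))"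
proof -
 have "integrable M (%x. PP 0 x * u x * cnj (cnj (v x)))" by(rule PP_integrable(1)[OF u VV_cnj(1)[OF v]])
 thus ?thesis by(simp add: PP_def mult.assoc)
qed

lemma bil_sym: "bil u v = bil v u"
 by(simp add: bil_def mult.commute)

lemma wsol_bil:
 assumes u: "wsol 0 h u" and h: "h : L2 M" and v: "v : VV" shows "bil u v = (LINT x|M. h x * v x)"
proof -
 note uV = wsol_D(1)[OF u]
 have "L2_inner M (grad d Om u i) (grad d Om (%x. cnj (v x)) i) = (LINT x|M. grad d Om u i x * grad d Om v i x)" if i: "i < d" for i
 proof -
  have "L2_inner M (grad d Om u i) (grad d Om (%x. cnj (v x)) i) = L2_inner M (grad d Om u i) (%x. cnj (grad d Om v i x))"
   by(intro L2_inner_cong_AE AE_I2 refl VV_cnj(2) VV_L2(2) L2_cnj VV_cnj(1) uV v i)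
  thus ?thesis by(simp add: L2_inner_def)
 qed
 thus ?thesis using wsol_D(2)[OF u VV_cnj(1)[OF v]] by(simp add: bil_def L2_inner_def PP_def mult.assoc)
qed

end

section \<open>Comparison of two resolvents\<close>

lemma Re_pos_nonzero: "0 < Re z ==> z ~= 0"
 by auto

lemma leb_on_restrict:
 assumes "open_Rd d A" "open_Rd d B" "A \<subseteq> B"
 shows "leb_on d A = restrict_space (leb_on d B) A" "A : sets (leb_on d B)"
proof -
 note s = open_Rd_sets[OF assms(1)] open_Rd_sets'[OF assms(2)]
 have "restrict_space (leb_on d B) A = restrict_space (leb d) (B \<inter> A)" unfolding leb_on_def
  by(rule restrict_restrict_space) (use s open_Rd_sets'[OF assms(1)] in auto)
 thus "leb_on d A = restrict_space (leb_on d B) A" using assms(3) by(simp add: leb_on_def Int_absorb1)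
 show "A : sets (leb_on d B)" unfolding leb_on_def using sets_restrict_space_iff[OF s(2)] s(1) assms(3) by simp
qed

lemma ext_int:
 assumes "open_Rd d A" "open_Rd d B" "A \<subseteq> B"
 shows "(LINT x|(leb_on d A). u x) = (LINT x|(leb_on d B). extend_zero A u x)"
  "integrable (leb_on d A) u \<longleftrightarrow> integrable (leb_on d B) (extend_zero A u)"
proof -
 have "A \<inter> space (leb_on d B) : sets (leb_on d B)" using leb_on_restrict(2)[OF assms] by auto
 thus "(LINT x|(leb_on d A). u x) = (LINT x|(leb_on d B). extend_zero A u x)"
  "integrable (leb_on d A) u \<longleftrightarrow> integrable (leb_on d B) (extend_zero A u)"
  unfolding leb_on_restrict(1)[OF assms] extend_zero_eq by(simp_all only: integral_restrict_space integrable_restrict_space)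
qed

lemma ext_AE:
 assumes "open_Rd d A" "open_Rd d B" "A \<subseteq> B"
 shows "(AE x in leb_on d A. P x) \<longleftrightarrow> (AE x in leb_on d B. x : A --> P x)"
proof -
 have "A \<inter> space (leb_on d B) : sets (leb_on d B)" using leb_on_restrict(2)[OF assms] by auto
 thus ?thesis unfolding leb_on_restrict(1)[OF assms] by(rule AE_restrict_space_iff)
qed

lemma ext_L2:
 assumes "open_Rd d A" "open_Rd d B" "A \<subseteq> B"
 shows "u : L2 (leb_on d A) ==> extend_zero A u : L2 (leb_on d B)"
  "n2 (leb_on d B) (extend_zero A u) = n2 (leb_on d A) u"
  "f : L2 (leb_on d B) ==> extend_zero A f : L2 (leb_on d A)"
  "f : L2 (leb_on d B) ==> n2 (leb_on d A) (extend_zero A f) <= n2 (leb_on d B) f"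
 using L2_restrict_iff[OF leb_on_restrict(2)[OF assms]] n2_restrict[OF leb_on_restrict(2)[OF assms]]
  extend_zero_L2(3,4)[OF leb_on_restrict(2)[OF assms]]
 unfolding leb_on_restrict(1)[OF assms, symmetric] by simp_all

text \<open>\<open>Om0\<close> and \<open>Om12\<close> are parameters with defining equations rather
  than expressions, so that exchanging the two domains gives an instance of the same locale over
  literally the same sets.\<close>

locale glue = A: adm d Om1 Q1 e1 m1 + B: adm d Om2 Q2 e2 m2 for d Om1 Om2 Q1 Q2 e1 m1 e2 m2 +
 fixes Om0 Om12 :: "pt set" and \<xi> :: "pt => real" and N :: real
 assumes U: "Om0 = Om1 \<union> Om2" and I: "Om12 = Om1 \<inter> Om2"
  and x01: "!!x. x : Om0 ==> 0 <= \<xi> x & \<xi> x <= 1" and x12: "!!x. x : Om0 ==> x ~: Om12 ==> \<xi> x = 0"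
  and xw: "weakly_differentiable d Om0 (%x. of_real (\<xi> x))"
  and xN: "AE x in leb_on d Om0. grad_length d Om0 (%x. of_real (\<xi> x)) x <= N" and N0: "0 <= N"
begin

abbreviation "M0 \<equiv> leb_on d Om0"
abbreviation "X x \<equiv> complex_of_real (\<xi> x)"
abbreviation "dx i x \<equiv> grad d Om0 (%x. of_real (\<xi> x)) i x"
abbreviation "ex1 \<equiv> extend_zero Om1"
abbreviation "ex2 \<equiv> extend_zero Om2"
abbreviation "g1 i u \<equiv> grad d Om1 u i"
abbreviation "g2 i u \<equiv> grad d Om2 u i"

lemma O0: "open_Rd d Om0" and O12: "open_Rd d Om12"
 using A.O B.O by(simp_all add: U I open_Rd_Un open_Rd_Int)

sublocale D0: domain d Om0 by unfold_locales (rule O0)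

lemma sb: "Om1 \<subseteq> Om0" "Om2 \<subseteq> Om0" "Om12 \<subseteq> Om0" "Om12 \<subseteq> Om2" by(auto simp: U I)

lemmas e1 = A.O O0 sb(1) and e2 = B.O O0 sb(2) and e12 = O12 O0 sb(3)

lemma dx_weak: "weak_grad d Om0 X (%i x. dx i x)"
 by(rule D0.weak_grad_grad[OF xw])

lemma X_meas: "X : bm M0" and dx_meas: "i < d ==> (%x. dx i x) : bm M0"
 using D0.weak_gradD(1,2)[OF dx_weak] by(auto simp: loc_integrable_def)

lemma X_le: "AE x in M0. cmod (X x) <= 1"
 using x01 by(intro AE_I2) (simp add: D0.space_M)

lemma dx_le: "i < d ==> AE x in M0. cmod (dx i x) <= N"
 using xN
proof eventually_elim
 case (elim x)
 thus ?case using member_le_L2_set[of "{..<d}" i "%i. cmod (dx i x)"] by(simp add: grad_length_def)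
qed

lemma X_L2: "f : L2 M0 ==> (%x. X x * f x) : L2 M0" and dx_L2: "i < d ==> f : L2 M0 ==> (%x. dx i x * f x) : L2 M0"
 using L2_mult_bounded[OF _ X_meas X_le] L2_mult_bounded[OF _ dx_meas dx_le] by auto

text \<open>A product rule for \<xi> u tested on \<open>Om2\<close>, although u lives on
  \<open>Om1\<close>. With u replaced by test functions ph n on \<open>Om1\<close>, the product of
  ph n and ps is a test function on \<open>Om0\<close>, where the weak gradient of \<xi> can be
  used; the limit is taken in L2.\<close>

lemma glue_product:
 assumes u: "u : A.VV" and ps: "ps : test_fun d Om2" and i: "i < d"
 shows "(LINT x|M0. ex1 u x * (X x * partial i ps x)) = - (LINT x|M0. (X x * ex1 (g1 i u) x + dx i x * ex1 u x) * ps x)"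
proof -
 note uL = A.VV_L2(1)[OF u] A.VV_L2(2)[OF u i]
 note UL = ext_L2(1)[OF e1 uL(1)] ext_L2(1)[OF e1 uL(2)]
 have ps0: "ps : test_fun d Om0" by(rule test_fun_mono[OF ps sb(2)])
 note pL = D0.test_L2[OF ps0] D0.test_L2[OF test_fun_partial[OF ps0 i]]
 note ml = X_L2[OF pL(2)] X_L2[OF pL(1)] dx_L2[OF i pL(1)]
 obtain ph where ph: "!!n. ph n : test_fun d Om1" "L2_lim A.M ph u"
  "!!i. i < d ==> L2_lim A.M (%n. partial i (ph n)) (g1 i u)"
  using A.h10_seq[OF A.VV_h10[OF u]] by blast
 have ph0: "ph n : test_fun d Om0" for n by(rule test_fun_mono[OF ph(1) sb(1)])
 have tr: "L2_lim M0 F (ex1 v)"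
  if F: "!!n. F n : test_fun d Om1" and l: "L2_lim A.M F v" for F v
 proof -
  have "n2 M0 (%x. F n x - ex1 v x) = n2 M0 (ex1 (%x. F n x - v x))" for n
   unfolding n2_eq
  proof (intro arg_cong[where f = sqrt] Bint_cong refl)
   fix x assume "x : space M0"
   hence "x : Rd d" using D0.sub by(auto simp: D0.space_M)
   hence "x ~: Om1 ==> F n x = 0" using test_fun_props(5)[OF F A.sub] by blast
   thus "(cmod (F n x - ex1 v x))^2 = (cmod (ex1 (%x. F n x - v x) x))^2" by(simp add: extend_zero_def)
  qed
  thus ?thesis using l by(simp only: ext_L2(2)[OF e1])
 qed
 note l1 = tr[OF ph(1,2)] and l2 = tr[OF test_fun_partial[OF ph(1) i] ph(3)[OF i]]
 note fL = D0.test_L2[OF ph0] D0.test_L2[OF test_fun_partial[OF ph0 i]]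
 have eq: "(LINT x|M0. ph n x * (X x * partial i ps x)) + (LINT x|M0. partial i (ph n) x * (X x * ps x)) = - (LINT x|M0. ph n x * (dx i x * ps x))" for n
 proof -
  have t: "(%x. ph n x * ps x) : test_fun d Om0" by(rule test_fun_mult[OF test_fun_smooth[OF ph0] ps0])
  have "(LINT x|M0. X x * partial i (%x. ph n x * ps x) x) = (LINT x|M0. ph n x * (X x * partial i ps x) + partial i (ph n) x * (X x * ps x))"
  proof (intro Bint_cong refl)
   fix x assume "x : space M0"
   hence "x : Rd d" using D0.sub by(auto simp: D0.space_M)
   from partial_mult[OF test_fun_smooth[OF ph0] test_fun_smooth[OF ps0] i this]
   show "X x * partial i (%x. ph n x * ps x) x = ph n x * (X x * partial i ps x) + partial i (ph n) x * (X x * ps x)"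
   by(simp add: algebra_simps)
  qed
  also have "... = (LINT x|M0. ph n x * (X x * partial i ps x)) + (LINT x|M0. partial i (ph n) x * (X x * ps x))"
   by(rule Bint_add[OF L2_mult_integrable[OF fL(1) ml(1)] L2_mult_integrable[OF fL(2) ml(2)]])
  finally show ?thesis using D0.weak_gradD(3)[OF dx_weak i t] by(simp add: mult_ac)
 qed
 note T = D0.L2_int_tendsto
 have "(%n. (LINT x|M0. ph n x * (X x * partial i ps x)) + (LINT x|M0. partial i (ph n) x * (X x * ps x)))
  ~~> (LINT x|M0. ex1 u x * (X x * partial i ps x)) + (LINT x|M0. ex1 (g1 i u) x * (X x * ps x))"
  by(rule tendsto_add[OF T[OF fL(1) UL(1) l1 ml(1)] T[OF fL(2) UL(2) l2 ml(2)]])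
 moreover have "(%n. - (LINT x|M0. ph n x * (dx i x * ps x))) ~~> - (LINT x|M0. ex1 u x * (dx i x * ps x))"
  by(rule tendsto_minus[OF T[OF fL(1) UL(1) l1 ml(3)]])
 ultimately have e: "(LINT x|M0. ex1 u x * (X x * partial i ps x)) + (LINT x|M0. ex1 (g1 i u) x * (X x * ps x)) = - (LINT x|M0. ex1 u x * (dx i x * ps x))"
  unfolding eq by(rule LIMSEQ_unique)
 have "(LINT x|M0. (X x * ex1 (g1 i u) x + dx i x * ex1 u x) * ps x) = (LINT x|M0. ex1 (g1 i u) x * (X x * ps x) + ex1 u x * (dx i x * ps x))"
  by(intro Bint_cong refl) (simp add: algebra_simps)
 also have "... = (LINT x|M0. ex1 (g1 i u) x * (X x * ps x)) + (LINT x|M0. ex1 u x * (dx i x * ps x))"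
  by(rule Bint_add[OF L2_mult_integrable[OF UL(2) ml(2)] L2_mult_integrable[OF UL(1) ml(3)]])
 finally show ?thesis using e by(simp only: eq_neg_iff_add_eq_0 add.assoc)
qed

lemma G_L2:
 assumes u: "u : A.VV" and i: "i < d"
 shows "(%x. X x * ex1 (g1 i u) x + dx i x * ex1 u x) : L2 M0"
 by(intro L2.add_mem X_L2 dx_L2 i ext_L2(1)[OF e1] A.VV_L2(1)[OF u] A.VV_L2(2)[OF u i])

text \<open>Membership of \<xi> u in the second form domain is a hypothesis that does not say what
  its gradient on \<open>Om2\<close> is. \<open>glue_product\<close> identifies it, and the boundary
  between the two domains contributes nothing.\<close>

lemma glue_grad:
 assumes u: "u : A.VV" and v: "extend_zero Om12 (%x. X x * u x) : B.VV" and i: "i < d"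
 shows "AE x in B.M. g2 i (extend_zero Om12 (%x. X x * u x)) x = extend_zero Om12 (%x. X x * ex1 (g1 i u) x + dx i x * ex1 u x) x"
proof (rule B.grad_AE[OF _ i])
 let ?v = "extend_zero Om12 (%x. X x * u x)" and ?G = "%i. extend_zero Om12 (%x. X x * ex1 (g1 i u) x + dx i x * ex1 u x)"
 have GL: "?G i : L2 B.M" if "i < d" for i
 proof -
  have "?G i = ex2 (?G i)" by(rule ext) (auto simp: extend_zero_def I)
  thus ?thesis using ext_L2(3)[OF e2 ext_L2(1)[OF e12 ext_L2(3)[OF e12 G_L2[OF u that]]]]
   by(simp only: extend_zero_idem)
 qed
 have t: "(LINT x|B.M. extend_zero Om12 a x * b x) = (LINT x|M0. c x)"
  if "!!x. x : Om0 ==> c x = extend_zero Om12 a x * b x" for a b c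
  unfolding ext_int(1)[OF e2] using that sb(4)
  by(intro Bint_cong refl) (auto simp: extend_zero_def D0.space_M)
 show "weak_grad d Om2 ?v ?G" unfolding weak_grad_def
 proof (intro conjI allI impI ballI B.L2_loc GL B.VV_L2(1) v)
  fix j ps assume j: "j < d" and ps: "ps : test_fun d Om2"
  have z: "ps x = 0" if "x : Om0" "x ~: Om2" for x
   using test_fun_props(5)[OF ps B.sub, of x] that D0.sub by auto
  have "(LINT x|B.M. ?v x * partial j ps x) = (LINT x|M0. ex1 u x * (X x * partial j ps x))"
   using x12 by(intro t) (auto simp: extend_zero_def I)
  moreover have "(LINT x|B.M. ?G j x * ps x) = (LINT x|M0. (X x * ex1 (g1 j u) x + dx j x * ex1 u x) * ps x)"
   using z by(intro t) (auto simp: extend_zero_def I)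
  ultimately show "(LINT x|B.M. ?v x * partial j ps x) = - (LINT x|B.M. ?G j x * ps x)"
   using glue_product[OF u ps j] by simp
 qed
qed

text \<open>Everything is rewritten as an integral over \<open>Om0\<close>, so that the second form
  at w and \<xi> u can be compared with the first form at u and \<xi> w.\<close>

lemma glue_bil:
 assumes u: "u : A.VV" and v: "extend_zero Om12 (%x. X x * u x) : B.VV" and w: "w : B.VV"
 shows "B.bil w (extend_zero Om12 (%x. X x * u x)) =
   (\<Sum>i<d. (LINT x|M0. ex2 (g2 i w) x * (X x * ex1 (g1 i u) x + dx i x * ex1 u x))) + (LINT x|M0. (Q2 x + 1) * (X x * ex1 u x * ex2 w x))"
  "integrable M0 (%x. (Q2 x + 1) * (X x * ex1 u x * ex2 w x))"
proof -
 let ?v = "extend_zero Om12 (%x. X x * u x)" and ?G = "%i x. X x * ex1 (g1 i u) x + dx i x * ex1 u x"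
 have "(LINT x|B.M. g2 i w x * g2 i ?v x) = (LINT x|M0. ex2 (g2 i w) x * ?G i x)" if i: "i < d" for i
 proof -
  have GL: "extend_zero Om12 (?G i) : bm B.M"
  proof -
   have "extend_zero Om12 (?G i) = ex2 (extend_zero Om12 (?G i))" by(rule ext) (auto simp: extend_zero_def I)
   thus ?thesis using L2_measurable[OF ext_L2(3)[OF e2 ext_L2(1)[OF e12 ext_L2(3)[OF e12 G_L2[OF u i]]]]]
   by(simp only: extend_zero_idem)
  qed
  have "(LINT x|B.M. g2 i w x * g2 i ?v x) = (LINT x|B.M. g2 i w x * extend_zero Om12 (?G i) x)"
  proof (rule integral_cong_AE)
   show "AE x in B.M. g2 i w x * g2 i ?v x = g2 i w x * extend_zero Om12 (?G i) x"
   using glue_grad[OF u v i] by eventually_elim simp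
  qed (intro borel_measurable_times GL L2_measurable[OF B.VV_L2(2)[OF w i]] L2_measurable[OF B.VV_L2(2)[OF v i]])+
  also have "... = (LINT x|M0. ex2 (g2 i w) x * ?G i x)" unfolding ext_int(1)[OF e2]
  proof (intro Bint_cong refl)
   fix x assume "x : space M0"
   hence "x : Om0" by(simp add: D0.space_M)
   hence x: "x : Om1 \<union> Om2" using U by blast
   have "?G i x = 0" if "x ~: Om1" using that by(simp add: extend_zero_def)
   thus "ex2 (%x. g2 i w x * extend_zero Om12 (?G i) x) x = ex2 (g2 i w) x * ?G i x"
   using x by(cases "x : Om1"; cases "x : Om2") (simp_all add: extend_zero_def I)
  qed
  finally show ?thesis .
 qed
 moreover have e: "ex2 (%x. (Q2 x + 1) * (w x * ?v x)) x = (Q2 x + 1) * (X x * ex1 u x * ex2 w x)" if "x : Om0" for x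
  using that x12[OF that] by(auto simp: extend_zero_def I U)
 have "(LINT x|B.M. (Q2 x + 1) * (w x * ?v x)) = (LINT x|M0. (Q2 x + 1) * (X x * ex1 u x * ex2 w x))"
  unfolding ext_int(1)[OF e2] using e by(intro Bint_cong refl) (simp add: D0.space_M)
 ultimately show "B.bil w ?v = (\<Sum>i<d. (LINT x|M0. ex2 (g2 i w) x * ?G i x)) + (LINT x|M0. (Q2 x + 1) * (X x * ex1 u x * ex2 w x))"
  by(simp add: B.bil_def)
 have "integrable M0 (ex2 (%x. (Q2 x + 1) * (w x * ?v x)))" using B.bil_integrable[OF w v] ext_int(2)[OF e2] by blast
 moreover have "integrable M0 (ex2 (%x. (Q2 x + 1) * (w x * ?v x))) \<longleftrightarrow> integrable M0 (%x. (Q2 x + 1) * (X x * ex1 u x * ex2 w x))"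
  using e by(intro Bochner_Integration.integrable_cong refl) (simp add: D0.space_M)
 ultimately show "integrable M0 (%x. (Q2 x + 1) * (X x * ex1 u x * ex2 w x))" by blast
qed

definition zt :: "pt => complex" where
 "zt = indicator (Om0 \<inter> closure {x : Om0. 1 - \<xi> x ~= 0})"

lemma zt_meas: "zt : bm M0"
proof -
 have "open_Rd d (Om0 - closure {x : Om0. 1 - \<xi> x ~= 0})" by(rule open_Rd_Diff_closed[OF O0]) simp
 hence "Om0 - closure {x : Om0. 1 - \<xi> x ~= 0} : sets M0" by(rule leb_on_restrict(2)[OF _ O0]) auto
 hence "space M0 - (Om0 - closure {x : Om0. 1 - \<xi> x ~= 0}) : sets M0" by auto
 moreover have "space M0 - (Om0 - closure {x : Om0. 1 - \<xi> x ~= 0}) = Om0 \<inter> closure {x : Om0. 1 - \<xi> x ~= 0}"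
  unfolding D0.space_M by auto
 ultimately show ?thesis unfolding zt_def by(intro borel_measurable_indicator) simp
qed

lemma zt_cases: "zt x = 0 \<or> zt x = 1" and zt_one: "x : Om0 ==> \<xi> x ~= 1 ==> zt x = 1"
 using closure_subset[of "{x : Om0. 1 - \<xi> x ~= 0}"] by(auto simp: zt_def indicator_def)

lemma zt_le: "cmod (zt x) <= 1"
 using zt_cases[of x] by auto

text \<open>Off the support of 1 - \<xi> lies an open set \<open>Z\<close> on which \<xi> is 1.
  Against test functions on \<open>Z\<close> the weak gradient of \<xi> is that of a
  constant.\<close>

lemma dx_zero: assumes i: "i < d" shows "AE x in M0. zt x = 0 --> dx i x = 0"
proof -
 define Z where "Z = Om0 - closure {x : Om0. 1 - \<xi> x ~= 0}"
 have OZ: "open_Rd d Z" unfolding Z_def by(rule open_Rd_Diff_closed[OF O0]) simp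
 have ZZ: "Z \<subseteq> Om0" by(auto simp: Z_def)
 have one: "\<xi> x = 1" if "x : Z" for x
  using that closure_subset[of "{x : Om0. 1 - \<xi> x ~= 0}"] by(auto simp: Z_def)
 interpret Z: domain d Z by unfold_locales (rule OZ)
 have "AE x in Z.M. dx i x = 0"
 proof (rule fundamental_lemma[OF OZ])
  have l: "loc_integrable d Om0 (%x. dx i x)" by(rule D0.weak_gradD(2)[OF dx_weak i])
  thus "loc_integrable d Z (%x. dx i x)" unfolding loc_integrable_def leb_on_restrict(1)[OF OZ O0 ZZ]
   using ZZ by(auto intro: measurable_restrict_space1)
  fix ph assume ph: "ph : test_fun d Z"
  have ph0: "ph : test_fun d Om0" by(rule test_fun_mono[OF ph ZZ])
  note z = test_fun_props(5)[OF ph Z.sub] test_fun_props(5)[OF test_fun_partial[OF ph i] Z.sub]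
  have c: "(LINT x|M0. a x * b x) = (LINT x|Z.M. a' x * b x)"
   if "!!x. x : Rd d ==> x ~: Z ==> b x = 0" "!!x. x : Z ==> a x = a' x" for a a' b :: "pt => complex"
   unfolding ext_int(1)[OF OZ O0 ZZ]
  proof (intro Bint_cong refl)
   fix x assume "x : space M0"
   hence "x : Rd d" using D0.sub by(auto simp: D0.space_M)
   thus "a x * b x = extend_zero Z (%x. a' x * b x) x" using that by(simp add: extend_zero_def)
  qed
  have "(LINT x|Z.M. dx i x * ph x) = (LINT x|M0. dx i x * ph x)" by(rule c[symmetric]) (use z in auto)
  also have "... = - (LINT x|M0. X x * partial i ph x)" using D0.weak_gradD(3)[OF dx_weak i ph0] by simp
  also have "(LINT x|M0. X x * partial i ph x) = (LINT x|Z.M. 1 * partial i ph x)" by(rule c) (use z one in auto)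
  also have "(LINT x|Z.M. 1 * partial i ph x) = 0" using Z.weak_gradD(3)[OF Z.weak_grad_const i ph] by simp
  finally show "(LINT x|Z.M. dx i x * ph x) = 0" by simp
 qed
 hence "AE x in M0. x : Z --> dx i x = 0" unfolding ext_AE[OF OZ O0 ZZ] .
 thus ?thesis using AE_space
 proof eventually_elim
  case (elim x)
  thus ?case by(auto simp: D0.space_M zt_def Z_def indicator_def split: if_splits)
 qed
qed

lemma dx_zt: "AE x in M0. L2_set (%i. cmod (dx i x)) {..<d} <= N * cmod (zt x)"
proof -
 have "AE x in M0. ALL i:{..<d}. zt x = 0 --> dx i x = 0" using dx_zero by(intro AE_finite_allI) auto
 thus ?thesis using xN
 proof eventually_elim
  case (elim x)
  show ?case
  proof (cases "zt x = 0")
   case True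
   hence "L2_set (%i. cmod (dx i x)) {..<d} = 0" using elim(1) by(intro L2_set_0') auto
   thus ?thesis using True by simp
  next
   case False
   hence "zt x = 1" using zt_cases by blast
   thus ?thesis using elim(2) by(simp add: grad_length_def)
  qed
 qed
qed

text \<open>Cauchy-Schwarz is used over the index i pointwise and then in L2. \<open>dx_zt\<close>
  inserts the indicator \<open>zt\<close>, so u is measured only on the support of 1 - \<xi>, where
  \<open>zt_bound\<close> applies.\<close>

lemma glue_cross:
 assumes u: "u : A.VV" and w: "w : B.VV"
 shows "integrable M0 (%x. \<Sum>i<d. dx i x * (ex2 (g2 i w) x * ex1 u x))"
  "cmod (LINT x|M0. (\<Sum>i<d. dx i x * (ex2 (g2 i w) x * ex1 u x))) <= N * (n2 B.M (B.DD w) * n2 M0 (%x. zt x * ex1 u x))"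
proof -
 note uL = ext_L2(1)[OF e1 A.VV_L2(1)[OF u]] and DL = ext_L2(1)[OF e2 B.DD_L2(1)[OF w]]
 have zL: "(%x. zt x * ex1 u x) : L2 M0"
  by(rule L2_mult_bounded[OF uL zt_meas AE_I2[OF zt_le]])
 have "integrable M0 (%x. ex2 (g2 i w) x * (dx i x * ex1 u x))" if "i < d" for i
  by(intro L2_mult_integrable ext_L2(1)[OF e2] B.VV_L2(2)[OF w that] dx_L2[OF that] uL)
 thus 1: "integrable M0 (%x. \<Sum>i<d. dx i x * (ex2 (g2 i w) x * ex1 u x))"
  by(intro Bochner_Integration.integrable_sum) (simp add: mult_ac)
 note pr = L2_prod[OF DL zL]
 have "cmod (LINT x|M0. (\<Sum>i<d. dx i x * (ex2 (g2 i w) x * ex1 u x))) <= (LINT x|M0. N * (cmod (ex2 (B.DD w) x) * cmod (zt x * ex1 u x)))"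
 proof (rule norm_integral_le_AE[OF 1 integrable_mult_right[OF pr(1)]])
  show "AE x in M0. cmod (\<Sum>i<d. dx i x * (ex2 (g2 i w) x * ex1 u x)) <= N * (cmod (ex2 (B.DD w) x) * cmod (zt x * ex1 u x))"
   using dx_zt
  proof eventually_elim
   case (elim x)
   have D: "L2_set (%i. cmod (ex2 (g2 i w) x)) {..<d} = cmod (ex2 (B.DD w) x)"
   by(simp add: extend_zero_def B.DD_def L2_set_0')
   have "cmod (\<Sum>i<d. dx i x * (ex2 (g2 i w) x * ex1 u x)) <= (\<Sum>i<d. cmod (dx i x) * cmod (ex2 (g2 i w) x) * cmod (ex1 u x))"
   by(rule order_trans[OF norm_sum]) (simp add: norm_mult mult.assoc)
   also have "... = (\<Sum>i<d. \<bar>cmod (dx i x)\<bar> * \<bar>cmod (ex2 (g2 i w) x)\<bar>) * cmod (ex1 u x)" by(simp add: sum_distrib_right)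
   also have "... <= (L2_set (%i. cmod (dx i x)) {..<d} * cmod (ex2 (B.DD w) x)) * cmod (ex1 u x)"
   unfolding D[symmetric] by(intro mult_right_mono L2_set_mult_ineq) simp
   also have "... <= ((N * cmod (zt x)) * cmod (ex2 (B.DD w) x)) * cmod (ex1 u x)"
   by(intro mult_right_mono elim) auto
   finally show ?case by(simp add: norm_mult mult_ac)
  qed
 qed
 also have "... = N * (LINT x|M0. cmod (ex2 (B.DD w) x) * cmod (zt x * ex1 u x))" by(rule integral_mult_right_zero)
 also have "... <= N * (n2 M0 (ex2 (B.DD w)) * n2 M0 (%x. zt x * ex1 u x))" by(rule mult_left_mono[OF pr(2) N0])
 finally show "cmod (LINT x|M0. (\<Sum>i<d. dx i x * (ex2 (g2 i w) x * ex1 u x))) <= N * (n2 B.M (B.DD w) * n2 M0 (%x. zt x * ex1 u x))"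
  unfolding ext_L2(2)[OF e2] .
qed

text \<open>Write \<open>zt\<close> u as the product of \<open>zt\<close> / (Q1 + 1) and (Q1 + 1) u.
  Then |Q1 + 1| <= 2 <Q1> brings in the separation bound c and is the origin of the factor
  2.\<close>

lemma zt_bound:
 assumes u: "u : A.VV" and j: "(%x. of_real (A.jp x) * u x) : L2 A.M" "n2 A.M (%x. of_real (A.jp x) * u x) <= c"
  and \<beta>: "0 <= \<beta>" "AE x in A.M. cmod (zt x / (Q1 x + 1)) <= \<beta>"
 shows "(%x. zt x * ex1 u x) : L2 M0" "n2 M0 (%x. zt x * ex1 u x) <= 2 * \<beta> * c"
proof -
 note uL = ext_L2(1)[OF e1 A.VV_L2(1)[OF u]] and JL = ext_L2(1)[OF e1 j(1)]
 show zL: "(%x. zt x * ex1 u x) : L2 M0"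
  by(rule L2_mult_bounded[OF uL zt_meas AE_I2[OF zt_le]])
 have "n2 M0 (%x. zt x * ex1 u x) <= 2 * \<beta> * n2 M0 (ex1 (%x. of_real (A.jp x) * u x))"
 proof (rule L2_bound(2)[OF JL L2_measurable[OF zL]])
  have "AE x in A.M. cmod (zt x * u x) <= 2 * \<beta> * cmod (of_real (A.jp x) * u x)" using \<beta>(2) A.Q_AE
  proof eventually_elim
   case (elim x)
   have "0 < Re (Q1 x + 1)" using elim by simp
   hence "Q1 x + 1 ~= 0" by(rule Re_pos_nonzero)
   hence "cmod (zt x) = cmod (zt x / (Q1 x + 1)) * cmod (Q1 x + 1)" by(simp add: norm_divide)
   also have "... <= \<beta> * (2 * A.jp x)"
   using elim \<beta>(1) norm_triangle_ineq[of "Q1 x" 1] jap_ge(1,2)[of "Q1 x"] by(intro mult_mono) auto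
   finally have "cmod (zt x) * cmod (u x) <= \<beta> * (2 * A.jp x) * cmod (u x)" by(rule mult_right_mono) simp
   thus ?case using jap_ge(4)[of "Q1 x"] by(simp add: norm_mult)
  qed
  hence "AE x in M0. x : Om1 --> cmod (zt x * u x) <= 2 * \<beta> * cmod (of_real (A.jp x) * u x)" unfolding ext_AE[OF e1] .
  thus "AE x in M0. cmod (zt x * ex1 u x) <= 2 * \<beta> * cmod (ex1 (%x. of_real (A.jp x) * u x) x)"
  proof eventually_elim
   case (elim x)
   thus ?case by(cases "x : Om1") (simp_all add: extend_zero_def)
  qed
 qed (use \<beta> in simp)
 also have "... <= 2 * \<beta> * c" unfolding ext_L2(2)[OF e1] using \<beta>(1) by(intro mult_left_mono j) simp
 finally show "n2 M0 (%x. zt x * ex1 u x) <= 2 * \<beta> * c" .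
qed

end

section \<open>The norm estimate of the resolvent difference\<close>

context glue begin

definition RR where
 "RR f x = ex1 (resolvent d Om1 Q1 (-1) (ex1 f)) x - ex2 (resolvent d Om2 Q2 (-1) (ex2 f)) x"

text \<open>Lets each estimate for u on \<open>Om1\<close> be reused for w on
  \<open>Om2\<close>.\<close>

lemma swap: "glue d Om2 Om1 Q2 Q1 e2 m2 e1 m1 Om0 Om12 \<xi> N"
proof -
 have "Om0 = Om2 \<union> Om1" "Om12 = Om2 \<inter> Om1" using U I by auto
 thus ?thesis
  by(intro glue.intro glue_axioms.intro B.adm_axioms A.adm_axioms x01 x12 xw xN N0)
qed

text \<open>The solution v for f on \<open>Om2\<close> is eliminated by symmetry in favour of w, so
  only u and w need estimates. Splitting 1 = \<xi> + (1 - \<xi>) leaves five integrals. The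
  coefficients of \<beta>1 and \<beta>2 carry 1 + N because the terms with grad \<xi> contribute N
  and those with 1 - \<xi> contribute 1.\<close>

lemma RR_pairing:
 assumes h1: "ALL f:schr_dom d Om1 Q1. extend_zero Om12 (%x. X x * f x) : form_dom d Om2 Q2"
  and h2: "ALL g:schr_dom d Om2 Q2. extend_zero Om12 (%x. X x * g x) : form_dom d Om1 Q1"
  and a: "AE x in leb_on d Om12. cmod (X x * (Q1 x - Q2 x) / ((Q1 x + 1) * (Q2 x + 1))) <= \<alpha>" "0 <= \<alpha>"
  and b1: "AE x in A.M. cmod (zt x / (Q1 x + 1)) <= \<beta>1" "0 <= \<beta>1"
  and b2: "AE x in B.M. cmod (zt x / (Q2 x + 1)) <= \<beta>2" "0 <= \<beta>2"
  and f: "f : L2 M0" and g: "g : L2 M0"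
 defines "C1 \<equiv> sep_const e1 m1" and "C2 \<equiv> sep_const e2 m2"
 shows "RR f : L2 M0" "cmod (L2_inner M0 (RR f) g) <=
  (4 * C1 * C2 * \<alpha> + 2 * (1 + N) * C1 * \<beta>1 + 2 * (1 + N) * C2 * \<beta>2) * (n2 M0 f * n2 M0 g)"
proof -
 interpret sw: glue d Om2 Om1 Q2 Q1 e2 m2 e1 m1 Om0 Om12 \<xi> N by(rule swap)
 define u where "u = resolvent d Om1 Q1 (-1) (ex1 f)"
 define v where "v = resolvent d Om2 Q2 (-1) (ex2 f)"
 define w where "w = resolvent d Om2 Q2 (-1) (ex2 (%x. cnj (g x)))"
 have cg: "(%x. cnj (g x)) : L2 M0" by(rule L2_cnj[OF g])
 note fL = ext_L2(3)[OF e1 f] ext_L2(3)[OF e2 f] ext_L2(3)[OF e2 cg]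
 note fn = ext_L2(4)[OF e1 f] ext_L2(4)[OF e2 cg]
 have u: "A.wsol 0 (ex1 f) u" "u : schr_dom d Om1 Q1" unfolding u_def by(rule A.resolvent_wsol[OF fL(1)])+
 have v: "B.wsol 0 (ex2 f) v" "v : schr_dom d Om2 Q2" unfolding v_def by(rule B.resolvent_wsol[OF fL(2)])+
 have w: "B.wsol 0 (ex2 (%x. cnj (g x))) w" "w : schr_dom d Om2 Q2" unfolding w_def by(rule B.resolvent_wsol[OF fL(3)])+
 note uV = A.wsol_D(1)[OF u(1)] and vV = B.wsol_D(1)[OF v(1)] and wV = B.wsol_D(1)[OF w(1)]
 note UL = ext_L2(1)[OF e1 A.VV_L2(1)[OF uV]] and VL = ext_L2(1)[OF e2 B.VV_L2(1)[OF vV]] and WL = ext_L2(1)[OF e2 B.VV_L2(1)[OF wV]]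
 have RRe: "RR f = (%x. ex1 u x - ex2 v x)" by(rule ext) (simp add: RR_def u_def v_def)
 show "RR f : L2 M0" unfolding RRe by(rule L2.diff_mem[OF UL VL])
 have uj: "(%x. of_real (A.jp x) * u x) : L2 A.M" "n2 A.M (%x. of_real (A.jp x) * u x) <= C1 * n2 M0 f" "n2 A.M (A.DD u) <= n2 M0 f"
 proof -
  show "(%x. of_real (A.jp x) * u x) : L2 A.M" by(rule A.separation(1)[OF u(1) fL(1)]) simp
  have "n2 A.M (%x. of_real (A.jp x) * u x) <= C1 * n2 A.M (ex1 f)" unfolding C1_def by(rule A.separation(2)[OF u(1) fL(1)]) simp
  also have "... <= C1 * n2 M0 f" unfolding C1_def by(intro mult_left_mono fn A.sep_const_nonneg)
  finally show "n2 A.M (%x. of_real (A.jp x) * u x) <= C1 * n2 M0 f" .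
  show "n2 A.M (A.DD u) <= n2 M0 f" by(rule order_trans[OF A.energy(2)[OF u(1) fL(1)] fn(1)]) simp
 qed
 have wj: "(%x. of_real (B.jp x) * w x) : L2 B.M" "n2 B.M (%x. of_real (B.jp x) * w x) <= C2 * n2 M0 g" "n2 B.M (B.DD w) <= n2 M0 g"
 proof -
  show "(%x. of_real (B.jp x) * w x) : L2 B.M" by(rule B.separation(1)[OF w(1) fL(3)]) simp
  have "n2 B.M (%x. of_real (B.jp x) * w x) <= C2 * n2 B.M (ex2 (%x. cnj (g x)))" unfolding C2_def by(rule B.separation(2)[OF w(1) fL(3)]) simp
  also have "... <= C2 * n2 M0 (%x. cnj (g x))" unfolding C2_def by(intro mult_left_mono fn B.sep_const_nonneg)
  finally show "n2 B.M (%x. of_real (B.jp x) * w x) <= C2 * n2 M0 g" by(simp only: n2_cnj)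
  have "n2 B.M (B.DD w) <= n2 M0 (%x. cnj (g x))" by(rule order_trans[OF B.energy(2)[OF w(1) fL(3)] fn(2)]) simp
  thus "n2 B.M (B.DD w) <= n2 M0 g" by(simp only: n2_cnj)
 qed
 note zu = zt_bound[OF uV uj(1,2) b1(2,1)] and zw = sw.zt_bound[OF wV wj(1,2) b2(2,1)]
 let ?F = "n2 M0 f" and ?G = "n2 M0 g"
 have nn: "0 <= ?F" "0 <= ?G" "0 <= C1" "0 <= C2"
  unfolding C1_def C2_def by(simp_all only: n2_nonneg A.sep_const_nonneg B.sep_const_nonneg)

 \<comment> \<open>Symmetry of the bilinear form on \<open>Om2\<close> moves the resolvent from f to
   the conjugate of g.\<close>
 have sym: "(LINT x|M0. ex2 v x * cnj (g x)) = (LINT x|M0. f x * ex2 w x)"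
 proof -
  have "(LINT x|B.M. ex2 (%x. cnj (g x)) x * v x) = (LINT x|B.M. ex2 f x * w x)"
   using B.wsol_bil[OF v(1) fL(2) wV] B.wsol_bil[OF w(1) fL(3) vV] B.bil_sym[of v w] by simp
  moreover have "ex2 (%x. ex2 (%x. cnj (g x)) x * v x) = (%x. ex2 v x * cnj (g x))" "ex2 (%x. ex2 f x * w x) = (%x. f x * ex2 w x)"
   by(auto simp: extend_zero_def)
  ultimately show ?thesis unfolding ext_int(1)[OF e2] by simp
 qed

 have pair: "L2_inner M0 (RR f) g = (LINT x|M0. X x * ex1 u x * cnj (g x)) - (LINT x|M0. X x * ex2 w x * f x)
   + (LINT x|M0. (1 - X x) * ex1 u x * cnj (g x)) - (LINT x|M0. (1 - X x) * ex2 w x * f x)"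
 proof -
  have sp: "(LINT x|M0. p x * q x) = (LINT x|M0. X x * p x * q x) + (LINT x|M0. (1 - X x) * p x * q x)"
   if "p : L2 M0" "q : L2 M0" for p q
  proof -
   have "integrable M0 (%x. X x * p x * q x)" "integrable M0 (%x. p x * q x)"
   using L2_mult_integrable[OF X_L2[OF that(1)] that(2)] L2_mult_integrable[OF that] by simp_all
   thus ?thesis by(simp add: left_diff_distrib)
  qed
  have "L2_inner M0 (RR f) g = (LINT x|M0. ex1 u x * cnj (g x)) - (LINT x|M0. ex2 v x * cnj (g x))"
   unfolding RRe L2.ip_diff[OF UL VL g] unfolding L2_inner_def ..
  also have "(LINT x|M0. ex2 v x * cnj (g x)) = (LINT x|M0. ex2 w x * f x)" unfolding sym by(simp only: mult.commute)
  finally show ?thesis unfolding sp[OF UL cg] sp[OF WL f] by simp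
 qed

 have vV': "extend_zero Om12 (%x. X x * u x) : B.VV" by(rule bspec[OF h1 u(2)])
 have wV': "extend_zero Om12 (%x. X x * w x) : A.VV" by(rule bspec[OF h2 w(2)])
 have ea: "(LINT x|M0. X x * ex1 u x * cnj (g x)) = B.bil w (extend_zero Om12 (%x. X x * u x))"
  unfolding B.wsol_bil[OF w(1) fL(3) vV'] ext_int(1)[OF e2]
 proof (intro Bint_cong refl)
  fix x assume "x : space M0"
  hence x: "x : Om0" by(simp add: D0.space_M)
  show "X x * ex1 u x * cnj (g x) = ex2 (%x. ex2 (%x. cnj (g x)) x * extend_zero Om12 (%x. X x * u x) x) x"
   using x12[OF x] by(auto simp: extend_zero_def I)
 qed
 have eb: "(LINT x|M0. X x * ex2 w x * f x) = A.bil u (extend_zero Om12 (%x. X x * w x))"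
  unfolding A.wsol_bil[OF u(1) fL(1) wV'] ext_int(1)[OF e1]
 proof (intro Bint_cong refl)
  fix x assume "x : space M0"
  hence x: "x : Om0" by(simp add: D0.space_M)
  show "X x * ex2 w x * f x = ex1 (%x. ex1 f x * extend_zero Om12 (%x. X x * w x) x) x"
   using x12[OF x] by(auto simp: extend_zero_def I)
 qed
 note ba = glue_bil[OF uV vV' wV] and bb = sw.glue_bil[OF wV wV' uV]
 let ?S1 = "\<integral>x. (\<Sum>i<d. dx i x * (ex2 (g2 i w) x * ex1 u x)) \<partial>M0"
 let ?S2 = "\<integral>x. (\<Sum>i<d. dx i x * (ex1 (g1 i u) x * ex2 w x)) \<partial>M0"
 let ?S3 = "\<integral>x. (Q2 x - Q1 x) * (X x * ex1 u x * ex2 w x) \<partial>M0"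
 \<comment> \<open>The terms with \<xi> and both gradients occur in the two expressions alike and
   cancel; only those with derivatives of \<xi> survive.\<close>
 have gr: "(\<Sum>i<d. (LINT x|M0. ex2 (g2 i w) x * (X x * ex1 (g1 i u) x + dx i x * ex1 u x)))
   - (\<Sum>i<d. (LINT x|M0. ex1 (g1 i u) x * (X x * ex2 (g2 i w) x + dx i x * ex2 w x))) = ?S1 - ?S2"
 proof -
  have 1: "(LINT x|M0. ex2 (g2 i w) x * (X x * ex1 (g1 i u) x + dx i x * ex1 u x)) - (LINT x|M0. ex1 (g1 i u) x * (X x * ex2 (g2 i w) x + dx i x * ex2 w x))
   = (LINT x|M0. dx i x * (ex2 (g2 i w) x * ex1 u x)) - (LINT x|M0. dx i x * (ex1 (g1 i u) x * ex2 w x))"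
   and 2: "integrable M0 (%x. dx i x * (ex2 (g2 i w) x * ex1 u x))" and 3: "integrable M0 (%x. dx i x * (ex1 (g1 i u) x * ex2 w x))"
   if i: "i < d" for i
  proof -
   note GL = ext_L2(1)[OF e1 A.VV_L2(2)[OF uV i]] ext_L2(1)[OF e2 B.VV_L2(2)[OF wV i]]
   have i1: "integrable M0 (%x. ex2 (g2 i w) x * (X x * ex1 (g1 i u) x))" by(intro L2_mult_integrable X_L2 GL)
   have i2: "integrable M0 (%x. ex2 (g2 i w) x * (dx i x * ex1 u x))" by(intro L2_mult_integrable dx_L2 i UL GL)
   have i3: "integrable M0 (%x. ex1 (g1 i u) x * (X x * ex2 (g2 i w) x))" by(intro L2_mult_integrable X_L2 GL)
   have i4: "integrable M0 (%x. ex1 (g1 i u) x * (dx i x * ex2 w x))" by(intro L2_mult_integrable dx_L2 i WL GL)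
   have m: "ex2 (g2 i w) x * (dx i x * ex1 u x) = dx i x * (ex2 (g2 i w) x * ex1 u x)"
   "ex1 (g1 i u) x * (dx i x * ex2 w x) = dx i x * (ex1 (g1 i u) x * ex2 w x)"
   "ex1 (g1 i u) x * (X x * ex2 (g2 i w) x) = ex2 (g2 i w) x * (X x * ex1 (g1 i u) x)" for x by(simp_all only: mult_ac)
   show "integrable M0 (%x. dx i x * (ex2 (g2 i w) x * ex1 u x))" using i2 unfolding m(1) .
   show "integrable M0 (%x. dx i x * (ex1 (g1 i u) x * ex2 w x))" using i4 unfolding m(2) .
   show "(LINT x|M0. ex2 (g2 i w) x * (X x * ex1 (g1 i u) x + dx i x * ex1 u x)) - (LINT x|M0. ex1 (g1 i u) x * (X x * ex2 (g2 i w) x + dx i x * ex2 w x))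
   = (LINT x|M0. dx i x * (ex2 (g2 i w) x * ex1 u x)) - (LINT x|M0. dx i x * (ex1 (g1 i u) x * ex2 w x))"
   unfolding distrib_left Bint_add[OF i1 i2] Bint_add[OF i3 i4] unfolding m by simp
  qed
  have "?S1 = (\<Sum>i<d. \<integral>x. dx i x * (ex2 (g2 i w) x * ex1 u x) \<partial>M0)" using 2 by(intro Bint_sum) auto
  moreover have "?S2 = (\<Sum>i<d. \<integral>x. dx i x * (ex1 (g1 i u) x * ex2 w x) \<partial>M0)" using 3 by(intro Bint_sum) auto
  ultimately show ?thesis using 1 unfolding sum_subtractf[symmetric] by(simp only: sum_subtractf[symmetric]) (intro sum.cong, auto)
 qed
 have c: "(Q1 x + 1) * (X x * ex2 w x * ex1 u x) = (Q1 x + 1) * (X x * ex1 u x * ex2 w x)" for x by(simp only: mult_ac)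
 have S3i: "integrable M0 (%x. (Q2 x - Q1 x) * (X x * ex1 u x * ex2 w x))"
  and S3: "(LINT x|M0. (Q2 x + 1) * (X x * ex1 u x * ex2 w x)) - (LINT x|M0. (Q1 x + 1) * (X x * ex2 w x * ex1 u x)) = ?S3"
 proof -
  have s: "(Q2 x + 1) * (X x * ex1 u x * ex2 w x) - (Q1 x + 1) * (X x * ex1 u x * ex2 w x) = (Q2 x - Q1 x) * (X x * ex1 u x * ex2 w x)" for x
   by(simp add: left_diff_distrib distrib_right)
  note i = ba(2) bb(2)[unfolded c]
  show "integrable M0 (%x. (Q2 x - Q1 x) * (X x * ex1 u x * ex2 w x))"
   using Bochner_Integration.integrable_diff[OF i] unfolding s .
  show "(LINT x|M0. (Q2 x + 1) * (X x * ex1 u x * ex2 w x)) - (LINT x|M0. (Q1 x + 1) * (X x * ex2 w x * ex1 u x)) = ?S3"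
   unfolding c Bint_diff[OF i, symmetric] s ..
 qed
 have "(LINT x|M0. X x * ex1 u x * cnj (g x)) - (LINT x|M0. X x * ex2 w x * f x) = ?S1 - ?S2 + ?S3"
  unfolding ea eb ba(1) bb(1) by(simp only: add_diff_add gr S3)
 hence key: "L2_inner M0 (RR f) g = ?S1 - ?S2 + ?S3
   + (LINT x|M0. (1 - X x) * ex1 u x * cnj (g x)) - (LINT x|M0. (1 - X x) * ex2 w x * f x)"
  unfolding pair by simp

 have T1: "cmod ?S1 <= 2 * N * C1 * \<beta>1 * (?F * ?G)"
 proof -
  have "cmod ?S1 <= N * (n2 B.M (B.DD w) * n2 M0 (%x. zt x * ex1 u x))" by(rule glue_cross(2)[OF uV wV])
  also have "... <= N * (?G * (2 * \<beta>1 * (C1 * ?F)))" by(intro mult_left_mono mult_mono wj zu n2_nonneg N0)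
  finally show ?thesis by(simp add: mult_ac)
 qed
 have T2: "cmod ?S2 <= 2 * N * C2 * \<beta>2 * (?F * ?G)"
 proof -
  have "cmod ?S2 <= N * (n2 A.M (A.DD u) * n2 M0 (%x. zt x * ex2 w x))" by(rule sw.glue_cross(2)[OF wV uV])
  also have "... <= N * (?F * (2 * \<beta>2 * (C2 * ?G)))" by(intro mult_left_mono mult_mono uj zw n2_nonneg N0)
  finally show ?thesis by(simp add: mult_ac)
 qed
 \<comment> \<open>The factor 4 comes from |Q1 + 1| <= 2 <Q1> and |Q2 + 1| <= 2 <Q2>. Here
   separation is used for both solutions at once, which produces the product C1 C2.\<close>
 have T3: "cmod ?S3 <= 4 * C1 * C2 * \<alpha> * (?F * ?G)"
 proof -
  let ?p = "ex1 (%x. of_real (A.jp x) * u x)" and ?q = "ex2 (%x. of_real (B.jp x) * w x)"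
  note pr = L2_prod[OF ext_L2(1)[OF e1 uj(1)] ext_L2(1)[OF e2 wj(1)]]
  have "AE x in M0. x : Om12 --> cmod (X x * (Q1 x - Q2 x) / ((Q1 x + 1) * (Q2 x + 1))) <= \<alpha>" using a(1) unfolding ext_AE[OF e12] .
  moreover have "AE x in M0. x : Om1 --> 0 <= Re (Q1 x)" unfolding ext_AE[OF e1, symmetric] using A.Q_AE by eventually_elim simp
  moreover have "AE x in M0. x : Om2 --> 0 <= Re (Q2 x)" unfolding ext_AE[OF e2, symmetric] using B.Q_AE by eventually_elim simp
  ultimately have "AE x in M0. cmod ((Q2 x - Q1 x) * (X x * ex1 u x * ex2 w x)) <= 4 * \<alpha> * (cmod (?p x) * cmod (?q x))"
  proof eventually_elim
   case (elim x)
   show ?case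
   proof (cases "x : Om12")
   case True
   hence x: "x : Om1" "x : Om2" by(auto simp: I)
   have "0 < Re (Q1 x + 1)" "0 < Re (Q2 x + 1)" using elim x by simp_all
   hence nz: "Q1 x + 1 ~= 0" "Q2 x + 1 ~= 0" by - (rule Re_pos_nonzero, assumption)+
   define y where "y = X x * (Q1 x - Q2 x) / ((Q1 x + 1) * (Q2 x + 1))"
   have "X x * (Q1 x - Q2 x) = y * ((Q1 x + 1) * (Q2 x + 1))" unfolding y_def using nz by simp
   hence "cmod (X x * (Q1 x - Q2 x)) = cmod y * (cmod (Q1 x + 1) * cmod (Q2 x + 1))" by(simp only: norm_mult)
   also have "... <= \<alpha> * ((2 * A.jp x) * (2 * B.jp x))"
   using elim(1) True a(2) norm_triangle_ineq[of "Q1 x" 1] jap_ge(1,2)[of "Q1 x"] norm_triangle_ineq[of "Q2 x" 1] jap_ge(1,2)[of "Q2 x"]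
   by(intro mult_mono) (auto simp: y_def)
   finally have "cmod (X x * (Q1 x - Q2 x)) * (cmod (u x) * cmod (w x)) <= \<alpha> * ((2 * A.jp x) * (2 * B.jp x)) * (cmod (u x) * cmod (w x))"
   by(rule mult_right_mono) simp
   moreover have "cmod ((Q2 x - Q1 x) * (X x * ex1 u x * ex2 w x)) = cmod (X x * (Q1 x - Q2 x)) * (cmod (u x) * cmod (w x))"
   using x by(simp add: extend_zero_def norm_mult norm_minus_commute)
   moreover have "\<alpha> * ((2 * A.jp x) * (2 * B.jp x)) * (cmod (u x) * cmod (w x)) = 4 * \<alpha> * (cmod (?p x) * cmod (?q x))"
   using x jap_ge(4)[of "Q1 x"] jap_ge(4)[of "Q2 x"] by(simp add: extend_zero_def norm_mult)
   ultimately show ?thesis by linarith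
   next
   case False
   hence "ex1 u x * ex2 w x = 0" by(auto simp: extend_zero_def I)
   hence "(Q2 x - Q1 x) * (X x * ex1 u x * ex2 w x) = 0" by simp
   thus ?thesis using a(2) by(simp only: norm_zero) simp
   qed
  qed
  from norm_integral_le_AE[OF S3i integrable_mult_right[OF pr(1)] this]
  have "cmod ?S3 <= (LINT x|M0. 4 * \<alpha> * (cmod (?p x) * cmod (?q x)))" .
  also have "... = 4 * \<alpha> * (LINT x|M0. cmod (?p x) * cmod (?q x))" by(rule integral_mult_right_zero)
  also have "... <= 4 * \<alpha> * (n2 M0 ?p * n2 M0 ?q)" using a(2) by(intro mult_left_mono pr(2)) simp
  also have "... <= 4 * \<alpha> * ((C1 * ?F) * (C2 * ?G))" unfolding ext_L2(2)[OF e1] ext_L2(2)[OF e2]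
   using a(2) nn by(intro mult_left_mono mult_mono uj(2) wj(2) n2_nonneg mult_nonneg_nonneg) auto
  finally show ?thesis by(simp add: mult_ac)
 qed
 have T4: "cmod (LINT x|M0. (1 - X x) * p x * q x) <= n2 M0 (%x. zt x * p x) * n2 M0 q"
  if p: "p : L2 M0" "(%x. zt x * p x) : L2 M0" and q: "q : L2 M0" for p q
 proof -
  note pr = L2_prod[OF p(2) q]
  have "cmod (LINT x|M0. (1 - X x) * p x * q x) <= (LINT x|M0. cmod (zt x * p x) * cmod (q x))"
  proof (rule norm_integral_le_AE[OF _ pr(1)])
   have "integrable M0 (%x. p x * q x - X x * p x * q x)"
   by(rule Bochner_Integration.integrable_diff[OF L2_mult_integrable[OF p(1) q] L2_mult_integrable[OF X_L2[OF p(1)] q]])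
   thus "integrable M0 (%x. (1 - X x) * p x * q x)" by(simp only: left_diff_distrib mult_1)
   show "AE x in M0. cmod ((1 - X x) * p x * q x) <= cmod (zt x * p x) * cmod (q x)"
   proof (rule AE_I2)
   fix x assume "x : space M0"
   hence x: "x : Om0" by(simp add: D0.space_M)
   have "cmod (1 - X x) <= cmod (zt x)"
   proof (cases "\<xi> x = 1")
   case False
   have "1 - X x = of_real (1 - \<xi> x)" by simp
   hence "cmod (1 - X x) = \<bar>1 - \<xi> x\<bar>" by(simp only: norm_of_real)
   thus ?thesis using x01[OF x] zt_one[OF x False] by simp
   qed simp
   thus "cmod ((1 - X x) * p x * q x) <= cmod (zt x * p x) * cmod (q x)"
   unfolding norm_mult by(intro mult_right_mono) auto
   qed
  qed
  thus ?thesis using pr(2) by linarith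
 qed
 have T5: "cmod (LINT x|M0. (1 - X x) * ex1 u x * cnj (g x)) <= 2 * C1 * \<beta>1 * (?F * ?G)"
 proof -
  have "n2 M0 (%x. zt x * ex1 u x) * n2 M0 (%x. cnj (g x)) <= (2 * \<beta>1 * (C1 * ?F)) * ?G"
   unfolding n2_cnj by(rule mult_right_mono[OF zu(2) n2_nonneg])
  with T4[OF UL zu(1) cg] show ?thesis by(simp add: mult_ac)
 qed
 have T6: "cmod (LINT x|M0. (1 - X x) * ex2 w x * f x) <= 2 * C2 * \<beta>2 * (?F * ?G)"
 proof -
  have "n2 M0 (%x. zt x * ex2 w x) * n2 M0 f <= (2 * \<beta>2 * (C2 * ?G)) * ?F"
   by(rule mult_right_mono[OF zw(2) n2_nonneg])
  with T4[OF WL zw(1) f] show ?thesis by(simp add: mult_ac)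
 qed
 have tri: "cmod (s1 - s2 + s3 + s4 - s5) <= cmod s1 + cmod s2 + cmod s3 + cmod s4 + cmod s5" for s1 s2 s3 s4 s5
  using norm_triangle_ineq4[of "s1 - s2 + s3 + s4" s5] norm_triangle_ineq[of "s1 - s2 + s3" s4]
   norm_triangle_ineq[of "s1 - s2" s3] norm_triangle_ineq4[of s1 s2] by linarith
 have "cmod (L2_inner M0 (RR f) g) <= 2 * N * C1 * \<beta>1 * (?F * ?G) + 2 * N * C2 * \<beta>2 * (?F * ?G) + 4 * C1 * C2 * \<alpha> * (?F * ?G)
  + 2 * C1 * \<beta>1 * (?F * ?G) + 2 * C2 * \<beta>2 * (?F * ?G)"
  unfolding key by(rule order_trans[OF tri]) (intro add_mono T1 T2 T3 T5 T6)
 thus "cmod (L2_inner M0 (RR f) g) <= (4 * C1 * C2 * \<alpha> + 2 * (1 + N) * C1 * \<beta>1 + 2 * (1 + N) * C2 * \<beta>2) * (?F * ?G)"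
  by(simp add: algebra_simps)
qed

text \<open>Choosing g = \<open>RR f\<close> turns the bilinear bound into a norm bound, and a
  single \<open>K\<close> dominates the three coefficients.\<close>

lemma RR_op_norm:
 assumes h1: "ALL f:schr_dom d Om1 Q1. extend_zero Om12 (%x. X x * f x) : form_dom d Om2 Q2"
  and h2: "ALL g:schr_dom d Om2 Q2. extend_zero Om12 (%x. X x * g x) : form_dom d Om1 Q1"
  and a: "AE x in leb_on d Om12. cmod (X x * (Q1 x - Q2 x) / ((Q1 x + 1) * (Q2 x + 1))) <= \<alpha>" "0 <= \<alpha>"
  and b1: "AE x in A.M. cmod (zt x / (Q1 x + 1)) <= \<beta>1" "0 <= \<beta>1"
  and b2: "AE x in B.M. cmod (zt x / (Q2 x + 1)) <= \<beta>2" "0 <= \<beta>2"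
  and K: "4 * sep_const e1 m1 * sep_const e2 m2 <= K" "2 * (1 + N) * sep_const e1 m1 <= K" "2 * (1 + N) * sep_const e2 m2 <= K"
 shows "op_norm M0 RR <= ennreal (K * (\<alpha> + (\<beta>1 + \<beta>2)))"
 unfolding op_norm_def
proof (rule Inf_lower, rule CollectI, rule ballI)
 fix f assume f: "f : L2 M0"
 note R = RR_pairing[OF h1 h2 a b1 b2 f]
 have RL: "RR f : L2 M0" by(rule R(1)[OF f])
 let ?c = "K * (\<alpha> + (\<beta>1 + \<beta>2))"
 have "0 <= 4 * sep_const e1 m1 * sep_const e2 m2" using A.sep_const_nonneg B.sep_const_nonneg by simp
 hence c: "0 <= ?c" using K(1) a(2) b1(2) b2(2) by(intro mult_nonneg_nonneg) auto
 have le: "4 * sep_const e1 m1 * sep_const e2 m2 * \<alpha> + 2 * (1 + N) * sep_const e1 m1 * \<beta>1 + 2 * (1 + N) * sep_const e2 m2 * \<beta>2 <= ?c"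
  using mult_right_mono[OF K(1) a(2)] mult_right_mono[OF K(2) b1(2)] mult_right_mono[OF K(3) b2(2)]
  unfolding distrib_left by linarith
 have "(n2 M0 (RR f))^2 <= ?c * (n2 M0 f * n2 M0 (RR f))"
 proof -
  have "(n2 M0 (RR f))^2 <= cmod (L2_inner M0 (RR f) (RR f))" unfolding L2.nrm_sq[OF RL] by(rule complex_Re_le_cmod)
  also note R(2)[OF RL]
  also have "(4 * sep_const e1 m1 * sep_const e2 m2 * \<alpha> + 2 * (1 + N) * sep_const e1 m1 * \<beta>1 + 2 * (1 + N) * sep_const e2 m2 * \<beta>2) * (n2 M0 f * n2 M0 (RR f))
   <= ?c * (n2 M0 f * n2 M0 (RR f))" by(rule mult_right_mono[OF le]) (intro mult_nonneg_nonneg n2_nonneg)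
  finally show ?thesis .
 qed
 hence "n2 M0 (RR f) * n2 M0 (RR f) <= (?c * n2 M0 f) * n2 M0 (RR f)" by(simp only: power2_eq_square mult_ac)
 hence "n2 M0 (RR f) <= ?c * n2 M0 f"
  using n2_nonneg[of M0 "RR f"] mult_nonneg_nonneg[OF c n2_nonneg[of M0 f]] by(cases "n2 M0 (RR f) = 0") (auto dest: mult_right_le_imp_le)
 thus "L2_norm M0 (RR f) <= ennreal ?c * L2_norm M0 f"
  unfolding L2_norm_eq[OF RL] L2_norm_eq[OF f] ennreal_mult[OF c n2_nonneg, symmetric] by(rule ennreal_leI)
qed

end

lemma Linf_AE: "AE x in M. ennreal (norm (f x)) <= Linf_norm M f"
 unfolding Linf_norm_def by(rule esssup_AE)

lemma Linf_AE_real: assumes "Linf_norm M f < \<infinity>" shows "AE x in M. norm (f x) <= enn2real (Linf_norm M f)"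
 using Linf_AE[where M = M and f = f]
proof eventually_elim
 case (elim x)
 have "Linf_norm M f = ennreal (enn2real (Linf_norm M f))" using assms by simp
 thus ?case using elim by(metis ennreal_le_iff enn2real_nonneg)
qed

lemma schatten_interpolation:
 assumes O: "open_Rd d Om1" "open_Rd d Om2" "open_Rd d Om0" "Om1 \<subseteq> Om0" "Om2 \<subseteq> Om0"
  and R: "A1 : schatten_class (leb_on d Om1) p" "A2 : schatten_class (leb_on d Om2) p" and p: "0 < p" "p < q"
 defines "D \<equiv> %f x. extend_zero Om1 (A1 (extend_zero Om1 f)) x - extend_zero Om2 (A2 (extend_zero Om2 f)) x"
 shows "EX Kq>0. schatten_norm (leb_on d Om0) q D <= ennreal Kq * epowr (op_norm (leb_on d Om0) D) (1 - p/q)"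
proof -
 note r1 = leb_on_restrict[OF O(1,3,4)] and r2 = leb_on_restrict[OF O(2,3,5)]
 interpret T: two_operators "leb_on d Om0" Om1 Om2 A1 A2
  using r1(2) r2(2) compact_of_schatten[OF R(1)[unfolded r1(1)]] compact_of_schatten[OF R(2)[unfolded r2(1)]]
  by(rule two_operators.intro)
 have "D = T.D" by(intro ext) (simp add: D_def T.D_def)
 thus ?thesis using T.schatten_norm_D_le[OF schatten_operator_of_class[OF R(1)[unfolded r1(1)] p(1)] schatten_operator_of_class[OF R(2)[unfolded r2(1)] p(1)] p] by simp
qed

theorem theorem3p2:
  fixes N \<epsilon>1 m1 \<epsilon>2 m2 :: real
  assumes "0 \<le> N"
  shows "\<exists>K::real. K \<ge> 0 \<and>
    (\<forall>(d::nat) \<Omega>1 \<Omega>2 Q1 Q2 (\<xi> :: pt \<Rightarrow> real).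
      let \<Omega>0 = \<Omega>1 \<union> \<Omega>2;
          \<zeta> = indicator (\<Omega>0 \<inter> closure {x \<in> \<Omega>0. 1 - \<xi> x \<noteq> 0}) :: pt \<Rightarrow> complex;
          D = (\<lambda>f x. ext_resolvent d \<Omega>1 Q1 (-1) f x - ext_resolvent d \<Omega>2 Q2 (-1) f x)
      in
      d \<ge> 1 \<longrightarrow>
      open_Rd d \<Omega>1 \<longrightarrow> \<Omega>1 \<noteq> {} \<longrightarrow> open_Rd d \<Omega>2 \<longrightarrow> \<Omega>2 \<noteq> {} \<longrightarrow>
      admissible d \<Omega>1 Q1 \<epsilon>1 m1 \<longrightarrow> admissible d \<Omega>2 Q2 \<epsilon>2 m2 \<longrightarrow>
      (\<forall>x\<in>\<Omega>0. 0 \<le> \<xi> x \<and> \<xi> x \<le> 1) \<longrightarrow>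
      (\<forall>x\<in>\<Omega>0. indicator (\<Omega>1 \<inter> \<Omega>2) x * \<xi> x = \<xi> x) \<longrightarrow>
      weakly_differentiable d \<Omega>0 (\<lambda>x. of_real (\<xi> x)) \<longrightarrow>
      Linf_norm (leb_on d \<Omega>0) (grad_length d \<Omega>0 (\<lambda>x. of_real (\<xi> x))) = ennreal N \<longrightarrow>
      (\<exists>h. weak_laplacian d \<Omega>0 (\<lambda>x. of_real (\<xi> x)) h \<and> Linf_norm (leb_on d \<Omega>0) h < \<infinity>) \<longrightarrow>
      (\<forall>f\<in>schr_dom d \<Omega>1 Q1. extend_zero (\<Omega>1 \<inter> \<Omega>2) (\<lambda>x. of_real (\<xi> x) * f x) \<in> form_dom d \<Omega>2 Q2) \<longrightarrow>
      (\<forall>g\<in>schr_dom d \<Omega>2 Q2. extend_zero (\<Omega>1 \<inter> \<Omega>2) (\<lambda>x. of_real (\<xi> x) * g x) \<in> form_dom d \<Omega>1 Q1) \<longrightarrow>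
      op_norm (leb_on d \<Omega>0) D
        \<le> ennreal K *
          (Linf_norm (leb_on d (\<Omega>1 \<inter> \<Omega>2))
             (\<lambda>x. of_real (\<xi> x) * (Q1 x - Q2 x) / ((Q1 x + 1) * (Q2 x + 1)))
           + (Linf_norm (leb_on d \<Omega>1) (\<lambda>x. \<zeta> x / (Q1 x + 1))
            + Linf_norm (leb_on d \<Omega>2) (\<lambda>x. \<zeta> x / (Q2 x + 1))))
      \<and>
      (\<forall>p>0.
        resolvent d \<Omega>1 Q1 (-1) \<in> schatten_class (leb_on d \<Omega>1) p \<longrightarrow>
        resolvent d \<Omega>2 Q2 (-1) \<in> schatten_class (leb_on d \<Omega>2) p \<longrightarrow>
        (\<forall>q>p. \<exists>Kq::real. Kq > 0 \<and>
           schatten_norm (leb_on d \<Omega>0) q D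
             \<le> ennreal Kq * epowr (op_norm (leb_on d \<Omega>0) D) (1 - p/q))))"
proof -
 let ?s1 = "sep_const \<epsilon>1 m1" and ?s2 = "sep_const \<epsilon>2 m2"
 \<comment> \<open>Fixed before d, the domains and the potentials. Absolute values are taken because
   \<open>sep_const\<close> is known to be nonnegative only once admissibility is available; the
   summand 1 makes K positive, as the case of an infinite right-hand side requires.\<close>
 define K where "K = 1 + \<bar>4 * ?s1 * ?s2\<bar> + \<bar>2 * (1 + N) * ?s1\<bar> + \<bar>2 * (1 + N) * ?s2\<bar>"
 have K: "0 < K" "4 * ?s1 * ?s2 <= K" "2 * (1 + N) * ?s1 <= K" "2 * (1 + N) * ?s2 <= K"
  unfolding K_def by linarith+
 show ?thesis
  unfolding Let_def
 proof (intro exI[of _ K] conjI[OF less_imp_le[OF K(1)]] allI impI)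
  fix d :: nat and Om1 Om2 :: "pt set" and Q1 Q2 and \<xi> :: "pt => real"
  let ?O = "Om1 \<union> Om2"
  let ?z = "indicator (?O \<inter> closure {x : ?O. 1 - \<xi> x ~= 0}) :: pt => complex"
  let ?D = "%f x. ext_resolvent d Om1 Q1 (-1) f x - ext_resolvent d Om2 Q2 (-1) f x"
  assume O: "open_Rd d Om1" "open_Rd d Om2" and adm: "admissible d Om1 Q1 \<epsilon>1 m1" "admissible d Om2 Q2 \<epsilon>2 m2"
   and x: "ALL x:?O. 0 <= \<xi> x & \<xi> x <= 1" "ALL x:?O. indicator (Om1 \<inter> Om2) x * \<xi> x = \<xi> x"
   "weakly_differentiable d ?O (%x. of_real (\<xi> x))"
   "Linf_norm (leb_on d ?O) (grad_length d ?O (%x. of_real (\<xi> x))) = ennreal N"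
   and h: "ALL f:schr_dom d Om1 Q1. extend_zero (Om1 \<inter> Om2) (%x. of_real (\<xi> x) * f x) : form_dom d Om2 Q2"
   "ALL g:schr_dom d Om2 Q2. extend_zero (Om1 \<inter> Om2) (%x. of_real (\<xi> x) * g x) : form_dom d Om1 Q1"
  have "glue d Om1 Om2 Q1 Q2 \<epsilon>1 m1 \<epsilon>2 m2 ?O (Om1 \<inter> Om2) \<xi> N"
  proof (intro glue.intro glue_axioms.intro adm.intro domain.intro adm_axioms.intro O adm refl assms x(3))
   show "0 <= \<xi> y & \<xi> y <= 1" if "y : ?O" for y by(rule bspec[OF x(1) that])
   show "\<xi> y = 0" if "y : ?O" "y ~: Om1 \<inter> Om2" for y using bspec[OF x(2) that(1)] that(2) by simp
   show "AE y in leb_on d ?O. grad_length d ?O (%x. of_real (\<xi> x)) y <= N"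
   using Linf_AE[where M = "leb_on d ?O" and f = "grad_length d ?O (%x. of_real (\<xi> x))"] unfolding x(4)
   proof eventually_elim
   case (elim y)
   hence "norm (grad_length d ?O (%x. of_real (\<xi> x)) y) <= N" by(simp only: ennreal_le_iff[OF assms])
   thus ?case by(simp only: real_norm_def abs_le_iff)
   qed
  qed
  then interpret G: glue d Om1 Om2 Q1 Q2 \<epsilon>1 m1 \<epsilon>2 m2 ?O "Om1 \<inter> Om2" \<xi> N .
  have DR: "?D = G.RR" by(intro ext) (simp add: G.RR_def ext_resolvent_def)
  let ?a = "Linf_norm (leb_on d (Om1 \<inter> Om2)) (%x. of_real (\<xi> x) * (Q1 x - Q2 x) / ((Q1 x + 1) * (Q2 x + 1)))"
  let ?b1 = "Linf_norm (leb_on d Om1) (%x. ?z x / (Q1 x + 1))" and ?b2 = "Linf_norm (leb_on d Om2) (%x. ?z x / (Q2 x + 1))"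
  show "op_norm (leb_on d ?O) ?D <= ennreal K * (?a + (?b1 + ?b2)) &
   (ALL p>0. resolvent d Om1 Q1 (-1) : schatten_class (leb_on d Om1) p -->
   resolvent d Om2 Q2 (-1) : schatten_class (leb_on d Om2) p -->
   (ALL q>p. EX Kq>0. schatten_norm (leb_on d ?O) q ?D <= ennreal Kq * epowr (op_norm (leb_on d ?O) ?D) (1 - p/q)))"
  proof (intro conjI allI impI)
   show "op_norm (leb_on d ?O) ?D <= ennreal K * (?a + (?b1 + ?b2))"
   \<comment> \<open>If one of the norms is infinite, so is the right-hand side, since K > 0.
     Otherwise all three are real numbers and \<open>RR_op_norm\<close> applies.\<close>
   proof (cases "?a < \<infinity> & ?b1 < \<infinity> & ?b2 < \<infinity>")
   case True
   hence fin: "?a < \<infinity>" "?b1 < \<infinity>" "?b2 < \<infinity>" by blast+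
   have e: "?a = ennreal (enn2real ?a)" "?b1 = ennreal (enn2real ?b1)" "?b2 = ennreal (enn2real ?b2)" using fin by simp_all
   have "op_norm (leb_on d ?O) G.RR <= ennreal (K * (enn2real ?a + (enn2real ?b1 + enn2real ?b2)))"
   by(rule G.RR_op_norm[OF h Linf_AE_real[OF fin(1)] enn2real_nonneg _ enn2real_nonneg _ enn2real_nonneg K(2-4)])
   (use Linf_AE_real[OF fin(2)] Linf_AE_real[OF fin(3)] in \<open>simp_all only: G.zt_def\<close>)
   also have "... = ennreal K * (ennreal (enn2real ?a) + (ennreal (enn2real ?b1) + ennreal (enn2real ?b2)))"
   using K(1) by(simp add: ennreal_mult ennreal_plus)
   finally show ?thesis unfolding DR e[symmetric] .
   next
   case False
   hence s: "?a + (?b1 + ?b2) = top" by(auto simp: less_top[symmetric])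
   have "ennreal K * top = top" using K(1) by(simp add: ennreal_mult_eq_top_iff)
   thus ?thesis unfolding s by simp
   qed
  next
   fix p q :: real
   assume p: "0 < p" "p < q" and R: "resolvent d Om1 Q1 (-1) : schatten_class (leb_on d Om1) p" "resolvent d Om2 Q2 (-1) : schatten_class (leb_on d Om2) p"
   show "EX Kq>0. schatten_norm (leb_on d ?O) q ?D <= ennreal Kq * epowr (op_norm (leb_on d ?O) ?D) (1 - p/q)"
   using schatten_interpolation[OF O G.O0 G.sb(1,2) R p] unfolding ext_resolvent_def .
  qed
 qed
qed

end
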